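(* Let $\mathcal{X}$ be a finite alphabet, $\{\rho_B^x\}_{x\in\mathcal{X}}\subset S(B)$ density matrices, and for a type $Q\in\mathscr{P}_n(\mathcal{X})$ let $e_{\mathrm s}(n,R,Q)$ be the exponent of the optimal probability of error for source coding at rate $R$ of the source of constant type $$\rho^{(Q)}_{X^nB^n}=\frac1{|T_Q^n|}\sum_{\mathbf{x}\in T_Q^n}|\mathbf{x}\rangle\langle\mathbf{x}|\otimes\rho_{B^n}^{\mathbf{x}}.$$ There exist positive constants $K_1,K_2,N_0$ depending on $\{\rho_B^x\}_{x\in\mathcal{X}}$, $|\mathcal{X}|$ and $R$ such that $$e_{\mathrm s}(n,R+\delta_n',Q)\ \ge\ E^{\downarrow}_{\mathrm{r,s}}(R,Q)-\frac{K_1\log n}{n}-\frac1n,$$ $$e_{\mathrm s}(n,R,Q)\ \le\ E_{\mathrm{sp,s}}(R+\delta_n',Q)+\frac{K_2\log n}{n}+\frac1n\log\Bigl(1+\frac1n\Bigr),$$ where $\delta_n':=(|\mathcal{X}|+1)\frac{\log(n+1)}{n}$; the lower bound holds for $R\in(0,H(Q))$ and all $n\in\mathbb{N}$, and the upper bound holds for $R\in(H(Q|B)_\rho,\hat H_0(Q|B)_\rho)$ and all $n\ge N_0$ (with $Q\in\mathscr{P}_n(\mathcal{X})$).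
   Context: Logarithms are base 2. $\mathcal{H}_B$ is a finite-dimensional Hilbert space, $S(B)$ the set of density matrices on it. For $\mathbf{x}=(x_1,\dots,x_n)$, $\rho_{B^n}^{\mathbf{x}}:=\rho_B^{x_1}\otimes\cdots\otimes\rho_B^{x_n}$. $H(Q)$ is Shannon entropy. $\mathscr{P}_n(\mathcal{X})$ is the set of probability distributions $Q$ on $\mathcal{X}$ with $nQ(x)\in\{0,1,\dots,n\}$ for all $x$; $T_Q^n\subset\mathcal{X}^n$ is the set of sequences in which each $x$ occurs exactly $nQ(x)$ times. A source code of rate $R$ is a pair consisting of an encoder $\mathcal{E}:\mathcal{X}^n\to\mathcal{Z}$ with $|\mathcal{Z}|=\lceil2^{nR}\rceil$ and a decoder, i.e. for each $z\in\mathcal{Z}$ a POVM $\{\Pi^{(z)}_{\mathbf{x}}\}_{\mathbf{x}\in\mathcal{X}^n}$ on $\mathcal{H}_B^{\otimes n}$. For the source $\rho^{(Q)}_{X^nB^n}$ its error probability is $1-\frac1{|T_Q^n|}\sum_{\mathbf{x}\in T_Q^n}\operatorname{Tr}[\Pi_{\mathbf{x}}^{(\mathcal{E}(\mathbf{x}))}\rho_{B^n}^{\mathbf{x}}]$. $P^\star_{\mathrm{e,s}}(n,R,Q)$ is the infimum over all such codes and $e_{\mathrm s}(n,R,Q):=-\frac1n\log P^\star_{\mathrm{e,s}}(n,R,Q)$, with $-\log0=+\infty$. Petz's quantum Rényi divergence: $D_\alpha(\rho\|\sigma):=\frac1{\alpha-1}\log\operatorname{Tr}[\rho^\alpha\sigma^{1-\alpha}]$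 for $\alpha\in[0,1)$ ($\rho^0$ being the support projection; $+\infty$ if the trace is $0$), and $D_1=D$ is the quantum relative entropy $D(\rho\|\sigma)=\operatorname{Tr}[\rho(\log\rho-\log\sigma)]$. Put $\rho_B^Q:=\sum_xQ(x)\rho_B^x$ and let $\Pi_{\rho_B^x}$ be the projection onto the support of $\rho_B^x$. Define $$E^{\downarrow}_{\mathrm{r,s}}(R,Q):=\max_{0\le s\le1}\Bigl\{s\Bigl[\sum_xQ(x)D_{1-s}(\rho_B^x\|\rho_B^Q)-H(Q)\Bigr]+sR\Bigr\},$$ $$E_{\mathrm{sp,s}}(R,Q):=\sup_{s\ge0}\Bigl\{s\Bigl[\inf_{\tau_B\in S(B)}\sum_xQ(x)D_{\frac1{1+s}}(\rho_B^x\|\tau_B)-H(Q)\Bigr]+sR\Bigr\},$$ $$H(Q|B)_\rho:=H(Q)-\sum_xQ(x)D(\rho_B^x\|\rho_B^Q),\qquad \hat H_0(Q|B)_\rho:=H(Q)+\sup_{\tau_B\in S(B)}\sum_xQ(x)\log\operatorname{Tr}[\Pi_{\rho_B^x}\tau_B].$$ *)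

theory Defs
  imports
    "Jordan_Normal_Form.Schur_Decomposition"
    "Jordan_Normal_Form.Matrix_Kernel"
    "HOL-Library.Extended_Real"
begin

text \<open>
  A Hilbert space of dimension \<open>d\<close> is \<open>\<complex>\<^sup>d\<close>, and operators on it are the \<open>d \<times> d\<close> complex matrices
  of \<open>Jordan_Normal_Form\<close>; the \<open>n\<close>-fold tensor power then has dimension \<open>d ^ n\<close>.  The alphabet
  is a finite type \<open>'x\<close>, and \<open>n\<close>-letter sequences are lists of length \<open>n\<close>.
\<close>

section \<open>Matrices\<close>

definition mat_trace :: "complex mat \<Rightarrow> complex" where
  "mat_trace A = (\<Sum>i<dim_row A. A $$ (i, i))"

definition msum :: "nat \<Rightarrow> ('i \<Rightarrow> complex mat) \<Rightarrow> 'i set \<Rightarrow> complex mat" where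
  "msum d F I = Matrix.mat d d (\<lambda>(i, j). \<Sum>k\<in>I. F k $$ (i, j))"

text \<open>Kronecker product, with the indices of the left factor as the most significant ones.\<close>

definition kron :: "complex mat \<Rightarrow> complex mat \<Rightarrow> complex mat" where
  "kron A B = Matrix.mat (dim_row A * dim_row B) (dim_col A * dim_col B)
     (\<lambda>(i, j). A $$ (i div dim_row B, j div dim_col B) * B $$ (i mod dim_row B, j mod dim_col B))"

definition tensor_list :: "complex mat list \<Rightarrow> complex mat" where
  "tensor_list As = foldr kron As (1\<^sub>m 1)"

definition psd :: "nat \<Rightarrow> complex mat \<Rightarrow> bool" where
  "psd d A \<longleftrightarrow> A \<in> carrier_mat d d \<and> mat_adjoint A = A \<and>
     (\<forall>v\<in>carrier_vec d. 0 \<le> Re ((A *\<^sub>v v) \<bullet>c v))"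

definition density_ops :: "nat \<Rightarrow> complex mat set" where
  "density_ops d = {A. psd d A \<and> mat_trace A = 1}"

definition unitary_mat :: "nat \<Rightarrow> complex mat \<Rightarrow> bool" where
  "unitary_mat d U \<longleftrightarrow> U \<in> carrier_mat d d \<and>
     mat_adjoint U * U = 1\<^sub>m d \<and> U * mat_adjoint U = 1\<^sub>m d"

text \<open>
  A unitary diagonalization of a Hermitian matrix.  Which one is chosen is irrelevant for
  \<open>mat_fun\<close>, see \<open>mat_fun_eq\<close> below.
\<close>

definition is_eig_decomp :: "complex mat \<Rightarrow> complex mat \<Rightarrow> (nat \<Rightarrow> real) \<Rightarrow> bool" where
  "is_eig_decomp A U e \<longleftrightarrow> unitary_mat (dim_row A) U \<and>
     A = U * mat_diag (dim_row A) (\<lambda>i. complex_of_real (e i)) * mat_adjoint U"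

definition eig_decomp :: "complex mat \<Rightarrow> complex mat \<times> (nat \<Rightarrow> real)" where
  "eig_decomp A = (SOME (U, e). is_eig_decomp A U e)"

definition mat_fun :: "(real \<Rightarrow> real) \<Rightarrow> complex mat \<Rightarrow> complex mat" where
  "mat_fun f A = (case eig_decomp A of (U, e) \<Rightarrow>
     U * mat_diag (dim_row A) (\<lambda>i. complex_of_real (f (e i))) * mat_adjoint U)"

lemma mat_adjoint_carrier:
  assumes "U \<in> carrier_mat d d" shows "mat_adjoint U \<in> carrier_mat d d"
  using assms by (auto simp: mat_adjoint_def)

lemma mat_fun_eq:
  assumes "is_eig_decomp A V g"
  shows "mat_fun f A = V * mat_diag (dim_row A) (\<lambda>i. complex_of_real (f (g i))) * mat_adjoint V"
proof -
  define d where "d = dim_row A"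
  define D where "D h = mat_diag d (\<lambda>i. complex_of_real (h i))" for h
  have D[simp]: "D h \<in> carrier_mat d d" for h by (simp add: D_def)
  obtain U e where Ue: "eig_decomp A = (U, e)" by (rule prod.exhaust)
  have "case (V, g) of (U, e) \<Rightarrow> is_eig_decomp A U e"
    unfolding prod.case by (rule assms)
  hence "case eig_decomp A of (U, e) \<Rightarrow> is_eig_decomp A U e"
    unfolding eig_decomp_def by (rule someI[where P = "\<lambda>(U, e). is_eig_decomp A U e"])
  hence dec: "is_eig_decomp A U e" unfolding Ue prod.case .
  have U: "U \<in> carrier_mat d d" "mat_adjoint U * U = 1\<^sub>m d" "U * mat_adjoint U = 1\<^sub>m d"
    and AU: "A = U * D e * mat_adjoint U"
    using dec unfolding is_eig_decomp_def unitary_mat_def D_def d_def by blast+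
  have V: "V \<in> carrier_mat d d" "mat_adjoint V * V = 1\<^sub>m d" "V * mat_adjoint V = 1\<^sub>m d"
    and AV: "A = V * D g * mat_adjoint V"
    using assms unfolding is_eig_decomp_def unitary_mat_def D_def d_def by blast+
  note U' = mat_adjoint_carrier[OF U(1)] and V' = mat_adjoint_carrier[OF V(1)]
  have assoc: "(X * Y) * Z = X * (Y * Z)"
    if "X \<in> carrier_mat d d" "Y \<in> carrier_mat d d" "Z \<in> carrier_mat d d" for X Y Z :: "complex mat"
    using that by (rule assoc_mult_mat)
  define W where "W = mat_adjoint V * U"
  have W: "W \<in> carrier_mat d d" unfolding W_def using U V' by auto
  have "mat_adjoint V * A * U = W * D e"
  proof -
    have "mat_adjoint V * A * U = mat_adjoint V * (U * (D e * (mat_adjoint U * U)))"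
      unfolding AU using U(1) U' V' by (simp add: assoc mult_carrier_mat[of _ d d _ d])
    thus ?thesis
      unfolding W_def U(2) using U(1) V' by (simp add: assoc mult_carrier_mat[of _ d d _ d] right_mult_one_mat[of _ d d])
  qed
  moreover have "mat_adjoint V * A * U = D g * W"
  proof -
    have "mat_adjoint V * A * U = (mat_adjoint V * V) * (D g * (mat_adjoint V * U))"
      unfolding AV using U(1) V(1) V' by (simp add: assoc mult_carrier_mat[of _ d d _ d])
    thus ?thesis
      unfolding W_def V(2) using U(1) V' by (simp add: mult_carrier_mat[of _ d d _ d] left_mult_one_mat[of _ d d])
  qed
  ultimately have comm: "W * D e = D g * W" by simp
  have entry: "W $$ (i, j) * complex_of_real (e j) = complex_of_real (g i) * W $$ (i, j)"
    if "i < d" "j < d" for i j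
  proof -
    have "(W * D e) $$ (i, j) = (D g * W) $$ (i, j)" by (simp add: comm)
    thus ?thesis
      using that unfolding D_def mat_diag_mult_left[OF W] mat_diag_mult_right[OF W] by simp
  qed
  have commf: "W * D (\<lambda>i. f (e i)) = D (\<lambda>i. f (g i)) * W"
  proof -
    have "W $$ (i, j) * complex_of_real (f (e j)) = complex_of_real (f (g i)) * W $$ (i, j)"
      if "i < d" "j < d" for i j
      using entry[OF that] by (cases "W $$ (i, j) = 0") (auto simp: mult.commute)
    thus ?thesis
      unfolding D_def mat_diag_mult_left[OF W] mat_diag_mult_right[OF W] by (intro eq_matI) auto
  qed
  have "mat_fun f A = U * D (\<lambda>i. f (e i)) * mat_adjoint U"
    by (simp add: mat_fun_def Ue D_def d_def)
  also have "\<dots> = (V * mat_adjoint V) * (U * (D (\<lambda>i. f (e i)) * mat_adjoint U))"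
    unfolding V(3) using U(1) U' by (simp add: assoc mult_carrier_mat[of _ d d _ d] left_mult_one_mat[of _ d d])
  also have "\<dots> = V * ((W * D (\<lambda>i. f (e i))) * mat_adjoint U)"
    unfolding W_def using U(1) U' V(1) V' by (simp add: assoc mult_carrier_mat[of _ d d _ d])
  also have "\<dots> = V * (D (\<lambda>i. f (g i)) * (mat_adjoint V * (U * mat_adjoint U)))"
    unfolding commf unfolding W_def using U(1) U' V(1) V' by (simp add: assoc mult_carrier_mat[of _ d d _ d])
  also have "\<dots> = V * D (\<lambda>i. f (g i)) * mat_adjoint V"
    unfolding U(3) using V(1) V' by (simp add: assoc mult_carrier_mat[of _ d d _ d] right_mult_one_mat[of _ d d])
  finally show ?thesis by (simp add: D_def d_def)
qed

text \<open>
  Since \<open>0 powr a = 0\<close> for every \<open>a\<close>, powers of positive semidefinite matrices are taken on the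
  support; in particular \<open>mat_powr A 0\<close> is the support projection, not the identity.
\<close>

definition mat_powr :: "complex mat \<Rightarrow> real \<Rightarrow> complex mat" where
  "mat_powr A a = mat_fun (\<lambda>t. t powr a) A"

text \<open>Since \<open>log 2 0 = 0\<close>, the logarithm is taken on the support as well.\<close>

definition mat_log2 :: "complex mat \<Rightarrow> complex mat" where
  "mat_log2 A = mat_fun (log 2) A"

definition supp_proj :: "complex mat \<Rightarrow> complex mat" where
  "supp_proj A = mat_fun (\<lambda>t. if t = 0 then 0 else 1) A"


section \<open>Entropic quantities\<close>

definition log2_ereal :: "real \<Rightarrow> ereal" where
  "log2_ereal t = (if t = 0 then -\<infinity> else ereal (log 2 t))"

definition shannon_entropy :: "('x::finite \<Rightarrow> real) \<Rightarrow> real" where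
  "shannon_entropy Q = - (\<Sum>x\<in>UNIV. Q x * log 2 (Q x))"

text \<open>
  The support of \<open>\<rho>\<close> is contained in that of \<open>\<sigma>\<close> iff the kernel of \<open>\<sigma>\<close> is contained in that of
  \<open>\<rho>\<close>; otherwise the relative entropy is infinite.
\<close>

definition rel_entropy :: "complex mat \<Rightarrow> complex mat \<Rightarrow> ereal" where
  "rel_entropy \<rho> \<sigma> = (if mat_kernel \<sigma> \<subseteq> mat_kernel \<rho>
     then ereal (Re (mat_trace (\<rho> * (mat_log2 \<rho> - mat_log2 \<sigma>)))) else \<infinity>)"

text \<open>Meant for \<open>\<alpha> \<in> {0..1}\<close>.\<close>

definition petz_div :: "real \<Rightarrow> complex mat \<Rightarrow> complex mat \<Rightarrow> ereal" where
  "petz_div \<alpha> \<rho> \<sigma> = (if \<alpha> = 1 then rel_entropy \<rho> \<sigma> else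
     (let t = Re (mat_trace (mat_powr \<rho> \<alpha> * mat_powr \<sigma> (1 - \<alpha>)))
      in if t = 0 then \<infinity> else ereal (1 / (\<alpha> - 1) * log 2 t)))"

definition avg_state ::
    "nat \<Rightarrow> ('x::finite \<Rightarrow> complex mat) \<Rightarrow> ('x \<Rightarrow> real) \<Rightarrow> complex mat" where
  "avg_state d \<rho> Q = msum d (\<lambda>x. complex_of_real (Q x) \<cdot>\<^sub>m \<rho> x) UNIV"

text \<open>
  In the sums over the alphabet below, letters with \<open>Q x = 0\<close> do not contribute, because
  \<open>0 * \<infinity> = 0\<close> in \<open>ereal\<close>.
\<close>

definition cond_entropy ::
    "nat \<Rightarrow> ('x::finite \<Rightarrow> complex mat) \<Rightarrow> ('x \<Rightarrow> real) \<Rightarrow> ereal" where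
  "cond_entropy d \<rho> Q = ereal (shannon_entropy Q) -
     (\<Sum>x\<in>UNIV. ereal (Q x) * rel_entropy (\<rho> x) (avg_state d \<rho> Q))"

definition cond_entropy_hat0 ::
    "nat \<Rightarrow> ('x::finite \<Rightarrow> complex mat) \<Rightarrow> ('x \<Rightarrow> real) \<Rightarrow> ereal" where
  "cond_entropy_hat0 d \<rho> Q = ereal (shannon_entropy Q) +
     (SUP \<tau>\<in>density_ops d.
        \<Sum>x\<in>UNIV. ereal (Q x) * log2_ereal (Re (mat_trace (supp_proj (\<rho> x) * \<tau>))))"

text \<open>
  \<open>E_rs_down\<close> is the random coding exponent, its maximum over \<open>s\<close> being written as a supremum;
  \<open>E_sps\<close> is the sphere-packing exponent.  Both are \<open>ereal\<close>-valued since \<open>E_sps\<close> can be infinite.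
\<close>

definition E_rs_down ::
    "nat \<Rightarrow> ('x::finite \<Rightarrow> complex mat) \<Rightarrow> real \<Rightarrow> ('x \<Rightarrow> real) \<Rightarrow> ereal" where
  "E_rs_down d \<rho> R Q = (SUP s\<in>{0..1}.
     ereal s * ((\<Sum>x\<in>UNIV. ereal (Q x) * petz_div (1 - s) (\<rho> x) (avg_state d \<rho> Q))
                - ereal (shannon_entropy Q)) + ereal (s * R))"

definition E_sps ::
    "nat \<Rightarrow> ('x::finite \<Rightarrow> complex mat) \<Rightarrow> real \<Rightarrow> ('x \<Rightarrow> real) \<Rightarrow> ereal" where
  "E_sps d \<rho> R Q = (SUP s\<in>{0..}.
     ereal s * ((INF \<tau>\<in>density_ops d. \<Sum>x\<in>UNIV. ereal (Q x) * petz_div (1 / (1 + s)) (\<rho> x) \<tau>)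
                - ereal (shannon_entropy Q)) + ereal (s * R))"


section \<open>Source coding with quantum side information\<close>

definition seqs :: "nat \<Rightarrow> 'x list set" where
  "seqs n = {xs. length xs = n}"

definition types :: "nat \<Rightarrow> ('x::finite \<Rightarrow> real) set" where
  "types n = {Q. (\<forall>x. 0 \<le> Q x) \<and> (\<Sum>x\<in>UNIV. Q x) = 1 \<and>
     (\<forall>x. real n * Q x \<in> real ` {0..n})}"

definition type_seqs :: "nat \<Rightarrow> ('x::finite \<Rightarrow> real) \<Rightarrow> 'x list set" where
  "type_seqs n Q = {xs \<in> seqs n. \<forall>x. real (count_list xs x) = real n * Q x}"

definition seq_state :: "('x \<Rightarrow> complex mat) \<Rightarrow> 'x list \<Rightarrow> complex mat" where
  "seq_state \<rho> xs = tensor_list (map \<rho> xs)"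

definition is_povm :: "nat \<Rightarrow> 'i set \<Rightarrow> ('i \<Rightarrow> complex mat) \<Rightarrow> bool" where
  "is_povm d I P \<longleftrightarrow> (\<forall>i\<in>I. psd d (P i)) \<and> msum d P I = 1\<^sub>m d"

text \<open>The message set is \<open>{..<M}\<close> with \<open>M\<close> the least integer not below \<open>2 powr (n * R)\<close>.\<close>

definition messages :: "nat \<Rightarrow> real \<Rightarrow> nat set" where
  "messages n R = {..<nat \<lceil>2 powr (real n * R)\<rceil>}"

definition source_codes ::
    "nat \<Rightarrow> nat \<Rightarrow> real \<Rightarrow> (('x::finite list \<Rightarrow> nat) \<times> (nat \<Rightarrow> 'x list \<Rightarrow> complex mat)) set" where
  "source_codes d n R = {(enc, P). enc \<in> seqs n \<rightarrow> messages n R \<and>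
     (\<forall>z\<in>messages n R. is_povm (d ^ n) (seqs n) (P z))}"

text \<open>
  Error probability of a code on the source that emits a uniformly distributed sequence
  \<open>xs \<in> type_seqs n Q\<close> together with the state \<open>seq_state \<rho> xs\<close>.
\<close>

definition err_prob ::
    "('x::finite \<Rightarrow> complex mat) \<Rightarrow> nat \<Rightarrow> ('x \<Rightarrow> real) \<Rightarrow>
     ('x list \<Rightarrow> nat) \<times> (nat \<Rightarrow> 'x list \<Rightarrow> complex mat) \<Rightarrow> real" where
  "err_prob \<rho> n Q = (\<lambda>(enc, P). 1 - 1 / real (card (type_seqs n Q)) *
     (\<Sum>xs\<in>type_seqs n Q. Re (mat_trace (P (enc xs) xs * seq_state \<rho> xs))))"

definition opt_err_prob ::
    "nat \<Rightarrow> ('x::finite \<Rightarrow> complex mat) \<Rightarrow> nat \<Rightarrow> real \<Rightarrow> ('x \<Rightarrow> real) \<Rightarrow> real" where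
  "opt_err_prob d \<rho> n R Q = (INF c\<in>source_codes d n R. err_prob \<rho> n Q c)"

definition err_exponent ::
    "nat \<Rightarrow> ('x::finite \<Rightarrow> complex mat) \<Rightarrow> nat \<Rightarrow> real \<Rightarrow> ('x \<Rightarrow> real) \<Rightarrow> ereal" where
  "err_exponent d \<rho> n R Q = - ereal (1 / real n) * log2_ereal (opt_err_prob d \<rho> n R Q)"

definition rate_slack :: "'x::finite itself \<Rightarrow> nat \<Rightarrow> real" where
  "rate_slack TYPE('x) n = (real (card (UNIV :: 'x set)) + 1) * log 2 (real (n + 1)) / real n"

end

theory Submission
  imports Defs "HOL-Analysis.Analysis" "HOL-Combinatorics.Multiset_Permutations"
begin

text \<open>
  Lower bound on the exponent: bin the sequences greedily into messages and decode with the pretty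
  good measurement built from the states in the announced bin.  Its error is at most that of any
  binary tests \<open>E x\<close> of \<open>\<rho>\<^sup>x\<close> against the sum of the other states in the bin, and on a type class
  \<open>\<Sum>x. \<rho>\<^sup>x \<le> 2 powr (n * H(Q)) * \<rho>\<^sup>Q \<otimes> \<dots> \<otimes> \<rho>\<^sup>Q\<close>, so that Audenaert's inequality for \<open>\<rho>\<^sup>x\<close>
  against a multiple of this product gives the exponent \<open>E_rs_down\<close> without any loss in the rate.

  Upper bound: a minimax argument over \<open>s \<ge> 0\<close> and states yields one state \<open>\<tau>\<close>, mixed with a little of
  the maximally mixed state, that is nearly optimal in \<open>E_sps\<close> for all \<open>s\<close> at once.  For every sequence
  \<open>x\<close> of the type class the Nussbaum-Szkola distributions reduce testing \<open>\<rho>\<^sup>x\<close> against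
  \<open>\<tau> \<otimes> \<dots> \<otimes> \<tau>\<close> to a classical problem for independent letters, where an exponential tilting bounds
  the error from below up to polynomial factors.  The decoders of a code accept the product state
  with total weight at most the number of messages, which is small compared with the type class, so
  the average over the type class of the errors on \<open>\<rho>\<^sup>x\<close> is large.
\<close>

section \<open>Hermitian and positive semidefinite matrices\<close>

unbundle no vec_syntax

text \<open>The constants must not depend on \<open>Q\<close> or \<open>n\<close>, so every
  remainder has to be explicit and uniform over types. This speaks against a central limit argument
  in the upper bound: the variance of the log-likelihood ratio changes with \<open>Q\<close> and may
  vanish. The interpolation behind the windows needs only a bound on the oscillation of a single
  summand. This is why the saddle state is depolarized with weight 1/n: its eigenvalues become at
  least 1/(dn), each summand oscillates by O(log n), and the smallest positive eigenvalue of the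
  given states enters K2. Depolarizing and the grid of the minimax argument cost terms proportional
  to s, hence a rate shift of order 1/n; \<open>rate_slack\<close> pays for it together with the
  polynomial defect in the size of the type class. Singular states are the recurring obstacle:
  powers and logarithms live on supports, so positivity of traces and eigenvalues has to be secured
  before logarithms are taken, and the bin states are perturbed by a small multiple of the identity
  to make their sum invertible.\<close>

lemma mat_adjoint_index:
  assumes "A \<in> carrier_mat m n" "i < n" "j < m"
  shows "mat_adjoint A $$ (i, j) = cnj (A $$ (j, i))"
  using assms by (simp add: mat_adjoint_def mat_of_rows_index)

lemma mult_mat_index:
  assumes "A \<in> carrier_mat l m" "B \<in> carrier_mat m n" "i < l" "j < n"
  shows "(A * B) $$ (i, j) = (\<Sum>k<m. A $$ (i, k) * B $$ (k, j))"
  using assms by (simp add: scalar_prod_def lessThan_atLeast0)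

text \<open>Entrywise, unlike the adjoint equation in \<open>psd\<close>, so that entries can be
  conjugated inside multiple sums; \<open>hermitian_iff\<close> links the two forms.\<close>

definition hermitian :: "nat \<Rightarrow> complex mat \<Rightarrow> bool" where
  "hermitian d A \<longleftrightarrow> A \<in> carrier_mat d d \<and> (\<forall>i<d. \<forall>j<d. A $$ (j, i) = cnj (A $$ (i, j)))"

text \<open>Arguments are index functions instead of vectors, so that matrix columns, differences
  and superpositions can be inserted without carrier conditions.\<close>

definition qform :: "nat \<Rightarrow> complex mat \<Rightarrow> (nat \<Rightarrow> complex) \<Rightarrow> complex" where
  "qform d A v = (\<Sum>i<d. \<Sum>j<d. cnj (v i) * A $$ (i, j) * v j)"

lemma hermitianD:
  assumes "hermitian d A"
  shows "A \<in> carrier_mat d d" "i < d \<Longrightarrow> j < d \<Longrightarrow> A $$ (j, i) = cnj (A $$ (i, j))"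
  using assms unfolding hermitian_def by blast+

lemma hermitian_iff: "hermitian d A \<longleftrightarrow> A \<in> carrier_mat d d \<and> mat_adjoint A = A"
proof
  assume h: "hermitian d A"
  note A = hermitianD(1)[OF h]
  have "mat_adjoint A = A"
  proof (rule eq_matI)
    show "mat_adjoint A $$ (i, j) = A $$ (i, j)" if "i < dim_row A" "j < dim_col A" for i j
      using hermitianD(2)[OF h, of j i] that A mat_adjoint_index[OF A, of i j] by auto
  qed (use mat_adjoint_carrier[OF A] A in auto)
  thus "A \<in> carrier_mat d d \<and> mat_adjoint A = A" using A by simp
next
  assume h: "A \<in> carrier_mat d d \<and> mat_adjoint A = A"
  thus "hermitian d A"
    unfolding hermitian_def by (metis mat_adjoint_index)
qed

lemma psd_iff_qform:
  "psd d A \<longleftrightarrow> hermitian d A \<and> (\<forall>v. 0 \<le> Re (qform d A v))"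
proof -
  have eq: "(A *\<^sub>v v) \<bullet>c v = qform d A (vec_index v)"
    if A: "A \<in> carrier_mat d d" and v: "v \<in> carrier_vec d" for v :: "complex Matrix.vec"
    using A v unfolding qform_def
    by (auto simp: scalar_prod_def lessThan_atLeast0 sum_distrib_left mult_ac intro!: sum.cong)
  have eq2: "qform d A (vec_index (Matrix.vec d v)) = qform d A v" for v
    unfolding qform_def by (intro sum.cong refl) auto
  show ?thesis
  proof
    assume p: "psd d A"
    hence "hermitian d A" unfolding hermitian_iff psd_def by blast
    moreover have "0 \<le> Re (qform d A v)" for v
    proof -
      have "0 \<le> Re ((A *\<^sub>v Matrix.vec d v) \<bullet>c Matrix.vec d v)"
        using p unfolding psd_def by (meson vec_carrier)
      thus ?thesis using eq[of "Matrix.vec d v"] p eq2 unfolding psd_def by simp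
    qed
    ultimately show "hermitian d A \<and> (\<forall>v. 0 \<le> Re (qform d A v))" by blast
  next
    assume "hermitian d A \<and> (\<forall>v. 0 \<le> Re (qform d A v))"
    thus "psd d A" unfolding psd_def hermitian_iff using eq by auto
  qed
qed

lemma mat_trace_mult_comm:
  assumes "A \<in> carrier_mat m n" "B \<in> carrier_mat n m"
  shows "mat_trace (A * B) = mat_trace (B * A)"
proof -
  have "mat_trace (A * B) = (\<Sum>i<m. \<Sum>k<n. A $$ (i, k) * B $$ (k, i))"
    using assms by (simp add: mat_trace_def mult_mat_index[of _ m n _ m] del: index_mult_mat(1))
  also have "\<dots> = (\<Sum>k<n. \<Sum>i<m. A $$ (i, k) * B $$ (k, i))" by (rule sum.swap)
  also have "\<dots> = mat_trace (B * A)"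
    using assms
    by (simp add: mat_trace_def mult_mat_index[of _ n m _ n] mult.commute del: index_mult_mat(1))
  finally show ?thesis .
qed

section \<open>The spectral theorem for Hermitian matrices\<close>

lemma mat_trace_eq_sum_eigenvalues:
  fixes A :: "complex mat"
  assumes A: "A \<in> carrier_mat d d"
  shows "\<exists>es. char_poly A = (\<Prod>e\<leftarrow>es. [:- e, 1:]) \<and> length es = d \<and> mat_trace A = sum_list es"
proof -
  obtain es where es: "char_poly A = (\<Prod>e\<leftarrow>es. [:- e, 1:])" "length es = d"
    using char_poly_factorized[OF A] by blast
  obtain B P Q where "schur_decomposition A es = (B, P, Q)" by (cases "schur_decomposition A es")
  from schur_decomposition[OF A es(1) this]
  have s: "similar_mat_wit A B P Q" and dg: "diag_mat B = es" by auto
  from similar_mat_witD2[OF A s] have PQ: "P \<in> carrier_mat d d" "Q \<in> carrier_mat d d"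
    "B \<in> carrier_mat d d" "A = P * B * Q" "Q * P = 1\<^sub>m d" by auto
  have "mat_trace A = mat_trace (Q * (P * B))"
    unfolding PQ(4) by (rule mat_trace_mult_comm[of _ d d]) (use PQ in auto)
  also have "Q * (P * B) = B"
    using PQ(1,2,3,5) by (metis assoc_mult_mat left_mult_one_mat)
  also have "mat_trace B = sum_list es"
    unfolding dg[symmetric] mat_trace_def diag_mat_def
    by (simp add: interv_sum_list_conv_sum_set_nat lessThan_atLeast0)
  finally show ?thesis using es by blast
qed

text \<open>If all roots of the characteristic polynomial were \<open>c\<close>, the trace, being
  their sum, would be \<open>d * c\<close>. This trace test supplies the next eigenvector in the
  induction of \<open>hermitian_eigensystem\<close>.\<close>

lemma exists_eigenvalue_neq:
  fixes A :: "complex mat"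
  assumes A: "A \<in> carrier_mat d d" and tr: "mat_trace A \<noteq> of_nat d * c"
  shows "\<exists>\<mu> w. \<mu> \<noteq> c \<and> (\<exists>i<d. w i \<noteq> 0) \<and> (\<forall>i<d. (\<Sum>j<d. A $$ (i, j) * w j) = \<mu> * w i)"
proof -
  obtain es where es: "char_poly A = (\<Prod>e\<leftarrow>es. [:- e, 1:])" "length es = d" "mat_trace A = sum_list es"
    using mat_trace_eq_sum_eigenvalues[OF A] by blast
  have "\<exists>\<mu>\<in>set es. \<mu> \<noteq> c"
  proof (rule ccontr)
    assume "\<not> (\<exists>\<mu>\<in>set es. \<mu> \<noteq> c)"
    hence "es = replicate d c" using es(2) by (metis replicate_length_same)
    thus False using tr es(3) by (simp add: sum_list_replicate)
  qed
  then obtain \<mu> where mu: "\<mu> \<in> set es" "\<mu> \<noteq> c" by blast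
  have "poly (char_poly A) \<mu> = 0"
    unfolding es(1) using mu(1) by (auto simp: poly_prod_list prod_list_zero_iff)
  hence "eigenvalue A \<mu>" using eigenvalue_root_char_poly[OF A] by blast
  then obtain v where v: "v \<in> carrier_vec d" "v \<noteq> 0\<^sub>v d" "A *\<^sub>v v = \<mu> \<cdot>\<^sub>v v"
    using A unfolding eigenvalue_def eigenvector_def by auto
  have "\<exists>i<d. v $ i \<noteq> 0"
  proof (rule ccontr)
    assume "\<not> (\<exists>i<d. v $ i \<noteq> 0)"
    hence "v = 0\<^sub>v d" using v(1) by (intro eq_vecI) auto
    thus False using v(2) by simp
  qed
  moreover have "(\<Sum>j<d. A $$ (i, j) * v $ j) = \<mu> * v $ i" if i: "i < d" for i
  proof -
    have "(A *\<^sub>v v) $ i = (\<mu> \<cdot>\<^sub>v v) $ i" by (simp add: v(3))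
    thus ?thesis using A v(1) i by (simp add: scalar_prod_def lessThan_atLeast0)
  qed
  ultimately show ?thesis using mu(2) by blast
qed

lemma hermitian_adjoint_sum:
  assumes h: "hermitian d A"
  shows "(\<Sum>i<d. cnj (u i) * (\<Sum>j<d. A $$ (i, j) * w j)) =
         (\<Sum>j<d. cnj (\<Sum>i<d. A $$ (j, i) * u i) * w j)"
proof -
  have "(\<Sum>i<d. cnj (u i) * (\<Sum>j<d. A $$ (i, j) * w j)) =
        (\<Sum>i<d. \<Sum>j<d. cnj (A $$ (j, i) * u i) * w j)"
    unfolding sum_distrib_left
  proof (intro sum.cong refl)
    show "cnj (u i) * (A $$ (i, j) * w j) = cnj (A $$ (j, i) * u i) * w j"
      if "i \<in> {..<d}" "j \<in> {..<d}" for i j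
      using hermitianD(2)[OF h, of j i] that by simp
  qed
  also have "\<dots> = (\<Sum>j<d. \<Sum>i<d. cnj (A $$ (j, i) * u i) * w j)" by (rule sum.swap)
  finally show ?thesis by (simp add: sum_distrib_right)
qed

text \<open>Induction on the number of orthonormal eigenvectors found. Instead of restricting to
  their orthogonal complement, a sum of rank-one terms gives all of them the common eigenvalue
  \<open>c\<close>. An eigenvector of the resulting \<open>B\<close> for another eigenvalue is
  orthogonal to them because \<open>B\<close> is Hermitian, and on such vectors \<open>B\<close> and
  \<open>A\<close> agree.\<close>

lemma hermitian_eigensystem:
  assumes h: "hermitian d A" and "k \<le> d"
  shows "\<exists>U (e :: nat \<Rightarrow> real).
    (\<forall>a<k. \<forall>b<k. (\<Sum>i<d. cnj (U i a) * U i b) = (if a = b then 1 else 0)) \<and>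
    (\<forall>a<k. \<forall>i<d. (\<Sum>j<d. A $$ (i, j) * U j a) = of_real (e a) * U i a)"
  using assms(2)
proof (induction k)
  case 0
  show ?case by auto
next
  case (Suc k)
  note A = hermitianD(1)[OF h]
  from Suc.IH[OF Suc_leD[OF Suc.prems]] obtain U and e :: "nat \<Rightarrow> real" where
    Ue: "\<forall>a<k. \<forall>b<k. (\<Sum>i<d. cnj (U i a) * U i b) = (if a = b then 1 else 0)"
    "\<forall>a<k. \<forall>i<d. (\<Sum>j<d. A $$ (i, j) * U j a) = of_real (e a) * U i a"
    by (elim exE conjE)
  note U = Ue(1)[rule_format] and e = Ue(2)[rule_format]
  \<comment> \<open>Shift the eigenvalues already found to \<open>c\<close>, where \<open>c\<close> is chosen so that, by the trace,
    not every eigenvalue of the shifted matrix is \<open>c\<close>.\<close>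
  obtain c :: real where c: "mat_trace A - of_real (\<Sum>a<k. e a - c) \<noteq> of_nat d * of_real c"
  proof -
    have "mat_trace A - of_real (\<Sum>a<k. e a - 0) \<noteq> of_nat d * of_real 0 \<or>
          mat_trace A - of_real (\<Sum>a<k. e a - 1) \<noteq> of_nat d * of_real 1"
    proof (rule ccontr)
      assume "\<not> ?thesis"
      hence "mat_trace A - of_real (\<Sum>a<k. e a) = 0"
        "mat_trace A - of_real (\<Sum>a<k. e a) + of_nat k = of_nat d"
        by (auto simp: sum_subtractf)
      hence "(of_nat k :: complex) = of_nat d" by simp
      thus False using Suc.prems by (simp only: of_nat_eq_iff)
    qed
    thus thesis using that[of 0] that[of 1] by argo
  qed
  define B where "B = Matrix.mat d d (\<lambda>(i, j). A $$ (i, j) - (\<Sum>a<k. of_real (e a - c) * U i a * cnj (U j a)))"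
  have hB: "hermitian d B"
    unfolding hermitian_def
  proof (intro conjI allI impI)
    show "B $$ (j, i) = cnj (B $$ (i, j))" if "i < d" "j < d" for i j
      using that hermitianD(2)[OF h that] by (simp add: B_def mult_ac)
  qed (simp add: B_def)
  note B = hermitianD(1)[OF hB]
  have Bw: "(\<Sum>j<d. B $$ (i, j) * w j) =
      (\<Sum>j<d. A $$ (i, j) * w j) - (\<Sum>a<k. of_real (e a - c) * U i a * (\<Sum>j<d. cnj (U j a) * w j))"
    if "i < d" for i w
  proof -
    have "(\<Sum>j<d. B $$ (i, j) * w j) = (\<Sum>j<d. A $$ (i, j) * w j) -
        (\<Sum>j<d. \<Sum>a<k. of_real (e a - c) * U i a * (cnj (U j a) * w j))"
      using that by (simp add: B_def left_diff_distrib sum_subtractf sum_distrib_right mult.assoc)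
    also have "(\<Sum>j<d. \<Sum>a<k. of_real (e a - c) * U i a * (cnj (U j a) * w j)) =
        (\<Sum>a<k. \<Sum>j<d. of_real (e a - c) * U i a * (cnj (U j a) * w j))"
      by (rule sum.swap)
    finally show ?thesis by (simp add: sum_distrib_left)
  qed
  have BU: "(\<Sum>j<d. B $$ (i, j) * U j b) = of_real c * U i b" if "i < d" "b < k" for i b
  proof -
    have "(\<Sum>a<k. of_real (e a - c) * U i a * (\<Sum>j<d. cnj (U j a) * U j b)) =
        (\<Sum>a<k. if a = b then of_real (e a - c) * U i a else 0)"
      using that(2) by (intro sum.cong) (auto simp: U)
    also have "\<dots> = of_real (e b - c) * U i b" using that(2) by simp
    finally show ?thesis using that by (simp add: Bw e left_diff_distrib)
  qed
  have "mat_trace B = mat_trace A - (\<Sum>i<d. \<Sum>a<k. of_real (e a - c) * (cnj (U i a) * U i a))"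
    using A by (simp add: mat_trace_def B_def sum_subtractf mult_ac)
  also have "(\<Sum>i<d. \<Sum>a<k. of_real (e a - c) * (cnj (U i a) * U i a)) =
      (\<Sum>a<k. \<Sum>i<d. of_real (e a - c) * (cnj (U i a) * U i a))" by (rule sum.swap)
  also have "\<dots> = of_real (\<Sum>a<k. e a - c)"
    by (simp add: sum_distrib_left[symmetric] U)
  finally have trB: "mat_trace B \<noteq> of_nat d * of_real c" using c by simp
  obtain \<mu> w where mu: "\<mu> \<noteq> of_real c" and w0: "\<exists>i<d. w i \<noteq> 0"
    and w: "\<And>i. i < d \<Longrightarrow> (\<Sum>j<d. B $$ (i, j) * w j) = \<mu> * w i"
    using exists_eigenvalue_neq[OF B trB] by blast
  \<comment> \<open>Moving \<open>B\<close> across the inner product yields the factor \<mu> on one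
    side and \<open>c\<close> on the other; since they differ, the inner product is zero.\<close>
  have orth: "(\<Sum>j<d. cnj (U j b) * w j) = 0" if b: "b < k" for b
  proof -
    have "\<mu> * (\<Sum>j<d. cnj (U j b) * w j) = (\<Sum>i<d. cnj (U i b) * (\<mu> * w i))"
      by (simp add: sum_distrib_left mult.left_commute)
    also have "\<dots> = (\<Sum>i<d. cnj (U i b) * (\<Sum>j<d. B $$ (i, j) * w j))" by (simp add: w)
    also have "\<dots> = of_real c * (\<Sum>j<d. cnj (U j b) * w j)"
      unfolding hermitian_adjoint_sum[OF hB] using b
      by (simp add: BU sum_distrib_left mult.assoc del: complex_cnj_mult)
        (simp add: mult.assoc)
    finally show ?thesis using mu by simp
  qed
  have Aw: "(\<Sum>j<d. A $$ (i, j) * w j) = \<mu> * w i" if "i < d" for i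
    using w[OF that] that by (simp add: Bw orth)
  define N where "N = (\<Sum>i<d. (cmod (w i))\<^sup>2)"
  have N: "N > 0" unfolding N_def using w0 by (auto intro!: sum_pos2)
  have ww: "(\<Sum>i<d. cnj (w i) * w i) = of_real N"
    unfolding N_def of_real_sum complex_norm_square by (simp add: mult.commute)
  have "\<mu> * (\<Sum>i<d. cnj (w i) * w i) = (\<Sum>i<d. cnj (w i) * (\<mu> * w i))"
    by (simp add: sum_distrib_left mult.left_commute)
  also have "\<dots> = (\<Sum>i<d. cnj (w i) * (\<Sum>j<d. A $$ (i, j) * w j))"
    by (simp add: Aw)
  also have "\<dots> = cnj \<mu> * (\<Sum>i<d. cnj (w i) * w i)"
    unfolding hermitian_adjoint_sum[OF h] by (simp add: Aw sum_distrib_left mult.assoc)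
  finally have "cnj \<mu> = \<mu>" using N by (simp add: ww)
  hence "\<mu> \<in> \<real>" by (simp add: Reals_cnj_iff)
  then obtain m :: real where m: "\<mu> = of_real m" by (rule Reals_cases)
  define V where "V = (\<lambda>i a. if a = k then w i / of_real (sqrt N) else U i a)"
  define f where "f = (\<lambda>a. if a = k then m else e a)"
  have orth': "(\<Sum>j<d. cnj (w j) * U j b) = 0" if "b < k" for b
    using arg_cong[OF orth[OF that], of cnj] by (simp add: mult.commute)
  have sq: "complex_of_real (sqrt N) * complex_of_real (sqrt N) = complex_of_real N"
    using N by (simp flip: of_real_mult)
  have "(\<Sum>i<d. cnj (V i a) * V i b) = (if a = b then 1 else 0)" if "a < Suc k" "b < Suc k" for a b
    using that U[of a b] orth[of a] orth'[of b] ww sq N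
    by (cases "a = k"; cases "b = k")
      (auto simp: V_def sum_divide_distrib[symmetric] simp flip: of_real_mult)
  moreover have "(\<Sum>j<d. A $$ (i, j) * V j a) = of_real (f a) * V i a" if "a < Suc k" "i < d" for a i
    using that e[of a i] Aw[of i] by (auto simp: V_def f_def m sum_divide_distrib[symmetric])
  ultimately show ?case by blast
qed

lemma mat_eq_iff_index:
  assumes "A \<in> carrier_mat m n" "B \<in> carrier_mat m n"
  shows "A = B \<longleftrightarrow> (\<forall>i<m. \<forall>j<n. A $$ (i, j) = B $$ (i, j))"
  using assms by (auto intro!: eq_matI)

text \<open>Both orthonormality relations are kept: that of the columns computes coordinates of
  eigenvectors, that of the rows gives Parseval's identity.\<close>

lemma is_eig_decomp_iff:
  assumes A: "A \<in> carrier_mat d d"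
  shows "is_eig_decomp A U e \<longleftrightarrow> U \<in> carrier_mat d d \<and>
    (\<forall>a<d. \<forall>b<d. (\<Sum>i<d. cnj (U $$ (i, a)) * U $$ (i, b)) = (if a = b then 1 else 0)) \<and>
    (\<forall>a<d. \<forall>b<d. (\<Sum>i<d. U $$ (a, i) * cnj (U $$ (b, i))) = (if a = b then 1 else 0)) \<and>
    (\<forall>i<d. \<forall>j<d. A $$ (i, j) = (\<Sum>k<d. U $$ (i, k) * of_real (e k) * cnj (U $$ (j, k))))"
    (is "_ \<longleftrightarrow> ?U \<and> ?P1 \<and> ?P2 \<and> ?P3")
proof (cases ?U)
  case U: True
  note U' = mat_adjoint_carrier[OF U]
  note [simp del] = index_mult_mat(1)
  have 1: "mat_adjoint U * U = 1\<^sub>m d \<longleftrightarrow> ?P1"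
    by (subst mat_eq_iff_index[of _ d d])
      (use U U' in \<open>simp_all add: mult_mat_index[OF U' U] mat_adjoint_index[OF U]\<close>)
  have 2: "U * mat_adjoint U = 1\<^sub>m d \<longleftrightarrow> ?P2"
    by (subst mat_eq_iff_index[of _ d d])
      (use U U' in \<open>simp_all add: mult_mat_index[OF U U'] mat_adjoint_index[OF U]\<close>)
  define D where "D = U * mat_diag d (\<lambda>i. complex_of_real (e i))"
  have D: "D \<in> carrier_mat d d" using U by (simp add: D_def)
  have Di: "D $$ (i, k) = U $$ (i, k) * of_real (e k)" if "i < d" "k < d" for i k
    using that by (simp add: D_def mat_diag_mult_right[OF U])
  have 3: "A = D * mat_adjoint U \<longleftrightarrow> ?P3"
    by (subst mat_eq_iff_index[of _ d d])
      (use A U U' D in \<open>simp_all add: mult_mat_index[OF D U'] mat_adjoint_index[OF U] Di\<close>)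
  have "dim_row A = d" using A by auto
  thus ?thesis unfolding is_eig_decomp_def unitary_mat_def using 1 2 3[unfolded D_def] U by auto
next
  case False
  have "dim_row A = d" using A by auto
  thus ?thesis using False unfolding is_eig_decomp_def unitary_mat_def by auto
qed

theorem hermitian_is_eig_decomp:
  assumes h: "hermitian d A"
  shows "\<exists>U e. is_eig_decomp A U e"
proof -
  note A = hermitianD(1)[OF h]
  obtain U0 and e :: "nat \<Rightarrow> real" where
    U0: "\<forall>a<d. \<forall>b<d. (\<Sum>i<d. cnj (U0 i a) * U0 i b) = (if a = b then 1 else 0)" and
    e: "\<forall>a<d. \<forall>i<d. (\<Sum>j<d. A $$ (i, j) * U0 j a) = of_real (e a) * U0 i a"
    using hermitian_eigensystem[OF h le_refl] by blast
  define U where "U = Matrix.mat d d (\<lambda>(i, j). U0 i j)"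
  have U: "U \<in> carrier_mat d d" unfolding U_def by simp
  note U' = mat_adjoint_carrier[OF U]
  let ?D = "mat_diag d (\<lambda>i. complex_of_real (e i))"
  have D: "?D \<in> carrier_mat d d" by simp
  note [simp del] = index_mult_mat(1)
  have Ui: "U $$ (i, j) = U0 i j" if "i < d" "j < d" for i j using that by (simp add: U_def)
  have UU: "mat_adjoint U * U = 1\<^sub>m d"
    by (subst mat_eq_iff_index[of _ d d])
      (use U U' U0 in \<open>simp_all add: mult_mat_index[OF U' U] mat_adjoint_index[OF U] Ui\<close>)
  have UU': "U * mat_adjoint U = 1\<^sub>m d" by (rule mat_mult_left_right_inverse[OF U' U UU])
  have AU: "A * U = U * ?D"
    by (subst mat_eq_iff_index[of _ d d])
      (use A U e in \<open>simp_all add: mult_mat_index[OF A U] mat_diag_mult_right[OF U] Ui mult.commute[of "U0 _ _" "of_real _"]\<close>)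
  have "A = A * (U * mat_adjoint U)" unfolding UU' using A by simp
  also have "\<dots> = A * U * mat_adjoint U" using A U U' by (simp add: assoc_mult_mat[of _ d d _ d _ d])
  finally have "A = U * ?D * mat_adjoint U" unfolding AU .
  moreover have "dim_row A = d" using A by auto
  ultimately have "is_eig_decomp A U e"
    unfolding is_eig_decomp_def unitary_mat_def using U UU UU' by simp
  thus ?thesis by blast
qed

section \<open>Functional calculus and overlaps of eigenbases\<close>

definition eig_coef :: "nat \<Rightarrow> complex mat \<Rightarrow> (nat \<Rightarrow> complex) \<Rightarrow> nat \<Rightarrow> complex" where
  "eig_coef d U v k = (\<Sum>i<d. cnj (U $$ (i, k)) * v i)"

lemma is_eig_decompD:
  assumes "A \<in> carrier_mat d d" "is_eig_decomp A U e"
  shows "U \<in> carrier_mat d d"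
    "a < d \<Longrightarrow> b < d \<Longrightarrow> (\<Sum>i<d. cnj (U $$ (i, a)) * U $$ (i, b)) = (if a = b then 1 else 0)"
    "a < d \<Longrightarrow> b < d \<Longrightarrow> (\<Sum>i<d. U $$ (a, i) * cnj (U $$ (b, i))) = (if a = b then 1 else 0)"
    "i < d \<Longrightarrow> j < d \<Longrightarrow> A $$ (i, j) = (\<Sum>k<d. U $$ (i, k) * of_real (e k) * cnj (U $$ (j, k)))"
  using assms(2) unfolding is_eig_decomp_iff[OF assms(1)] by blast+

lemma mat_fun_carrier_decomp:
  assumes A: "A \<in> carrier_mat d d" and dec: "is_eig_decomp A U e"
  shows "mat_fun f A \<in> carrier_mat d d" "is_eig_decomp (mat_fun f A) U (\<lambda>k. f (e k))"
proof -
  note U = is_eig_decompD(1)[OF A dec] and U' = mat_adjoint_carrier[OF is_eig_decompD(1)[OF A dec]]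
  have dA: "dim_row A = d" using A by auto
  show c: "mat_fun f A \<in> carrier_mat d d" unfolding mat_fun_eq[OF dec] dA using U U' by auto
  hence "dim_row (mat_fun f A) = d" by auto
  thus "is_eig_decomp (mat_fun f A) U (\<lambda>k. f (e k))"
    using dec mat_fun_eq[OF dec, of f] dA unfolding is_eig_decomp_def by simp
qed

lemma is_eig_decomp_hermitian:
  assumes A: "A \<in> carrier_mat d d" and dec: "is_eig_decomp A U e"
  shows "hermitian d A"
  unfolding hermitian_def
proof (intro conjI allI impI)
  show "A $$ (j, i) = cnj (A $$ (i, j))" if "i < d" "j < d" for i j
    using that by (simp add: is_eig_decompD(4)[OF A dec] mult_ac)
qed (rule A)

lemma qform_eig:
  assumes A: "A \<in> carrier_mat d d" and dec: "is_eig_decomp A U e"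
  shows "qform d A v = of_real (\<Sum>k<d. e k * (cmod (eig_coef d U v k))\<^sup>2)"
proof -
  have "qform d A v = (\<Sum>i<d. \<Sum>j<d. \<Sum>k<d. of_real (e k) * ((U $$ (i, k) * cnj (v i)) * (cnj (U $$ (j, k)) * v j)))"
    unfolding qform_def
    by (intro sum.cong refl) (simp add: is_eig_decompD(4)[OF A dec] sum_distrib_left sum_distrib_right mult_ac)
  also have "\<dots> = (\<Sum>i<d. \<Sum>k<d. \<Sum>j<d. of_real (e k) * ((U $$ (i, k) * cnj (v i)) * (cnj (U $$ (j, k)) * v j)))"
    by (intro sum.cong refl sum.swap)
  also have "\<dots> = (\<Sum>k<d. \<Sum>i<d. \<Sum>j<d. of_real (e k) * ((U $$ (i, k) * cnj (v i)) * (cnj (U $$ (j, k)) * v j)))"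
    by (rule sum.swap)
  also have "\<dots> = (\<Sum>k<d. of_real (e k) * (cnj (eig_coef d U v k) * eig_coef d U v k))"
    by (simp add: eig_coef_def sum_product) (simp only: sum_distrib_left)
  also have "\<dots> = (\<Sum>k<d. of_real (e k * (cmod (eig_coef d U v k))\<^sup>2))"
    by (simp only: of_real_mult complex_norm_square mult.commute)
  finally show ?thesis by simp
qed

lemma qform_mat_fun:
  assumes "A \<in> carrier_mat d d" "is_eig_decomp A U e"
  shows "qform d (mat_fun f A) v = of_real (\<Sum>k<d. f (e k) * (cmod (eig_coef d U v k))\<^sup>2)"
  using qform_eig[OF mat_fun_carrier_decomp[OF assms]] .

lemma mat_fun_ident:
  assumes "A \<in> carrier_mat d d" "is_eig_decomp A U e"
  shows "mat_fun (\<lambda>t. t) A = A"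
  using mat_fun_eq[OF assms(2)] assms(2) unfolding is_eig_decomp_def by simp

lemma eig_coef_col:
  assumes "A \<in> carrier_mat d d" "is_eig_decomp A U e" "k < d" "l < d"
  shows "eig_coef d U (\<lambda>i. U $$ (i, k)) l = (if l = k then 1 else 0)"
  unfolding eig_coef_def using is_eig_decompD(2)[OF assms(1,2)] assms(3,4) by simp

lemma qform_col:
  assumes "A \<in> carrier_mat d d" "is_eig_decomp A U e" "k < d"
  shows "qform d A (\<lambda>i. U $$ (i, k)) = of_real (e k)"
proof -
  have "(\<Sum>l<d. e l * (cmod (eig_coef d U (\<lambda>i. U $$ (i, k)) l))\<^sup>2) = (\<Sum>l<d. if l = k then e l else 0)"
    by (intro sum.cong refl) (simp add: eig_coef_col[OF assms])
  thus ?thesis unfolding qform_eig[OF assms(1,2)] using assms(3) by simp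
qed

lemma psd_eig_nonneg:
  assumes "psd d A" "is_eig_decomp A U e" "k < d"
  shows "0 \<le> e k"
proof -
  have "A \<in> carrier_mat d d" using assms(1) by (simp add: psd_def)
  from qform_col[OF this assms(2,3)] assms(1) show ?thesis
    unfolding psd_iff_qform by (metis Re_complex_of_real)
qed

lemma psdI_eig:
  assumes "A \<in> carrier_mat d d" "is_eig_decomp A U e" "\<And>k. k < d \<Longrightarrow> 0 \<le> e k"
  shows "psd d A"
  unfolding psd_iff_qform qform_eig[OF assms(1,2)]
  using is_eig_decomp_hermitian[OF assms(1,2)] assms(3) by (auto intro!: sum_nonneg)

lemma psd_obtain_eig:
  assumes "psd d A"
  obtains U e where "A \<in> carrier_mat d d" "is_eig_decomp A U e" "\<And>k. k < d \<Longrightarrow> 0 \<le> e k"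
proof -
  have h: "hermitian d A" using assms by (simp add: psd_iff_qform)
  obtain U e where "is_eig_decomp A U e" using hermitian_is_eig_decomp[OF h] by blast
  thus thesis using that hermitianD(1)[OF h] psd_eig_nonneg[OF assms] by blast
qed

lemma psd_mat_fun:
  assumes "psd d A" "\<And>t. 0 \<le> t \<Longrightarrow> 0 \<le> f t"
  shows "psd d (mat_fun f A)"
proof -
  obtain U e where "A \<in> carrier_mat d d" "is_eig_decomp A U e" "\<And>k. k < d \<Longrightarrow> 0 \<le> e k"
    using psd_obtain_eig[OF assms(1)] by metis
  thus ?thesis using psdI_eig[OF mat_fun_carrier_decomp] assms(2) by blast
qed

text \<open>The trace is taken in the eigenbasis of \<open>A\<close>, where
  \<open>mat_fun f A\<close> is diagonal and \<open>X\<close> contributes its diagonal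
  entries.\<close>

lemma trace_mat_fun_mult:
  assumes A: "A \<in> carrier_mat d d" and dec: "is_eig_decomp A U e" and X: "X \<in> carrier_mat d d"
  shows "mat_trace (mat_fun f A * X) = (\<Sum>k<d. of_real (f (e k)) * qform d X (\<lambda>i. U $$ (i, k)))"
proof -
  note F = mat_fun_carrier_decomp[OF A dec, of f]
  have "mat_trace (mat_fun f A * X) = (\<Sum>i<d. \<Sum>j<d. mat_fun f A $$ (i, j) * X $$ (j, i))"
    using F(1) X by (simp add: mat_trace_def mult_mat_index[OF F(1) X] del: index_mult_mat(1))
  also have "\<dots> = (\<Sum>i<d. \<Sum>j<d. \<Sum>k<d. of_real (f (e k)) * (cnj (U $$ (j, k)) * X $$ (j, i) * U $$ (i, k)))"
    by (intro sum.cong refl) (simp add: is_eig_decompD(4)[OF F] sum_distrib_left sum_distrib_right mult_ac)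
  also have "\<dots> = (\<Sum>i<d. \<Sum>k<d. \<Sum>j<d. of_real (f (e k)) * (cnj (U $$ (j, k)) * X $$ (j, i) * U $$ (i, k)))"
    by (intro sum.cong refl sum.swap)
  also have "\<dots> = (\<Sum>k<d. \<Sum>i<d. \<Sum>j<d. of_real (f (e k)) * (cnj (U $$ (j, k)) * X $$ (j, i) * U $$ (i, k)))"
    by (rule sum.swap)
  also have "\<dots> = (\<Sum>k<d. \<Sum>j<d. \<Sum>i<d. of_real (f (e k)) * (cnj (U $$ (j, k)) * X $$ (j, i) * U $$ (i, k)))"
    by (intro sum.cong refl sum.swap)
  finally show ?thesis by (simp add: qform_def sum_distrib_left)
qed

lemma trace_psd_mult_nonneg:
  assumes "psd d A" "psd d B"
  shows "0 \<le> Re (mat_trace (A * B))"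
proof -
  obtain U e where A: "A \<in> carrier_mat d d" "is_eig_decomp A U e" and e: "\<And>k. k < d \<Longrightarrow> 0 \<le> e k"
    using psd_obtain_eig[OF assms(1)] by metis
  have "B \<in> carrier_mat d d" using assms(2) by (simp add: psd_def)
  from trace_mat_fun_mult[OF A this, of "\<lambda>t. t"]
  show ?thesis unfolding mat_fun_ident[OF A]
    using assms(2) e by (auto simp: psd_iff_qform intro!: sum_nonneg mult_nonneg_nonneg)
qed

text \<open>Transition probabilities between two eigenbases, a doubly stochastic array. They turn
  traces of products of functions of two matrices into classical double sums; weighted by the
  eigenvalues of either matrix they are the Nussbaum-Szkola distributions.\<close>

definition overlap :: "nat \<Rightarrow> complex mat \<Rightarrow> complex mat \<Rightarrow> nat \<Rightarrow> nat \<Rightarrow> real" where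
  "overlap d U V k l = (cmod (\<Sum>i<d. cnj (V $$ (i, l)) * U $$ (i, k)))\<^sup>2"

lemma trace_mat_fun_mult_mat_fun:
  assumes "A \<in> carrier_mat d d" "is_eig_decomp A U e" "B \<in> carrier_mat d d" "is_eig_decomp B V g"
  shows "mat_trace (mat_fun f A * mat_fun h B) =
    of_real (\<Sum>k<d. \<Sum>l<d. f (e k) * h (g l) * overlap d U V k l)"
  unfolding trace_mat_fun_mult[OF assms(1,2) mat_fun_carrier_decomp(1)[OF assms(3,4)]]
    qform_mat_fun[OF assms(3,4)]
  by (simp add: overlap_def eig_coef_def sum_distrib_left mult_ac)

lemma overlap_nonneg: "0 \<le> overlap d U V k l"
  by (simp add: overlap_def)

text \<open>Parseval's identity, from orthonormality of the rows of \<open>U\<close>.\<close>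

lemma sum_eig_coef:
  assumes "A \<in> carrier_mat d d" "is_eig_decomp A U e"
  shows "(\<Sum>k<d. (cmod (eig_coef d U v k))\<^sup>2) = (\<Sum>i<d. (cmod (v i))\<^sup>2)"
proof -
  have "of_real (\<Sum>k<d. (cmod (eig_coef d U v k))\<^sup>2) =
      (\<Sum>k<d. \<Sum>i<d. \<Sum>j<d. (cnj (v i) * v j) * (U $$ (i, k) * cnj (U $$ (j, k))))"
    unfolding of_real_sum complex_norm_square eig_coef_def
    by (simp add: sum_product mult_ac) (rule sum.cong[OF refl], rule sum.swap)
  also have "\<dots> = (\<Sum>i<d. \<Sum>k<d. \<Sum>j<d. (cnj (v i) * v j) * (U $$ (i, k) * cnj (U $$ (j, k))))"
    by (rule sum.swap)
  also have "\<dots> = (\<Sum>i<d. \<Sum>j<d. \<Sum>k<d. (cnj (v i) * v j) * (U $$ (i, k) * cnj (U $$ (j, k))))"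
    by (intro sum.cong refl sum.swap)
  also have "\<dots> = (\<Sum>i<d. \<Sum>j<d. if i = j then cnj (v i) * v j else 0)"
    by (intro sum.cong refl) (simp add: sum_distrib_left[symmetric] is_eig_decompD(3)[OF assms])
  also have "\<dots> = of_real (\<Sum>i<d. (cmod (v i))\<^sup>2)"
    unfolding of_real_sum complex_norm_square by (simp add: mult.commute)
  finally show ?thesis by (simp only: of_real_eq_iff)
qed

lemma overlap_sum:
  assumes "A \<in> carrier_mat d d" "is_eig_decomp A U e" "B \<in> carrier_mat d d" "is_eig_decomp B V g"
  shows "k < d \<Longrightarrow> (\<Sum>l<d. overlap d U V k l) = 1"
proof -
  assume k: "k < d"
  have "(\<Sum>l<d. overlap d U V k l) = (\<Sum>i<d. (cmod (U $$ (i, k)))\<^sup>2)"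
    unfolding overlap_def using sum_eig_coef[OF assms(3,4), of "\<lambda>i. U $$ (i, k)"]
    by (simp add: eig_coef_def)
  also have "complex_of_real \<dots> = 1"
    unfolding of_real_sum complex_norm_square
    using is_eig_decompD(2)[OF assms(1,2) k k] by (simp add: mult.commute)
  finally show ?thesis by (simp only: of_real_eq_1_iff)
qed

lemma overlap_commute: "overlap d U V k l = overlap d V U l k"
proof -
  have "(\<Sum>i<d. cnj (V $$ (i, l)) * U $$ (i, k)) = cnj (\<Sum>i<d. cnj (U $$ (i, k)) * V $$ (i, l))"
    by (simp add: mult.commute)
  thus ?thesis unfolding overlap_def by (simp only: complex_mod_cnj)
qed

section \<open>Operator monotonicity and concavity of powers\<close>

text \<open>The right side is smallest at b = e a / (e + s), where equality holds. After the
  triangle inequality and clearing denominators, the defect is a perfect square.\<close>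

lemma parallel_sum_le:
  fixes a b :: complex and e s :: real
  assumes "0 \<le> e" "0 < s"
  shows "e * s / (e + s) * (cmod a)\<^sup>2 \<le> e * (cmod (a - b))\<^sup>2 + s * (cmod b)\<^sup>2"
proof -
  define x y where "x = cmod (a - b)" and "y = cmod b"
  have "cmod a \<le> x + y" unfolding x_def y_def using norm_triangle_ineq[of "a - b" b] by simp
  hence "(cmod a)\<^sup>2 \<le> (x + y)\<^sup>2" by (intro power_mono) auto
  hence "e * s * (cmod a)\<^sup>2 \<le> e * s * (x + y)\<^sup>2" using assms by (intro mult_left_mono) auto
  also have "\<dots> \<le> (e * x\<^sup>2 + s * y\<^sup>2) * (e + s)"
  proof -
    have "(e * x\<^sup>2 + s * y\<^sup>2) * (e + s) - e * s * (x + y)\<^sup>2 = (e * x - s * y)\<^sup>2"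
      by (simp add: power2_eq_square algebra_simps)
    thus ?thesis by (smt (verit) zero_le_power2)
  qed
  finally show ?thesis using assms unfolding x_def y_def by (simp add: divide_le_eq)
qed

text \<open>The parallel sum of the numbers \<open>s\<close> and \<open>t\<close>; applied to
  \<open>A\<close> it is the parallel sum of \<open>A\<close> and \<open>s\<close> times the
  identity.\<close>

definition par_fun :: "real \<Rightarrow> real \<Rightarrow> real" where
  "par_fun s t = t * s / (t + s)"

lemma eig_coef_diff: "eig_coef d U (\<lambda>i. v i - w i) k = eig_coef d U v k - eig_coef d U w k"
  by (simp add: eig_coef_def right_diff_distrib sum_subtractf)

text \<open>One half of a variational formula: the form of the parallel sum is the minimum over
  \<open>w\<close> of the right side, the other half being \<open>qform_par_fun_attained\<close>.
  The right side is affine in \<open>A\<close>, so the minimum is monotone and concave in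
  \<open>A\<close>; both properties of operator powers come from this.\<close>

lemma qform_par_fun_le:
  assumes p: "psd d A" and s: "0 < s"
  shows "Re (qform d (mat_fun (par_fun s) A) v) \<le>
    Re (qform d A (\<lambda>i. v i - w i)) + s * (\<Sum>i<d. (cmod (w i))\<^sup>2)"
proof -
  obtain U e where A: "A \<in> carrier_mat d d" "is_eig_decomp A U e" and e: "\<And>k. k < d \<Longrightarrow> 0 \<le> e k"
    using psd_obtain_eig[OF p] by metis
  have "Re (qform d (mat_fun (par_fun s) A) v) = (\<Sum>k<d. e k * s / (e k + s) * (cmod (eig_coef d U v k))\<^sup>2)"
    unfolding qform_mat_fun[OF A] par_fun_def by simp
  also have "\<dots> \<le> (\<Sum>k<d. e k * (cmod (eig_coef d U v k - eig_coef d U w k))\<^sup>2 + s * (cmod (eig_coef d U w k))\<^sup>2)"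
    by (intro sum_mono parallel_sum_le) (use e s in auto)
  also have "\<dots> = Re (qform d A (\<lambda>i. v i - w i)) + s * (\<Sum>i<d. (cmod (w i))\<^sup>2)"
    unfolding qform_eig[OF A] eig_coef_diff sum_eig_coef[OF A, of w, symmetric]
    by (simp add: sum.distrib sum_distrib_left)
  finally show ?thesis .
qed

lemma qform_par_fun_attained:
  assumes p: "psd d A" and s: "0 < s"
  shows "\<exists>w. Re (qform d (mat_fun (par_fun s) A) v) =
    Re (qform d A (\<lambda>i. v i - w i)) + s * (\<Sum>i<d. (cmod (w i))\<^sup>2)"
proof -
  obtain U e where A: "A \<in> carrier_mat d d" "is_eig_decomp A U e" and e: "\<And>k. k < d \<Longrightarrow> 0 \<le> e k"
    using psd_obtain_eig[OF p] by metis
  \<comment> \<open>The minimizer of the scalar problem in each eigendirection of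
    \<open>A\<close>.\<close>
  define c where "c = (\<lambda>k. of_real (e k / (e k + s)) * eig_coef d U v k)"
  define w where "w = (\<lambda>i. \<Sum>l<d. U $$ (i, l) * c l)"
  have w: "eig_coef d U w k = c k" if k: "k < d" for k
  proof -
    have "eig_coef d U w k = (\<Sum>i<d. \<Sum>l<d. c l * (cnj (U $$ (i, k)) * U $$ (i, l)))"
      by (simp add: eig_coef_def w_def sum_distrib_left mult_ac)
    also have "\<dots> = (\<Sum>l<d. \<Sum>i<d. c l * (cnj (U $$ (i, k)) * U $$ (i, l)))" by (rule sum.swap)
    also have "\<dots> = (\<Sum>l<d. if k = l then c l else 0)"
      by (intro sum.cong refl) (simp add: sum_distrib_left[symmetric] is_eig_decompD(2)[OF A] k)
    finally show ?thesis using k by simp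
  qed
  have "Re (qform d (mat_fun (par_fun s) A) v) = (\<Sum>k<d. e k * s / (e k + s) * (cmod (eig_coef d U v k))\<^sup>2)"
    unfolding qform_mat_fun[OF A] par_fun_def by simp
  also have "\<dots> = (\<Sum>k<d. e k * (cmod (eig_coef d U v k - eig_coef d U w k))\<^sup>2 + s * (cmod (eig_coef d U w k))\<^sup>2)"
  proof (intro sum.cong refl)
    fix k assume "k \<in> {..<d}"
    hence k: "k < d" by simp
    define a where "a = eig_coef d U v k"
    have pos: "e k + s > 0" using e[OF k] s by simp
    have "1 - e k / (e k + s) = s / (e k + s)" using pos by (simp add: field_simps)
    hence 1: "a - c k = of_real (s / (e k + s)) * a"
      unfolding c_def a_def[symmetric] by (metis left_diff_distrib mult_1 of_real_1 of_real_diff)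
    have 2: "(cmod (a - c k))\<^sup>2 = (s / (e k + s))\<^sup>2 * (cmod a)\<^sup>2"
      unfolding 1 norm_mult norm_of_real power_mult_distrib power2_abs ..
    have 3: "(cmod (c k))\<^sup>2 = (e k / (e k + s))\<^sup>2 * (cmod a)\<^sup>2"
      unfolding c_def a_def norm_mult norm_of_real power_mult_distrib power2_abs ..
    have "e k * (s / (e k + s))\<^sup>2 + s * (e k / (e k + s))\<^sup>2 = e k * s * (e k + s) / (e k + s)\<^sup>2"
      by (simp add: power_divide add_divide_distrib[symmetric] power2_eq_square algebra_simps)
    hence 4: "e k * s / (e k + s) = e k * (s / (e k + s))\<^sup>2 + s * (e k / (e k + s))\<^sup>2"
      using pos by (simp add: power2_eq_square)
    show "e k * s / (e k + s) * (cmod (eig_coef d U v k))\<^sup>2 =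
        e k * (cmod (eig_coef d U v k - eig_coef d U w k))\<^sup>2 + s * (cmod (eig_coef d U w k))\<^sup>2"
      unfolding w[OF k] a_def[symmetric] 2 3 4 by (simp add: algebra_simps)
  qed
  also have "\<dots> = Re (qform d A (\<lambda>i. v i - w i)) + s * (\<Sum>i<d. (cmod (w i))\<^sup>2)"
    unfolding qform_eig[OF A] eig_coef_diff sum_eig_coef[OF A, of w, symmetric]
    by (simp add: sum.distrib sum_distrib_left)
  finally show ?thesis by blast
qed

text \<open>Substituting \<open>s\<close> by \<open>t * s\<close> in the integral extracts the
  factor \<open>t powr p\<close>, so powers are positive superpositions of parallel sums. The value
  of the constant is irrelevant, only its positivity is used.\<close>

lemma powr_integral_representation:
  fixes p :: real
  assumes p: "0 < p" "p < 1"
  shows "\<exists>K>0. \<forall>t\<ge>0. has_bochner_integral lborel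
    (\<lambda>s. indicator {0<..} s * (s powr (p - 2) * par_fun s t)) (K * t powr p)"
proof -
  \<comment> \<open>The integrand at \<open>t = 1\<close>; the integrands for other positive
    \<open>t\<close> are multiples of its dilation \<open>g (s / t)\<close>.\<close>
  define g where "g = (\<lambda>s::real. indicator {0<..} s * (s powr (p - 2) * par_fun s 1))"
  have g_nonneg: "0 \<le> g s" for s by (auto simp: g_def par_fun_def indicator_def)
  have [measurable]: "g \<in> borel_measurable borel" unfolding g_def par_fun_def by measurable
  have int01: "set_integrable lebesgue {0..1} (\<lambda>s. s powr (p - 1))"
    by (intro nonnegative_absolutely_integrable_1 integrable_on_powr_from_0) (use p in auto)
  have int1: "set_integrable lebesgue {1..} (\<lambda>s. s powr (p - 2))"
    by (intro nonnegative_absolutely_integrable_1 has_integral_integrable[OF has_integral_powr_to_inf])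
      (use p in auto)
  \<comment> \<open>Since s / (1 + s) is at most s and at most 1, \<open>g\<close> is dominated by
    \<open>s powr (p - 1)\<close> near 0 and by \<open>s powr (p - 2)\<close> at infinity.\<close>
  have "integrable lebesgue g"
  proof (rule Bochner_Integration.integrable_bound)
    show "integrable lebesgue (\<lambda>s. indicator {0..1} s *\<^sub>R s powr (p - 1) + indicator {1..} s *\<^sub>R s powr (p - 2))"
      using int01 int1 unfolding set_integrable_def by (rule Bochner_Integration.integrable_add)
    show "AE s in lebesgue. norm (g s) \<le> norm (indicator {0..1} s *\<^sub>R s powr (p - 1) + indicator {1..} s *\<^sub>R s powr (p - 2))"
    proof (intro AE_I2)
      fix s :: real
      show "norm (g s) \<le> norm (indicator {0..1} s *\<^sub>R s powr (p - 1) + indicator {1..} s *\<^sub>R s powr (p - 2))"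
      proof (cases "s > 0")
        case True
        have eq: "s powr (p - 1) = s powr (p - 2) * s" using True by (simp add: powr_diff power2_eq_square)
        have gs: "g s = s powr (p - 2) * (s / (1 + s))" using True by (simp add: g_def par_fun_def)
        have "g s \<le> s powr (p - 2) * s" "g s \<le> s powr (p - 2) * 1"
          unfolding gs using True by (auto intro!: mult_left_mono simp: divide_le_eq algebra_simps)
        thus ?thesis using True g_nonneg[of s] eq
          by (cases "s \<le> 1") (auto simp: indicator_def intro: order_trans)
      qed (simp add: g_def)
    qed
    show "g \<in> borel_measurable lebesgue" by (rule measurable_completion) measurable
  qed
  hence gi: "integrable lborel g" using integrable_completion[of g lborel] by simp
  define K where "K = integral\<^sup>L lborel g"
  \<comment> \<open>On (0, 1] both \<open>1 \<le> s powr (p - 1)\<close> and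
    \<open>1 / 2 \<le> 1 / (1 + s)\<close>.\<close>
  have "1 / 2 \<le> K"
  proof -
    have "(\<integral>s. indicator {0<..1::real} s * (1 / 2 :: real) \<partial>lborel) \<le> K" unfolding K_def
    proof (rule integral_mono[OF _ gi])
      show "indicator {0<..1} s * (1 / 2) \<le> g s" for s
      proof (cases "0 < s \<and> s \<le> 1")
        case True
        have "1 \<le> s powr (p - 1)" using True p ge_one_powr_ge_zero[of "1 / s" "1 - p"]
          by (simp add: powr_divide powr_minus_divide[symmetric])
        hence "1 * (1 / 2) \<le> s powr (p - 1) * (1 / (1 + s))"
          using True by (intro mult_mono) (auto simp: field_simps)
        moreover have "s powr (p - 1) = s powr (p - 2) * s" using True by (simp add: powr_diff power2_eq_square)
        ultimately show ?thesis using True by (simp add: g_def par_fun_def mult_ac)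
      next
        case False
        thus ?thesis using g_nonneg[of s] by (auto simp: indicator_def)
      qed
    qed simp
    thus ?thesis by simp
  qed
  moreover have "has_bochner_integral lborel
      (\<lambda>s. indicator {0<..} s * (s powr (p - 2) * par_fun s t)) (K * t powr p)" if t: "t \<ge> 0" for t
  proof (cases "t = 0")
    case True
    thus ?thesis using p by (simp add: par_fun_def has_bochner_integral_zero)
  next
    case False
    hence t: "t > 0" using t by simp
    have "has_bochner_integral lborel g K" using gi unfolding K_def by (rule has_bochner_integral_integrable)
    from lborel_has_bochner_integral_real_affine_iff[of "1 / t" g K 0] t this
    have h: "has_bochner_integral lborel (\<lambda>s. g (s / t)) (t * K)" by simp
    have eq: "g (s / t) * t powr (p - 1) = indicator {0<..} s * (s powr (p - 2) * par_fun s t)" for s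
    proof (cases "s > 0")
      case True
      have "par_fun (s / t) 1 = s / (t + s)" using t True by (simp add: par_fun_def field_simps)
      moreover have "(s / t) powr (p - 2) = s powr (p - 2) / t powr (p - 2)" using t True by (simp add: powr_divide)
      moreover have "t powr (p - 1) = t powr (p - 2) * t" using t by (simp add: powr_diff power2_eq_square)
      ultimately show ?thesis using t True by (simp add: g_def) (simp add: par_fun_def)
    qed (use t in \<open>simp add: g_def zero_less_divide_iff\<close>)
    have "t * t powr (p - 1) = t powr p" using t by (simp add: powr_diff)
    hence K: "t * K * t powr (p - 1) = K * t powr p" by (simp add: mult_ac)
    show ?thesis
      using has_bochner_integral_mult_left[where c = "t powr (p - 1)", OF h] unfolding eq K .
  qed
  ultimately show ?thesis by (intro exI[of _ K]) auto
qed

lemma psdD: "psd d A \<Longrightarrow> A \<in> carrier_mat d d" "psd d A \<Longrightarrow> hermitian d A"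
  by (simp_all add: psd_iff_qform hermitianD(1))

text \<open>One constant serves all matrices and all vectors, so inequalities between integrands
  pass to the powers. Integrating quadratic forms avoids matrix-valued integrals.\<close>

lemma qform_powr_integral:
  assumes p: "0 < p" "p < 1"
  shows "\<exists>K>0. \<forall>A v. psd d A \<longrightarrow> has_bochner_integral lborel
    (\<lambda>s. indicator {0<..} s * (s powr (p - 2) * Re (qform d (mat_fun (par_fun s) A) v)))
    (K * Re (qform d (mat_powr A p) v))"
proof -
  obtain K where K: "K > 0" and Ki: "\<And>t. t \<ge> 0 \<Longrightarrow> has_bochner_integral lborel
    (\<lambda>s. indicator {0<..} s * (s powr (p - 2) * par_fun s t)) (K * t powr p)"
    using powr_integral_representation[OF p] by metis
  have "has_bochner_integral lborel
    (\<lambda>s. indicator {0<..} s * (s powr (p - 2) * Re (qform d (mat_fun (par_fun s) A) v)))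
    (K * Re (qform d (mat_powr A p) v))" if psdA: "psd d A" for A v
  proof -
    obtain U e where A: "A \<in> carrier_mat d d" "is_eig_decomp A U e" and e: "\<And>k. k < d \<Longrightarrow> 0 \<le> e k"
      using psd_obtain_eig[OF psdA] by metis
    have "has_bochner_integral lborel
      (\<lambda>s. \<Sum>k<d. indicator {0<..} s * (s powr (p - 2) * par_fun s (e k)) * (cmod (eig_coef d U v k))\<^sup>2)
      (\<Sum>k<d. K * e k powr p * (cmod (eig_coef d U v k))\<^sup>2)"
      by (intro has_bochner_integral_sum has_bochner_integral_mult_left Ki e) simp
    thus ?thesis
      unfolding mat_powr_def qform_mat_fun[OF A] by (simp add: sum_distrib_left mult_ac)
  qed
  thus ?thesis using K by blast
qed

lemma has_bochner_integral_mono: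
  fixes a b :: real
  assumes "has_bochner_integral M f a" "has_bochner_integral M g b" "\<And>x. f x \<le> g x"
  shows "a \<le> b"
  using assms integral_mono[of M f g] by (auto simp: has_bochner_integral_iff)

text \<open>The Loewner-Heinz inequality: for each \<open>s\<close> the minimizer for
  \<open>B\<close> is a competitor in the minimum for \<open>A\<close>.\<close>

lemma qform_mat_powr_mono:
  assumes A: "psd d A" and B: "psd d B" and le: "\<And>v. Re (qform d A v) \<le> Re (qform d B v)"
    and p: "0 < p" "p < 1"
  shows "Re (qform d (mat_powr A p) v) \<le> Re (qform d (mat_powr B p) v)"
proof -
  obtain K where K: "K > 0" and Ki': "\<forall>A v. psd d A \<longrightarrow> has_bochner_integral lborel
    (\<lambda>s. indicator {0<..} s * (s powr (p - 2) * Re (qform d (mat_fun (par_fun s) A) v)))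
    (K * Re (qform d (mat_powr A p) v))"
    using qform_powr_integral[OF p, of d] by (elim exE conjE)
  note Ki = Ki'[rule_format]
  have "Re (qform d (mat_fun (par_fun s) A) v) \<le> Re (qform d (mat_fun (par_fun s) B) v)" if s: "s > 0" for s
  proof -
    obtain w where w: "Re (qform d (mat_fun (par_fun s) B) v) =
        Re (qform d B (\<lambda>i. v i - w i)) + s * (\<Sum>i<d. (cmod (w i))\<^sup>2)"
      using qform_par_fun_attained[OF B s] by blast
    show ?thesis using qform_par_fun_le[OF A s, of v w] le[of "\<lambda>i. v i - w i"] unfolding w by simp
  qed
  hence "K * Re (qform d (mat_powr A p) v) \<le> K * Re (qform d (mat_powr B p) v)"
    by (intro has_bochner_integral_mono[OF Ki[OF A] Ki[OF B]])
      (auto simp: indicator_def intro!: mult_left_mono)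
  thus ?thesis using K by simp
qed

text \<open>The minimizer for the mixture \<open>C\<close> is a competitor for both \<open>A\<close>
  and \<open>B\<close>, and the functional being minimized is affine in the matrix.\<close>

lemma qform_mat_powr_concave:
  assumes A: "psd d A" and B: "psd d B" and C: "psd d C" and w: "0 \<le> w" "w \<le> 1"
    and C_eq: "\<And>v. Re (qform d C v) = w * Re (qform d A v) + (1 - w) * Re (qform d B v)"
    and p: "0 < p" "p < 1"
  shows "w * Re (qform d (mat_powr A p) v) + (1 - w) * Re (qform d (mat_powr B p) v)
    \<le> Re (qform d (mat_powr C p) v)"
proof -
  obtain K where K: "K > 0" and Ki': "\<forall>A v. psd d A \<longrightarrow> has_bochner_integral lborel
    (\<lambda>s. indicator {0<..} s * (s powr (p - 2) * Re (qform d (mat_fun (par_fun s) A) v)))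
    (K * Re (qform d (mat_powr A p) v))"
    using qform_powr_integral[OF p, of d] by (elim exE conjE)
  note Ki = Ki'[rule_format]
  have *: "w * Re (qform d (mat_fun (par_fun s) A) v) + (1 - w) * Re (qform d (mat_fun (par_fun s) B) v)
    \<le> Re (qform d (mat_fun (par_fun s) C) v)" if s: "s > 0" for s
  proof -
    obtain z where z: "Re (qform d (mat_fun (par_fun s) C) v) =
        Re (qform d C (\<lambda>i. v i - z i)) + s * (\<Sum>i<d. (cmod (z i))\<^sup>2)"
      using qform_par_fun_attained[OF C s] by blast
    have "w * Re (qform d (mat_fun (par_fun s) A) v) + (1 - w) * Re (qform d (mat_fun (par_fun s) B) v) \<le>
      w * (Re (qform d A (\<lambda>i. v i - z i)) + s * (\<Sum>i<d. (cmod (z i))\<^sup>2)) +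
      (1 - w) * (Re (qform d B (\<lambda>i. v i - z i)) + s * (\<Sum>i<d. (cmod (z i))\<^sup>2))"
      using w by (intro add_mono mult_left_mono qform_par_fun_le A B s) auto
    also have "\<dots> = Re (qform d (mat_fun (par_fun s) C) v)"
      unfolding z C_eq by (simp add: algebra_simps)
    finally show ?thesis .
  qed
  have "w * (K * Re (qform d (mat_powr A p) v)) + (1 - w) * (K * Re (qform d (mat_powr B p) v))
    \<le> K * Re (qform d (mat_powr C p) v)"
  proof (rule has_bochner_integral_mono[OF _ Ki[OF C]])
    show "has_bochner_integral lborel (\<lambda>s.
        w * (indicator {0<..} s * (s powr (p - 2) * Re (qform d (mat_fun (par_fun s) A) v))) +
        (1 - w) * (indicator {0<..} s * (s powr (p - 2) * Re (qform d (mat_fun (par_fun s) B) v))))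
      (w * (K * Re (qform d (mat_powr A p) v)) + (1 - w) * (K * Re (qform d (mat_powr B p) v)))"
      by (intro has_bochner_integral_add has_bochner_integral_mult_right Ki A B)
    show "w * (indicator {0<..} s * (s powr (p - 2) * Re (qform d (mat_fun (par_fun s) A) v))) +
        (1 - w) * (indicator {0<..} s * (s powr (p - 2) * Re (qform d (mat_fun (par_fun s) B) v)))
      \<le> indicator {0<..} s * (s powr (p - 2) * Re (qform d (mat_fun (par_fun s) C) v))" for s
    proof (cases "s > 0")
      case True
      from mult_left_mono[OF *[OF True], of "s powr (p - 2)"] True
      show ?thesis by (simp add: algebra_simps)
    qed simp
  qed
  hence "K * (w * Re (qform d (mat_powr A p) v) + (1 - w) * Re (qform d (mat_powr B p) v))
    \<le> K * Re (qform d (mat_powr C p) v)" by (simp add: algebra_simps)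
  thus ?thesis using K by simp
qed

text \<open>The trace is a combination, with the eigenvalues of \<open>X\<close> as nonnegative
  weights, of values of the quadratic form at eigenvectors of \<open>X\<close>.\<close>

lemma trace_mult_mono_qform:
  assumes X: "psd d X" and Y: "Y \<in> carrier_mat d d" and Z: "Z \<in> carrier_mat d d"
    and le: "\<And>v. Re (qform d Y v) \<le> Re (qform d Z v)"
  shows "Re (mat_trace (X * Y)) \<le> Re (mat_trace (X * Z))"
proof -
  obtain U e where A: "X \<in> carrier_mat d d" "is_eig_decomp X U e" and e: "\<And>k. k < d \<Longrightarrow> 0 \<le> e k"
    using psd_obtain_eig[OF X] by metis
  show ?thesis
    using trace_mat_fun_mult[OF A Y, of "\<lambda>t. t"] trace_mat_fun_mult[OF A Z, of "\<lambda>t. t"]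
    unfolding mat_fun_ident[OF A] by (auto intro!: sum_mono mult_left_mono e le)
qed

section \<open>Quantum hypothesis testing\<close>

lemma qform_add:
  assumes "A \<in> carrier_mat d d" "B \<in> carrier_mat d d"
  shows "qform d (A + B) v = qform d A v + qform d B v"
  using assms by (simp add: qform_def distrib_left distrib_right sum.distrib)

lemma qform_minus:
  assumes "A \<in> carrier_mat d d" "B \<in> carrier_mat d d"
  shows "qform d (A - B) v = qform d A v - qform d B v"
  using assms by (simp add: qform_def left_diff_distrib right_diff_distrib sum_subtractf)

lemma qform_smult:
  assumes "A \<in> carrier_mat d d"
  shows "qform d (c \<cdot>\<^sub>m A) v = c * qform d A v"
  using assms by (simp add: qform_def sum_distrib_left mult_ac)

lemma qform_one: "qform d (1\<^sub>m d) v = of_real (\<Sum>i<d. (cmod (v i))\<^sup>2)"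
proof -
  have "qform d (1\<^sub>m d) v = (\<Sum>i<d. \<Sum>j<d. if i = j then cnj (v i) * v j else 0)"
    unfolding qform_def by (intro sum.cong[OF refl]) simp
  also have "\<dots> = (\<Sum>i<d. v i * cnj (v i))" by (intro sum.cong[OF refl]) simp
  also have "\<dots> = of_real (\<Sum>i<d. (cmod (v i))\<^sup>2)"
    unfolding of_real_sum complex_norm_square ..
  finally show ?thesis .
qed

lemma hermitianI:
  "A \<in> carrier_mat d d \<Longrightarrow> (\<And>i j. i < d \<Longrightarrow> j < d \<Longrightarrow> A $$ (j, i) = cnj (A $$ (i, j))) \<Longrightarrow> hermitian d A"
  unfolding hermitian_def by blast

lemma hermitian_add:
  assumes "hermitian d A" "hermitian d B"
  shows "hermitian d (A + B)"
proof (rule hermitianI)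
  show "(A + B) $$ (j, i) = cnj ((A + B) $$ (i, j))" if "i < d" "j < d" for i j
    using that hermitianD(1)[OF assms(1)] hermitianD(1)[OF assms(2)]
      hermitianD(2)[OF assms(1) that] hermitianD(2)[OF assms(2) that] by simp
qed (use assms hermitianD(1) in auto)

lemma hermitian_smult:
  assumes "hermitian d A"
  shows "hermitian d (complex_of_real c \<cdot>\<^sub>m A)"
proof (rule hermitianI)
  show "(of_real c \<cdot>\<^sub>m A) $$ (j, i) = cnj ((of_real c \<cdot>\<^sub>m A) $$ (i, j))" if "i < d" "j < d" for i j
    using that hermitianD(1)[OF assms] hermitianD(2)[OF assms that] by simp
qed (use assms hermitianD(1) in auto)

lemma hermitian_minus:
  assumes "hermitian d A" "hermitian d B"
  shows "hermitian d (A - B)"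
proof (rule hermitianI)
  show "(A - B) $$ (j, i) = cnj ((A - B) $$ (i, j))" if "i < d" "j < d" for i j
    using that hermitianD(1)[OF assms(1)] hermitianD(1)[OF assms(2)]
      hermitianD(2)[OF assms(1) that] hermitianD(2)[OF assms(2) that] by simp
qed (use minus_carrier_mat[OF hermitianD(1)[OF assms(2)]] in auto)

lemma hermitian_one: "hermitian d (1\<^sub>m d)"
  by (rule hermitianI) auto

lemma psd_add: "psd d A \<Longrightarrow> psd d B \<Longrightarrow> psd d (A + B)"
  by (simp add: psd_iff_qform hermitian_add qform_add hermitianD(1))

lemma psd_smult: "psd d A \<Longrightarrow> 0 \<le> c \<Longrightarrow> psd d (complex_of_real c \<cdot>\<^sub>m A)"
  by (simp add: psd_iff_qform hermitian_smult qform_smult hermitianD(1))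

lemma psd_one: "psd d (1\<^sub>m d)"
  by (simp add: psd_iff_qform hermitian_one qform_one sum_nonneg)

lemma psd_minusI:
  assumes "hermitian d A" "hermitian d B" "\<And>v. Re (qform d B v) \<le> Re (qform d A v)"
  shows "psd d (A - B)"
  using assms by (simp add: psd_iff_qform hermitian_minus qform_minus hermitianD(1))

lemma hermitian_msum:
  assumes "\<And>k. k \<in> I \<Longrightarrow> hermitian d (F k)"
  shows "hermitian d (msum d F I)"
  unfolding hermitian_def
proof (intro conjI allI impI)
  show "msum d F I $$ (j, i) = cnj (msum d F I $$ (i, j))" if "i < d" "j < d" for i j
    using that hermitianD(2)[OF assms that] by (simp add: msum_def)
qed (simp add: msum_def)

lemma msum_carrier: "msum d F I \<in> carrier_mat d d"
  by (simp add: msum_def)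

lemma qform_msum: "qform d (msum d F I) v = (\<Sum>k\<in>I. qform d (F k) v)"
proof -
  have "qform d (msum d F I) v = (\<Sum>i<d. \<Sum>j<d. \<Sum>k\<in>I. cnj (v i) * F k $$ (i, j) * v j)"
    unfolding qform_def by (intro sum.cong refl) (simp add: msum_def sum_distrib_left sum_distrib_right)
  also have "\<dots> = (\<Sum>i<d. \<Sum>k\<in>I. \<Sum>j<d. cnj (v i) * F k $$ (i, j) * v j)"
    by (intro sum.cong[OF refl] sum.swap)
  also have "\<dots> = (\<Sum>k\<in>I. qform d (F k) v)" unfolding qform_def by (rule sum.swap)
  finally show ?thesis .
qed

lemma psd_msum: "(\<And>k. k \<in> I \<Longrightarrow> psd d (F k)) \<Longrightarrow> psd d (msum d F I)"
  by (simp add: psd_iff_qform hermitian_msum qform_msum sum_nonneg)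

lemma trace_mult_expand:
  assumes "A \<in> carrier_mat d d" "B \<in> carrier_mat d d"
  shows "mat_trace (A * B) = (\<Sum>i<d. \<Sum>j<d. A $$ (i, j) * B $$ (j, i))"
  using assms by (simp add: mat_trace_def mult_mat_index[OF assms] del: index_mult_mat(1))

lemma trace_mult_add_right:
  assumes "A \<in> carrier_mat d d" "B \<in> carrier_mat d d" "C \<in> carrier_mat d d"
  shows "mat_trace (A * (B + C)) = mat_trace (A * B) + mat_trace (A * C)"
  using assms by (simp add: trace_mult_expand[of _ d] distrib_left sum.distrib)

lemma trace_mult_minus_right:
  assumes "A \<in> carrier_mat d d" "B \<in> carrier_mat d d" "C \<in> carrier_mat d d"
  shows "mat_trace (A * (B - C)) = mat_trace (A * B) - mat_trace (A * C)"
  using assms minus_carrier_mat[OF assms(3), of B]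
  by (simp add: trace_mult_expand[of _ d] right_diff_distrib sum_subtractf)

lemma trace_mult_minus_left:
  assumes "A \<in> carrier_mat d d" "B \<in> carrier_mat d d" "C \<in> carrier_mat d d"
  shows "mat_trace ((B - C) * A) = mat_trace (B * A) - mat_trace (C * A)"
  using assms minus_carrier_mat[OF assms(3), of B]
  by (simp add: trace_mult_expand[of _ d] left_diff_distrib sum_subtractf)

lemma trace_mult_smult_right:
  assumes "A \<in> carrier_mat d d" "B \<in> carrier_mat d d"
  shows "mat_trace (A * (c \<cdot>\<^sub>m B)) = c * mat_trace (A * B)"
  using assms by (simp add: trace_mult_expand[of _ d] sum_distrib_left mult_ac)

lemma trace_mult_msum_right:
  assumes "A \<in> carrier_mat d d" "\<And>k. k \<in> I \<Longrightarrow> F k \<in> carrier_mat d d"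
  shows "mat_trace (A * msum d F I) = (\<Sum>k\<in>I. mat_trace (A * F k))"
proof -
  have "mat_trace (A * msum d F I) = (\<Sum>i<d. \<Sum>j<d. \<Sum>k\<in>I. A $$ (i, j) * F k $$ (j, i))"
    unfolding trace_mult_expand[OF assms(1) msum_carrier]
    by (intro sum.cong refl) (simp add: msum_def sum_distrib_left)
  also have "\<dots> = (\<Sum>i<d. \<Sum>k\<in>I. \<Sum>j<d. A $$ (i, j) * F k $$ (j, i))"
    by (intro sum.cong[OF refl] sum.swap)
  also have "\<dots> = (\<Sum>k\<in>I. \<Sum>i<d. \<Sum>j<d. A $$ (i, j) * F k $$ (j, i))" by (rule sum.swap)
  finally show ?thesis using assms by (simp add: trace_mult_expand[of _ d])
qed

lemma trace_mat_fun:
  assumes A: "A \<in> carrier_mat d d" and dec: "is_eig_decomp A U e"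
  shows "mat_trace (mat_fun f A) = of_real (\<Sum>k<d. f (e k))"
proof -
  note F = mat_fun_carrier_decomp[OF A dec, of f]
  have "mat_trace (mat_fun f A) = mat_trace (mat_fun f A * 1\<^sub>m d)" using F by simp
  also have "\<dots> = (\<Sum>k<d. of_real (f (e k)) * qform d (1\<^sub>m d) (\<lambda>i. U $$ (i, k)))"
    by (rule trace_mat_fun_mult[OF A dec]) simp
  also have "\<dots> = (\<Sum>k<d. of_real (f (e k)))"
  proof (intro sum.cong refl)
    fix k assume "k \<in> {..<d}"
    hence "qform d (1\<^sub>m d) (\<lambda>i. U $$ (i, k)) = 1"
      unfolding qform_one of_real_sum complex_norm_square
      using is_eig_decompD(2)[OF A dec, of k k] by (simp add: mult.commute)
    thus "of_real (f (e k)) * qform d (1\<^sub>m d) (\<lambda>i. U $$ (i, k)) = of_real (f (e k))" by simp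
  qed
  finally show ?thesis by simp
qed

lemma trace_mat_fun_mult_same:
  assumes h: "hermitian d A"
  shows "mat_trace (mat_fun f A * mat_fun g A) = mat_trace (mat_fun (\<lambda>t. f t * g t) A)"
proof -
  note A = hermitianD(1)[OF h]
  obtain U e where dec: "is_eig_decomp A U e" using hermitian_is_eig_decomp[OF h] by blast
  note F = mat_fun_carrier_decomp[OF A dec, of g]
  show ?thesis
    unfolding trace_mat_fun_mult[OF A dec F(1)] trace_mat_fun[OF A dec]
    by (simp add: qform_col[OF F])
qed

lemma mat_fun_cong:
  assumes "A \<in> carrier_mat d d" "is_eig_decomp A U e" "\<And>k. k < d \<Longrightarrow> f (e k) = g (e k)"
  shows "mat_fun f A = mat_fun g A"
proof -
  have "dim_row A = d" using assms(1) by auto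
  thus ?thesis unfolding mat_fun_eq[OF assms(2)] using assms(3)
    by (intro arg_cong2[where f = "(*)"] refl) (auto simp: mat_diag_def intro!: eq_matI)
qed

lemma psd_mat_powr: "psd d A \<Longrightarrow> psd d (mat_powr A p)"
  unfolding mat_powr_def by (rule psd_mat_fun) auto

lemma trace_powr_split:
  assumes "psd d A"
  shows "mat_trace (mat_powr A (1 - s) * mat_powr A s) = mat_trace A"
proof -
  obtain U e where A: "A \<in> carrier_mat d d" "is_eig_decomp A U e" and e: "\<And>k. k < d \<Longrightarrow> 0 \<le> e k"
    using psd_obtain_eig[OF assms] by metis
  have "mat_fun (\<lambda>t. t powr (1 - s) * t powr s) A = mat_fun (\<lambda>t. t) A"
    by (rule mat_fun_cong[OF A]) (use e in \<open>auto simp flip: powr_add\<close>)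
  thus ?thesis
    unfolding mat_powr_def trace_mat_fun_mult_same[OF psdD(2)[OF assms]] mat_fun_ident[OF A] by simp
qed

lemma trace_mat_powr_comm:
  assumes "psd d A" "psd d B"
  shows "mat_trace (A * B) = mat_trace (B * A)"
  by (rule mat_trace_mult_comm[of _ d d]) (use psdD assms in auto)

text \<open>This proof of Audenaert's inequality from operator monotonicity of powers is due to Ozawa.\<close>

theorem audenaert_test:
  assumes A: "psd d A" and B: "psd d B" and s: "0 < s" "s < 1"
  shows "\<exists>T. psd d T \<and> psd d (1\<^sub>m d - T) \<and>
    Re (mat_trace ((1\<^sub>m d - T) * A)) + Re (mat_trace (T * B))
      \<le> Re (mat_trace (mat_powr A (1 - s) * mat_powr B s))"
proof -
  note Ac = psdD(1)[OF A] and Bc = psdD(1)[OF B]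
  define D where "D = A - B"
  have hD: "hermitian d D" unfolding D_def by (intro hermitian_minus psdD A B)
  note Dc = hermitianD(1)[OF hD]
  obtain U e where dec: "is_eig_decomp D U e" using hermitian_is_eig_decomp[OF hD] by blast
  \<comment> \<open>The Neyman-Pearson projection onto the positive part \<open>P\<close> of
    \<open>A - B\<close>; its total error is Tr A - Tr P.\<close>
  define T where "T = mat_fun (\<lambda>t. if t > 0 then 1 else 0) D"
  define P where "P = mat_fun (\<lambda>t. max 0 t) D"
  have T: "psd d T" unfolding T_def
    by (rule psdI_eig[OF mat_fun_carrier_decomp[OF Dc dec]]) simp
  have P: "psd d P" unfolding P_def
    by (rule psdI_eig[OF mat_fun_carrier_decomp[OF Dc dec]]) simp
  note Tc = psdD(1)[OF T] and Pc = psdD(1)[OF P]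
  have T1: "psd d (1\<^sub>m d - T)"
  proof (intro psd_minusI hermitian_one psdD T)
    fix v
    have "(\<Sum>k<d. (if e k > 0 then 1 else 0) * (cmod (eig_coef d U v k))\<^sup>2) \<le> (\<Sum>k<d. (cmod (eig_coef d U v k))\<^sup>2)"
      by (intro sum_mono) auto
    thus "Re (qform d T v) \<le> Re (qform d (1\<^sub>m d) v)"
      unfolding T_def qform_mat_fun[OF Dc dec] qform_one sum_eig_coef[OF Dc dec, of v] by simp
  qed
  have TD: "mat_trace (T * D) = mat_trace P"
    unfolding T_def P_def trace_mat_fun_mult[OF Dc dec Dc] trace_mat_fun[OF Dc dec]
    by (auto simp: qform_col[OF Dc dec] intro!: sum.cong)
  have "Re (mat_trace ((1\<^sub>m d - T) * A)) + Re (mat_trace (T * B)) = Re (mat_trace A) - Re (mat_trace (T * D))"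
    unfolding D_def using Ac Bc Tc
    by (simp add: trace_mult_minus_left[of _ d] trace_mult_minus_right[of _ d])
  hence lhs: "Re (mat_trace ((1\<^sub>m d - T) * A)) + Re (mat_trace (T * B)) = Re (mat_trace A) - Re (mat_trace P)"
    by (simp add: TD)
  \<comment> \<open>\<open>C\<close> dominates both \<open>A\<close> and \<open>B\<close>.
    Monotonicity replaces one power of \<open>A\<close>, then the other, and then one power of
    \<open>B\<close> by powers of \<open>C\<close>, until only Tr C - Tr B = Tr P is left.\<close>
  define C where "C = B + P"
  have C: "psd d C" unfolding C_def by (intro psd_add B P)
  have BC: "Re (qform d B v) \<le> Re (qform d C v)" for v
    unfolding C_def using P Bc Pc by (simp add: qform_add psd_iff_qform)
  have AC: "Re (qform d A v) \<le> Re (qform d C v)" for v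
  proof -
    have "(\<Sum>k<d. e k * (cmod (eig_coef d U v k))\<^sup>2) \<le> (\<Sum>k<d. max 0 (e k) * (cmod (eig_coef d U v k))\<^sup>2)"
      by (intro sum_mono mult_right_mono) auto
    hence "Re (qform d D v) \<le> Re (qform d P v)"
      unfolding P_def qform_mat_fun[OF Dc dec] qform_eig[OF Dc dec] by simp
    thus ?thesis unfolding C_def D_def using Ac Bc Pc by (simp add: qform_add qform_minus)
  qed
  note pw = psd_mat_powr psdD(1)[OF psd_mat_powr]
  have s': "0 < 1 - s" "1 - s < 1" using s by auto
  have CB: "psd d (mat_powr C s - mat_powr B s)"
    by (rule psd_minusI[OF psdD(2)[OF pw(1)[OF C]] psdD(2)[OF pw(1)[OF B]] qform_mat_powr_mono[OF B C BC s]])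
  have "Re (mat_trace A) - Re (mat_trace (mat_powr A (1 - s) * mat_powr B s)) =
      Re (mat_trace (mat_powr A (1 - s) * mat_powr A s)) - Re (mat_trace (mat_powr A (1 - s) * mat_powr B s))"
    unfolding trace_powr_split[OF A] ..
  also have "\<dots> \<le> Re (mat_trace (mat_powr A (1 - s) * mat_powr C s)) - Re (mat_trace (mat_powr A (1 - s) * mat_powr B s))"
    by (intro diff_right_mono trace_mult_mono_qform[OF pw(1)[OF A] pw(2)[OF A] pw(2)[OF C]]
        qform_mat_powr_mono[OF A C AC s])
  also have "\<dots> = Re (mat_trace ((mat_powr C s - mat_powr B s) * mat_powr A (1 - s)))"
    unfolding trace_mult_minus_left[OF pw(2)[OF A] pw(2)[OF C] pw(2)[OF B]]
      trace_mat_powr_comm[OF pw(1)[OF A, of "1 - s"] pw(1)[OF C, of s]]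
      trace_mat_powr_comm[OF pw(1)[OF A, of "1 - s"] pw(1)[OF B, of s]] by simp
  also have "\<dots> \<le> Re (mat_trace ((mat_powr C s - mat_powr B s) * mat_powr C (1 - s)))"
    by (rule trace_mult_mono_qform[OF CB pw(2)[OF A] pw(2)[OF C] qform_mat_powr_mono[OF A C AC s']])
  also have "\<dots> = Re (mat_trace C) - Re (mat_trace (mat_powr B s * mat_powr C (1 - s)))"
    unfolding trace_mult_minus_left[OF pw(2)[OF C] pw(2)[OF C] pw(2)[OF B]]
      trace_mat_powr_comm[OF pw(1)[OF C, of s] pw(1)[OF C, of "1 - s"]] trace_powr_split[OF C] by simp
  also have "\<dots> \<le> Re (mat_trace C) - Re (mat_trace (mat_powr B s * mat_powr B (1 - s)))"
    by (intro diff_left_mono trace_mult_mono_qform[OF pw(1)[OF B] pw(2)[OF B] pw(2)[OF C]]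
        qform_mat_powr_mono[OF B C BC s'])
  also have "\<dots> = Re (mat_trace P)"
    unfolding trace_mat_powr_comm[OF pw(1)[OF B, of s] pw(1)[OF B, of "1 - s"]] trace_powr_split[OF B]
    using Bc Pc by (simp add: C_def mat_trace_def sum.distrib)
  finally show ?thesis using T T1 lhs by (intro exI[of _ T]) simp
qed

section \<open>One-shot source coding\<close>

lemma sandwich_index:
  assumes "H \<in> carrier_mat d d" "Y \<in> carrier_mat d d" "i < d" "j < d"
  shows "(H * (Y * H)) $$ (i, j) = (\<Sum>k<d. \<Sum>l<d. H $$ (i, k) * Y $$ (k, l) * H $$ (l, j))"
  unfolding mult_mat_index[OF assms(1) mult_carrier_mat[OF assms(2,1)] assms(3,4)]
  by (intro sum.cong refl)
    (simp add: mult_mat_index[OF assms(2,1) _ assms(4)] sum_distrib_left mult.assoc del: index_mult_mat(1))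

lemma qform_sandwich:
  assumes H: "hermitian d H" and Y: "Y \<in> carrier_mat d d"
  shows "qform d (H * (Y * H)) v = qform d Y (\<lambda>k. \<Sum>j<d. H $$ (k, j) * v j)"
proof -
  note Hc = hermitianD(1)[OF H]
  let ?t = "\<lambda>i j k l. (cnj (v i) * H $$ (i, k)) * (Y $$ (k, l) * (H $$ (l, j) * v j))"
  have "qform d (H * (Y * H)) v = (\<Sum>i<d. \<Sum>j<d. \<Sum>k<d. \<Sum>l<d. ?t i j k l)"
    unfolding qform_def
    by (intro sum.cong refl) (simp add: sandwich_index[OF Hc Y] sum_distrib_left sum_distrib_right mult.assoc)
  also have "\<dots> = (\<Sum>i<d. \<Sum>k<d. \<Sum>j<d. \<Sum>l<d. ?t i j k l)"
    by (rule sum.cong[OF refl]) (rule sum.swap)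
  also have "\<dots> = (\<Sum>i<d. \<Sum>k<d. \<Sum>l<d. \<Sum>j<d. ?t i j k l)"
    by (rule sum.cong[OF refl], rule sum.cong[OF refl]) (rule sum.swap)
  also have "\<dots> = (\<Sum>k<d. \<Sum>i<d. \<Sum>l<d. \<Sum>j<d. ?t i j k l)" by (rule sum.swap)
  also have "\<dots> = (\<Sum>k<d. \<Sum>l<d. \<Sum>i<d. \<Sum>j<d. ?t i j k l)"
    by (rule sum.cong[OF refl]) (rule sum.swap)
  also have "\<dots> = (\<Sum>k<d. \<Sum>l<d. (\<Sum>i<d. cnj (v i) * H $$ (i, k)) * (Y $$ (k, l) * (\<Sum>j<d. H $$ (l, j) * v j)))"
    by (simp add: sum_distrib_left sum_distrib_right)
      (rule sum.cong[OF refl], rule sum.cong[OF refl], rule sum.swap)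
  also have "\<dots> = (\<Sum>k<d. \<Sum>l<d. cnj (\<Sum>j<d. H $$ (k, j) * v j) * Y $$ (k, l) * (\<Sum>j<d. H $$ (l, j) * v j))"
  proof (intro sum.cong refl)
    fix k l assume "k \<in> {..<d}"
    hence "(\<Sum>i<d. cnj (v i) * H $$ (i, k)) = cnj (\<Sum>j<d. H $$ (k, j) * v j)"
      using hermitianD(2)[OF H, of k] by (auto intro!: sum.cong simp: mult.commute)
    thus "(\<Sum>i<d. cnj (v i) * H $$ (i, k)) * (Y $$ (k, l) * (\<Sum>j<d. H $$ (l, j) * v j)) =
        cnj (\<Sum>j<d. H $$ (k, j) * v j) * Y $$ (k, l) * (\<Sum>j<d. H $$ (l, j) * v j)"
      by (simp only: mult.assoc)
  qed
  finally show ?thesis unfolding qform_def .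
qed

lemma psd_sandwich:
  assumes H: "hermitian d H" and Y: "psd d Y"
  shows "psd d (H * (Y * H))"
proof -
  note Hc = hermitianD(1)[OF H] and Yc = psdD(1)[OF Y] and Yh = psdD(2)[OF Y]
  have "hermitian d (H * (Y * H))"
  proof (rule hermitianI)
    fix i j assume ij: "i < d" "j < d"
    have "(H * (Y * H)) $$ (j, i) = (\<Sum>k<d. \<Sum>l<d. cnj (H $$ (i, l) * Y $$ (l, k) * H $$ (k, j)))"
      unfolding sandwich_index[OF Hc Yc ij(2,1)]
    proof (intro sum.cong refl)
      fix k l assume "k \<in> {..<d}" "l \<in> {..<d}"
      thus "H $$ (j, k) * Y $$ (k, l) * H $$ (l, i) = cnj (H $$ (i, l) * Y $$ (l, k) * H $$ (k, j))"
        using hermitianD(2)[OF H, of k j] hermitianD(2)[OF Yh, of l k] hermitianD(2)[OF H, of i l] ij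
        by simp
    qed
    also have "\<dots> = (\<Sum>l<d. \<Sum>k<d. cnj (H $$ (i, l) * Y $$ (l, k) * H $$ (k, j)))" by (rule sum.swap)
    also have "\<dots> = cnj ((H * (Y * H)) $$ (i, j))"
      unfolding sandwich_index[OF Hc Yc ij] cnj_sum ..
    finally show "(H * (Y * H)) $$ (j, i) = cnj ((H * (Y * H)) $$ (i, j))" .
  qed (use Hc Yc in auto)
  thus ?thesis using Y unfolding psd_iff_qform qform_sandwich[OF H Yc] by blast
qed

text \<open>A pretty good measurement for \<open>H N H\<close> against \<open>H (1 - N) H\<close> errs at most as much as any
  test \<open>T\<close>: with the inner product \<open>\<langle>X, Y\<rangle> = Tr (X H Y H)\<close> the difference of the two errors is
  \<open>\<langle>N - T, N - T\<rangle> + \<langle>T, 1 - T\<rangle>\<close>.\<close>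

lemma pretty_good_measurement_le_test:
  assumes H: "psd d H" and N: "hermitian d N" and T: "psd d T" and T1: "psd d (1\<^sub>m d - T)"
  shows "Re (mat_trace ((1\<^sub>m d - N) * (H * (N * H)))) \<le>
    Re (mat_trace ((1\<^sub>m d - T) * (H * (N * H)))) + Re (mat_trace (T * (H * H - H * (N * H))))"
proof -
  note Hc = psdD(1)[OF H] and Nc = hermitianD(1)[OF N] and Tc = psdD(1)[OF T]
  have oc: "1\<^sub>m d \<in> carrier_mat d d" by simp
  define ip where "ip X Y = Re (mat_trace (X * (H * (Y * H))))" for X Y
  have sc: "H * (Y * H) \<in> carrier_mat d d" if "Y \<in> carrier_mat d d" for Y
    using that Hc by (intro mult_carrier_mat)
  have minus: "ip (X - X') Y = ip X Y - ip X' Y"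
    if "X \<in> carrier_mat d d" "X' \<in> carrier_mat d d" "Y \<in> carrier_mat d d" for X X' Y
    unfolding ip_def using trace_mult_minus_left[OF sc[OF that(3)] that(1,2)] by simp
  have sym: "ip X Y = ip Y X" if X: "X \<in> carrier_mat d d" and Y: "Y \<in> carrier_mat d d" for X Y
  proof -
    have "mat_trace (X * (H * (Y * H))) = mat_trace ((X * H) * (Y * H))"
      using assoc_mult_mat[OF X Hc mult_carrier_mat[OF Y Hc]] by simp
    also have "\<dots> = mat_trace ((Y * H) * (X * H))"
      by (rule mat_trace_mult_comm[of _ d d]) (use X Y Hc in auto)
    also have "\<dots> = mat_trace (Y * (H * (X * H)))"
      using assoc_mult_mat[OF Y Hc mult_carrier_mat[OF X Hc]] by simp
    finally show ?thesis by (simp add: ip_def)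
  qed
  have self: "0 \<le> ip X X" if X: "hermitian d X" for X
  proof -
    note Xc = hermitianD(1)[OF X]
    \<comment> \<open>Regrouped, the expression is the trace of the positive matrix
      \<open>X * (H * X)\<close> times \<open>H\<close>.\<close>
    have "H * (X * H) = (H * X) * H" using assoc_mult_mat[OF Hc Xc Hc] by simp
    hence "X * (H * (X * H)) = (X * (H * X)) * H"
      using assoc_mult_mat[OF Xc mult_carrier_mat[OF Hc Xc] Hc] by simp
    thus ?thesis unfolding ip_def using trace_psd_mult_nonneg[OF psd_sandwich[OF X H] H] by simp
  qed
  have "0 \<le> ip T (1\<^sub>m d - T)"
    unfolding ip_def by (intro trace_psd_mult_nonneg[of d] psd_sandwich psdD H T T1)
  moreover have "ip T (1\<^sub>m d - T) = ip T (1\<^sub>m d) - ip T T"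
    using sym[OF Tc minus_carrier_mat[OF Tc]] sym[OF Tc oc] minus[OF oc Tc Tc] by simp
  moreover have "0 \<le> ip (N - T) (N - T)" by (intro self hermitian_minus N psdD T)
  moreover have "ip (N - T) (N - T) = ip N N - ip T N - (ip N T - ip T T)"
    using minus[OF Nc Tc minus_carrier_mat[OF Tc]] sym[OF Nc minus_carrier_mat[OF Tc]]
      sym[OF Tc minus_carrier_mat[OF Tc]] minus[OF Nc Tc Nc] minus[OF Nc Tc Tc] sym[OF Nc Tc] by simp
  moreover have "Re (mat_trace ((1\<^sub>m d - N) * (H * (N * H)))) = ip (1\<^sub>m d) N - ip N N"
    using minus[OF oc Nc Nc] by (simp add: ip_def)
  moreover have "Re (mat_trace ((1\<^sub>m d - T) * (H * (N * H)))) = ip (1\<^sub>m d) N - ip T N"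
    using minus[OF oc Tc Nc] by (simp add: ip_def)
  moreover have "Re (mat_trace (T * (H * H - H * (N * H)))) = ip T (1\<^sub>m d) - ip T N"
    using trace_mult_minus_right[OF Tc mult_carrier_mat[OF Hc Hc] sc[OF Nc]] Hc by (simp add: ip_def)
  moreover have "ip N T = ip T N" by (rule sym[OF Nc Tc])
  ultimately show ?thesis by simp
qed

lemma mat_fun_mult:
  assumes h: "hermitian d A"
  shows "mat_fun f A * mat_fun g A = mat_fun (\<lambda>t. f t * g t) A"
proof -
  note A = hermitianD(1)[OF h]
  obtain U e where dec: "is_eig_decomp A U e" using hermitian_is_eig_decomp[OF h] by blast
  have dA: "dim_row A = d" using A by auto
  note U = is_eig_decompD(1)[OF A dec] and U' = mat_adjoint_carrier[OF is_eig_decompD(1)[OF A dec]]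
  define D where "D f = mat_diag d (\<lambda>i. complex_of_real (f (e i)))" for f :: "real \<Rightarrow> real"
  have D: "D f \<in> carrier_mat d d" for f by (simp add: D_def)
  have UU: "mat_adjoint U * U = 1\<^sub>m d" using dec dA unfolding is_eig_decomp_def unitary_mat_def by auto
  note c = mult_carrier_mat[of _ d d _ d]
  have F: "mat_fun f A = U * D f * mat_adjoint U" for f
    unfolding mat_fun_eq[OF dec] dA D_def ..
  have "mat_fun f A * mat_fun g A = U * (D f * ((mat_adjoint U * U) * (D g * mat_adjoint U)))"
    unfolding F using U U' D by (simp add: assoc_mult_mat[of _ d d _ d _ d] c)
  also have "\<dots> = U * (D f * D g) * mat_adjoint U"
    unfolding UU using U U' D by (simp add: assoc_mult_mat[of _ d d _ d _ d] c left_mult_one_mat[of _ d d])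
  also have "D f * D g = D (\<lambda>t. f t * g t)" by (simp add: D_def)
  finally show ?thesis by (simp add: F)
qed

lemma mat_fun_one:
  assumes h: "hermitian d A"
  shows "mat_fun (\<lambda>_. 1) A = 1\<^sub>m d"
proof -
  note A = hermitianD(1)[OF h]
  obtain U e where dec: "is_eig_decomp A U e" using hermitian_is_eig_decomp[OF h] by blast
  have dA: "dim_row A = d" using A by auto
  note U = is_eig_decompD(1)[OF A dec]
  have "U * mat_adjoint U = 1\<^sub>m d" using dec dA unfolding is_eig_decomp_def unitary_mat_def by auto
  moreover have "mat_diag d (\<lambda>i. complex_of_real 1) = 1\<^sub>m d" by (auto simp: mat_diag_def)
  ultimately show ?thesis unfolding mat_fun_eq[OF dec] dA using U by simp
qed

text \<open>The lower bound by \<open>c\<close> makes all eigenvalues positive, so the powers 1/2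
  and -1/2 are inverse to each other on the whole space and not only on the support.\<close>

lemma psd_square_root_inverse:
  assumes S: "psd d S" and c: "0 < c" "\<And>v. c * (\<Sum>i<d. (cmod (v i))\<^sup>2) \<le> Re (qform d S v)"
  shows "\<exists>H G. psd d H \<and> psd d G \<and> H * H = S \<and> H * G = 1\<^sub>m d \<and> G * H = 1\<^sub>m d"
proof -
  obtain U e where A: "S \<in> carrier_mat d d" "is_eig_decomp S U e"
    using psd_obtain_eig[OF S] by metis
  have e: "0 < e k" if k: "k < d" for k
  proof -
    have "of_real (\<Sum>i<d. (cmod (U $$ (i, k)))\<^sup>2) = (1 :: complex)"
      unfolding of_real_sum complex_norm_square
      using is_eig_decompD(2)[OF A k k] by (simp add: mult.commute)
    hence "(\<Sum>i<d. (cmod (U $$ (i, k)))\<^sup>2) = 1" by (simp only: of_real_eq_1_iff)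
    thus ?thesis using c(1) c(2)[of "\<lambda>i. U $$ (i, k)"] qform_col[OF A k] by simp
  qed
  define H where "H = mat_powr S (1 / 2)"
  define G where "G = mat_powr S (- (1 / 2))"
  note h = psdD(2)[OF S]
  have "H * H = S"
    unfolding H_def mat_powr_def mat_fun_mult[OF h]
    using mat_fun_cong[OF A, of "\<lambda>t. t powr (1 / 2) * t powr (1 / 2)" "\<lambda>t. t"] e mat_fun_ident[OF A]
    by (force simp flip: powr_add)
  moreover have "H * G = 1\<^sub>m d" "G * H = 1\<^sub>m d"
    unfolding H_def G_def mat_powr_def mat_fun_mult[OF h]
    using mat_fun_cong[OF A, of "\<lambda>t. t powr (1 / 2) * t powr (- (1 / 2))" "\<lambda>t. 1"]
      mat_fun_cong[OF A, of "\<lambda>t. t powr (- (1 / 2)) * t powr (1 / 2)" "\<lambda>t. 1"] e mat_fun_one[OF h]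
    by (force simp flip: powr_add)+
  ultimately show ?thesis using psd_mat_powr[OF S] unfolding H_def G_def by blast
qed

lemma msum_sandwich:
  assumes G: "G \<in> carrier_mat d d" and F: "\<And>k. k \<in> I \<Longrightarrow> F k \<in> carrier_mat d d"
  shows "msum d (\<lambda>k. G * (F k * G)) I = G * (msum d F I * G)"
proof (rule eq_matI)
  fix i j assume "i < dim_row (G * (msum d F I * G))" "j < dim_col (G * (msum d F I * G))"
  hence ij: "i < d" "j < d" using G by auto
  have "msum d (\<lambda>k. G * (F k * G)) I $$ (i, j) =
      (\<Sum>x\<in>I. \<Sum>k<d. \<Sum>l<d. G $$ (i, k) * F x $$ (k, l) * G $$ (l, j))"
    using ij by (simp add: msum_def sandwich_index[OF G F ij] cong: sum.cong)
  also have "\<dots> = (\<Sum>k<d. \<Sum>x\<in>I. \<Sum>l<d. G $$ (i, k) * F x $$ (k, l) * G $$ (l, j))" by (rule sum.swap)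
  also have "\<dots> = (\<Sum>k<d. \<Sum>l<d. \<Sum>x\<in>I. G $$ (i, k) * F x $$ (k, l) * G $$ (l, j))"
    by (intro sum.cong[OF refl] sum.swap)
  also have "\<dots> = (G * (msum d F I * G)) $$ (i, j)"
    unfolding sandwich_index[OF G msum_carrier ij]
    by (intro sum.cong refl) (simp add: msum_def sum_distrib_left sum_distrib_right)
  finally show "msum d (\<lambda>k. G * (F k * G)) I $$ (i, j) = (G * (msum d F I * G)) $$ (i, j)" .
qed (use G in \<open>auto simp: msum_def\<close>)

text \<open>Derandomized random binning: each new element joins a bin in which the collision cost it
  adds is at most the average over the bins. A uniformly random assignment satisfies the same bound
  in expectation.\<close>

lemma greedy_binning:
  fixes c :: "'i \<Rightarrow> 'i \<Rightarrow> real"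
  assumes "finite T" "M > 0"
  shows "\<exists>f. (\<forall>x. f x < M) \<and> (\<Sum>x\<in>T. \<Sum>y\<in>T - {x}. if f y = f x then c x y else 0)
    \<le> (\<Sum>x\<in>T. \<Sum>y\<in>T - {x}. c x y) / real M"
  using assms(1)
proof (induction T rule: finite_induct)
  case empty
  show ?case using assms(2) by (auto intro: exI[of _ "\<lambda>_. 0"])
next
  case (insert a T)
  then obtain f where f: "\<And>x. f x < M" and le: "(\<Sum>x\<in>T. \<Sum>y\<in>T - {x}. if f y = f x then c x y else 0)
    \<le> (\<Sum>x\<in>T. \<Sum>y\<in>T - {x}. c x y) / real M" by blast
  define w where "w y = c a y + c y a" for y
  \<comment> \<open>The costs over the \<open>M\<close> bins add up to the total cost of the new
    element, so some bin is not above average.\<close>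
  have "\<exists>z<M. (\<Sum>y\<in>T. if f y = z then w y else 0) \<le> (\<Sum>y\<in>T. w y) / real M"
  proof (rule ccontr)
    assume "\<not> ?thesis"
    hence "(\<Sum>z<M. (\<Sum>y\<in>T. w y) / real M) < (\<Sum>z<M. \<Sum>y\<in>T. if f y = z then w y else 0)"
      using assms(2) by (intro sum_strict_mono) auto
    also have "\<dots> = (\<Sum>y\<in>T. \<Sum>z<M. if f y = z then w y else 0)" by (rule sum.swap)
    also have "\<dots> = (\<Sum>y\<in>T. w y)" using f by simp
    finally show False using assms(2) by simp
  qed
  then obtain z where z: "z < M" "(\<Sum>y\<in>T. if f y = z then w y else 0) \<le> (\<Sum>y\<in>T. w y) / real M" by blast
  define g where "g = f(a := z)"
  have split: "(\<Sum>x\<in>insert a T. \<Sum>y\<in>insert a T - {x}. h x y) =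
      (\<Sum>x\<in>T. \<Sum>y\<in>T - {x}. h x y) + (\<Sum>y\<in>T. h a y + h y a)" for h :: "'i \<Rightarrow> 'i \<Rightarrow> real"
  proof -
    have "(\<Sum>y\<in>insert a T - {x}. h x y) = h x a + (\<Sum>y\<in>T - {x}. h x y)" if "x \<in> T" for x
    proof -
      have "insert a T - {x} = insert a (T - {x})" using that insert.hyps by auto
      thus ?thesis using insert.hyps by simp
    qed
    moreover have "insert a T - {a} = T" using insert.hyps by auto
    ultimately show ?thesis using insert.hyps by (simp add: sum.distrib)
  qed
  have "(\<Sum>x\<in>insert a T. \<Sum>y\<in>insert a T - {x}. if g y = g x then c x y else 0) =
      (\<Sum>x\<in>T. \<Sum>y\<in>T - {x}. if f y = f x then c x y else 0) + (\<Sum>y\<in>T. if f y = z then w y else 0)"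
    unfolding split using insert.hyps
    by (intro arg_cong2[of _ _ _ _ "(+)"] sum.cong refl) (auto simp: g_def w_def)
  also have "\<dots> \<le> (\<Sum>x\<in>T. \<Sum>y\<in>T - {x}. c x y) / real M + (\<Sum>y\<in>T. w y) / real M"
    using le z(2) by simp
  also have "\<dots> = (\<Sum>x\<in>insert a T. \<Sum>y\<in>insert a T - {x}. c x y) / real M"
    unfolding split w_def by (simp add: add_divide_distrib)
  finally show ?case using f z(1) by (intro exI[of _ g]) (auto simp: g_def)
qed

lemma trace_le_dim:
  assumes T: "psd d T" and T1: "psd d (1\<^sub>m d - T)"
  shows "Re (mat_trace T) \<le> real d"
proof -
  have "0 \<le> Re (mat_trace (1\<^sub>m d * (1\<^sub>m d - T)))" by (rule trace_psd_mult_nonneg[OF psd_one T1])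
  also have "mat_trace (1\<^sub>m d * (1\<^sub>m d - T)) = mat_trace (1\<^sub>m d * 1\<^sub>m d) - mat_trace (1\<^sub>m d * T)"
    by (rule trace_mult_minus_right[of _ d]) (use psdD(1)[OF T] in auto)
  also have "\<dots> = of_nat d - mat_trace T" using psdD(1)[OF T] by (simp add: mat_trace_def)
  finally show ?thesis by simp
qed

text \<open>The decoder for \<open>z\<close> is the pretty good measurement for the states of bin
  \<open>z\<close>, with \<eta> times the identity added at every index of \<open>I\<close>. This
  makes the sum invertible, even for an empty bin, so the operators sum exactly to the identity. The
  additions cost at most \<open>card I * d * \<eta>\<close>, hence at most \<epsilon>.\<close>

theorem one_shot_source_code:
  fixes \<sigma> :: "'i \<Rightarrow> complex mat"
  assumes I: "finite I" "I \<noteq> {}" "T \<subseteq> I"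
    and \<sigma>: "\<And>x. x \<in> T \<Longrightarrow> psd d (\<sigma> x)"
    and test: "\<And>x. x \<in> T \<Longrightarrow> psd d (E x)" "\<And>x. x \<in> T \<Longrightarrow> psd d (1\<^sub>m d - E x)"
    and \<epsilon>: "0 < \<epsilon>"
  shows "\<exists>P. \<forall>z. is_povm d I (P z) \<and> (\<forall>x\<in>T. f x = z \<longrightarrow> Re (mat_trace ((1\<^sub>m d - P z x) * \<sigma> x)) \<le>
    Re (mat_trace ((1\<^sub>m d - E x) * \<sigma> x)) +
    (\<Sum>y\<in>T - {x}. if f y = f x then Re (mat_trace (E x * \<sigma> y)) else 0) + \<epsilon>)"
proof (rule choice, rule allI)
  fix z
  have oc: "1\<^sub>m d \<in> carrier_mat d d" by simp
  \<comment> \<open>The summand 1 keeps the denominator positive for \<open>d = 0\<close>.\<close>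
  define \<eta> where "\<eta> = \<epsilon> / (real (card I) * real d + 1)"
  have \<eta>: "0 < \<eta>" "\<eta> * (real (card I) * real d) \<le> \<epsilon>"
  proof -
    have pos: "0 < real (card I) * real d + 1" by (intro add_nonneg_pos) auto
    thus "0 < \<eta>" using \<epsilon> by (simp add: \<eta>_def)
    show "\<eta> * (real (card I) * real d) \<le> \<epsilon>"
      unfolding \<eta>_def using \<epsilon> pos by (simp add: divide_le_eq del: of_nat_mult)
  qed
  define W where "W x = (if x \<in> T \<and> f x = z then \<sigma> x else 0\<^sub>m d d)" for x
  have zero: "psd d (0\<^sub>m d d)"
    unfolding psd_iff_qform hermitian_def qform_def by simp
  have W: "psd d (W x)" for x unfolding W_def using \<sigma> zero by auto
  define R where "R x = W x + complex_of_real \<eta> \<cdot>\<^sub>m 1\<^sub>m d" for x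
  have R: "psd d (R x)" for x unfolding R_def using \<eta> by (intro psd_add W psd_smult psd_one) auto
  note Wc = psdD(1)[OF W] and Rc = psdD(1)[OF R]
  have qR: "Re (qform d (R x) v) = Re (qform d (W x) v) + \<eta> * (\<Sum>i<d. (cmod (v i))\<^sup>2)" for x v
    using Wc by (simp add: R_def qform_add qform_smult qform_one)
  define S where "S = msum d R I"
  have S: "psd d S" unfolding S_def by (intro psd_msum R)
  have "\<eta> * (\<Sum>i<d. (cmod (v i))\<^sup>2) \<le> Re (qform d S v)" for v
  proof -
    obtain a where a: "a \<in> I" using I by blast
    have "\<eta> * (\<Sum>i<d. (cmod (v i))\<^sup>2) \<le> Re (qform d (R a) v)"
      unfolding qR using W[of a] by (simp add: psd_iff_qform)
    also have "\<dots> \<le> (\<Sum>x\<in>I. Re (qform d (R x) v))"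
      using R a I by (intro member_le_sum) (auto simp: psd_iff_qform)
    finally show ?thesis unfolding S_def qform_msum by simp
  qed
  from psd_square_root_inverse[OF S \<eta>(1) this] obtain H G where H: "psd d H" and G: "psd d G"
    and HH: "H * H = S" and HG: "H * G = 1\<^sub>m d" and GH: "G * H = 1\<^sub>m d" by blast
  note Hc = psdD(1)[OF H] and Gc = psdD(1)[OF G]
  note c = mult_carrier_mat[of _ d d _ d]
  note assoc = assoc_mult_mat[of _ d d _ d _ d]
  define P where "P x = G * (R x * G)" for x
  have P: "psd d (P x)" for x unfolding P_def by (intro psd_sandwich psdD G R)
  note Pc = psdD(1)[OF P]
  have "msum d P I = G * (S * G)"
    unfolding P_def S_def by (rule msum_sandwich[OF Gc Rc])
  also have "\<dots> = (G * H) * (H * G)" unfolding HH[symmetric] using Gc Hc by (simp add: assoc c)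
  finally have sumP: "msum d P I = 1\<^sub>m d" unfolding GH HG by simp
  have povm: "is_povm d I P" unfolding is_povm_def using P sumP by blast
  have P1: "psd d (1\<^sub>m d - P x)" if "x \<in> I" for x
  proof (intro psd_minusI hermitian_one psdD P)
    fix v
    have "Re (qform d (P x) v) \<le> (\<Sum>y\<in>I. Re (qform d (P y) v))"
      using P that I by (intro member_le_sum) (auto simp: psd_iff_qform)
    thus "Re (qform d (P x) v) \<le> Re (qform d (1\<^sub>m d) v)"
      unfolding sumP[symmetric] qform_msum by simp
  qed
  \<comment> \<open>Identifies \<open>P x\<close> as the operator \<open>N\<close> of the pretty
    good comparison, with \<open>H\<close> the square root of the sum \<open>S\<close> of all
    perturbed states.\<close>
  have HPH: "H * (P x * H) = R x" for x
  proof -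
    have "H * (P x * H) = (H * G) * (R x * (G * H))"
      unfolding P_def using Gc Hc Rc by (simp add: assoc c)
    thus ?thesis unfolding HG GH using Rc[of x] by simp
  qed
  have trR: "Re (mat_trace (X * R x)) = Re (mat_trace (X * W x)) + \<eta> * Re (mat_trace X)"
    if X: "X \<in> carrier_mat d d" for X x
    unfolding R_def using X Wc[of x]
    by (simp add: trace_mult_add_right[of _ d] trace_mult_smult_right[of _ d])
  have "Re (mat_trace ((1\<^sub>m d - P x) * \<sigma> x)) \<le> Re (mat_trace ((1\<^sub>m d - E x) * \<sigma> x)) +
      (\<Sum>y\<in>T - {x}. if f y = f x then Re (mat_trace (E x * \<sigma> y)) else 0) + \<epsilon>"
    if x: "x \<in> T" and fx: "f x = z" for x
  proof -
    have xI: "x \<in> I" using x I by blast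
    have Wx: "W x = \<sigma> x" using x fx by (simp add: W_def)
    note Ec = psdD(1)[OF test(1)[OF x]]
    have E1c: "1\<^sub>m d - E x \<in> carrier_mat d d" and P1c: "1\<^sub>m d - P x \<in> carrier_mat d d"
      using minus_carrier_mat[OF Ec] minus_carrier_mat[OF Pc[of x]] by auto
    have trE: "Re (mat_trace (1\<^sub>m d - E x)) = real d - Re (mat_trace (E x))"
      using Ec by (simp add: mat_trace_def sum_subtractf)
    have nn: "0 \<le> Re (mat_trace X)" if "psd d X" for X
      using trace_psd_mult_nonneg[OF that psd_one] psdD(1)[OF that] by simp
    have "Re (mat_trace ((1\<^sub>m d - P x) * \<sigma> x)) \<le> Re (mat_trace ((1\<^sub>m d - P x) * R x))"
      unfolding trR[OF P1c] Wx using nn[OF P1[OF xI]] \<eta> by simp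
    also have "\<dots> \<le> Re (mat_trace ((1\<^sub>m d - E x) * R x)) + Re (mat_trace (E x * (S - R x)))"
      using pretty_good_measurement_le_test[OF H psdD(2)[OF P] test(1)[OF x] test(2)[OF x], of x]
      unfolding HPH HH .
    also have "Re (mat_trace ((1\<^sub>m d - E x) * R x)) =
        Re (mat_trace ((1\<^sub>m d - E x) * \<sigma> x)) + \<eta> * (real d - Re (mat_trace (E x)))"
      unfolding trR[OF E1c] Wx trE ..
    also have "Re (mat_trace (E x * (S - R x))) = (\<Sum>y\<in>I. Re (mat_trace (E x * R y))) - Re (mat_trace (E x * R x))"
      unfolding S_def trace_mult_minus_right[OF Ec msum_carrier Rc]
        trace_mult_msum_right[OF Ec Rc] by simp
    also have "\<dots> = (\<Sum>y\<in>I - {x}. Re (mat_trace (E x * R y)))"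
      using xI I by (simp add: sum_diff1)
    also have "\<dots> = (\<Sum>y\<in>I - {x}. Re (mat_trace (E x * W y))) + real (card (I - {x})) * (\<eta> * Re (mat_trace (E x)))"
      unfolding trR[OF Ec] sum.distrib by simp
    also have "(\<Sum>y\<in>I - {x}. Re (mat_trace (E x * W y))) =
        (\<Sum>y\<in>T - {x}. if f y = f x then Re (mat_trace (E x * \<sigma> y)) else 0)"
    proof (rule sum.mono_neutral_cong_right)
      have "mat_trace (E x * 0\<^sub>m d d) = 0" using Ec by (simp add: mat_trace_def)
      thus "\<forall>y\<in>I - {x} - (T - {x}). Re (mat_trace (E x * W y)) = 0"
        and "\<And>y. y \<in> T - {x} \<Longrightarrow> Re (mat_trace (E x * W y)) =
          (if f y = f x then Re (mat_trace (E x * \<sigma> y)) else 0)"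
        by (auto simp: W_def fx)
    qed (use I in auto)
    also have "real (card (I - {x})) * (\<eta> * Re (mat_trace (E x))) = (real (card I) - 1) * (\<eta> * Re (mat_trace (E x)))"
    proof -
      have "card I \<ge> 1" using xI I by (metis card_gt_0_iff empty_iff less_eq_Suc_le One_nat_def)
      thus ?thesis using xI I by (simp add: of_nat_diff)
    qed
    also have "Re (mat_trace ((1\<^sub>m d - E x) * \<sigma> x)) + \<eta> * (real d - Re (mat_trace (E x))) +
        ((\<Sum>y\<in>T - {x}. if f y = f x then Re (mat_trace (E x * \<sigma> y)) else 0) +
        (real (card I) - 1) * (\<eta> * Re (mat_trace (E x)))) \<le>
        Re (mat_trace ((1\<^sub>m d - E x) * \<sigma> x)) +
        (\<Sum>y\<in>T - {x}. if f y = f x then Re (mat_trace (E x * \<sigma> y)) else 0) + \<epsilon>"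
    proof -
      let ?t = "Re (mat_trace (E x))"
      have t: "?t \<le> real d" "0 \<le> ?t" using trace_le_dim[OF test(1)[OF x] test(2)[OF x]] nn[OF test(1)[OF x]] by auto
      have card: "1 \<le> real (card I)" using xI I by (auto simp: card_gt_0_iff Suc_le_eq)
      have "real d - ?t + (real (card I) - 1) * ?t \<le> real d + (real (card I) - 1) * real d"
        using t card by (intro add_mono mult_left_mono) auto
      also have "\<dots> = real (card I) * real d" by (simp add: algebra_simps)
      finally have "\<eta> * (real d - ?t + (real (card I) - 1) * ?t) \<le> \<epsilon>"
        using \<eta> mult_left_mono order_trans less_imp_le by meson
      thus ?thesis by (simp add: algebra_simps)
    qed
    finally show ?thesis .
  qed
  thus "\<exists>P. is_povm d I P \<and> (\<forall>x\<in>T. f x = z \<longrightarrow> Re (mat_trace ((1\<^sub>m d - P x) * \<sigma> x)) \<le>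
    Re (mat_trace ((1\<^sub>m d - E x) * \<sigma> x)) +
    (\<Sum>y\<in>T - {x}. if f y = f x then Re (mat_trace (E x * \<sigma> y)) else 0) + \<epsilon>)"
    using povm by blast
qed

section \<open>Tensor products\<close>

text \<open>The \<open>k\<close>-th of the \<open>n\<close> base-\<open>d\<close> digits of \<open>i < d ^ n\<close>, most significant first, as in \<open>kron\<close>.\<close>

primrec dig :: "nat \<Rightarrow> nat \<Rightarrow> nat \<Rightarrow> nat \<Rightarrow> nat" where
  "dig d 0 i k = 0"
| "dig d (Suc n) i k = (case k of 0 \<Rightarrow> i div d ^ n | Suc k' \<Rightarrow> dig d n (i mod d ^ n) k')"

lemma div_less_digit: "i < d * m \<Longrightarrow> i div m < (d :: nat)" for m :: nat
  by (simp add: less_mult_imp_div_less)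

lemma dig_less: "i < d ^ n \<Longrightarrow> k < n \<Longrightarrow> dig d n i k < d"
proof (induction n arbitrary: i k)
  case (Suc n)
  hence "d ^ n > 0" by (cases "d = 0") auto
  thus ?case using Suc by (auto split: nat.split simp: div_less_digit)
qed simp

lemma dig_inject:
  "i < d ^ n \<Longrightarrow> j < d ^ n \<Longrightarrow> (\<And>k. k < n \<Longrightarrow> dig d n i k = dig d n j k) \<Longrightarrow> i = j"
proof (induction n arbitrary: i j)
  case (Suc n)
  hence pos: "d ^ n > 0" by (cases "d = 0") auto
  have "i div d ^ n = j div d ^ n" using Suc.prems(3)[of 0] by simp
  moreover have "i mod d ^ n = j mod d ^ n"
    using Suc.IH[of "i mod d ^ n" "j mod d ^ n"] Suc.prems(3)[of "Suc _"] pos by simp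
  ultimately show ?case by (metis div_mult_mod_eq)
qed simp

lemma sum_lessThan_mult:
  fixes f :: "nat \<Rightarrow> 'a :: comm_monoid_add"
  assumes "0 < m"
  shows "(\<Sum>i<d * m. f i) = (\<Sum>a<d. \<Sum>b<m. f (a * m + b))"
  using assms
proof (induction d)
  case (Suc d)
  have "(\<Sum>i<Suc d * m. f i) = (\<Sum>i<d * m. f i) + (\<Sum>i\<in>{d * m..<d * m + m}. f i)"
    using sum.atLeastLessThan_concat[of 0 "d * m" "d * m + m" f]
    by (simp add: lessThan_atLeast0 add.commute)
  moreover have "(\<Sum>i\<in>{d * m..<d * m + m}. f i) = (\<Sum>b<m. f (d * m + b))"
    using sum.shift_bounds_nat_ivl[of f 0 "d * m" m] by (simp add: lessThan_atLeast0 add.commute)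
  ultimately show ?case using Suc by simp
qed simp

text \<open>Indices below \<open>d ^ n\<close> correspond to words of \<open>n\<close> digits, and a
  sum over words of a product over positions factors. All computations with tensor products reduce
  to this interchange.\<close>

lemma sum_prod_dig:
  fixes g :: "nat \<Rightarrow> nat \<Rightarrow> 'a :: comm_semiring_1"
  shows "(\<Sum>i<d ^ n. \<Prod>k<n. g k (dig d n i k)) = (\<Prod>k<n. \<Sum>a<d. g k a)"
proof (induction n arbitrary: g)
  case (Suc n)
  show ?case
  proof (cases "d = 0")
    case False
    hence pos: "d ^ n > 0" by simp
    have "(\<Sum>i<d ^ Suc n. \<Prod>k<Suc n. g k (dig d (Suc n) i k)) =
        (\<Sum>a<d. \<Sum>b<d ^ n. \<Prod>k<Suc n. g k (dig d (Suc n) (a * d ^ n + b) k))"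
      using sum_lessThan_mult[OF pos, of _ d] by simp
    also have "\<dots> = (\<Sum>a<d. \<Sum>b<d ^ n. g 0 a * (\<Prod>k<n. g (Suc k) (dig d n b k)))"
      by (intro sum.cong refl) (use pos in \<open>simp add: prod.lessThan_Suc_shift del: prod.lessThan_Suc\<close>)
    also have "\<dots> = (\<Sum>a<d. g 0 a) * (\<Prod>k<n. \<Sum>a<d. g (Suc k) a)"
      by (simp add: sum_distrib_left[symmetric] sum_distrib_right Suc.IH[of "\<lambda>k. g (Suc k)"])
    finally show ?thesis by (simp add: prod.lessThan_Suc_shift del: prod.lessThan_Suc)
  qed simp
qed simp

lemma sum2_prod_dig:
  fixes g :: "nat \<Rightarrow> nat \<Rightarrow> nat \<Rightarrow> 'a :: comm_semiring_1"
  shows "(\<Sum>i<d ^ n. \<Sum>j<d ^ n. \<Prod>k<n. g k (dig d n i k) (dig d n j k)) = (\<Prod>k<n. \<Sum>a<d. \<Sum>b<d. g k a b)"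
proof -
  have "(\<Sum>i<d ^ n. \<Sum>j<d ^ n. \<Prod>k<n. g k (dig d n i k) (dig d n j k)) =
      (\<Sum>i<d ^ n. \<Prod>k<n. \<Sum>b<d. g k (dig d n i k) b)"
    by (intro sum.cong refl sum_prod_dig)
  also have "\<dots> = (\<Prod>k<n. \<Sum>a<d. \<Sum>b<d. g k a b)"
    by (rule sum_prod_dig[of "\<lambda>k a. \<Sum>b<d. g k a b"])
  finally show ?thesis .
qed

section \<open>Entries, eigenvalues and overlaps of tensor products\<close>

lemma tensor_list_carrier:
  assumes "\<And>A. A \<in> set As \<Longrightarrow> A \<in> carrier_mat d d"
  shows "tensor_list As \<in> carrier_mat (d ^ length As) (d ^ length As)"
  using assms
proof (induction As)
  case (Cons A As)
  hence "A \<in> carrier_mat d d" "tensor_list As \<in> carrier_mat (d ^ length As) (d ^ length As)" by auto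
  thus ?case by (auto simp: tensor_list_def kron_def)
qed (simp add: tensor_list_def)

lemma tensor_list_index:
  assumes "\<And>A. A \<in> set As \<Longrightarrow> A \<in> carrier_mat d d" "i < d ^ length As" "j < d ^ length As"
  shows "tensor_list As $$ (i, j) =
    (\<Prod>k<length As. (As ! k) $$ (dig d (length As) i k, dig d (length As) j k))"
  using assms
proof (induction As arbitrary: i j)
  case (Cons A As)
  let ?n = "length As"
  have A: "A \<in> carrier_mat d d" and T: "tensor_list As \<in> carrier_mat (d ^ ?n) (d ^ ?n)"
    using Cons.prems tensor_list_carrier[of As d] by auto
  have pos: "d ^ ?n > 0" using Cons.prems by (cases "d = 0") auto
  have "tensor_list (A # As) $$ (i, j) =
      A $$ (i div d ^ ?n, j div d ^ ?n) * tensor_list As $$ (i mod d ^ ?n, j mod d ^ ?n)"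
    using carrier_matD[OF A] carrier_matD[OF T] Cons.prems(2,3) by (simp add: tensor_list_def kron_def)
  also have "tensor_list As $$ (i mod d ^ ?n, j mod d ^ ?n) =
      (\<Prod>k<?n. (As ! k) $$ (dig d ?n (i mod d ^ ?n) k, dig d ?n (j mod d ^ ?n) k))"
    by (rule Cons.IH) (use Cons.prems pos in auto)
  finally show ?case by (simp add: prod.lessThan_Suc_shift del: prod.lessThan_Suc)
qed (simp add: tensor_list_def)

lemma prod_delta_dig:
  assumes "a < d ^ n" "b < d ^ n"
  shows "(\<Prod>k<n. if dig d n a k = dig d n b k then 1 else 0) = (if a = b then 1 else (0 :: complex))"
proof (cases "a = b")
  case False
  then obtain k where "k < n" "dig d n a k \<noteq> dig d n b k" using dig_inject[OF assms] by blast
  hence "(\<Prod>k<n. if dig d n a k = dig d n b k then 1 else 0) = (0 :: complex)"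
    by (intro prod_zero) auto
  thus ?thesis using False by simp
qed simp

lemma is_eig_decomp_tensor_list:
  assumes len: "length As = n" "length Us = n"
    and A: "\<And>k. k < n \<Longrightarrow> As ! k \<in> carrier_mat d d"
    and dec: "\<And>k. k < n \<Longrightarrow> is_eig_decomp (As ! k) (Us ! k) (e k)"
  shows "is_eig_decomp (tensor_list As) (tensor_list Us) (\<lambda>i. \<Prod>k<n. e k (dig d n i k))"
proof -
  have U: "Us ! k \<in> carrier_mat d d" if "k < n" for k using is_eig_decompD(1)[OF A dec] that by blast
  have Ac: "\<And>B. B \<in> set As \<Longrightarrow> B \<in> carrier_mat d d" using A len by (metis in_set_conv_nth)
  have Uc: "\<And>B. B \<in> set Us \<Longrightarrow> B \<in> carrier_mat d d" using U len by (metis in_set_conv_nth)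
  have TA: "tensor_list As \<in> carrier_mat (d ^ n) (d ^ n)" and TU: "tensor_list Us \<in> carrier_mat (d ^ n) (d ^ n)"
    using tensor_list_carrier[of As d] tensor_list_carrier[of Us d] Ac Uc len by auto
  have iA: "tensor_list As $$ (i, j) = (\<Prod>k<n. (As ! k) $$ (dig d n i k, dig d n j k))"
    and iU: "tensor_list Us $$ (i, j) = (\<Prod>k<n. (Us ! k) $$ (dig d n i k, dig d n j k))"
    if "i < d ^ n" "j < d ^ n" for i j
    using tensor_list_index[of As d i j] tensor_list_index[of Us d i j] Ac Uc len that by auto
  note dl = dig_less[of _ d n]
  show ?thesis unfolding is_eig_decomp_iff[OF TA]
  proof (intro conjI allI impI)
    fix a b assume ab: "a < d ^ n" "b < d ^ n"
    have "(\<Sum>i<d ^ n. cnj (tensor_list Us $$ (i, a)) * tensor_list Us $$ (i, b)) =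
      (\<Sum>i<d ^ n. \<Prod>k<n. cnj ((Us ! k) $$ (dig d n i k, dig d n a k)) * (Us ! k) $$ (dig d n i k, dig d n b k))"
      using ab by (simp add: iU prod.distrib)
    also have "\<dots> = (\<Prod>k<n. \<Sum>i<d. cnj ((Us ! k) $$ (i, dig d n a k)) * (Us ! k) $$ (i, dig d n b k))"
      by (rule sum_prod_dig[of "\<lambda>k i. cnj ((Us ! k) $$ (i, dig d n a k)) * (Us ! k) $$ (i, dig d n b k)"])
    also have "\<dots> = (\<Prod>k<n. if dig d n a k = dig d n b k then 1 else 0)"
      using is_eig_decompD(2)[OF A dec] dl ab by (intro prod.cong) auto
    finally show "(\<Sum>i<d ^ n. cnj (tensor_list Us $$ (i, a)) * tensor_list Us $$ (i, b)) = (if a = b then 1 else 0)"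
      unfolding prod_delta_dig[OF ab] .
    have "(\<Sum>i<d ^ n. tensor_list Us $$ (a, i) * cnj (tensor_list Us $$ (b, i))) =
      (\<Sum>i<d ^ n. \<Prod>k<n. (Us ! k) $$ (dig d n a k, dig d n i k) * cnj ((Us ! k) $$ (dig d n b k, dig d n i k)))"
      using ab by (simp add: iU prod.distrib)
    also have "\<dots> = (\<Prod>k<n. \<Sum>i<d. (Us ! k) $$ (dig d n a k, i) * cnj ((Us ! k) $$ (dig d n b k, i)))"
      by (rule sum_prod_dig[of "\<lambda>k i. (Us ! k) $$ (dig d n a k, i) * cnj ((Us ! k) $$ (dig d n b k, i))"])
    also have "\<dots> = (\<Prod>k<n. if dig d n a k = dig d n b k then 1 else 0)"
      using is_eig_decompD(3)[OF A dec] dl ab by (intro prod.cong) auto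
    finally show "(\<Sum>i<d ^ n. tensor_list Us $$ (a, i) * cnj (tensor_list Us $$ (b, i))) = (if a = b then 1 else 0)"
      unfolding prod_delta_dig[OF ab] .
    have "(\<Sum>i<d ^ n. tensor_list Us $$ (a, i) * of_real (\<Prod>k<n. e k (dig d n i k)) * cnj (tensor_list Us $$ (b, i))) =
      (\<Sum>i<d ^ n. \<Prod>k<n. (Us ! k) $$ (dig d n a k, dig d n i k) * of_real (e k (dig d n i k)) * cnj ((Us ! k) $$ (dig d n b k, dig d n i k)))"
      using ab by (simp add: iU prod.distrib)
    also have "\<dots> = (\<Prod>k<n. \<Sum>i<d. (Us ! k) $$ (dig d n a k, i) * of_real (e k i) * cnj ((Us ! k) $$ (dig d n b k, i)))"
      by (rule sum_prod_dig[of "\<lambda>k i. (Us ! k) $$ (dig d n a k, i) * of_real (e k i) * cnj ((Us ! k) $$ (dig d n b k, i))"])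
    also have "\<dots> = (\<Prod>k<n. (As ! k) $$ (dig d n a k, dig d n b k))"
      using is_eig_decompD(4)[OF A dec] dl ab by (intro prod.cong) auto
    finally show "tensor_list As $$ (a, b) = (\<Sum>i<d ^ n. tensor_list Us $$ (a, i) *
        of_real (\<Prod>k<n. e k (dig d n i k)) * cnj (tensor_list Us $$ (b, i)))"
      using ab by (simp add: iA)
  qed (rule TU)
qed

lemma overlap_tensor_list:
  assumes len: "length Us = n" "length Vs = n"
    and U: "\<And>k. k < n \<Longrightarrow> Us ! k \<in> carrier_mat d d" and V: "\<And>k. k < n \<Longrightarrow> Vs ! k \<in> carrier_mat d d"
    and ij: "i < d ^ n" "j < d ^ n"
  shows "overlap (d ^ n) (tensor_list Us) (tensor_list Vs) i j =
    (\<Prod>k<n. overlap d (Us ! k) (Vs ! k) (dig d n i k) (dig d n j k))"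
proof -
  have Uc: "\<And>B. B \<in> set Us \<Longrightarrow> B \<in> carrier_mat d d" using U len by (metis in_set_conv_nth)
  have Vc: "\<And>B. B \<in> set Vs \<Longrightarrow> B \<in> carrier_mat d d" using V len by (metis in_set_conv_nth)
  have iU: "tensor_list Us $$ (i, j) = (\<Prod>k<n. (Us ! k) $$ (dig d n i k, dig d n j k))"
    and iV: "tensor_list Vs $$ (i, j) = (\<Prod>k<n. (Vs ! k) $$ (dig d n i k, dig d n j k))"
    if "i < d ^ n" "j < d ^ n" for i j
    using tensor_list_index[of Us d i j] tensor_list_index[of Vs d i j] Uc Vc len that by auto
  have "(\<Sum>m<d ^ n. cnj (tensor_list Vs $$ (m, j)) * tensor_list Us $$ (m, i)) =
    (\<Sum>m<d ^ n. \<Prod>k<n. cnj ((Vs ! k) $$ (dig d n m k, dig d n j k)) * (Us ! k) $$ (dig d n m k, dig d n i k))"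
    using ij by (simp add: iU iV prod.distrib)
  also have "\<dots> = (\<Prod>k<n. \<Sum>m<d. cnj ((Vs ! k) $$ (m, dig d n j k)) * (Us ! k) $$ (m, dig d n i k))"
    by (rule sum_prod_dig[of "\<lambda>k m. cnj ((Vs ! k) $$ (m, dig d n j k)) * (Us ! k) $$ (m, dig d n i k)"])
  finally show ?thesis
    unfolding overlap_def by (simp only: prod_norm[symmetric] prod_power_distrib)
qed

text \<open>The decomposition is chosen letter by letter so that eigenvalues and eigenvectors of the
  tensor product have product form, which an arbitrary decomposition would not.\<close>

lemma exists_tensor_list_eig:
  assumes "\<forall>A\<in>set As. psd d A" and n: "length As = n"
  shows "\<exists>Us (e :: nat \<Rightarrow> nat \<Rightarrow> real). length Us = n \<and> (\<forall>k<n. is_eig_decomp (As ! k) (Us ! k) (e k)) \<and>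
    (\<forall>k<n. \<forall>i<d. 0 \<le> e k i) \<and> (\<forall>k<n. Us ! k \<in> carrier_mat d d) \<and>
    is_eig_decomp (tensor_list As) (tensor_list Us) (\<lambda>i. \<Prod>k<n. e k (dig d n i k)) \<and>
    tensor_list As \<in> carrier_mat (d ^ n) (d ^ n)"
proof -
  have p: "psd d (As ! k)" if "k < n" for k using assms that by simp
  have "\<forall>k\<in>{..<n}. \<exists>Ue. is_eig_decomp (As ! k) (fst Ue) (snd Ue)"
    using hermitian_is_eig_decomp psdD(2)[OF p] by (metis fst_conv lessThan_iff snd_conv)
  then obtain Ue where Ue: "\<And>k. k < n \<Longrightarrow> is_eig_decomp (As ! k) (fst (Ue k)) (snd (Ue k))"
    by (metis lessThan_iff bchoice)
  define Us where "Us = map (\<lambda>k. fst (Ue k)) [0..<n]"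
  have len: "length Us = n" by (simp add: Us_def)
  have dec: "is_eig_decomp (As ! k) (Us ! k) (snd (Ue k))" if "k < n" for k
    using Ue that by (simp add: Us_def)
  have nn: "0 \<le> snd (Ue k) i" if "k < n" "i < d" for k i
    using psd_eig_nonneg[OF p dec] that by blast
  have Uc: "Us ! k \<in> carrier_mat d d" if "k < n" for k
    using is_eig_decompD(1)[OF psdD(1)[OF p] dec] that by blast
  have "tensor_list As \<in> carrier_mat (d ^ n) (d ^ n)"
    using tensor_list_carrier[of As d] assms psdD(1) by blast
  moreover have "is_eig_decomp (tensor_list As) (tensor_list Us) (\<lambda>i. \<Prod>k<n. snd (Ue k) (dig d n i k))"
    by (rule is_eig_decomp_tensor_list[OF n len]) (use psdD(1)[OF p] dec in auto)
  ultimately show ?thesis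
    by (intro exI[of _ Us] exI[of _ "\<lambda>k. snd (Ue k)"]) (simp add: len dec nn Uc)
qed

lemma psd_tensor_list:
  assumes "\<And>A. A \<in> set As \<Longrightarrow> psd d A"
  shows "psd (d ^ length As) (tensor_list As)"
proof -
  have bA: "\<forall>A\<in>set As. psd d A" using assms by blast
  obtain Us and e :: "nat \<Rightarrow> nat \<Rightarrow> real" where ex: "length Us = length As" "\<forall>k<length As. is_eig_decomp (As ! k) (Us ! k) (e k)"
    "\<forall>k<length As. \<forall>i<d. 0 \<le> e k i" "\<forall>k<length As. Us ! k \<in> carrier_mat d d"
    "is_eig_decomp (tensor_list As) (tensor_list Us) (\<lambda>i. \<Prod>k<length As. e k (dig d (length As) i k))"
    "tensor_list As \<in> carrier_mat (d ^ length As) (d ^ length As)"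
    using exists_tensor_list_eig[OF bA refl] by (elim exE conjE)
  note * = ex(1) ex(2)[rule_format] ex(3)[rule_format] ex(4)[rule_format] ex(5,6)
  show ?thesis by (rule psdI_eig[OF *(6,5)]) (auto intro!: prod_nonneg *(3) dig_less)
qed

lemma trace_tensor_list:
  assumes "\<And>A. A \<in> set As \<Longrightarrow> A \<in> carrier_mat d d"
  shows "mat_trace (tensor_list As) = (\<Prod>k<length As. mat_trace (As ! k))"
proof -
  let ?n = "length As"
  have "dim_row (tensor_list As) = d ^ ?n" using tensor_list_carrier[of As d] assms by auto
  hence "mat_trace (tensor_list As) = (\<Sum>i<d ^ ?n. \<Prod>k<?n. (As ! k) $$ (dig d ?n i k, dig d ?n i k))"
    unfolding mat_trace_def using tensor_list_index[of As d] assms by (intro sum.cong) auto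
  also have "\<dots> = (\<Prod>k<?n. \<Sum>a<d. (As ! k) $$ (a, a))"
    by (rule sum_prod_dig[of "\<lambda>k a. (As ! k) $$ (a, a)"])
  also have "\<dots> = (\<Prod>k<?n. mat_trace (As ! k))"
    using assms unfolding mat_trace_def by (intro prod.cong refl) (metis carrier_matD(1) lessThan_iff nth_mem)
  finally show ?thesis .
qed

text \<open>In product eigenbases the eigenvalues, their powers and the overlaps all factor over the
  digits, so the double sum for the trace factors as well.\<close>

lemma trace_mat_powr_tensor_list:
  assumes A: "\<And>A. A \<in> set As \<Longrightarrow> psd d A" and B: "\<And>B. B \<in> set Bs \<Longrightarrow> psd d B"
    and n: "length As = n" "length Bs = n"
  shows "Re (mat_trace (mat_powr (tensor_list As) a * mat_powr (tensor_list Bs) b)) =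
    (\<Prod>k<n. Re (mat_trace (mat_powr (As ! k) a * mat_powr (Bs ! k) b)))"
proof -
  have bA: "\<forall>A\<in>set As. psd d A" and bB: "\<forall>B\<in>set Bs. psd d B" using A B by blast+
  obtain Us and e :: "nat \<Rightarrow> nat \<Rightarrow> real" where ex: "length Us = n" "\<forall>k<n. is_eig_decomp (As ! k) (Us ! k) (e k)"
    "\<forall>k<n. \<forall>i<d. 0 \<le> e k i" "\<forall>k<n. Us ! k \<in> carrier_mat d d"
    "is_eig_decomp (tensor_list As) (tensor_list Us) (\<lambda>i. \<Prod>k<n. e k (dig d (n) i k))"
    "tensor_list As \<in> carrier_mat (d ^ n) (d ^ n)"
    using exists_tensor_list_eig[OF bA n(1)] by (elim exE conjE)
  note U = ex(1) ex(2)[rule_format] ex(3)[rule_format] ex(4)[rule_format] ex(5,6)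
  obtain Vs and g :: "nat \<Rightarrow> nat \<Rightarrow> real" where ex: "length Vs = n" "\<forall>k<n. is_eig_decomp (Bs ! k) (Vs ! k) (g k)"
    "\<forall>k<n. \<forall>i<d. 0 \<le> g k i" "\<forall>k<n. Vs ! k \<in> carrier_mat d d"
    "is_eig_decomp (tensor_list Bs) (tensor_list Vs) (\<lambda>i. \<Prod>k<n. g k (dig d (n) i k))"
    "tensor_list Bs \<in> carrier_mat (d ^ n) (d ^ n)"
    using exists_tensor_list_eig[OF bB n(2)] by (elim exE conjE)
  note V = ex(1) ex(2)[rule_format] ex(3)[rule_format] ex(4)[rule_format] ex(5,6)
  have "Re (mat_trace (mat_powr (tensor_list As) a * mat_powr (tensor_list Bs) b)) =
    (\<Sum>i<d ^ n. \<Sum>j<d ^ n. (\<Prod>k<n. e k (dig d n i k)) powr a * (\<Prod>k<n. g k (dig d n j k)) powr b *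
      overlap (d ^ n) (tensor_list Us) (tensor_list Vs) i j)"
    unfolding mat_powr_def trace_mat_fun_mult_mat_fun[OF U(6,5) V(6,5)] by simp
  also have "\<dots> = (\<Sum>i<d ^ n. \<Sum>j<d ^ n. \<Prod>k<n. e k (dig d n i k) powr a * g k (dig d n j k) powr b *
      overlap d (Us ! k) (Vs ! k) (dig d n i k) (dig d n j k))"
    using dig_less[of _ d n] U(3) V(3)
    by (intro sum.cong refl)
      (simp add: overlap_tensor_list[OF U(1) V(1) U(4) V(4)] prod_powr_distrib prod.distrib)
  also have "\<dots> = (\<Prod>k<n. \<Sum>i<d. \<Sum>j<d. e k i powr a * g k j powr b * overlap d (Us ! k) (Vs ! k) i j)"
    by (rule sum2_prod_dig[of "\<lambda>k i j. e k i powr a * g k j powr b * overlap d (Us ! k) (Vs ! k) i j"])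
  also have "\<dots> = (\<Prod>k<n. Re (mat_trace (mat_powr (As ! k) a * mat_powr (Bs ! k) b)))"
  proof (intro prod.cong refl)
    fix k assume "k \<in> {..<n}"
    hence k: "k < n" by simp
    have "As ! k \<in> carrier_mat d d" "Bs ! k \<in> carrier_mat d d" using A B n k psdD(1) by simp_all
    thus "(\<Sum>i<d. \<Sum>j<d. e k i powr a * g k j powr b * overlap d (Us ! k) (Vs ! k) i j) =
        Re (mat_trace (mat_powr (As ! k) a * mat_powr (Bs ! k) b))"
      unfolding mat_powr_def by (simp add: trace_mat_fun_mult_mat_fun[OF _ U(2)[OF k] _ V(2)[OF k]])
  qed
  finally show ?thesis .
qed

lemma is_eig_decomp_smult:
  assumes A: "A \<in> carrier_mat d d" and dec: "is_eig_decomp A U e"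
  shows "is_eig_decomp (complex_of_real c \<cdot>\<^sub>m A) U (\<lambda>k. c * e k)"
proof -
  have cA: "complex_of_real c \<cdot>\<^sub>m A \<in> carrier_mat d d" using A by simp
  show ?thesis
    unfolding is_eig_decomp_iff[OF cA]
    using is_eig_decompD[OF A dec] A by (simp add: sum_distrib_left mult_ac)
qed

lemma mat_powr_smult:
  assumes A: "psd d A" and c: "0 \<le> c"
  shows "mat_powr (complex_of_real c \<cdot>\<^sub>m A) p = complex_of_real (c powr p) \<cdot>\<^sub>m mat_powr A p"
proof -
  obtain U e where dec: "A \<in> carrier_mat d d" "is_eig_decomp A U e" and e: "\<And>k. k < d \<Longrightarrow> 0 \<le> e k"
    using psd_obtain_eig[OF A] by metis
  have cA: "complex_of_real c \<cdot>\<^sub>m A \<in> carrier_mat d d" using dec by simp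
  note 1 = mat_fun_carrier_decomp[OF dec, of "\<lambda>t. t powr p"]
  note 2 = mat_fun_carrier_decomp[OF cA is_eig_decomp_smult[OF dec], of "\<lambda>t. t powr p"]
  have 3: "complex_of_real (c powr p) \<cdot>\<^sub>m mat_fun (\<lambda>t. t powr p) A \<in> carrier_mat d d" using 1 by simp
  show ?thesis unfolding mat_powr_def mat_eq_iff_index[OF 2(1) 3]
  proof (intro allI impI)
    fix i j assume ij: "i < d" "j < d"
    have "mat_fun (\<lambda>t. t powr p) (complex_of_real c \<cdot>\<^sub>m A) $$ (i, j) =
        (\<Sum>k<d. complex_of_real (c powr p) * (U $$ (i, k) * of_real (e k powr p) * cnj (U $$ (j, k))))"
      unfolding is_eig_decompD(4)[OF 2 ij] by (intro sum.cong refl) (simp add: powr_mult c e)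
    also have "\<dots> = (complex_of_real (c powr p) \<cdot>\<^sub>m mat_fun (\<lambda>t. t powr p) A) $$ (i, j)"
      using 1(1) ij is_eig_decompD(4)[OF 1 ij] by (simp add: sum_distrib_left)
    finally show "mat_fun (\<lambda>t. t powr p) (complex_of_real c \<cdot>\<^sub>m A) $$ (i, j) =
      (complex_of_real (c powr p) \<cdot>\<^sub>m mat_fun (\<lambda>t. t powr p) A) $$ (i, j)" .
  qed
qed

lemma mat_powr_one: "psd d A \<Longrightarrow> mat_powr A 1 = A"
proof -
  assume p: "psd d A"
  obtain U e where A: "A \<in> carrier_mat d d" "is_eig_decomp A U e" and e: "\<And>k. k < d \<Longrightarrow> 0 \<le> e k"
    using psd_obtain_eig[OF p] by metis
  show ?thesis unfolding mat_powr_def using mat_fun_cong[OF A, of "\<lambda>t. t powr 1" "\<lambda>t. t"] e mat_fun_ident[OF A]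
    by simp
qed

text \<open>Adds the endpoint \<open>s = 1\<close> to Audenaert's inequality. There the test is the
  support projection of \<open>A\<close>, which makes no error on \<open>A\<close> and has exactly
  the claimed weight on \<open>B\<close>.\<close>

lemma exists_test_le_trace_powr:
  assumes A: "psd d A" and B: "psd d B" and s: "0 < s" "s \<le> 1"
  shows "\<exists>T. psd d T \<and> psd d (1\<^sub>m d - T) \<and>
    Re (mat_trace ((1\<^sub>m d - T) * A)) + Re (mat_trace (T * B))
      \<le> Re (mat_trace (mat_powr A (1 - s) * mat_powr B s))"
proof (cases "s = 1")
  case True
  obtain U e where dec: "A \<in> carrier_mat d d" "is_eig_decomp A U e" and e: "\<And>k. k < d \<Longrightarrow> 0 \<le> e k"
    using psd_obtain_eig[OF A] by metis
  define T where "T = mat_powr A 0"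
  have T: "psd d T" unfolding T_def by (rule psd_mat_powr[OF A])
  have "psd d (1\<^sub>m d - T)"
  proof (intro psd_minusI hermitian_one psdD T)
    fix v
    have "(\<Sum>k<d. e k powr 0 * (cmod (eig_coef d U v k))\<^sup>2) \<le> (\<Sum>k<d. (cmod (eig_coef d U v k))\<^sup>2)"
      by (intro sum_mono) auto
    thus "Re (qform d T v) \<le> Re (qform d (1\<^sub>m d) v)"
      unfolding T_def mat_powr_def qform_mat_fun[OF dec] qform_one sum_eig_coef[OF dec, of v] by simp
  qed
  moreover have "mat_trace ((1\<^sub>m d - T) * A) = 0"
  proof -
    have "mat_trace (T * A) = mat_trace A"
      using trace_powr_split[OF A, of 1] by (simp add: T_def mat_powr_one[OF A])
    thus ?thesis using psdD(1)[OF T] dec(1) by (simp add: trace_mult_minus_left[of _ d])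
  qed
  ultimately show ?thesis using T True mat_powr_one[OF B] by (intro exI[of _ T]) (simp add: T_def)
next
  case False
  thus ?thesis using audenaert_test[OF A B, of s] s by simp
qed

section \<open>The random coding exponent\<close>

lemma finite_seqs [simp]: "finite (seqs n :: 'x::finite list set)"
  using finite_lists_length_eq[of "UNIV :: 'x set" n] by (simp add: seqs_def)

lemma seqs_Suc: "seqs (Suc n) = (\<lambda>(x, xs). x # xs) ` (UNIV \<times> seqs n)"
  by (auto simp: seqs_def length_Suc_conv image_iff)

lemma sum_prod_seqs:
  fixes g :: "nat \<Rightarrow> 'x::finite \<Rightarrow> 'a::comm_semiring_1"
  shows "(\<Sum>xs\<in>seqs n. \<Prod>k<n. g k (xs ! k)) = (\<Prod>k<n. \<Sum>x\<in>UNIV. g k x)"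
proof (induction n arbitrary: g)
  case 0
  have "(seqs 0 :: 'x list set) = {[]}" by (auto simp: seqs_def)
  thus ?case by simp
next
  case (Suc n)
  have "(\<Sum>xs\<in>seqs (Suc n). \<Prod>k<Suc n. g k (xs ! k)) =
      (\<Sum>(x, xs)\<in>UNIV \<times> seqs n. g 0 x * (\<Prod>k<n. g (Suc k) (xs ! k)))"
    unfolding seqs_Suc
    by (subst sum.reindex) (auto simp: inj_on_def prod.lessThan_Suc_shift simp del: prod.lessThan_Suc intro!: sum.cong)
  also have "\<dots> = (\<Sum>x\<in>UNIV. g 0 x) * (\<Prod>k<n. \<Sum>x\<in>UNIV. g (Suc k) x)"
    by (simp add: sum.cartesian_product[symmetric] sum_distrib_left[symmetric] sum_distrib_right
        Suc.IH[of "\<lambda>k. g (Suc k)"])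
  finally show ?case by (simp add: prod.lessThan_Suc_shift del: prod.lessThan_Suc)
qed

lemma type_seqsD:
  assumes "xs \<in> type_seqs n Q"
  shows "length xs = n" "xs \<in> seqs n" "real (count_list xs x) = real n * Q x"
  using assms by (auto simp: type_seqs_def seqs_def)

lemma sum_type_seqs:
  fixes h :: "'x::finite \<Rightarrow> real"
  assumes "xs \<in> type_seqs n Q"
  shows "(\<Sum>k<n. h (xs ! k)) = real n * (\<Sum>x\<in>UNIV. Q x * h x)"
proof -
  have "(\<Sum>k<length xs. h (xs ! k)) = (\<Sum>x\<in>UNIV. real (count_list xs x) * h x)"
  proof (induction xs)
    case (Cons a xs)
    have "(\<Sum>x\<in>UNIV. real (count_list (a # xs) x) * h x) =
        (\<Sum>x\<in>UNIV. (if a = x then h x else 0) + real (count_list xs x) * h x)"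
      by (intro sum.cong) (auto simp: algebra_simps)
    thus ?case using Cons by (simp add: sum.lessThan_Suc_shift sum.distrib del: sum.lessThan_Suc)
  qed simp
  thus ?thesis using type_seqsD[OF assms] by (simp add: sum_distrib_left mult.assoc)
qed

lemma types_nonneg: "Q \<in> types n \<Longrightarrow> 0 \<le> Q x"
  by (simp add: types_def)

lemma type_seqs_pos:
  assumes "xs \<in> type_seqs n Q" "Q \<in> types n" "k < n"
  shows "0 < Q (xs ! k)"
proof -
  have "count_list xs (xs ! k) \<noteq> 0" using assms(3) type_seqsD(1)[OF assms(1)] by (simp add: count_list_0_iff)
  hence "real n * Q (xs ! k) \<noteq> 0" using type_seqsD(3)[OF assms(1)] by (metis of_nat_eq_0_iff)
  thus ?thesis using types_nonneg[OF assms(2), of "xs ! k"] by auto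
qed

lemma prod_type_seqs:
  fixes t :: "'x::finite \<Rightarrow> real"
  assumes xs: "xs \<in> type_seqs n Q" and Q: "Q \<in> types n" and t: "\<And>x. 0 < Q x \<Longrightarrow> 0 < t x"
  shows "(\<Prod>k<n. t (xs ! k)) = 2 powr (real n * (\<Sum>x\<in>UNIV. Q x * log 2 (t x)))"
proof -
  have "(\<Prod>k<n. t (xs ! k)) = (\<Prod>k<n. 2 powr log 2 (t (xs ! k)))"
    using t type_seqs_pos[OF xs Q] by (intro prod.cong refl) (simp add: powr_log_cancel)
  also have "\<dots> = 2 powr (\<Sum>k<n. log 2 (t (xs ! k)))" by (simp add: powr_sum)
  finally show ?thesis unfolding sum_type_seqs[OF xs, of "\<lambda>x. log 2 (t x)"] .
qed

lemma prod_type_seqs_self: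
  assumes "xs \<in> type_seqs n Q" "Q \<in> types n"
  shows "(\<Prod>k<n. Q (xs ! k)) = 2 powr (- real n * shannon_entropy Q)"
  using prod_type_seqs[OF assms, of Q] by (simp add: shannon_entropy_def)

lemma mat_trace_smult: "A \<in> carrier_mat d d \<Longrightarrow> mat_trace (c \<cdot>\<^sub>m A) = c * mat_trace A"
  by (simp add: mat_trace_def sum_distrib_left)

lemma is_povm_le_one:
  assumes "is_povm d I P" "finite I" "x \<in> I"
  shows "psd d (P x)" "psd d (1\<^sub>m d - P x)"
proof -
  show p: "psd d (P x)" using assms unfolding is_povm_def by blast
  show "psd d (1\<^sub>m d - P x)"
  proof (intro psd_minusI hermitian_one psdD p)
    fix v
    have "Re (qform d (P x) v) \<le> (\<Sum>y\<in>I. Re (qform d (P y) v))"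
      using assms unfolding is_povm_def psd_iff_qform by (intro member_le_sum) auto
    also have "\<dots> = Re (qform d (msum d P I) v)" by (simp add: qform_msum)
    finally show "Re (qform d (P x) v) \<le> Re (qform d (1\<^sub>m d) v)"
      using assms unfolding is_povm_def by simp
  qed
qed

lemma messages_nonempty: "0 < nat \<lceil>2 powr (real n * R)\<rceil>"
  by simp

section \<open>Product states and error probabilities\<close>

locale state_family =
  fixes d :: nat and \<rho> :: "'x::finite \<Rightarrow> complex mat"
  assumes density: "\<And>x. \<rho> x \<in> density_ops d"
begin

lemma psd_rho: "psd d (\<rho> x)" and trace_rho: "mat_trace (\<rho> x) = 1"
  using density[of x] by (auto simp: density_ops_def)

lemma psd_seq_state: "xs \<in> seqs n \<Longrightarrow> psd (d ^ n) (seq_state \<rho> xs)"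
  using psd_tensor_list[of "map \<rho> xs" d] psd_rho by (auto simp: seq_state_def seqs_def)

lemma trace_seq_state: "xs \<in> seqs n \<Longrightarrow> mat_trace (seq_state \<rho> xs) = 1"
  using trace_tensor_list[of "map \<rho> xs" d] psdD(1)[OF psd_rho]
  by (auto simp: seq_state_def seqs_def trace_rho)

lemma psd_avg_state:
  assumes "\<And>x. 0 \<le> Q x"
  shows "psd d (avg_state d \<rho> Q)"
  unfolding avg_state_def by (intro psd_msum psd_smult psd_rho assms)

text \<open>Distributes the tensor power over the average, so that sequences appear with their
  probability under independent letters drawn from \<open>Q\<close>.\<close>

lemma tensor_avg_state:
  "tensor_list (replicate n (avg_state d \<rho> Q)) =
    msum (d ^ n) (\<lambda>xs. of_real (\<Prod>k<n. Q (xs ! k)) \<cdot>\<^sub>m seq_state \<rho> xs) (seqs n)"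
proof (rule eq_matI)
  have avg: "avg_state d \<rho> Q \<in> carrier_mat d d" unfolding avg_state_def by (rule msum_carrier)
  have c: "tensor_list (replicate n (avg_state d \<rho> Q)) \<in> carrier_mat (d ^ n) (d ^ n)"
    using tensor_list_carrier[of "replicate n (avg_state d \<rho> Q)" d] avg by simp
  fix i j
  assume "i < dim_row (msum (d ^ n) (\<lambda>xs. of_real (\<Prod>k<n. Q (xs ! k)) \<cdot>\<^sub>m seq_state \<rho> xs) (seqs n))"
    "j < dim_col (msum (d ^ n) (\<lambda>xs. of_real (\<Prod>k<n. Q (xs ! k)) \<cdot>\<^sub>m seq_state \<rho> xs) (seqs n))"
  hence ij: "i < d ^ n" "j < d ^ n" by (auto simp: msum_def)
  have dl: "dig d n i k < d" "dig d n j k < d" if "k < n" for k using dig_less ij that by auto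
  have "tensor_list (replicate n (avg_state d \<rho> Q)) $$ (i, j) =
      (\<Prod>k<n. (avg_state d \<rho> Q) $$ (dig d n i k, dig d n j k))"
    using tensor_list_index[of "replicate n (avg_state d \<rho> Q)" d i j] avg ij by simp
  also have "\<dots> = (\<Prod>k<n. \<Sum>x\<in>UNIV. of_real (Q x) * \<rho> x $$ (dig d n i k, dig d n j k))"
    using dl carrier_matD[OF psdD(1)[OF psd_rho]]
    by (intro prod.cong refl) (auto simp: avg_state_def msum_def intro!: sum.cong)
  also have "\<dots> = (\<Sum>xs\<in>seqs n. \<Prod>k<n. of_real (Q (xs ! k)) * \<rho> (xs ! k) $$ (dig d n i k, dig d n j k))"
    by (rule sum_prod_seqs[symmetric])
  also have "\<dots> = (\<Sum>xs\<in>seqs n. (of_real (\<Prod>k<n. Q (xs ! k)) \<cdot>\<^sub>m seq_state \<rho> xs) $$ (i, j))"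
  proof (intro sum.cong refl)
    fix xs :: "'x list" assume xs: "xs \<in> seqs n"
    hence len: "length xs = n" by (simp add: seqs_def)
    have "seq_state \<rho> xs $$ (i, j) = (\<Prod>k<n. \<rho> (xs ! k) $$ (dig d n i k, dig d n j k))"
      unfolding seq_state_def using tensor_list_index[of "map \<rho> xs" d i j] psdD(1)[OF psd_rho] ij len by auto
    thus "(\<Prod>k<n. of_real (Q (xs ! k)) * \<rho> (xs ! k) $$ (dig d n i k, dig d n j k)) =
        (of_real (\<Prod>k<n. Q (xs ! k)) \<cdot>\<^sub>m seq_state \<rho> xs) $$ (i, j)"
      using psdD(1)[OF psd_seq_state[OF xs]] ij by (simp add: prod.distrib)
  qed
  finally show "tensor_list (replicate n (avg_state d \<rho> Q)) $$ (i, j) =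
      msum (d ^ n) (\<lambda>xs. of_real (\<Prod>k<n. Q (xs ! k)) \<cdot>\<^sub>m seq_state \<rho> xs) (seqs n) $$ (i, j)"
    using ij by (simp add: msum_def)
next
  have "avg_state d \<rho> Q \<in> carrier_mat d d" unfolding avg_state_def by (rule msum_carrier)
  hence "tensor_list (replicate n (avg_state d \<rho> Q)) \<in> carrier_mat (d ^ n) (d ^ n)"
    using tensor_list_carrier[of "replicate n (avg_state d \<rho> Q)" d] by simp
  thus "dim_row (tensor_list (replicate n (avg_state d \<rho> Q))) =
      dim_row (msum (d ^ n) (\<lambda>xs. of_real (\<Prod>k<n. Q (xs ! k)) \<cdot>\<^sub>m seq_state \<rho> xs) (seqs n))"
    "dim_col (tensor_list (replicate n (avg_state d \<rho> Q))) =
      dim_col (msum (d ^ n) (\<lambda>xs. of_real (\<Prod>k<n. Q (xs ! k)) \<cdot>\<^sub>m seq_state \<rho> xs) (seqs n))"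
    by (auto simp: msum_def)
qed

text \<open>All sequences of type \<open>Q\<close> carry the same weight, 2 to the power -nH(Q), in
  the expansion of the tensor power, and discarding the other sequences only lowers the trace
  against a positive \<open>X\<close>. The size of the type class does not enter, hence no
  polynomial factor is lost.\<close>

lemma sum_trace_type_seqs_le:
  assumes Q: "Q \<in> types n" and X: "psd (d ^ n) X"
  shows "(\<Sum>xs\<in>type_seqs n Q. Re (mat_trace (X * seq_state \<rho> xs))) \<le>
    2 powr (real n * shannon_entropy Q) * Re (mat_trace (X * tensor_list (replicate n (avg_state d \<rho> Q))))"
proof -
  note Xc = psdD(1)[OF X]
  let ?w = "\<lambda>xs. \<Prod>k<n. Q (xs ! k)"
  let ?b = "\<lambda>xs. Re (mat_trace (X * seq_state \<rho> xs))"
  have sub: "type_seqs n Q \<subseteq> seqs n" by (auto simp: type_seqs_def)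
  have b: "0 \<le> ?b xs" if "xs \<in> seqs n" for xs
    by (rule trace_psd_mult_nonneg[OF X psd_seq_state[OF that]])
  have "mat_trace (X * tensor_list (replicate n (avg_state d \<rho> Q))) =
      (\<Sum>xs\<in>seqs n. mat_trace (X * (of_real (?w xs) \<cdot>\<^sub>m seq_state \<rho> xs)))"
    unfolding tensor_avg_state
    by (rule trace_mult_msum_right[OF Xc]) (use psdD(1)[OF psd_seq_state] in auto)
  also have "\<dots> = (\<Sum>xs\<in>seqs n. of_real (?w xs) * mat_trace (X * seq_state \<rho> xs))"
    by (intro sum.cong refl trace_mult_smult_right[OF Xc] psdD(1)[OF psd_seq_state])
  finally have "Re (mat_trace (X * tensor_list (replicate n (avg_state d \<rho> Q)))) = (\<Sum>xs\<in>seqs n. ?w xs * ?b xs)"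
    by (simp del: of_real_prod)
  also have "\<dots> \<ge> (\<Sum>xs\<in>type_seqs n Q. ?w xs * ?b xs)"
    using sub b types_nonneg[OF Q] by (intro sum_mono2) (auto intro!: mult_nonneg_nonneg prod_nonneg)
  also have "(\<Sum>xs\<in>type_seqs n Q. ?w xs * ?b xs) = 2 powr (- real n * shannon_entropy Q) * (\<Sum>xs\<in>type_seqs n Q. ?b xs)"
    by (simp add: sum_distrib_left prod_type_seqs_self[OF _ Q])
  finally have "2 powr (real n * shannon_entropy Q) * (2 powr (- real n * shannon_entropy Q) * (\<Sum>xs\<in>type_seqs n Q. ?b xs))
      \<le> 2 powr (real n * shannon_entropy Q) * Re (mat_trace (X * tensor_list (replicate n (avg_state d \<rho> Q))))"
    by (intro mult_left_mono) auto
  thus ?thesis by (simp add: mult.assoc[symmetric] powr_add[symmetric])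
qed

lemma trace_povm_seq_state:
  assumes "is_povm (d ^ n) (seqs n) P" "xs \<in> seqs n"
  shows "0 \<le> Re (mat_trace (P xs * seq_state \<rho> xs))" "Re (mat_trace (P xs * seq_state \<rho> xs)) \<le> 1"
    "Re (mat_trace ((1\<^sub>m (d ^ n) - P xs) * seq_state \<rho> xs)) = 1 - Re (mat_trace (P xs * seq_state \<rho> xs))"
proof -
  note p = is_povm_le_one[OF assms(1) finite_seqs assms(2)]
  note s = psd_seq_state[OF assms(2)]
  show "0 \<le> Re (mat_trace (P xs * seq_state \<rho> xs))" by (rule trace_psd_mult_nonneg[OF p(1) s])
  show eq: "Re (mat_trace ((1\<^sub>m (d ^ n) - P xs) * seq_state \<rho> xs)) = 1 - Re (mat_trace (P xs * seq_state \<rho> xs))"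
    using psdD(1)[OF p(1)] psdD(1)[OF s] trace_seq_state[OF assms(2)]
    by (simp add: trace_mult_minus_left[of _ "d ^ n"])
  show "Re (mat_trace (P xs * seq_state \<rho> xs)) \<le> 1"
    using trace_psd_mult_nonneg[OF p(2) s] eq by simp
qed

lemma err_prob_eq:
  assumes c: "(enc, P) \<in> source_codes d n R" and T: "type_seqs n Q \<noteq> {}"
  shows "err_prob \<rho> n Q (enc, P) = (\<Sum>xs\<in>type_seqs n Q.
    Re (mat_trace ((1\<^sub>m (d ^ n) - P (enc xs) xs) * seq_state \<rho> xs))) / real (card (type_seqs n Q))"
proof -
  have sub: "type_seqs n Q \<subseteq> seqs n" by (auto simp: type_seqs_def)
  hence fin: "finite (type_seqs n Q)" using finite_subset finite_seqs by blast
  have "(\<Sum>xs\<in>type_seqs n Q. Re (mat_trace ((1\<^sub>m (d ^ n) - P (enc xs) xs) * seq_state \<rho> xs))) =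
      (\<Sum>xs\<in>type_seqs n Q. 1 - Re (mat_trace (P (enc xs) xs * seq_state \<rho> xs)))"
    using c sub by (intro sum.cong refl trace_povm_seq_state(3)) (auto simp: source_codes_def)
  also have "\<dots> = real (card (type_seqs n Q)) - (\<Sum>xs\<in>type_seqs n Q. Re (mat_trace (P (enc xs) xs * seq_state \<rho> xs)))"
    by (simp add: sum_subtractf)
  finally show ?thesis using T fin by (simp add: err_prob_def diff_divide_distrib)
qed

lemma err_prob_nonneg:
  assumes c: "c \<in> source_codes d n R" and T: "type_seqs n Q \<noteq> {}"
  shows "0 \<le> err_prob \<rho> n Q c"
proof -
  obtain enc P where eq: "c = (enc, P)" by force
  have sub: "type_seqs n Q \<subseteq> seqs n" by (auto simp: type_seqs_def)
  have "0 \<le> Re (mat_trace ((1\<^sub>m (d ^ n) - P (enc xs) xs) * seq_state \<rho> xs))" if "xs \<in> type_seqs n Q" for xs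
  proof -
    have "is_povm (d ^ n) (seqs n) (P (enc xs))" "xs \<in> seqs n"
      using c sub that unfolding eq source_codes_def by auto
    thus ?thesis using trace_povm_seq_state[of n "P (enc xs)" xs] by simp
  qed
  thus ?thesis unfolding eq err_prob_eq[OF c[unfolded eq] T] by (intro divide_nonneg_nonneg sum_nonneg) auto
qed

text \<open>A bin contains on average a fraction 1/M of the type class, so the interference that a
  sequence meets is at most \<open>B\<close>. Testing its state against \<open>B\<close> costs the
  trace \<open>t xs\<close>, in which the factor in front of the tensor power, raised to the power
  \<open>s\<close>, accounts for the term s (H - R).\<close>

lemma exists_code_le:
  assumes Q: "Q \<in> types n" and T: "type_seqs n Q \<noteq> {}" and s: "0 < s" "s \<le> 1" and \<epsilon>: "0 < \<epsilon>"
  defines "\<sigma> \<equiv> avg_state d \<rho> Q"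
  shows "\<exists>c\<in>source_codes d n R. \<exists>xs\<in>type_seqs n Q. err_prob \<rho> n Q c \<le>
    (2 powr (real n * (shannon_entropy Q - R))) powr s *
    (\<Prod>k<n. Re (mat_trace (mat_powr (\<rho> (xs ! k)) (1 - s) * mat_powr \<sigma> s))) + \<epsilon>"
proof -
  define M where "M = nat \<lceil>2 powr (real n * R)\<rceil>"
  define T where "T = type_seqs n Q"
  define D where "D = d ^ n"
  define H where "H = shannon_entropy Q"
  \<comment> \<open>Domination factor of the type class by the tensor power, divided among the
    \<open>M\<close> bins.\<close>
  define \<gamma> where "\<gamma> = 2 powr (real n * H) / real M"
  define \<sigma>n where "\<sigma>n = tensor_list (replicate n \<sigma>)"
  define B where "B = complex_of_real \<gamma> \<cdot>\<^sub>m \<sigma>n"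
  define t where "t xs = Re (mat_trace (mat_powr (seq_state \<rho> xs) (1 - s) * mat_powr B s))" for xs
  have M: "0 < M" "2 powr (real n * R) \<le> real M" unfolding M_def using messages_nonempty by (auto simp: le_nat_iff)
  have \<gamma>: "0 < \<gamma>" using M by (simp add: \<gamma>_def)
  have sub: "T \<subseteq> seqs n" by (auto simp: type_seqs_def T_def)
  hence fin: "finite T" using finite_subset finite_seqs by blast
  have psd\<sigma>: "psd d \<sigma>" unfolding \<sigma>_def using psd_avg_state types_nonneg[OF Q] by blast
  have psd\<sigma>n: "psd D \<sigma>n" unfolding \<sigma>n_def D_def using psd_tensor_list[of "replicate n \<sigma>" d] psd\<sigma> by simp
  have psdB: "psd D B" unfolding B_def using psd_smult[OF psd\<sigma>n] \<gamma> by simp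
  have psdS: "psd D (seq_state \<rho> xs)" if "xs \<in> T" for xs unfolding D_def using psd_seq_state sub that by blast
  have "\<forall>xs\<in>T. \<exists>E. psd D E \<and> psd D (1\<^sub>m D - E) \<and>
      Re (mat_trace ((1\<^sub>m D - E) * seq_state \<rho> xs)) + Re (mat_trace (E * B)) \<le> t xs"
    unfolding t_def using exists_test_le_trace_powr[OF psdS psdB s] by blast
  from bchoice[OF this] obtain E where "\<forall>xs\<in>T. psd D (E xs) \<and> psd D (1\<^sub>m D - E xs) \<and>
      Re (mat_trace ((1\<^sub>m D - E xs) * seq_state \<rho> xs)) + Re (mat_trace (E xs * B)) \<le> t xs" ..
  hence E: "\<And>xs. xs \<in> T \<Longrightarrow> psd D (E xs)" "\<And>xs. xs \<in> T \<Longrightarrow> psd D (1\<^sub>m D - E xs)"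
    and Et: "\<And>xs. xs \<in> T \<Longrightarrow> Re (mat_trace ((1\<^sub>m D - E xs) * seq_state \<rho> xs)) + Re (mat_trace (E xs * B)) \<le> t xs"
    by blast+
  define c where "c xs ys = Re (mat_trace (E xs * seq_state \<rho> ys))" for xs ys
  obtain f where f: "\<And>x. f x < M" and fle: "(\<Sum>x\<in>T. \<Sum>y\<in>T - {x}. if f y = f x then c x y else 0)
    \<le> (\<Sum>x\<in>T. \<Sum>y\<in>T - {x}. c x y) / real M"
    using greedy_binning[OF fin M(1), of c] by blast
  have "seqs n \<noteq> ({} :: 'x list set)" using sub assms(2) by (auto simp: T_def)
  from one_shot_source_code[OF finite_seqs this sub psdS E \<epsilon>, where f = f]
  obtain P where Pz: "\<forall>z. is_povm D (seqs n) (P z) \<and> (\<forall>xs\<in>T. f xs = z \<longrightarrow>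
      Re (mat_trace ((1\<^sub>m D - P z xs) * seq_state \<rho> xs)) \<le> Re (mat_trace ((1\<^sub>m D - E xs) * seq_state \<rho> xs)) +
      (\<Sum>y\<in>T - {xs}. if f y = f xs then Re (mat_trace (E xs * seq_state \<rho> y)) else 0) + \<epsilon>)" ..
  hence P: "is_povm D (seqs n) (P z)" for z by blast
  have Pe: "Re (mat_trace ((1\<^sub>m D - P (f xs) xs) * seq_state \<rho> xs)) \<le> Re (mat_trace ((1\<^sub>m D - E xs) * seq_state \<rho> xs)) +
      (\<Sum>y\<in>T - {xs}. if f y = f xs then c xs y else 0) + \<epsilon>" if "xs \<in> T" for xs
    using Pz that unfolding c_def by blast
  have code: "(f, P) \<in> source_codes d n R"
    using f P by (auto simp: source_codes_def messages_def M_def D_def)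
  have cM: "(\<Sum>y\<in>T - {x}. c x y) / real M \<le> Re (mat_trace (E x * B))" if x: "x \<in> T" for x
  proof -
    have "(\<Sum>y\<in>T - {x}. c x y) \<le> (\<Sum>y\<in>T. c x y)"
      using fin by (intro sum_mono2) (auto simp: c_def intro!: trace_psd_mult_nonneg E psdS x)
    also have "\<dots> \<le> 2 powr (real n * H) * Re (mat_trace (E x * \<sigma>n))"
      unfolding c_def T_def H_def \<sigma>n_def \<sigma>_def
      by (rule sum_trace_type_seqs_le[OF Q]) (use E(1)[OF x] in \<open>simp add: D_def\<close>)
    finally have "(\<Sum>y\<in>T - {x}. c x y) / real M \<le> \<gamma> * Re (mat_trace (E x * \<sigma>n))"
      unfolding \<gamma>_def using M(1) by (simp add: divide_right_mono)
    also have "\<dots> = Re (mat_trace (E x * B))"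
      unfolding B_def trace_mult_smult_right[OF psdD(1)[OF E(1)[OF x]] psdD(1)[OF psd\<sigma>n]] by simp
    finally show ?thesis .
  qed
  have "(\<Sum>xs\<in>T. Re (mat_trace ((1\<^sub>m D - P (f xs) xs) * seq_state \<rho> xs))) \<le>
      (\<Sum>xs\<in>T. Re (mat_trace ((1\<^sub>m D - E xs) * seq_state \<rho> xs)) +
        (\<Sum>y\<in>T - {xs}. if f y = f xs then c xs y else 0) + \<epsilon>)"
    by (intro sum_mono Pe)
  also have "\<dots> \<le> (\<Sum>xs\<in>T. Re (mat_trace ((1\<^sub>m D - E xs) * seq_state \<rho> xs)) +
        (\<Sum>y\<in>T - {xs}. c xs y) / real M + \<epsilon>)"
    using fle by (simp add: sum.distrib sum_divide_distrib)
  also have "\<dots> \<le> (\<Sum>xs\<in>T. t xs + \<epsilon>)"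
    using cM Et by (intro sum_mono) (smt (verit))
  finally have le: "(\<Sum>xs\<in>T. Re (mat_trace ((1\<^sub>m D - P (f xs) xs) * seq_state \<rho> xs))) \<le> (\<Sum>xs\<in>T. t xs + \<epsilon>)" .
  \<comment> \<open>The average over the class is bounded by its largest term. Nothing is lost,
    because the product over the letters depends only on the type.\<close>
  obtain xs where xs: "xs \<in> T" "\<And>ys. ys \<in> T \<Longrightarrow> t ys \<le> t xs"
  proof -
    have "Max (t ` T) \<in> t ` T" using fin assms(2) by (intro Max_in) (auto simp: T_def)
    then obtain xs where "xs \<in> T" "t xs = Max (t ` T)" by auto
    thus thesis using that Max_ge[of "t ` T"] fin by simp
  qed
  have card: "0 < real (card T)" using fin assms(2) by (simp add: T_def card_gt_0_iff)
  have "err_prob \<rho> n Q (f, P) \<le> (\<Sum>xs\<in>T. t xs + \<epsilon>) / real (card T)"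
    unfolding err_prob_eq[OF code assms(2)] using le by (simp add: T_def D_def divide_right_mono)
  also have "\<dots> \<le> (\<Sum>ys\<in>T. t xs + \<epsilon>) / real (card T)"
    using xs card by (intro divide_right_mono sum_mono) auto
  also have "\<dots> = t xs + \<epsilon>" using card by simp
  also have "t xs \<le> (2 powr (real n * (H - R))) powr s *
    (\<Prod>k<n. Re (mat_trace (mat_powr (\<rho> (xs ! k)) (1 - s) * mat_powr \<sigma> s)))"
  proof -
    have len: "length xs = n" using xs(1) type_seqsD(1) by (auto simp: T_def)
    have S: "psd D (seq_state \<rho> xs)" by (rule psdS[OF xs(1)])
    have "t xs = \<gamma> powr s * Re (mat_trace (mat_powr (seq_state \<rho> xs) (1 - s) * mat_powr \<sigma>n s))"
      unfolding t_def B_def mat_powr_smult[OF psd\<sigma>n less_imp_le[OF \<gamma>]]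
        trace_mult_smult_right[OF psdD(1)[OF psd_mat_powr[OF S]] psdD(1)[OF psd_mat_powr[OF psd\<sigma>n]]] by simp
    also have "Re (mat_trace (mat_powr (seq_state \<rho> xs) (1 - s) * mat_powr \<sigma>n s)) =
        (\<Prod>k<n. Re (mat_trace (mat_powr (\<rho> (xs ! k)) (1 - s) * mat_powr \<sigma> s)))"
      unfolding seq_state_def \<sigma>n_def
      using trace_mat_powr_tensor_list[of "map \<rho> xs" d "replicate n \<sigma>" n] psd_rho psd\<sigma> len by auto
    also have "\<gamma> powr s * \<dots> \<le> (2 powr (real n * (H - R))) powr s * \<dots>"
    proof (intro mult_right_mono powr_mono2 prod_nonneg)
      have "\<gamma> \<le> 2 powr (real n * H) / 2 powr (real n * R)"
        unfolding \<gamma>_def using M by (intro divide_left_mono) auto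
      thus "\<gamma> \<le> 2 powr (real n * (H - R))" by (simp add: powr_diff[symmetric] algebra_simps)
      show "0 \<le> Re (mat_trace (mat_powr (\<rho> (xs ! k)) (1 - s) * mat_powr \<sigma> s))" for k
        by (intro trace_psd_mult_nonneg[of d] psd_mat_powr psd_rho psd\<sigma>)
    qed (use s \<gamma> in auto)
    finally show ?thesis .
  qed
  finally show ?thesis using code xs(1) unfolding T_def H_def by (intro bexI[of _ "(f, P)"] bexI[of _ xs]) auto
qed

end

section \<open>The size of a type class\<close>

lemma fact_mult_power_le: "fact m * m ^ j \<le> (fact j * m ^ m :: nat)"
proof (cases "j \<le> m")
  \<comment> \<open>As a function of \<open>j\<close>, the quotient m^j / j! increases up to
    \<open>j = m\<close> and decreases afterwards; the two cases walk towards the maximum from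
    either side.\<close>
  case True
  thus ?thesis
  proof (induction "m - j" arbitrary: j)
    case (Suc l)
    hence "fact m * m ^ Suc j \<le> fact (Suc j) * m ^ m" by (intro Suc.hyps(1)) auto
    hence "m * (fact m * m ^ j) \<le> Suc j * (fact j * m ^ m)" by (simp add: algebra_simps)
    also have "\<dots> \<le> m * (fact j * m ^ m)" using Suc by (intro mult_right_mono) auto
    finally show ?case using Suc by simp
  qed simp
next
  case False
  hence "m \<le> j" by simp
  thus ?thesis
  proof (induction j rule: dec_induct)
    case (step j)
    have "fact m * m ^ Suc j = m * (fact m * m ^ j)" by simp
    also have "\<dots> \<le> m * (fact j * m ^ m)" by (intro mult_left_mono step.IH) auto
    also have "\<dots> \<le> Suc j * (fact j * m ^ m)" using step by (intro mult_right_mono) auto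
    finally show ?case by (simp add: algebra_simps)
  qed simp
qed

text \<open>The term \<open>j = m\<close> is the largest of the a + m + 1 terms in the binomial
  expansion of (m + a)^(m + a).\<close>

lemma binomial_max_term:
  "(a + m) ^ (a + m) * fact m * fact a \<le> (a + m + 1) * (fact (a + m) * (m ^ m * a ^ a) :: nat)"
proof -
  let ?N = "a + m"
  have tm: "(?N choose j) * m ^ j * a ^ (?N - j) * (fact m * fact a) \<le> fact ?N * (m ^ m * a ^ a)"
    if j: "j \<le> ?N" for j
  proof -
    have "(fact j * fact (?N - j)) * ((?N choose j) * m ^ j * a ^ (?N - j) * (fact m * fact a)) =
        fact ?N * ((fact m * m ^ j) * (fact a * a ^ (?N - j)))"
      using binomial_fact_lemma[OF j] by (simp add: algebra_simps)
    also have "\<dots> \<le> fact ?N * ((fact j * m ^ m) * (fact (?N - j) * a ^ a))"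
      by (intro mult_left_mono mult_mono fact_mult_power_le) auto
    finally have "(fact j * fact (?N - j)) * ((?N choose j) * m ^ j * a ^ (?N - j) * (fact m * fact a)) \<le>
        (fact j * fact (?N - j)) * (fact ?N * (m ^ m * a ^ a))" by (simp add: mult_ac)
    thus ?thesis by (subst (asm) mult_le_cancel1) auto
  qed
  have "?N ^ ?N * fact m * fact a = (\<Sum>j\<le>?N. (?N choose j) * m ^ j * a ^ (?N - j) * (fact m * fact a))"
    using binomial[of m a ?N] by (simp add: sum_distrib_right add.commute mult.assoc)
  also have "\<dots> \<le> (\<Sum>j\<le>?N. fact ?N * (m ^ m * a ^ a))" by (intro sum_mono tm) simp
  finally show ?thesis by simp
qed

text \<open>Letters are split off one at a time by the binomial bound. Each split costs a factor of
  at most the total count plus one, and a single letter costs nothing, whence the exponent.\<close>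

lemma multinomial_lower_bound:
  fixes c :: "'x \<Rightarrow> nat"
  assumes "finite A" "A \<noteq> {}"
  shows "(\<Sum>x\<in>A. c x) ^ (\<Sum>x\<in>A. c x) * (\<Prod>x\<in>A. fact (c x)) \<le>
    fact (\<Sum>x\<in>A. c x) * (\<Prod>x\<in>A. c x ^ c x) * ((\<Sum>x\<in>A. c x) + 1) ^ (card A - 1)"
  using assms
proof (induction A rule: finite_ne_induct)
  case (insert x A)
  define a where "a = (\<Sum>x\<in>A. c x)"
  define m where "m = c x"
  define p q where "p = (\<Prod>x\<in>A. fact (c x) :: nat)" and "q = (\<Prod>x\<in>A. c x ^ c x)"
  have IH: "a ^ a * p \<le> fact a * q * (a + 1) ^ (card A - 1)"
    using insert.IH by (simp add: a_def p_def q_def)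
  have card: "card A = Suc (card A - 1)" using insert.hyps by (simp add: card_gt_0_iff)
  have "fact a * ((a + m) ^ (a + m) * (fact m * p)) = ((a + m) ^ (a + m) * fact m * fact a) * p"
    by (simp add: mult_ac)
  also have "\<dots> \<le> (a + m + 1) * (fact (a + m) * (m ^ m * a ^ a)) * p"
    by (intro mult_right_mono binomial_max_term) simp
  also have "\<dots> = (a + m + 1) * fact (a + m) * m ^ m * (a ^ a * p)" by (simp add: algebra_simps)
  also have "\<dots> \<le> (a + m + 1) * fact (a + m) * m ^ m * (fact a * q * (a + m + 1) ^ (card A - 1))"
    by (intro mult_left_mono order.trans[OF IH] mult_left_mono power_mono) auto
  also have "\<dots> = fact a * (fact (a + m) * (m ^ m * q) * (a + m + 1) ^ Suc (card A - 1))"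
    by (simp add: algebra_simps)
  finally have "(a + m) ^ (a + m) * (fact m * p) \<le> fact (a + m) * (m ^ m * q) * (a + m + 1) ^ card A"
    unfolding card[symmetric] by (subst (asm) mult_le_cancel1) auto
  thus ?case using insert.hyps by (simp add: a_def[symmetric] m_def[symmetric] p_def[symmetric] q_def[symmetric] add.commute)
qed simp

text \<open>The class consists of the permutations of one multiset, so its size is a multinomial
  coefficient. The exponent \<open>CARD('x) - 1\<close> matters: it leaves two of the
  \<open>CARD('x) + 1\<close> factors n + 1 in \<open>rate_slack\<close> for other uses in the
  sphere-packing bound.\<close>

lemma card_type_seqs_ge:
  fixes Q :: "'x::finite \<Rightarrow> real"
  assumes Q: "Q \<in> types n" and n: "0 < n"
  shows "2 powr (real n * shannon_entropy Q) \<le>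
    real (card (type_seqs n Q)) * real (n + 1) ^ (CARD('x) - 1)"
proof -
  have "\<exists>c. real n * Q x = real c" for x using Q by (auto simp: types_def)
  then obtain c where c: "\<And>x. real n * Q x = real (c x)" by metis
  have Qc: "Q x = real (c x) / real n" for x using c[of x] n by (simp add: field_simps)
  have "real (\<Sum>x\<in>UNIV. c x) = real n * (\<Sum>x\<in>UNIV. Q x)" by (simp add: c[symmetric] sum_distrib_left)
  hence "real (\<Sum>x\<in>UNIV. c x) = real n" using Q by (simp add: types_def del: of_nat_sum)
  hence sc: "(\<Sum>x\<in>UNIV. c x) = n" by (simp only: of_nat_eq_iff)
  define M where "M = (\<Sum>x\<in>UNIV. replicate_mset (c x) x)"
  have cM: "count M x = c x" for x
  proof -
    have "count M x = (\<Sum>y\<in>UNIV. if y = x then c y else 0)"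
      unfolding M_def count_sum by (intro sum.cong) auto
    thus ?thesis by simp
  qed
  have sM: "size M = n" unfolding M_def by (simp add: size_multiset_sum sc)
  have "type_seqs n Q = permutations_of_multiset M"
  proof -
    have "xs \<in> type_seqs n Q \<longleftrightarrow> mset xs = M" for xs
    proof
      assume "xs \<in> type_seqs n Q"
      hence "count_list xs x = c x" for x using type_seqsD(3)[of xs n Q x] c[of x] by simp
      thus "mset xs = M" by (intro multiset_eqI) (simp add: cM count_mset)
    next
      assume "mset xs = M"
      moreover from this have "length xs = n" using sM by (metis size_mset)
      ultimately show "xs \<in> type_seqs n Q" using cM c by (auto simp: type_seqs_def seqs_def count_mset[symmetric])
    qed
    thus ?thesis by (auto simp: permutations_of_multiset_def)
  qed
  hence "card (type_seqs n Q) * (\<Prod>x\<in>set_mset M. fact (count M x)) = fact n"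
    using card_permutations_of_multiset[of M] sM by simp
  also have "(\<Prod>x\<in>set_mset M. fact (count M x)) = (\<Prod>x\<in>UNIV. fact (c x))"
    by (intro prod.mono_neutral_cong_left) (auto simp: cM count_eq_zero_iff[symmetric])
  finally have card: "card (type_seqs n Q) * (\<Prod>x\<in>UNIV. fact (c x)) = fact n" .
  have "n ^ n * (\<Prod>x\<in>UNIV. fact (c x)) \<le> fact n * (\<Prod>x\<in>UNIV. c x ^ c x) * (n + 1) ^ (CARD('x) - 1)"
    using multinomial_lower_bound[of "UNIV :: 'x set" c] by (simp add: sc)
  also have "\<dots> = (card (type_seqs n Q) * (\<Prod>x\<in>UNIV. c x ^ c x) * (n + 1) ^ (CARD('x) - 1)) * (\<Prod>x\<in>UNIV. fact (c x))"
    by (simp add: card[symmetric] mult_ac)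
  finally have "n ^ n \<le> card (type_seqs n Q) * (\<Prod>x\<in>UNIV. c x ^ c x) * (n + 1) ^ (CARD('x) - 1)"
    by (subst (asm) mult_le_cancel2) (auto simp: prod_pos)
  hence "real (n ^ n) \<le> real (card (type_seqs n Q) * (\<Prod>x\<in>UNIV. c x ^ c x) * (n + 1) ^ (CARD('x) - 1))"
    by (simp only: of_nat_le_iff)
  hence le: "real n ^ n \<le> real (card (type_seqs n Q)) * (\<Prod>x\<in>UNIV. real (c x) ^ c x) * real (n + 1) ^ (CARD('x) - 1)"
    by (simp only: of_nat_mult of_nat_power of_nat_prod)
  have "2 powr (real n * shannon_entropy Q) = (\<Prod>x\<in>UNIV. 2 powr (- (real (c x) * log 2 (Q x))))"
    by (simp add: shannon_entropy_def powr_sum[symmetric] sum_negf sum_distrib_left c[symmetric] mult.assoc)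
  also have "\<dots> = (\<Prod>x\<in>UNIV. real n ^ c x / real (c x) ^ c x)"
  proof (intro prod.cong refl)
    fix x
    show "2 powr (- (real (c x) * log 2 (Q x))) = real n ^ c x / real (c x) ^ c x"
    proof (cases "c x = 0")
      case False
      hence "Q x > 0" using n by (simp add: Qc)
      hence "2 powr (- (real (c x) * log 2 (Q x))) = 1 / (Q x ^ c x)"
        by (simp add: powr_minus_divide mult.commute[of "real (c x)"] powr_powr[symmetric] powr_realpow)
      thus ?thesis by (simp add: Qc power_divide)
    qed simp
  qed
  also have "\<dots> = real n ^ n / (\<Prod>x\<in>UNIV. real (c x) ^ c x)"
    by (simp add: prod_dividef power_sum[symmetric] sc)
  also have "\<dots> \<le> real (card (type_seqs n Q)) * real (n + 1) ^ (CARD('x) - 1)"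
  proof -
    have "0 < (\<Prod>x\<in>UNIV. real (c x) ^ c x)" by (intro prod_pos) (auto simp: zero_less_power_eq)
    thus ?thesis using le by (simp add: divide_le_eq mult_ac)
  qed
  finally show ?thesis .
qed

lemma type_seqs_nonempty:
  assumes "Q \<in> types n" "0 < n"
  shows "type_seqs n Q \<noteq> {}"
proof
  assume "type_seqs n Q = {}"
  thus False using card_type_seqs_ge[OF assms] by simp
qed

section \<open>From codes to the random coding exponent\<close>

context state_family
begin

text \<open>Powers vanish only at eigenvalue zero, so a vanishing trace for one pair of exponents
  forces all products of eigenvalues and overlaps to vanish, and with them Tr
  (\<open>\<rho> x\<close> times the average state). But this is at least \<open>Q x\<close> times
  Tr of the square of \<open>\<rho> x\<close>, which is positive. Hence the divergences in
  \<open>E_rs_down\<close> are finite where \<open>Q\<close> is positive.\<close>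

lemma trace_powr_avg_pos:
  assumes Q: "Q \<in> types n" and x: "0 < Q x"
  shows "0 < Re (mat_trace (mat_powr (\<rho> x) a * mat_powr (avg_state d \<rho> Q) b))"
proof -
  let ?\<sigma> = "avg_state d \<rho> Q"
  have psd\<sigma>: "psd d ?\<sigma>" using psd_avg_state types_nonneg[OF Q] by blast
  obtain U e where A: "\<rho> x \<in> carrier_mat d d" "is_eig_decomp (\<rho> x) U e" and e: "\<And>k. k < d \<Longrightarrow> 0 \<le> e k"
    using psd_obtain_eig[OF psd_rho] by metis
  obtain V g where B: "?\<sigma> \<in> carrier_mat d d" "is_eig_decomp ?\<sigma> V g" and g: "\<And>k. k < d \<Longrightarrow> 0 \<le> g k"
    using psd_obtain_eig[OF psd\<sigma>] by metis
  have t: "Re (mat_trace (mat_powr (\<rho> x) a * mat_powr ?\<sigma> b)) =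
      (\<Sum>k<d. \<Sum>l<d. e k powr a * g l powr b * overlap d U V k l)"
    unfolding mat_powr_def trace_mat_fun_mult_mat_fun[OF A B] by simp
  have nn: "0 \<le> e k powr a * g l powr b * overlap d U V k l" for k l
    by (simp add: overlap_nonneg)
  have "Re (mat_trace (mat_powr (\<rho> x) a * mat_powr ?\<sigma> b)) \<noteq> 0"
  proof
    assume "Re (mat_trace (mat_powr (\<rho> x) a * mat_powr ?\<sigma> b)) = 0"
    hence "(\<Sum>k<d. \<Sum>l<d. e k powr a * g l powr b * overlap d U V k l) = 0" by (simp add: t)
    hence "\<forall>k\<in>{..<d}. \<forall>l\<in>{..<d}. e k powr a * g l powr b * overlap d U V k l = 0"
      using nn by (subst (asm) sum_nonneg_eq_0_iff; simp add: sum_nonneg sum_nonneg_eq_0_iff)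
    hence "e k * g l * overlap d U V k l = 0" if "k \<in> {..<d}" "l \<in> {..<d}" for k l
      using that by (metis mult_eq_0_iff powr_eq_0_iff)
    hence "(\<Sum>k<d. \<Sum>l<d. e k * g l * overlap d U V k l) = 0" by (intro sum.neutral ballI)
    hence "mat_trace (mat_fun (\<lambda>t. t) (\<rho> x) * mat_fun (\<lambda>t. t) ?\<sigma>) = 0"
      unfolding trace_mat_fun_mult_mat_fun[OF A B] by (simp only: of_real_0)
    hence 0: "Re (mat_trace (\<rho> x * ?\<sigma>)) = 0" unfolding mat_fun_ident[OF A] mat_fun_ident[OF B] by simp
    have "mat_trace (\<rho> x * ?\<sigma>) = (\<Sum>y\<in>UNIV. mat_trace (\<rho> x * (of_real (Q y) \<cdot>\<^sub>m \<rho> y)))"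
      unfolding avg_state_def by (rule trace_mult_msum_right[OF A(1)]) (use psdD(1)[OF psd_rho] in auto)
    also have "\<dots> = (\<Sum>y\<in>UNIV. of_real (Q y) * mat_trace (\<rho> x * \<rho> y))"
      by (intro sum.cong refl trace_mult_smult_right[OF A(1)] psdD(1)[OF psd_rho])
    finally have "Re (mat_trace (\<rho> x * ?\<sigma>)) = (\<Sum>y\<in>UNIV. Q y * Re (mat_trace (\<rho> x * \<rho> y)))" by simp
    hence "Q x * Re (mat_trace (\<rho> x * \<rho> x)) \<le> 0"
      using 0 member_le_sum[of x UNIV "\<lambda>y. Q y * Re (mat_trace (\<rho> x * \<rho> y))"]
        types_nonneg[OF Q] trace_psd_mult_nonneg[OF psd_rho psd_rho] by simp
    hence le: "Re (mat_trace (\<rho> x * \<rho> x)) \<le> 0" using x by (simp add: mult_le_0_iff)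
    have "Re (mat_trace (mat_fun (\<lambda>t. t) (\<rho> x) * mat_fun (\<lambda>t. t) (\<rho> x))) = (\<Sum>k<d. e k * e k)"
      unfolding trace_mat_fun_mult_same[OF psdD(2)[OF psd_rho]] trace_mat_fun[OF A] by simp
    hence "(\<Sum>k<d. e k * e k) = 0"
      using le unfolding mat_fun_ident[OF A] by (intro antisym sum_nonneg) auto
    hence "e k = 0" if "k \<in> {..<d}" for k
      using that by (simp add: sum_nonneg_eq_0_iff)
    moreover have "(\<Sum>k<d. e k) = 1"
      using trace_mat_fun[OF A, of "\<lambda>t. t"] unfolding mat_fun_ident[OF A] trace_rho by (metis of_real_eq_1_iff)
    ultimately show False by simp
  qed
  moreover have "0 \<le> Re (mat_trace (mat_powr (\<rho> x) a * mat_powr ?\<sigma> b))"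
    unfolding t by (intro sum_nonneg nn)
  ultimately show ?thesis by linarith
qed

lemma opt_err_prob_bounds:
  assumes Q: "Q \<in> types n" and n: "0 < n"
  shows "source_codes d n R \<noteq> ({} :: (('x list \<Rightarrow> nat) \<times> _) set)" "bdd_below (err_prob \<rho> n Q ` source_codes d n R)"
    "0 \<le> opt_err_prob d \<rho> n R Q" "opt_err_prob d \<rho> n R Q \<le> 1"
proof -
  note T = type_seqs_nonempty[OF Q n]
  show ne: "source_codes d n R \<noteq> ({} :: (('x list \<Rightarrow> nat) \<times> _) set)" using exists_code_le[OF Q T, of 1 1 R] by auto
  show bdd: "bdd_below (err_prob \<rho> n Q ` source_codes d n R)"
    by (rule bdd_belowI2[of _ 0]) (rule err_prob_nonneg[OF _ T])
  show "0 \<le> opt_err_prob d \<rho> n R Q"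
    unfolding opt_err_prob_def by (rule cINF_greatest[OF ne]) (rule err_prob_nonneg[OF _ T])
  obtain enc :: "'x list \<Rightarrow> nat" and P where c: "(enc, P) \<in> source_codes d n R" using ne by auto
  have "0 \<le> Re (mat_trace (P (enc xs) xs * seq_state \<rho> xs))" if "xs \<in> type_seqs n Q" for xs
    using c type_seqsD(2)[OF that] by (intro trace_povm_seq_state(1)) (auto simp: source_codes_def)
  hence "err_prob \<rho> n Q (enc, P) \<le> 1"
    unfolding err_prob_def by (simp add: sum_nonneg)
  thus "opt_err_prob d \<rho> n R Q \<le> 1"
    unfolding opt_err_prob_def using cINF_lower[OF bdd c] by linarith
qed

lemma le_err_exponentI:
  assumes Q: "Q \<in> types n" and n: "0 < n" and le: "opt_err_prob d \<rho> n R Q \<le> 2 powr (- (real n * F))"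
  shows "ereal F \<le> err_exponent d \<rho> n R Q"
proof (cases "opt_err_prob d \<rho> n R Q = 0")
  case True
  thus ?thesis using n by (simp add: err_exponent_def log2_ereal_def)
next
  case False
  hence pos: "0 < opt_err_prob d \<rho> n R Q" using opt_err_prob_bounds(3)[OF Q n, of R] by linarith
  have "log 2 (opt_err_prob d \<rho> n R Q) \<le> log 2 (2 powr (- (real n * F)))"
    using le pos by (subst log_le_cancel_iff) auto
  hence "real n * F \<le> - log 2 (opt_err_prob d \<rho> n R Q)" by simp
  hence "F \<le> - (1 / real n) * log 2 (opt_err_prob d \<rho> n R Q)" using n by (simp add: field_simps)
  thus ?thesis using False by (simp add: err_exponent_def log2_ereal_def)
qed

text \<open>Each \<open>s\<close> is treated separately: for \<open>0 < s\<close> the \<epsilon> in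
  the code bound disappears in the infimum over codes, and at \<open>s = 0\<close> it suffices that
  error probabilities are at most one.\<close>

theorem random_coding_exponent_le:
  assumes Q: "Q \<in> types n" and n: "0 < n"
  shows "E_rs_down d \<rho> R Q \<le> err_exponent d \<rho> n R Q"
  unfolding E_rs_down_def
proof (rule SUP_least)
  fix s :: real assume "s \<in> {0..1}"
  hence s: "0 \<le> s" "s \<le> 1" by auto
  define H where "H = shannon_entropy Q"
  show "ereal s * ((\<Sum>x\<in>UNIV. ereal (Q x) * petz_div (1 - s) (\<rho> x) (avg_state d \<rho> Q)) - ereal (shannon_entropy Q))
    + ereal (s * R) \<le> err_exponent d \<rho> n R Q"
  proof (cases "s = 0")
    case True
    have "opt_err_prob d \<rho> n R Q \<le> 2 powr (- (real n * 0))" using opt_err_prob_bounds(4)[OF Q n] by simp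
    from le_err_exponentI[OF Q n this] show ?thesis using True by (simp add: zero_ereal_def[symmetric])
  next
    case False
    hence s: "0 < s" "s \<le> 1" using s by auto
    define t where "t x = Re (mat_trace (mat_powr (\<rho> x) (1 - s) * mat_powr (avg_state d \<rho> Q) s))" for x
    have t: "0 < t x" if "0 < Q x" for x unfolding t_def by (rule trace_powr_avg_pos[OF Q that])
    define L where "L = (\<Sum>x\<in>UNIV. Q x * log 2 (t x))"
    have "ereal (Q x) * petz_div (1 - s) (\<rho> x) (avg_state d \<rho> Q) = ereal (- (1 / s) * (Q x * log 2 (t x)))" for x
    proof (cases "Q x = 0")
      case True
      thus ?thesis by (simp add: zero_ereal_def[symmetric])
    next
      case False
      hence "0 < t x" using t[of x] types_nonneg[OF Q, of x] by simp
      thus ?thesis using s by (simp add: petz_div_def t_def[symmetric] Let_def)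
    qed
    hence "(\<Sum>x\<in>UNIV. ereal (Q x) * petz_div (1 - s) (\<rho> x) (avg_state d \<rho> Q)) = ereal (- (1 / s) * L)"
      by (simp add: L_def sum_distrib_left)
    hence eq: "ereal s * ((\<Sum>x\<in>UNIV. ereal (Q x) * petz_div (1 - s) (\<rho> x) (avg_state d \<rho> Q)) - ereal H) + ereal (s * R)
        = ereal (- L - s * H + s * R)"
      using s by (simp add: right_diff_distrib)
    have "opt_err_prob d \<rho> n R Q \<le> 2 powr (- (real n * (- L - s * H + s * R)))"
    proof (rule field_le_epsilon)
      fix \<epsilon> :: real assume "0 < \<epsilon>"
      from exists_code_le[OF Q type_seqs_nonempty[OF Q n] s this, of R]
      obtain c xs where c: "c \<in> source_codes d n R" and xs: "xs \<in> type_seqs n Q"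
        and le: "err_prob \<rho> n Q c \<le> (2 powr (real n * (H - R))) powr s * (\<Prod>k<n. t (xs ! k)) + \<epsilon>"
        unfolding t_def H_def by blast
      have "(2 powr (real n * (H - R))) powr s * (\<Prod>k<n. t (xs ! k)) = 2 powr (- (real n * (- L - s * H + s * R)))"
        using prod_type_seqs[OF xs Q, of t] t
        by (simp add: L_def[symmetric] powr_powr powr_add[symmetric]) (simp add: algebra_simps)
      thus "opt_err_prob d \<rho> n R Q \<le> 2 powr (- (real n * (- L - s * H + s * R))) + \<epsilon>"
        unfolding opt_err_prob_def using cINF_lower[OF opt_err_prob_bounds(2)[OF Q n] c] le by linarith
    qed
    from le_err_exponentI[OF Q n this] show ?thesis unfolding H_def[symmetric] eq .
  qed
qed

lemma E_rs_down_mono: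
  assumes "R \<le> R'"
  shows "E_rs_down d \<rho> R Q \<le> E_rs_down d \<rho> R' Q"
  unfolding E_rs_down_def
proof (rule SUP_mono)
  fix s :: real assume s: "s \<in> {0..1}"
  hence "ereal (s * R) \<le> ereal (s * R')" using assms by (simp add: mult_left_mono)
  thus "\<exists>t\<in>{0..1}. ereal s * ((\<Sum>x\<in>UNIV. ereal (Q x) * petz_div (1 - s) (\<rho> x) (avg_state d \<rho> Q)) -
      ereal (shannon_entropy Q)) + ereal (s * R) \<le>
    ereal t * ((\<Sum>x\<in>UNIV. ereal (Q x) * petz_div (1 - t) (\<rho> x) (avg_state d \<rho> Q)) -
      ereal (shannon_entropy Q)) + ereal (t * R')"
    using s by (intro bexI[of _ s] add_left_mono)
qed

end

section \<open>Windows for sums of independent variables\<close>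

text \<open>A hybrid of two samples in which the first \<open>k\<close> coordinates are resampled.
  Exchanging these coordinates between the two samples is an involution on pairs that preserves the
  product weight, so every hybrid has the original law.\<close>

definition mix :: "nat \<Rightarrow> (nat \<Rightarrow> 'b) \<Rightarrow> (nat \<Rightarrow> 'b) \<Rightarrow> nat \<Rightarrow> 'b" where
  "mix k \<omega> \<omega>' = (\<lambda>j. if j < k then \<omega>' j else \<omega> j)"

lemma mix_PiE: "\<omega> \<in> PiE A I \<Longrightarrow> \<omega>' \<in> PiE A I \<Longrightarrow> mix k \<omega> \<omega>' \<in> PiE A I"
  by (auto simp: mix_def PiE_def Pi_def extensional_def)

lemma mix_mix: "mix k (mix k \<omega> \<omega>') (mix k \<omega>' \<omega>) = \<omega>"
  by (auto simp: mix_def)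

lemma prod_mix:
  "(\<Prod>j<n. v j (mix k \<omega> \<omega>' j)) * (\<Prod>j<n. v j (mix k \<omega>' \<omega> j)) = (\<Prod>j<n. v j (\<omega> j)) * (\<Prod>j<n. (v j (\<omega>' j) :: real))"
  unfolding prod.distrib[symmetric] by (intro prod.cong) (auto simp: mix_def)

text \<open>A sum of independent bounded variables hits every quantile up to one step: resampling the
  summands of one copy one by one turns it into an independent copy, hence with probability at
  least \<open>1/4\<close> one of the \<open>n + 1\<close> interpolating sums, all of which have the same law, lies in the
  window.\<close>

lemma sum_independent_window:
  fixes v X :: "nat \<Rightarrow> 'b \<Rightarrow> real"
  defines "V \<equiv> \<lambda>\<omega> n. \<Prod>j<n. v j (\<omega> j)" and "S \<equiv> \<lambda>\<omega> n. \<Sum>j<n. X j (\<omega> j)"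
  assumes fin: "\<And>j. j < n \<Longrightarrow> finite (I j)"
    and v: "\<And>j a. j < n \<Longrightarrow> a \<in> I j \<Longrightarrow> 0 \<le> v j a"
    and X: "\<And>j a b. j < n \<Longrightarrow> a \<in> I j \<Longrightarrow> b \<in> I j \<Longrightarrow> X j b - X j a \<le> B"
    and B: "0 \<le> B"
    and one: "(\<Sum>\<omega>\<in>PiE {..<n} I. V \<omega> n) = 1"
    and lo: "1 / 2 \<le> (\<Sum>\<omega> | \<omega> \<in> PiE {..<n} I \<and> S \<omega> n \<le> l + 1. V \<omega> n)"
    and hi: "1 / 2 \<le> (\<Sum>\<omega> | \<omega> \<in> PiE {..<n} I \<and> l - 1 \<le> S \<omega> n. V \<omega> n)"
  shows "1 / (4 * (real n + 1)) \<le>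
    (\<Sum>\<omega> | \<omega> \<in> PiE {..<n} I \<and> l - 1 - B \<le> S \<omega> n \<and> S \<omega> n \<le> l + 1. V \<omega> n)"
proof -
  define \<Omega> where "\<Omega> = PiE {..<n} I"
  have fin\<Omega>: "finite \<Omega>" unfolding \<Omega>_def using fin by (intro finite_PiE) auto
  have V0: "0 \<le> V \<omega> n" if "\<omega> \<in> \<Omega>" for \<omega>
    using that v unfolding V_def \<Omega>_def by (intro prod_nonneg) (auto simp: PiE_iff)
  define W where "W \<omega> = (l - 1 - B \<le> S \<omega> n \<and> S \<omega> n \<le> l + 1)" for \<omega>
  define Low where "Low = {\<omega> \<in> \<Omega>. S \<omega> n \<le> l + 1}"
  define High where "High = {\<omega> \<in> \<Omega>. l - 1 \<le> S \<omega> n}"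
  define w where "w = (\<Sum>\<omega>\<in>\<Omega>. if W \<omega> then V \<omega> n else 0)"
  have inv: "(\<Sum>(\<omega>, \<omega>')\<in>\<Omega> \<times> \<Omega>. if W (mix k \<omega> \<omega>') then V \<omega> n * V \<omega>' n else 0) = w" for k
  proof -
    have "(\<Sum>(\<omega>, \<omega>')\<in>\<Omega> \<times> \<Omega>. if W (mix k \<omega> \<omega>') then V \<omega> n * V \<omega>' n else 0) =
        (\<Sum>(\<omega>, \<omega>')\<in>\<Omega> \<times> \<Omega>. if W \<omega> then V \<omega> n * V \<omega>' n else 0)"
    proof -
      define T where "T p = (mix k (fst p) (snd p), mix k (snd p) (fst p))" for p :: "(nat \<Rightarrow> 'b) \<times> (nat \<Rightarrow> 'b)"
      have T: "T (T p) = p" "p \<in> \<Omega> \<times> \<Omega> \<Longrightarrow> T p \<in> \<Omega> \<times> \<Omega>" for p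
        by (cases p, simp add: T_def mix_mix, cases p, simp add: T_def \<Omega>_def mix_PiE)
      have VT: "V (fst (T p)) n * V (snd (T p)) n = V (fst p) n * V (snd p) n" for p
        unfolding V_def T_def fst_conv snd_conv by (rule prod_mix)
      show ?thesis unfolding case_prod_beta
      proof (rule sum.reindex_bij_witness[of _ T T])
        fix p assume "p \<in> \<Omega> \<times> \<Omega>"
        show "(if W (fst (T p)) then V (fst (T p)) n * V (snd (T p)) n else 0) =
            (if W (mix k (fst p) (snd p)) then V (fst p) n * V (snd p) n else 0)"
          unfolding VT by (simp add: T_def)
      qed (use T in auto)
    qed
    also have "\<dots> = (\<Sum>\<omega>\<in>\<Omega>. \<Sum>\<omega>'\<in>\<Omega>. (if W \<omega> then V \<omega> n else 0) * V \<omega>' n)"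
      unfolding sum.cartesian_product by (intro sum.cong) auto
    also have "\<dots> = w" unfolding w_def sum_distrib_left[symmetric] using one by (simp add: \<Omega>_def)
    finally show ?thesis .
  qed
  have hit: "\<exists>k\<le>n. W (mix k \<omega> \<omega>')" if \<omega>: "\<omega> \<in> Low" and \<omega>': "\<omega>' \<in> High" for \<omega> \<omega>'
  proof (cases "l - 1 \<le> S \<omega> n")
    case True
    moreover have "mix 0 \<omega> \<omega>' = \<omega>" by (simp add: mix_def)
    ultimately show ?thesis using \<omega> B by (intro exI[of _ 0]) (simp add: W_def Low_def)
  next
    case False
    define s where "s k = S (mix k \<omega> \<omega>') n" for k
    have s0: "s 0 = S \<omega> n" by (simp add: s_def mix_def)
    have "s n = S \<omega>' n" unfolding s_def S_def by (intro sum.cong) (auto simp: mix_def)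
    hence sn: "l - 1 \<le> s n" using \<omega>' by (simp add: High_def)
    \<comment> \<open>The first hybrid whose sum reaches \<open>l - 1\<close>. Its predecessor lies
      below \<open>l - 1\<close>, by at most one step \<open>B\<close>, and therefore in the
      window.\<close>
    define K where "K = (LEAST k. l - 1 \<le> s k)"
    have K: "l - 1 \<le> s K" "K \<le> n" unfolding K_def by (rule LeastI, rule sn) (rule Least_le, rule sn)
    have "K \<noteq> 0" using K(1) s0 False by (intro notI) simp
    then obtain m where m: "K = Suc m" using not0_implies_Suc by blast
    have sm: "s m < l - 1" using not_less_Least[of m "\<lambda>k. l - 1 \<le> s k"] m K_def by simp
    have mn: "m < n" using K(2) m by simp
    have "s K - s m = (\<Sum>j<n. if j = m then X m (\<omega>' m) - X m (\<omega> m) else 0)"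
      unfolding s_def S_def m sum_subtractf[symmetric] by (intro sum.cong) (auto simp: mix_def)
    also have "\<dots> = X m (\<omega>' m) - X m (\<omega> m)" using mn by simp
    also have "\<dots> \<le> B"
      using \<omega> \<omega>' mn by (intro X[OF mn]) (auto simp: Low_def High_def \<Omega>_def PiE_iff)
    finally show ?thesis using K(1) sm mn by (intro exI[of _ m]) (simp add: W_def s_def)
  qed
  have "1 / 2 \<le> (\<Sum>\<omega>\<in>Low. V \<omega> n)" "1 / 2 \<le> (\<Sum>\<omega>\<in>High. V \<omega> n)"
    using lo hi by (simp_all add: Low_def High_def \<Omega>_def)
  hence "1 / 2 * (1 / 2) \<le> (\<Sum>\<omega>\<in>Low. V \<omega> n) * (\<Sum>\<omega>\<in>High. V \<omega> n)"
    by (intro mult_mono) auto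
  hence "1 / 4 \<le> (\<Sum>\<omega>\<in>Low. V \<omega> n) * (\<Sum>\<omega>\<in>High. V \<omega> n)" by simp
  also have "\<dots> = (\<Sum>(\<omega>, \<omega>')\<in>Low \<times> High. V \<omega> n * V \<omega>' n)"
    by (simp add: sum_product sum.cartesian_product)
  also have "\<dots> \<le> (\<Sum>(\<omega>, \<omega>')\<in>Low \<times> High. \<Sum>k\<le>n. if W (mix k \<omega> \<omega>') then V \<omega> n * V \<omega>' n else 0)"
  proof (intro sum_mono, clarify)
    fix \<omega> \<omega>' assume *: "\<omega> \<in> Low" "\<omega>' \<in> High"
    then obtain k where k: "k \<le> n" "W (mix k \<omega> \<omega>')" using hit by blast
    have nn: "0 \<le> V \<omega> n * V \<omega>' n" using * V0 by (auto simp: Low_def High_def)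
    have "V \<omega> n * V \<omega>' n = (if W (mix k \<omega> \<omega>') then V \<omega> n * V \<omega>' n else 0)" using k by simp
    also have "\<dots> \<le> (\<Sum>k\<le>n. if W (mix k \<omega> \<omega>') then V \<omega> n * V \<omega>' n else 0)"
      using k nn by (intro member_le_sum) auto
    finally show "V \<omega> n * V \<omega>' n \<le> (\<Sum>k\<le>n. if W (mix k \<omega> \<omega>') then V \<omega> n * V \<omega>' n else 0)" .
  qed
  also have "\<dots> \<le> (\<Sum>(\<omega>, \<omega>')\<in>\<Omega> \<times> \<Omega>. \<Sum>k\<le>n. if W (mix k \<omega> \<omega>') then V \<omega> n * V \<omega>' n else 0)"
  proof (intro sum_mono2)
    show "finite (\<Omega> \<times> \<Omega>)" using fin\<Omega> by simp
    show "Low \<times> High \<subseteq> \<Omega> \<times> \<Omega>" by (auto simp: Low_def High_def)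
    fix x assume "x \<in> \<Omega> \<times> \<Omega> - Low \<times> High"
    then obtain a b where "x = (a, b)" "a \<in> \<Omega>" "b \<in> \<Omega>" by auto
    moreover from this have "0 \<le> V a n * V b n" using V0 by simp
    ultimately show "0 \<le> (case x of (\<omega>, \<omega>') \<Rightarrow> \<Sum>k\<le>n. if W (mix k \<omega> \<omega>') then V \<omega> n * V \<omega>' n else 0)"
      by (simp add: sum_nonneg)
  qed
  also have "\<dots> = (\<Sum>k\<le>n. \<Sum>(\<omega>, \<omega>')\<in>\<Omega> \<times> \<Omega>. if W (mix k \<omega> \<omega>') then V \<omega> n * V \<omega>' n else 0)"
    unfolding case_prod_beta by (rule sum.swap)
  also have "\<dots> = (real n + 1) * w" by (simp add: inv)
  finally have "1 / (4 * (real n + 1)) \<le> w" by (simp add: field_simps)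
  also have "w = (\<Sum>\<omega> | \<omega> \<in> \<Omega> \<and> W \<omega>. V \<omega> n)"
    unfolding w_def using fin\<Omega> by (simp add: sum.inter_filter)
  finally show ?thesis by (simp add: \<Omega>_def W_def)
qed

text \<open>By continuity some \<open>s\<close> places the median of the log-likelihood ratio, under the law tilted by the
  exponent \<open>1 / (1 + s)\<close>, near \<open>(1 + s) * (r + lZ s)\<close>; the threshold \<open>\<gamma>\<close> is taken there.\<close>

lemma tilted_window:
  fixes q X :: "nat \<Rightarrow> 'b \<Rightarrow> real" and I :: "nat \<Rightarrow> 'b set" and n :: nat
  defines "lZ \<equiv> \<lambda>s. \<Sum>j<n. log 2 (\<Sum>a\<in>I j. q j a * 2 powr (X j a / (1 + s)))"
  assumes fin: "\<And>j. j < n \<Longrightarrow> finite (I j)"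
    and q: "\<And>j a. j < n \<Longrightarrow> a \<in> I j \<Longrightarrow> 0 \<le> q j a"
    and P1: "\<And>j. j < n \<Longrightarrow> (\<Sum>a\<in>I j. q j a * 2 powr X j a) = 1"
    and X: "\<And>j a b. j < n \<Longrightarrow> a \<in> I j \<Longrightarrow> b \<in> I j \<Longrightarrow> X j b - X j a \<le> B"
    and B: "0 \<le> B"
    and hyp: "\<And>s. 0 \<le> s \<Longrightarrow> - (1 + s) * lZ s - s * r \<le> E - s"
  shows "\<exists>\<gamma>\<ge>2 powr (r - E - B - 1). \<gamma> * 2 powr (- r) / (8 * (real n + 1)) \<le>
    (\<Sum>\<omega>\<in>PiE {..<n} I. min ((\<Prod>j<n. q j (\<omega> j)) * 2 powr (\<Sum>j<n. X j (\<omega> j))) (\<gamma> * (\<Prod>j<n. q j (\<omega> j))))"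
proof -
  define \<Omega> where "\<Omega> = PiE {..<n} I"
  have fin\<Omega>: "finite \<Omega>" unfolding \<Omega>_def using fin by (intro finite_PiE) auto
  define L where "L \<omega> = (\<Sum>j<n. X j (\<omega> j))" for \<omega>
  define Q where "Q \<omega> = (\<Prod>j<n. q j (\<omega> j))" for \<omega>
  have Q0: "0 \<le> Q \<omega>" if "\<omega> \<in> \<Omega>" for \<omega>
    unfolding Q_def using that q by (intro prod_nonneg) (auto simp: \<Omega>_def PiE_iff)
  define Z where "Z s j = (\<Sum>a\<in>I j. q j a * 2 powr (X j a / (1 + s)))" for s j
  have Zpos: "0 < Z s j" if j: "j < n" for s j
  proof -
    have "\<exists>a\<in>I j. q j a \<noteq> 0"
    proof (rule ccontr)
      assume "\<not> ?thesis"
      hence "(\<Sum>a\<in>I j. q j a * 2 powr X j a) = 0" by (intro sum.neutral) auto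
      thus False using P1[OF j] by simp
    qed
    then obtain a where "a \<in> I j" "q j a \<noteq> 0" by blast
    thus ?thesis unfolding Z_def using q[OF j] fin[OF j]
      by (intro sum_pos2[of _ a]) (auto simp: less_le)
  qed
  have lZ: "2 powr lZ s = (\<Prod>j<n. Z s j)" for s
    using Zpos by (simp add: lZ_def Z_def[symmetric] powr_sum)
  define v where "v s j a = q j a * 2 powr (X j a / (1 + s)) / Z s j" for s j a
  define V where "V s \<omega> = (\<Prod>j<n. v s j (\<omega> j))" for s \<omega>
  have v0: "0 \<le> v s j a" if "j < n" "a \<in> I j" for s j a
    using that q Zpos[OF that(1), of s] by (simp add: v_def)
  have V0: "0 \<le> V s \<omega>" if "\<omega> \<in> \<Omega>" for s \<omega>
    unfolding V_def using that v0 by (intro prod_nonneg) (auto simp: \<Omega>_def PiE_iff)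
  have V1: "(\<Sum>\<omega>\<in>\<Omega>. V s \<omega>) = 1" for s
  proof -
    have "(\<Sum>\<omega>\<in>\<Omega>. V s \<omega>) = (\<Prod>j<n. \<Sum>a\<in>I j. v s j a)"
      unfolding \<Omega>_def V_def using fin by (intro prod_sum_PiE[symmetric]) auto
    also have "\<dots> = 1"
    proof (rule prod.neutral, rule ballI)
      fix j assume "j \<in> {..<n}"
      thus "(\<Sum>a\<in>I j. v s j a) = 1"
        using Zpos[of j s] by (simp add: v_def sum_divide_distrib[symmetric] Z_def[symmetric])
    qed
    finally show ?thesis .
  qed
  have V: "V s \<omega> = Q \<omega> * 2 powr (L \<omega> / (1 + s) - lZ s)" for s \<omega>
    unfolding V_def v_def Q_def L_def powr_diff lZ
    by (simp add: prod.distrib prod_dividef powr_sum sum_divide_distrib)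
  \<comment> \<open>A continuous cutoff in place of an indicator function, so that the intermediate
    value theorem applies to \<open>g\<close>; this is why the windows extend by 1 on either
    side.\<close>
  define \<phi> :: "real \<Rightarrow> real" where "\<phi> y = max 0 (min 1 ((1 - y) / 2))" for y
  have \<phi>: "0 \<le> \<phi> y" "\<phi> y \<le> 1" "y \<ge> 1 \<Longrightarrow> \<phi> y = 0" "y \<le> -1 \<Longrightarrow> \<phi> y = 1" for y
    by (auto simp: \<phi>_def)
  define l where "l s = (1 + s) * (r + lZ s)" for s
  \<comment> \<open>A restatement of \<open>hyp\<close>. The term \<open>- s\<close> in that
    hypothesis makes the threshold tend to infinity with \<open>s\<close>.\<close>
  have l: "r - E + s \<le> l s" if "0 \<le> s" for s using hyp[OF that] by (simp add: l_def algebra_simps)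
  define g where "g s = (\<Sum>\<omega>\<in>\<Omega>. V s \<omega> * \<phi> (L \<omega> - l s))" for s
  have low: "g s \<le> (\<Sum>\<omega> | \<omega> \<in> \<Omega> \<and> L \<omega> \<le> l s + 1. V s \<omega>)" for s
  proof -
    have "g s \<le> (\<Sum>\<omega>\<in>\<Omega>. if L \<omega> \<le> l s + 1 then V s \<omega> else 0)"
      unfolding g_def using V0 \<phi> by (intro sum_mono) (auto simp: mult_left_le)
    thus ?thesis using fin\<Omega> by (simp add: sum.inter_filter)
  qed
  show ?thesis
  proof (cases "1 / 2 \<le> g 0")
    case True
    have "Z 0 j = 1" if "j < n" for j using P1[OF that] by (simp add: Z_def)
    hence lZ0: "lZ 0 = 0" by (simp add: lZ_def Z_def[symmetric])
    have E0: "0 \<le> E" using hyp[of 0] by (simp add: lZ0)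
    have l0: "l 0 = r" by (simp add: l_def lZ0)
    have V0': "V 0 \<omega> = Q \<omega> * 2 powr L \<omega>" for \<omega> by (simp add: V lZ0)
    let ?\<gamma> = "2 powr (r + 1)"
    have "?\<gamma> * 2 powr (- r) / (8 * (real n + 1)) = 1 / (4 * (real n + 1))"
      by (simp add: powr_add powr_minus field_simps)
    also have "\<dots> \<le> 1 / 2" by (simp add: field_simps)
    also have "\<dots> \<le> (\<Sum>\<omega> | \<omega> \<in> \<Omega> \<and> L \<omega> \<le> r + 1. V 0 \<omega>)" using True low[of 0] l0 by simp
    also have "\<dots> = (\<Sum>\<omega> | \<omega> \<in> \<Omega> \<and> L \<omega> \<le> r + 1. min (Q \<omega> * 2 powr L \<omega>) (?\<gamma> * Q \<omega>))"
    proof (intro sum.cong refl)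
      fix \<omega> assume "\<omega> \<in> {\<omega> \<in> \<Omega>. L \<omega> \<le> r + 1}"
      hence "Q \<omega> * 2 powr L \<omega> \<le> Q \<omega> * ?\<gamma>" using Q0 by (intro mult_left_mono) auto
      thus "V 0 \<omega> = min (Q \<omega> * 2 powr L \<omega>) (?\<gamma> * Q \<omega>)" by (simp add: V0' mult.commute)
    qed
    also have "\<dots> \<le> (\<Sum>\<omega>\<in>\<Omega>. min (Q \<omega> * 2 powr L \<omega>) (?\<gamma> * Q \<omega>))"
      using fin\<Omega> Q0 by (intro sum_mono2) auto
    finally show ?thesis
      using E0 B by (intro exI[of _ ?\<gamma>]) (simp add: \<Omega>_def L_def Q_def)
  next
    case False
    \<comment> \<open>For this \<open>s\<close> the threshold exceeds every value of
      \<open>L\<close> by at least one, so the cutoff is identically one.\<close>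
    define S where "S = max 0 (Max (L ` \<Omega>) + 1 - r + E)"
    have S0: "0 \<le> S" by (simp add: S_def)
    have "L \<omega> - l S \<le> -1" if "\<omega> \<in> \<Omega>" for \<omega>
    proof -
      have "L \<omega> \<le> Max (L ` \<Omega>)" using fin\<Omega> that by (intro Max_ge) auto
      thus ?thesis using l[OF S0] by (simp add: S_def max_def split: if_splits)
    qed
    hence gS: "g S = 1" unfolding g_def using \<phi>(4) V1[of S] by simp
    have "continuous_on {0..S} g"
    proof -
      have lZc: "continuous_on {0..S} lZ"
        unfolding lZ_def using Zpos
        by (intro continuous_intros ballI) (auto simp: Z_def[symmetric] less_le)
      have "continuous_on {0..S} l" unfolding l_def by (intro continuous_intros lZc)
      thus ?thesis unfolding g_def \<phi>_def V by (intro continuous_intros lZc) auto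
    qed
    moreover have "g 0 \<le> 1 / 2" "1 / 2 \<le> g S" using False gS by auto
    ultimately obtain s where s: "0 \<le> s" "s \<le> S" "g s = 1 / 2"
      using IVT'[of g 0 "1 / 2" S] S0 by auto
    have high: "1 / 2 \<le> (\<Sum>\<omega> | \<omega> \<in> \<Omega> \<and> l s - 1 \<le> L \<omega>. V s \<omega>)"
    proof -
      have "1 / 2 = (\<Sum>\<omega>\<in>\<Omega>. V s \<omega> * (1 - \<phi> (L \<omega> - l s)))"
        using s(3) V1[of s] by (simp add: g_def right_diff_distrib sum_subtractf)
      also have "\<dots> \<le> (\<Sum>\<omega>\<in>\<Omega>. if l s - 1 \<le> L \<omega> then V s \<omega> else 0)"
        using V0 \<phi> by (intro sum_mono) (auto simp: mult_left_le)
      finally show ?thesis using fin\<Omega> by (simp add: sum.inter_filter)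
    qed
    define A where "A = {\<omega> \<in> \<Omega>. l s - 1 - B \<le> L \<omega> \<and> L \<omega> \<le> l s + 1}"
    have win: "1 / (4 * (real n + 1)) \<le> (\<Sum>\<omega>\<in>A. V s \<omega>)"
      unfolding A_def V_def L_def \<Omega>_def
    proof (rule sum_independent_window[OF fin v0 X B])
      show "(\<Sum>\<omega>\<in>PiE {..<n} I. \<Prod>j<n. v s j (\<omega> j)) = 1" using V1[of s] by (simp add: \<Omega>_def V_def)
      show "1 / 2 \<le> (\<Sum>\<omega> | \<omega> \<in> PiE {..<n} I \<and> (\<Sum>j<n. X j (\<omega> j)) \<le> l s + 1. \<Prod>j<n. v s j (\<omega> j))"
        using low[of s] s(3) by (simp add: \<Omega>_def V_def L_def)
      show "1 / 2 \<le> (\<Sum>\<omega> | \<omega> \<in> PiE {..<n} I \<and> l s - 1 \<le> (\<Sum>j<n. X j (\<omega> j)). \<Prod>j<n. v s j (\<omega> j))"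
        using high by (simp add: \<Omega>_def V_def L_def)
    qed auto
    \<comment> \<open>The likelihood ratio at the lower end of the window, so that throughout the
      window the minimum is attained by \<open>\<gamma> * Q \<omega>\<close>.\<close>
    define \<gamma> where "\<gamma> = 2 powr (l s - 1 - B)"
    \<comment> \<open>The upper end of the window bounds the density of the tilted law relative to
      \<open>Q\<close>; the normalization \<open>lZ s\<close> cancels by the choice of
      \<open>l s\<close>.\<close>
    have QV: "V s \<omega> * 2 powr (- r - 1) \<le> Q \<omega>" if \<omega>: "\<omega> \<in> A" for \<omega>
    proof -
      have "L \<omega> / (1 + s) \<le> (l s + 1) / (1 + s)" using \<omega> s(1) by (intro divide_right_mono) (auto simp: A_def)
      also have "\<dots> = r + lZ s + 1 / (1 + s)" using s(1) by (simp add: l_def add_divide_distrib)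
      also have "\<dots> \<le> r + lZ s + 1" using s(1) by simp
      finally have "L \<omega> / (1 + s) - lZ s - r - 1 \<le> 0" by simp
      hence "2 powr (L \<omega> / (1 + s) - lZ s - r - 1) \<le> 2 powr 0" by (intro powr_mono) auto
      moreover have "V s \<omega> * 2 powr (- r - 1) = Q \<omega> * 2 powr (L \<omega> / (1 + s) - lZ s - r - 1)"
        unfolding V mult.assoc powr_add[symmetric] by (simp add: algebra_simps)
      moreover have "0 \<le> Q \<omega>" using Q0 \<omega> by (simp add: A_def)
      ultimately show ?thesis by (simp add: mult_left_le)
    qed
    have "\<gamma> * 2 powr (- r) / (8 * (real n + 1)) = \<gamma> * (1 / (4 * (real n + 1)) * 2 powr (- r - 1))"
      by (simp add: powr_diff field_simps)
    also have "\<dots> \<le> \<gamma> * ((\<Sum>\<omega>\<in>A. V s \<omega>) * 2 powr (- r - 1))"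
      using win by (intro mult_left_mono mult_right_mono) (auto simp: \<gamma>_def)
    also have "\<dots> \<le> \<gamma> * (\<Sum>\<omega>\<in>A. Q \<omega>)"
      unfolding sum_distrib_right by (intro mult_left_mono sum_mono QV) (auto simp: \<gamma>_def)
    also have "\<dots> = (\<Sum>\<omega>\<in>A. min (Q \<omega> * 2 powr L \<omega>) (\<gamma> * Q \<omega>))"
      unfolding sum_distrib_left
    proof (intro sum.cong refl)
      fix \<omega> assume \<omega>: "\<omega> \<in> A"
      hence "Q \<omega> * \<gamma> \<le> Q \<omega> * 2 powr L \<omega>" using Q0 by (intro mult_left_mono) (auto simp: A_def \<gamma>_def)
      thus "\<gamma> * Q \<omega> = min (Q \<omega> * 2 powr L \<omega>) (\<gamma> * Q \<omega>)" by (simp add: mult.commute)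
    qed
    also have "\<dots> \<le> (\<Sum>\<omega>\<in>\<Omega>. min (Q \<omega> * 2 powr L \<omega>) (\<gamma> * Q \<omega>))"
      using fin\<Omega> Q0 by (intro sum_mono2) (auto simp: A_def \<gamma>_def)
    finally show ?thesis
      using l[OF s(1)] s(1) by (intro exI[of _ \<gamma>]) (simp add: \<Omega>_def L_def Q_def \<gamma>_def)
  qed
qed

section \<open>A minimax theorem\<close>

lemma young_powr:
  fixes a b :: real
  assumes "0 < a" "0 < b" "0 \<le> \<theta>" "\<theta> \<le> 1"
  shows "a powr \<theta> * b powr (1 - \<theta>) \<le> \<theta> * a + (1 - \<theta>) * b"
  using Youngs_inequality_0[of \<theta> "1 - \<theta>" a b] assms by simp

text \<open>\<open>G\<close> is the perspective of a log-sum-exp function. The inequality is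
  Hoelder's, obtained from Young's inequality for the normalized terms. With u = 1 + s it gives
  concavity in \<open>s\<close> of the sphere-packing objective.\<close>

lemma perspective_log_sum_convex:
  fixes q X :: "'b \<Rightarrow> real"
  assumes fin: "finite I" and q: "\<And>a. a \<in> I \<Longrightarrow> 0 \<le> q a" "b \<in> I" "0 < q b"
    and u: "0 < u1" "0 < u2" and w: "0 \<le> w" "w \<le> 1"
  defines "G \<equiv> \<lambda>u. u * log 2 (\<Sum>a\<in>I. q a * 2 powr (X a / u))"
  shows "G (w * u1 + (1 - w) * u2) \<le> w * G u1 + (1 - w) * G u2"
proof -
  define u where "u = w * u1 + (1 - w) * u2"
  define Z where "Z u = (\<Sum>a\<in>I. q a * 2 powr (X a / u))" for u
  have Zpos: "0 < Z u" for u
    unfolding Z_def using q fin by (intro sum_pos2[of _ b]) auto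
  have upos: "0 < u"
  proof (cases "w = 0")
    case False
    hence "0 < w * u1" using u w by simp
    thus ?thesis using u w by (simp add: u_def add_pos_nonneg)
  qed (use u in \<open>simp add: u_def\<close>)
  \<comment> \<open>Chosen so that \<open>\<theta> / u1 = w / u\<close> and
    \<open>(1 - \<theta>) / u2 = (1 - w) / u\<close>, which makes the exponents add up to
    \<open>X a / u\<close>.\<close>
  define \<theta> where "\<theta> = w * u1 / u"
  have \<theta>': "1 - \<theta> = (1 - w) * u2 / u" using upos by (simp add: \<theta>_def u_def field_simps)
  have \<theta>: "0 \<le> \<theta>" "\<theta> \<le> 1"
  proof -
    show "0 \<le> \<theta>" using w u upos by (simp add: \<theta>_def)
    have "0 \<le> 1 - \<theta>" unfolding \<theta>' using w u upos by simp
    thus "\<theta> \<le> 1" by simp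
  qed
  have term_le: "2 powr (X a / u) \<le> Z u1 powr \<theta> * Z u2 powr (1 - \<theta>) *
      (\<theta> * (2 powr (X a / u1) / Z u1) + (1 - \<theta>) * (2 powr (X a / u2) / Z u2))" for a
  proof -
    have "\<theta> / u1 = w / u" "(1 - \<theta>) / u2 = (1 - w) / u" unfolding \<theta>' using u by (auto simp: \<theta>_def)
    hence "X a / u1 * \<theta> + X a / u2 * (1 - \<theta>) = X a * (w / u) + X a * ((1 - w) / u)"
      by (metis times_divide_eq_left times_divide_eq_right)
    also have "\<dots> = X a / u" by (simp add: distrib_left[symmetric] add_divide_distrib[symmetric])
    finally have "2 powr (X a / u) = (2 powr (X a / u1)) powr \<theta> * (2 powr (X a / u2)) powr (1 - \<theta>)"
      by (simp add: powr_powr powr_add[symmetric])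
    also have "\<dots> = Z u1 powr \<theta> * Z u2 powr (1 - \<theta>) *
        ((2 powr (X a / u1) / Z u1) powr \<theta> * (2 powr (X a / u2) / Z u2) powr (1 - \<theta>))"
      using Zpos[of u1] Zpos[of u2] by (simp add: powr_divide)
    also have "\<dots> \<le> Z u1 powr \<theta> * Z u2 powr (1 - \<theta>) *
      (\<theta> * (2 powr (X a / u1) / Z u1) + (1 - \<theta>) * (2 powr (X a / u2) / Z u2))"
      using Zpos \<theta> by (intro mult_left_mono young_powr) auto
    finally show ?thesis .
  qed
  have "Z u \<le> (\<Sum>a\<in>I. q a * (Z u1 powr \<theta> * Z u2 powr (1 - \<theta>) *
      (\<theta> * (2 powr (X a / u1) / Z u1) + (1 - \<theta>) * (2 powr (X a / u2) / Z u2))))"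
    unfolding Z_def[of u] by (intro sum_mono mult_left_mono term_le q)
  also have "\<dots> = Z u1 powr \<theta> * Z u2 powr (1 - \<theta>) * (\<theta> * (Z u1 / Z u1) + (1 - \<theta>) * (Z u2 / Z u2))"
  proof -
    have "(\<Sum>a\<in>I. q a * (2 powr (X a / v) / Z v)) = (\<Sum>a\<in>I. q a * 2 powr (X a / v)) / Z v" for v
      by (simp add: sum_divide_distrib)
    hence "(\<Sum>a\<in>I. q a * (2 powr (X a / v) / Z v)) = Z v / Z v" for v
      by (simp only: Z_def)
    hence "\<theta> * (Z u1 / Z u1) + (1 - \<theta>) * (Z u2 / Z u2) =
      \<theta> * (\<Sum>a\<in>I. q a * (2 powr (X a / u1) / Z u1)) + (1 - \<theta>) * (\<Sum>a\<in>I. q a * (2 powr (X a / u2) / Z u2))"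
      by simp
    also have "\<dots> = (\<Sum>a\<in>I. q a * (\<theta> * (2 powr (X a / u1) / Z u1) + (1 - \<theta>) * (2 powr (X a / u2) / Z u2)))"
      by (simp add: sum_distrib_left sum.distrib distrib_left mult.left_commute)
    finally show ?thesis by (simp add: sum_distrib_left mult.left_commute)
  qed
  also have "\<dots> = Z u1 powr \<theta> * Z u2 powr (1 - \<theta>)" using Zpos[of u1] Zpos[of u2] by simp
  finally have "Z u \<le> Z u1 powr \<theta> * Z u2 powr (1 - \<theta>)" .
  moreover have "0 < Z u1 powr \<theta> * Z u2 powr (1 - \<theta>)" using Zpos[of u1] Zpos[of u2] by simp
  ultimately have "log 2 (Z u) \<le> log 2 (Z u1 powr \<theta> * Z u2 powr (1 - \<theta>))"
    using Zpos[of u] by (subst log_le_cancel_iff) auto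
  also have "\<dots> = \<theta> * log 2 (Z u1) + (1 - \<theta>) * log 2 (Z u2)"
    using Zpos[of u1] Zpos[of u2] by (simp add: log_mult log_powr)
  finally have "u * log 2 (Z u) \<le> u * (\<theta> * log 2 (Z u1) + (1 - \<theta>) * log 2 (Z u2))"
    using upos by simp
  also have "\<dots> = (u * \<theta>) * log 2 (Z u1) + (u * (1 - \<theta>)) * log 2 (Z u2)" by (simp add: algebra_simps)
  also have "u * \<theta> = w * u1" using upos by (simp add: \<theta>_def)
  also have "u * (1 - \<theta>) = (1 - w) * u2" unfolding \<theta>' using upos by simp
  finally show ?thesis unfolding G_def u_def[symmetric] Z_def[symmetric] by (simp add: mult.assoc)
qed

text \<open>The set of pairs lying above some (F a - c, G a - c) is convex and misses the open
  negative quadrant; the normalized normal of a separating line gives \<open>w\<close>. Mixing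
  enters only through \<open>m\<close>, so \<open>K\<close> may be any type with an abstract convex
  combination.\<close>

lemma two_function_alternative:
  fixes F G :: "'a \<Rightarrow> real" and m :: "real \<Rightarrow> 'a \<Rightarrow> 'a \<Rightarrow> 'a"
  assumes m: "\<And>w a b. 0 \<le> w \<Longrightarrow> w \<le> 1 \<Longrightarrow> a \<in> K \<Longrightarrow> b \<in> K \<Longrightarrow> m w a b \<in> K"
    and F: "\<And>w a b. 0 \<le> w \<Longrightarrow> w \<le> 1 \<Longrightarrow> a \<in> K \<Longrightarrow> b \<in> K \<Longrightarrow> F (m w a b) \<le> w * F a + (1 - w) * F b"
    and G: "\<And>w a b. 0 \<le> w \<Longrightarrow> w \<le> 1 \<Longrightarrow> a \<in> K \<Longrightarrow> b \<in> K \<Longrightarrow> G (m w a b) \<le> w * G a + (1 - w) * G b"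
    and no: "\<And>a. a \<in> K \<Longrightarrow> \<not> (F a < c \<and> G a < c)"
  shows "\<exists>w. 0 \<le> w \<and> w \<le> 1 \<and> (\<forall>a\<in>K. c \<le> w * F a + (1 - w) * G a)"
proof (cases "K = {}")
  case False
  define C where "C = {p :: real \<times> real. \<exists>a\<in>K. F a - c \<le> fst p \<and> G a - c \<le> snd p}"
  define N where "N = {p :: real \<times> real. fst p < 0 \<and> snd p < 0}"
  have "convex N" unfolding N_def convex_alt
  proof (intro allI ballI impI, elim conjE)
    fix x y :: "real \<times> real" and u :: real
    assume "x \<in> {p. fst p < 0 \<and> snd p < 0}" "y \<in> {p. fst p < 0 \<and> snd p < 0}" "0 \<le> u" "u \<le> 1"
    thus "(1 - u) *\<^sub>R x + u *\<^sub>R y \<in> {p. fst p < 0 \<and> snd p < 0}"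
      using convex_bound_lt[of "fst x" 0 "fst y" "1 - u" u] convex_bound_lt[of "snd x" 0 "snd y" "1 - u" u] by simp
  qed
  moreover have "convex C" unfolding convex_alt
  proof (intro allI ballI impI, elim conjE)
    fix x y :: "real \<times> real" and u :: real
    assume "x \<in> C" "y \<in> C" and u: "0 \<le> u" "u \<le> 1"
    then obtain a b where a: "a \<in> K" "F a - c \<le> fst x" "G a - c \<le> snd x"
      and b: "b \<in> K" "F b - c \<le> fst y" "G b - c \<le> snd y" unfolding C_def by auto
    have "F (m (1 - u) a b) \<le> (1 - u) * F a + u * F b" "G (m (1 - u) a b) \<le> (1 - u) * G a + u * G b"
      using F[of "1 - u" a b] G[of "1 - u" a b] u a b by auto
    moreover have "(1 - u) * (F a - c) \<le> (1 - u) * fst x" "u * (F b - c) \<le> u * fst y"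
      "(1 - u) * (G a - c) \<le> (1 - u) * snd x" "u * (G b - c) \<le> u * snd y"
      using u a b by (auto intro!: mult_left_mono)
    ultimately have "F (m (1 - u) a b) - c \<le> (1 - u) * fst x + u * fst y"
      "G (m (1 - u) a b) - c \<le> (1 - u) * snd x + u * snd y"
      by (auto simp: algebra_simps)
    moreover have "m (1 - u) a b \<in> K" using m u a b by simp
    ultimately show "(1 - u) *\<^sub>R x + u *\<^sub>R y \<in> C" unfolding C_def by auto
  qed
  moreover have "N \<noteq> {}" unfolding N_def by (auto intro!: exI[of _ "-1"])
  moreover have "C \<noteq> {}" using False unfolding C_def by auto
  moreover have "N \<inter> C = {}" unfolding N_def C_def using no by fastforce
  ultimately obtain h \<beta> where h: "h \<noteq> 0" and hN: "\<forall>x\<in>N. inner h x \<le> \<beta>" and hC: "\<forall>x\<in>C. \<beta> \<le> inner h x"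
    using separating_hyperplane_sets[of N C] by blast
  obtain h1 h2 where hh: "h = (h1, h2)" by force
  have N: "h1 * (- x) + h2 * (- y) \<le> \<beta>" if "0 < x" "0 < y" for x y
    using hN[rule_format, of "(- x, - y)"] that by (simp add: hh N_def)
  \<comment> \<open>Points of the quadrant approach the origin, where the functional is
    zero.\<close>
  have b0: "0 \<le> \<beta>"
  proof (rule field_le_epsilon)
    fix e :: real assume e: "0 < e"
    define x where "x = e / (\<bar>h1\<bar> + \<bar>h2\<bar> + 1)"
    have x: "0 < x" using e by (simp add: x_def add_pos_nonneg)
    have "(h1 + h2) * x \<le> (\<bar>h1\<bar> + \<bar>h2\<bar> + 1) * x" using x by (intro mult_right_mono) auto
    also have "\<dots> = e" unfolding x_def using abs_ge_zero[of h1] abs_ge_zero[of h2] by (simp add: field_simps)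
    finally show "0 \<le> \<beta> + e" using N[OF x x] by (simp add: algebra_simps)
  qed
  \<comment> \<open>A negative coefficient would make the functional unbounded above on the
    quadrant.\<close>
  have h0: "0 \<le> h1" "0 \<le> h2"
  proof -
    show "0 \<le> h1"
    proof (rule ccontr)
      assume "\<not> 0 \<le> h1"
      hence neg: "h1 < 0" by simp
      define x where "x = (\<beta> + \<bar>h2\<bar> + 1) / (- h1)"
      have "0 < x" unfolding x_def using neg b0 by (intro divide_pos_pos) auto
      moreover have "h1 * (- x) = \<beta> + \<bar>h2\<bar> + 1" unfolding x_def using neg by simp
      ultimately show False using N[of x 1] by simp
    qed
    show "0 \<le> h2"
    proof (rule ccontr)
      assume "\<not> 0 \<le> h2"
      hence neg: "h2 < 0" by simp
      define x where "x = (\<beta> + \<bar>h1\<bar> + 1) / (- h2)"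
      have "0 < x" unfolding x_def using neg b0 by (intro divide_pos_pos) auto
      moreover have "h2 * (- x) = \<beta> + \<bar>h1\<bar> + 1" unfolding x_def using neg by simp
      ultimately show False using N[of 1 x] by simp
    qed
  qed
  have sum_pos: "0 < h1 + h2" using h h0 unfolding hh by (cases "h1 = 0") (auto simp: zero_prod_def)
  define w where "w = h1 / (h1 + h2)"
  have w: "0 \<le> w" "w \<le> 1" "1 - w = h2 / (h1 + h2)"
    unfolding w_def using h0 sum_pos by (auto simp: field_simps)
  have "c \<le> w * F a + (1 - w) * G a" if "a \<in> K" for a
  proof -
    have "(F a - c, G a - c) \<in> C" unfolding C_def using that by auto
    hence "0 \<le> h1 * (F a - c) + h2 * (G a - c)" using hC b0 by (force simp: hh)
    hence "0 \<le> (h1 * (F a - c) + h2 * (G a - c)) / (h1 + h2)" using sum_pos by simp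
    also have "\<dots> = w * (F a - c) + (1 - w) * (G a - c)" unfolding w(3) by (simp add: w_def add_divide_distrib)
    finally show ?thesis by (simp add: algebra_simps)
  qed
  thus ?thesis using w by blast
qed auto

text \<open>The alternative for two functions combines the \<open>t\<close> found for the earlier
  points with the new point \<open>s'\<close>; concavity in \<open>s\<close> then replaces the
  combination of two functions by a single value of the parameter. The domain \<open>K\<close> is
  generalized in the induction.\<close>

lemma finite_minimax:
  fixes F :: "real \<Rightarrow> 'a \<Rightarrow> real" and m :: "real \<Rightarrow> 'a \<Rightarrow> 'a \<Rightarrow> 'a"
  assumes "finite S" "\<And>s. s \<in> S \<Longrightarrow> 0 \<le> s"
    and m: "\<And>w a b. 0 \<le> w \<Longrightarrow> w \<le> 1 \<Longrightarrow> a \<in> K \<Longrightarrow> b \<in> K \<Longrightarrow> m w a b \<in> K"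
    and convex: "\<And>s w a b. 0 \<le> s \<Longrightarrow> 0 \<le> w \<Longrightarrow> w \<le> 1 \<Longrightarrow> a \<in> K \<Longrightarrow> b \<in> K \<Longrightarrow>
      F s (m w a b) \<le> w * F s a + (1 - w) * F s b"
    and concave: "\<And>s t w a. 0 \<le> s \<Longrightarrow> 0 \<le> t \<Longrightarrow> 0 \<le> w \<Longrightarrow> w \<le> 1 \<Longrightarrow> a \<in> K \<Longrightarrow>
      w * F s a + (1 - w) * F t a \<le> F (w * s + (1 - w) * t) a"
    and no: "\<not> (\<exists>a\<in>K. \<forall>s\<in>S. F s a < c)"
  shows "\<exists>t\<ge>0. \<forall>a\<in>K. c \<le> F t a"
  using assms
proof (induction S arbitrary: K rule: finite_induct)
  case empty
  thus ?case by auto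
next
  case (insert s' S)
  \<comment> \<open>A strict sublevel set of a convex function is closed under \<open>m\<close>, so
    the induction hypothesis applies to it. Outside it \<open>F s'\<close> is already at least
    \<open>c\<close>.\<close>
  define K' where "K' = {a \<in> K. F s' a < c}"
  have s': "0 \<le> s'" using insert.prems by simp
  have "\<exists>t\<ge>0. \<forall>a\<in>K'. c \<le> F t a"
  proof (rule insert.IH)
    show "\<not> (\<exists>a\<in>K'. \<forall>s\<in>S. F s a < c)" using insert.prems(5) by (auto simp: K'_def)
    fix w :: real and a b assume w: "0 \<le> w" "w \<le> 1" and "a \<in> K'" "b \<in> K'"
    hence *: "a \<in> K" "b \<in> K" "F s' a < c" "F s' b < c" by (auto simp: K'_def)
    have "F s' (m w a b) \<le> w * F s' a + (1 - w) * F s' b" by (rule insert.prems(3)[OF s' w *(1,2)])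
    also have "\<dots> < c" using convex_bound_lt[OF *(3,4), of w "1 - w"] w by simp
    finally show "m w a b \<in> K'" using insert.prems(2)[OF w *(1,2)] by (simp add: K'_def)
  qed (use insert.prems in \<open>auto simp: K'_def\<close>)
  then obtain t where t: "0 \<le> t" "\<And>a. a \<in> K' \<Longrightarrow> c \<le> F t a" by blast
  have "\<exists>w. 0 \<le> w \<and> w \<le> 1 \<and> (\<forall>a\<in>K. c \<le> w * F t a + (1 - w) * F s' a)"
    by (rule two_function_alternative[of K m, OF insert.prems(2) insert.prems(3)[OF t(1)] insert.prems(3)[OF s']])
      (use t(2) in \<open>force simp: K'_def\<close>)+
  then obtain w where w: "0 \<le> w" "w \<le> 1" "\<And>a. a \<in> K \<Longrightarrow> c \<le> w * F t a + (1 - w) * F s' a" by blast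
  have "c \<le> F (w * t + (1 - w) * s') a" if "a \<in> K" for a
    using w(3)[OF that] insert.prems(4)[OF t(1) s' w(1,2) that] by linarith
  moreover have "0 \<le> w * t + (1 - w) * s'" using w t s' by simp
  ultimately show ?case by blast
qed

text \<open>A concave function on \<open>[0, \<infinity>)\<close> vanishing at \<open>0\<close> and below \<open>C s\<close> is controlled by
  its values on a fine enough finite grid, because \<open>\<Phi> s / s\<close> is nonincreasing.\<close>

lemma concave_grid:
  fixes E C \<eta> \<delta> :: real
  assumes E: "0 \<le> E" and C: "0 \<le> C" and \<eta>: "0 < \<eta>" and \<delta>: "0 < \<delta>"
  shows "\<exists>S. finite S \<and> (\<forall>s\<in>S. 0 \<le> s) \<and> (\<forall>\<Phi>. \<Phi> 0 = 0 \<longrightarrow> (\<forall>s\<ge>0. \<Phi> s \<le> C * s) \<longrightarrow>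
    (\<forall>s\<ge>0. \<forall>t\<ge>0. \<forall>w\<in>{0..1}. w * \<Phi> s + (1 - w) * \<Phi> t \<le> \<Phi> (w * s + (1 - w) * t)) \<longrightarrow>
    (\<forall>s\<in>S. \<Phi> s < E) \<longrightarrow> (\<forall>s\<ge>0. \<Phi> s \<le> E + \<eta> + s * \<delta>))"
proof -
  \<comment> \<open>Within one grid step a function of slope at most \<open>C\<close> gains at most
    \<eta>.\<close>
  define h where "h = \<eta> / (C + 1)"
  have h: "0 < h" "C * h \<le> \<eta>" unfolding h_def using C \<eta> by (auto simp: field_simps)
  \<comment> \<open>The grid extends until the slope \<open>E / (N * h)\<close> of a chord ending
    there is at most \<delta>.\<close>
  define N where "N = nat \<lceil>E / (\<delta> * h)\<rceil> + 1"
  have "E / (\<delta> * h) \<le> real N" unfolding N_def by linarith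
  hence "E \<le> real N * (\<delta> * h)" using h \<delta> by (simp add: divide_le_eq)
  moreover have N0: "0 < real N" by (simp add: N_def)
  ultimately have N: "E / (real N * h) \<le> \<delta>" using h by (simp add: divide_le_eq mult_ac)
  define S where "S = (\<lambda>i. real i * h) ` {1..N}"
  have "\<Phi> s \<le> E + \<eta> + s * \<delta>"
    if \<Phi>0: "\<Phi> 0 = 0" and le: "\<forall>s\<ge>0. \<Phi> s \<le> C * s"
      and conc: "\<forall>s\<ge>0. \<forall>t\<ge>0. \<forall>w\<in>{0..1}. w * \<Phi> s + (1 - w) * \<Phi> t \<le> \<Phi> (w * s + (1 - w) * t)"
      and S: "\<forall>s\<in>S. \<Phi> s < E" and s: "0 \<le> s" for \<Phi> and s :: real
  proof -
    have slope: "\<Phi> s \<le> s / t * \<Phi> t" if "0 < t" "t \<le> s" for t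
    proof -
      have "t / s * \<Phi> s \<le> \<Phi> t" using conc[rule_format, of s 0 "t / s"] that \<Phi>0 by simp
      thus ?thesis using that by (simp add: field_simps)
    qed
    define i where "i = nat \<lfloor>s / h\<rfloor>"
    have i: "real i * h \<le> s" "s \<le> real i * h + h"
    proof -
      have "real i \<le> s / h" "s / h \<le> real i + 1" unfolding i_def using s h by (auto simp: of_nat_nat)
      thus "real i * h \<le> s" "s \<le> real i * h + h" using h by (auto simp: field_simps)
    qed
    consider "i = 0" | "1 \<le> i" "i \<le> N" | "N < i" by linarith
    thus ?thesis
    proof cases
      case 1
      have "\<Phi> s \<le> C * s" using le s by blast
      also have "C * s \<le> C * h" using 1 i(2) C by (intro mult_left_mono) auto
      finally show ?thesis using h(2) E mult_nonneg_nonneg[OF s less_imp_le[OF \<delta>]] by linarith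
    next
      case 2
      define t where "t = real i * h"
      have t: "0 < t" "t \<le> s" "s - t \<le> h" using 2 h i by (auto simp: t_def)
      have "t \<in> S" unfolding S_def t_def using 2 by auto
      hence tE: "\<Phi> t < E" using S by blast
      have "\<Phi> t / t \<le> C" using le t by (simp add: divide_le_eq)
      hence "(s - t) * (\<Phi> t / t) \<le> (s - t) * C" using t by (intro mult_left_mono) auto
      also have "\<dots> \<le> h * C" using t C by (intro mult_right_mono) auto
      also have "\<dots> \<le> \<eta>" using h by (simp add: mult.commute)
      finally have "s / t * \<Phi> t \<le> \<Phi> t + \<eta>" using t by (simp add: field_simps)
      thus ?thesis using slope[OF t(1,2)] tE mult_nonneg_nonneg[OF s less_imp_le[OF \<delta>]] by linarith
    next
      case 3
      define t where "t = real N * h"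
      have t: "0 < t" "t \<le> s"
      proof -
        show "0 < t" using h N0 by (simp add: t_def)
        have "t \<le> real i * h" unfolding t_def using 3 h by (intro mult_right_mono) auto
        thus "t \<le> s" using i by simp
      qed
      have "t \<in> S" unfolding S_def t_def using N0 by (intro imageI) auto
      hence "\<Phi> t < E" using S by blast
      hence "s / t * \<Phi> t \<le> s / t * E" using t by (intro mult_left_mono) auto
      also have "\<dots> = s * (E / (real N * h))" by (simp add: t_def)
      also have "\<dots> \<le> s * \<delta>" using N s by (intro mult_left_mono) auto
      finally show ?thesis using slope[OF t] E \<eta> by linarith
    qed
  qed
  moreover have "finite S" "\<forall>s\<in>S. 0 \<le> s" using h by (auto simp: S_def)
  ultimately show ?thesis by (intro exI[of _ S]) blast
qed

text \<open>The grid takes the place of compactness in \<open>s\<close>: if no single point worked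
  for all its finitely many values, one value \<open>t\<close> would be bad for every point of
  \<open>K\<close>. Passing from the grid to all \<open>s\<close> costs
  \<open>\<eta> + s * \<delta>\<close>.\<close>

theorem concave_convex_minimax:
  fixes F :: "real \<Rightarrow> 'a \<Rightarrow> real" and m :: "real \<Rightarrow> 'a \<Rightarrow> 'a \<Rightarrow> 'a"
  assumes m: "\<And>w a b. 0 \<le> w \<Longrightarrow> w \<le> 1 \<Longrightarrow> a \<in> K \<Longrightarrow> b \<in> K \<Longrightarrow> m w a b \<in> K"
    and convex: "\<And>s w a b. 0 \<le> s \<Longrightarrow> 0 \<le> w \<Longrightarrow> w \<le> 1 \<Longrightarrow> a \<in> K \<Longrightarrow> b \<in> K \<Longrightarrow>
      F s (m w a b) \<le> w * F s a + (1 - w) * F s b"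
    and concave: "\<And>s t w a. 0 \<le> s \<Longrightarrow> 0 \<le> t \<Longrightarrow> 0 \<le> w \<Longrightarrow> w \<le> 1 \<Longrightarrow> a \<in> K \<Longrightarrow>
      w * F s a + (1 - w) * F t a \<le> F (w * s + (1 - w) * t) a"
    and zero: "\<And>a. a \<in> K \<Longrightarrow> F 0 a = 0"
    and bound: "\<And>s a. 0 \<le> s \<Longrightarrow> a \<in> K \<Longrightarrow> F s a \<le> C * s" and C: "0 \<le> C"
    and ex: "\<And>s. 0 \<le> s \<Longrightarrow> \<exists>a\<in>K. F s a < E" and E: "0 \<le> E" and \<eta>: "0 < \<eta>" and \<delta>: "0 < \<delta>"
  shows "\<exists>a\<in>K. \<forall>s\<ge>0. F s a \<le> E + \<eta> + s * \<delta>"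
proof -
  from concave_grid[OF E C \<eta> \<delta>] obtain S where S: "finite S" "\<forall>s\<in>S. 0 \<le> s"
    and grid: "\<forall>\<Phi>. \<Phi> 0 = 0 \<longrightarrow> (\<forall>s\<ge>0. \<Phi> s \<le> C * s) \<longrightarrow>
    (\<forall>s\<ge>0. \<forall>t\<ge>0. \<forall>w\<in>{0..1}. w * \<Phi> s + (1 - w) * \<Phi> t \<le> \<Phi> (w * s + (1 - w) * t)) \<longrightarrow>
    (\<forall>s\<in>S. \<Phi> s < E) \<longrightarrow> (\<forall>s\<ge>0. \<Phi> s \<le> E + \<eta> + s * \<delta>)"
    by (elim exE conjE)
  have "\<exists>a\<in>K. \<forall>s\<in>S. F s a < E"
  proof (rule ccontr)
    assume "\<not> ?thesis"
    hence "\<exists>t\<ge>0. \<forall>a\<in>K. E \<le> F t a"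
    proof (rule finite_minimax[of S K m F E, rotated -1])
      show "0 \<le> s" if "s \<in> S" for s using S that by blast
    qed (use S(1) m convex concave in blast)+
    then obtain t where "0 \<le> t" "\<forall>a\<in>K. E \<le> F t a" by blast
    thus False using ex[of t] by force
  qed
  then obtain a where a: "a \<in> K" "\<forall>s\<in>S. F s a < E" by blast
  have "\<forall>s\<ge>0. F s a \<le> E + \<eta> + s * \<delta>"
  proof (rule grid[THEN spec, THEN mp, THEN mp, THEN mp, THEN mp])
    show "F 0 a = 0" by (rule zero[OF a(1)])
    show "\<forall>s\<ge>0. F s a \<le> C * s" using bound[OF _ a(1)] by blast
    show "\<forall>s\<ge>0. \<forall>t\<ge>0. \<forall>w\<in>{0..1}. w * F s a + (1 - w) * F t a \<le> F (w * s + (1 - w) * t) a"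
      using concave[OF _ _ _ _ a(1)] by auto
    show "\<forall>s\<in>S. F s a < E" by (rule a(2))
  qed
  thus ?thesis using a(1) by blast
qed

section \<open>Comparison with classical tests\<close>

lemma is_eig_decomp_eigenvector:
  assumes A: "A \<in> carrier_mat d d" and dec: "is_eig_decomp A U e" and k: "k < d" and i: "i < d"
  shows "(\<Sum>j<d. A $$ (i, j) * U $$ (j, k)) = of_real (e k) * U $$ (i, k)"
proof -
  have "(\<Sum>j<d. A $$ (i, j) * U $$ (j, k)) =
      (\<Sum>j<d. \<Sum>l<d. U $$ (i, l) * of_real (e l) * (cnj (U $$ (j, l)) * U $$ (j, k)))"
    by (intro sum.cong refl) (simp add: is_eig_decompD(4)[OF A dec i] sum_distrib_right mult.assoc)
  also have "\<dots> = (\<Sum>l<d. \<Sum>j<d. U $$ (i, l) * of_real (e l) * (cnj (U $$ (j, l)) * U $$ (j, k)))"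
    by (rule sum.swap)
  also have "\<dots> = (\<Sum>l<d. if l = k then U $$ (i, l) * of_real (e l) else 0)"
    by (intro sum.cong refl) (simp add: sum_distrib_left[symmetric] is_eig_decompD(2)[OF A dec] k)
  finally show ?thesis using k by (simp add: mult.commute)
qed

lemma eig_coef_mult_vec:
  assumes A: "A \<in> carrier_mat d d" and dec: "is_eig_decomp A U e" and k: "k < d"
  shows "eig_coef d U (\<lambda>i. \<Sum>j<d. A $$ (i, j) * v j) k = of_real (e k) * eig_coef d U v k"
proof -
  have h: "hermitian d A" by (rule is_eig_decomp_hermitian[OF A dec])
  have "eig_coef d U (\<lambda>i. \<Sum>j<d. A $$ (i, j) * v j) k = (\<Sum>j<d. cnj (\<Sum>i<d. A $$ (j, i) * U $$ (i, k)) * v j)"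
    unfolding eig_coef_def by (rule hermitian_adjoint_sum[OF h])
  also have "\<dots> = (\<Sum>j<d. of_real (e k) * (cnj (U $$ (j, k)) * v j))"
    by (intro sum.cong refl) (simp add: is_eig_decomp_eigenvector[OF A dec k] mult.assoc)
  finally show ?thesis by (simp add: eig_coef_def sum_distrib_left)
qed

text \<open>The square of a matrix between zero and the identity is at most the matrix itself, since
  its eigenvalues lie in [0, 1].\<close>

lemma norm_test_vec_le_qform:
  assumes T: "psd d T" and T1: "psd d (1\<^sub>m d - T)"
  shows "(\<Sum>i<d. (cmod (\<Sum>j<d. T $$ (i, j) * v j))\<^sup>2) \<le> Re (qform d T v)"
proof -
  obtain U e where A: "T \<in> carrier_mat d d" "is_eig_decomp T U e" and e: "\<And>k. k < d \<Longrightarrow> 0 \<le> e k"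
    using psd_obtain_eig[OF T] by metis
  have e1: "e k \<le> 1" if k: "k < d" for k
  proof -
    have one: "qform d (1\<^sub>m d) (\<lambda>i. U $$ (i, k)) = 1"
      unfolding qform_one of_real_sum complex_norm_square
      using is_eig_decompD(2)[OF A k k] by (simp add: mult.commute)
    have "0 \<le> Re (qform d (1\<^sub>m d - T) (\<lambda>i. U $$ (i, k)))" using T1 unfolding psd_iff_qform by blast
    thus ?thesis using one qform_col[OF A k] A(1) by (simp add: qform_minus)
  qed
  have "(\<Sum>i<d. (cmod (\<Sum>j<d. T $$ (i, j) * v j))\<^sup>2) =
      (\<Sum>k<d. (cmod (eig_coef d U (\<lambda>i. \<Sum>j<d. T $$ (i, j) * v j) k))\<^sup>2)"
    by (rule sum_eig_coef[OF A, symmetric])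
  also have "\<dots> = (\<Sum>k<d. (e k)\<^sup>2 * (cmod (eig_coef d U v k))\<^sup>2)"
    by (intro sum.cong refl) (simp add: eig_coef_mult_vec[OF A] norm_mult power_mult_distrib)
  also have "\<dots> \<le> (\<Sum>k<d. e k * (cmod (eig_coef d U v k))\<^sup>2)"
    by (intro sum_mono mult_right_mono) (use e e1 in \<open>auto simp: power2_eq_square mult_left_le\<close>)
  finally show ?thesis unfolding qform_eig[OF A] by simp
qed

lemma norm_add_half:
  fixes a b :: complex
  shows "(cmod (a + b))\<^sup>2 / 2 \<le> (cmod a)\<^sup>2 + (cmod b)\<^sup>2"
proof -
  have "(cmod (a + b))\<^sup>2 \<le> (cmod a + cmod b)\<^sup>2" by (intro power_mono norm_triangle_ineq) auto
  also have "\<dots> \<le> 2 * ((cmod a)\<^sup>2 + (cmod b)\<^sup>2)"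
    using sum_squares_bound[of "cmod a" "cmod b"] by (simp add: power2_sum)
  finally show ?thesis by simp
qed

text \<open>Each amplitude between the two eigenbases splits as \<open>c1 i j + c i j\<close>, its
  parts under 1 - T and T. The errors are at least the eigenvalue-weighted sums of the squared
  parts, and half the squared modulus of a sum is at most the sum of the squared moduli. This loses
  only the factor 2 against a classical test.\<close>

theorem nussbaum_szkola_bound:
  assumes A: "psd d A" "is_eig_decomp A U a" and B: "psd d B" "is_eig_decomp B V b"
    and T: "psd d T" "psd d (1\<^sub>m d - T)" and \<gamma>: "0 \<le> \<gamma>"
  shows "(\<Sum>i<d. \<Sum>j<d. min (a i * overlap d U V i j) (\<gamma> * (b j * overlap d U V i j))) / 2
    \<le> Re (mat_trace ((1\<^sub>m d - T) * A)) + \<gamma> * Re (mat_trace (T * B))"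
proof -
  note Ac = psdD(1)[OF A(1)] and Bc = psdD(1)[OF B(1)] and Tc = psdD(1)[OF T(1)]
  note T1c = psdD(1)[OF T(2)]
  have a0: "0 \<le> a i" and b0: "0 \<le> b i" if "i < d" for i
    using psd_eig_nonneg[OF A that] psd_eig_nonneg[OF B that] by auto
  define u where "u i = (\<lambda>m. U $$ (m, i))" for i
  define v where "v j = (\<lambda>m. V $$ (m, j))" for j
  define c where "c i j = eig_coef d V (\<lambda>m. \<Sum>l<d. T $$ (m, l) * u i l) j" for i j
  define c1 where "c1 i j = eig_coef d V (\<lambda>m. \<Sum>l<d. (1\<^sub>m d - T) $$ (m, l) * u i l) j" for i j
  have TT: "1\<^sub>m d - (1\<^sub>m d - T) = T" using Tc by (intro eq_matI) auto
  have cc1: "c1 i j + c i j = eig_coef d V (u i) j" for i j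
  proof -
    have "(\<Sum>l<d. (1\<^sub>m d - T) $$ (m, l) * u i l) + (\<Sum>l<d. T $$ (m, l) * u i l) = u i m" if m: "m < d" for m
    proof -
      have "(\<Sum>l<d. (1\<^sub>m d - T) $$ (m, l) * u i l) + (\<Sum>l<d. T $$ (m, l) * u i l) = (\<Sum>l<d. if m = l then u i l else 0)"
        unfolding sum.distrib[symmetric] using Tc m by (intro sum.cong refl) (auto simp: left_diff_distrib)
      thus ?thesis using m by simp
    qed
    thus ?thesis unfolding c_def c1_def eig_coef_def sum.distrib[symmetric] distrib_left[symmetric] by simp
  qed
  have ov: "overlap d U V i j = (cmod (eig_coef d V (u i) j))\<^sup>2" for i j
    by (simp add: overlap_def eig_coef_def u_def)
  have 1: "Re (mat_trace ((1\<^sub>m d - T) * A)) \<ge> (\<Sum>i<d. \<Sum>j<d. a i * (cmod (c1 i j))\<^sup>2)"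
  proof -
    have "mat_trace ((1\<^sub>m d - T) * A) = mat_trace (mat_fun (\<lambda>t. t) A * (1\<^sub>m d - T))"
      unfolding mat_fun_ident[OF Ac A(2)] by (rule mat_trace_mult_comm[OF T1c Ac])
    also have "\<dots> = (\<Sum>i<d. of_real (a i) * qform d (1\<^sub>m d - T) (u i))"
      unfolding u_def by (rule trace_mat_fun_mult[OF Ac A(2) T1c])
    finally have "Re (mat_trace ((1\<^sub>m d - T) * A)) = (\<Sum>i<d. a i * Re (qform d (1\<^sub>m d - T) (u i)))" by simp
    also have "\<dots> \<ge> (\<Sum>i<d. a i * (\<Sum>m<d. (cmod (\<Sum>l<d. (1\<^sub>m d - T) $$ (m, l) * u i l))\<^sup>2))"
      using norm_test_vec_le_qform[OF T(2)] T(1) a0 by (intro sum_mono mult_left_mono) (auto simp: TT)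
    also have "(\<Sum>i<d. a i * (\<Sum>m<d. (cmod (\<Sum>l<d. (1\<^sub>m d - T) $$ (m, l) * u i l))\<^sup>2)) =
        (\<Sum>i<d. \<Sum>j<d. a i * (cmod (c1 i j))\<^sup>2)"
      unfolding c1_def sum_eig_coef[OF Bc B(2), symmetric, of "\<lambda>m. \<Sum>l<d. (1\<^sub>m d - T) $$ (m, l) * u _ l"]
      by (simp add: sum_distrib_left)
    finally show ?thesis .
  qed
  have 2: "Re (mat_trace (T * B)) \<ge> (\<Sum>i<d. \<Sum>j<d. b j * (cmod (c i j))\<^sup>2)"
  proof -
    \<comment> \<open>Self-adjointness of \<open>T\<close> identifies its matrix elements read from
      either eigenbasis up to conjugation.\<close>
    have cT: "cmod (eig_coef d U (\<lambda>m. \<Sum>l<d. T $$ (m, l) * v j l) i) = cmod (c i j)" for i j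
    proof -
      have "eig_coef d U (\<lambda>m. \<Sum>l<d. T $$ (m, l) * v j l) i = cnj (c i j)"
        unfolding c_def eig_coef_def
          hermitian_adjoint_sum[OF psdD(2)[OF T(1)], of "\<lambda>m. U $$ (m, i)" "v j"]
        by (simp add: u_def v_def mult.commute)
      thus ?thesis by simp
    qed
    have "mat_trace (T * B) = mat_trace (mat_fun (\<lambda>t. t) B * T)"
      unfolding mat_fun_ident[OF Bc B(2)] by (rule mat_trace_mult_comm[OF Tc Bc])
    also have "\<dots> = (\<Sum>j<d. of_real (b j) * qform d T (v j))"
      unfolding v_def by (rule trace_mat_fun_mult[OF Bc B(2) Tc])
    finally have "Re (mat_trace (T * B)) = (\<Sum>j<d. b j * Re (qform d T (v j)))" by simp
    also have "\<dots> \<ge> (\<Sum>j<d. b j * (\<Sum>m<d. (cmod (\<Sum>l<d. T $$ (m, l) * v j l))\<^sup>2))"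
      using norm_test_vec_le_qform[OF T] b0 by (intro sum_mono mult_left_mono) auto
    also have "(\<Sum>j<d. b j * (\<Sum>m<d. (cmod (\<Sum>l<d. T $$ (m, l) * v j l))\<^sup>2)) =
        (\<Sum>j<d. \<Sum>i<d. b j * (cmod (c i j))\<^sup>2)"
      unfolding sum_eig_coef[OF Ac A(2), symmetric, of "\<lambda>m. \<Sum>l<d. T $$ (m, l) * v _ l"] cT
      by (simp add: sum_distrib_left)
    also have "\<dots> = (\<Sum>i<d. \<Sum>j<d. b j * (cmod (c i j))\<^sup>2)" by (rule sum.swap)
    finally show ?thesis .
  qed
  have "(\<Sum>i<d. \<Sum>j<d. min (a i * overlap d U V i j) (\<gamma> * (b j * overlap d U V i j))) / 2 =
      (\<Sum>i<d. \<Sum>j<d. min (a i * overlap d U V i j) (\<gamma> * (b j * overlap d U V i j)) / 2)"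
    by (simp add: sum_divide_distrib)
  also have "\<dots> \<le> (\<Sum>i<d. \<Sum>j<d. a i * (cmod (c1 i j))\<^sup>2 + \<gamma> * (b j * (cmod (c i j))\<^sup>2))"
  proof (intro sum_mono)
    fix i j assume ij: "i \<in> {..<d}" "j \<in> {..<d}"
    define m where "m = min (a i) (\<gamma> * b j)"
    have m: "0 \<le> m" "m \<le> a i" "m \<le> \<gamma> * b j" unfolding m_def using a0 b0 ij \<gamma> by auto
    have "min (a i * overlap d U V i j) (\<gamma> * (b j * overlap d U V i j)) = m * overlap d U V i j"
      unfolding m_def using overlap_nonneg[of d U V i j]
      by (simp add: min_mult_distrib_right mult.assoc)
    also have "m * overlap d U V i j / 2 \<le> m * ((cmod (c1 i j))\<^sup>2 + (cmod (c i j))\<^sup>2)"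
      unfolding ov cc1[symmetric] using norm_add_half[of "c1 i j" "c i j"] m(1)
      by (simp add: mult_left_mono flip: times_divide_eq_right)
    also have "\<dots> \<le> a i * (cmod (c1 i j))\<^sup>2 + \<gamma> * b j * (cmod (c i j))\<^sup>2"
      unfolding distrib_left using m by (intro add_mono mult_right_mono) auto
    finally show "min (a i * overlap d U V i j) (\<gamma> * (b j * overlap d U V i j)) / 2 \<le>
        a i * (cmod (c1 i j))\<^sup>2 + \<gamma> * (b j * (cmod (c i j))\<^sup>2)" by (simp add: mult.assoc)
  qed
  also have "\<dots> = (\<Sum>i<d. \<Sum>j<d. a i * (cmod (c1 i j))\<^sup>2) + \<gamma> * (\<Sum>i<d. \<Sum>j<d. b j * (cmod (c i j))\<^sup>2)"
    by (simp add: sum.distrib sum_distrib_left)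
  also have "\<dots> \<le> Re (mat_trace ((1\<^sub>m d - T) * A)) + \<gamma> * Re (mat_trace (T * B))"
    using 1 2 \<gamma> by (intro add_mono mult_left_mono) auto
  finally show ?thesis .
qed

lemma trace_mult_eig:
  assumes A: "A \<in> carrier_mat d d" "is_eig_decomp A U a" and B: "B \<in> carrier_mat d d" "is_eig_decomp B V b"
  shows "Re (mat_trace (mat_powr A p * mat_powr B r)) =
    (\<Sum>k<d. \<Sum>l<d. a k powr p * b l powr r * overlap d U V k l)"
  unfolding mat_powr_def trace_mat_fun_mult_mat_fun[OF A B] by simp

section \<open>Domination of states and relative entropy\<close>

lemma qform_eig_col:
  assumes "A \<in> carrier_mat d d" "is_eig_decomp A U a"
  shows "Re (qform d A (\<lambda>m. V $$ (m, l))) = (\<Sum>k<d. a k * overlap d V U l k)"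
  unfolding qform_eig[OF assms] by (simp add: eig_coef_def overlap_def)

text \<open>If \<open>q \<rho> \<le> \<sigma>\<close> then \<open>\<rho> \<sigma>\<^sup>-\<^sup>1 \<rho> \<le> \<rho> / q\<close>; here is the diagonal of that inequality in an
  eigenbasis of \<open>\<rho>\<close>.\<close>

lemma sum_overlap_inverse_le:
  assumes A: "psd d A" "is_eig_decomp A U a" and B: "psd d B" "is_eig_decomp B V b"
    and q: "0 < q" and le: "\<And>v. q * Re (qform d A v) \<le> Re (qform d B v)"
    and k: "k < d" "0 < a k"
  shows "(\<Sum>l<d. overlap d U V k l / b l) \<le> 1 / (q * a k)"
proof -
  note Ac = psdD(1)[OF A(1)] and Bc = psdD(1)[OF B(1)]
  have b0: "0 \<le> b l" if "l < d" for l using psd_eig_nonneg[OF B that] .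
  define w where "w l = eig_coef d V (\<lambda>m. U $$ (m, k)) l" for l
  have ov: "overlap d U V k l = (cmod (w l))\<^sup>2" for l by (simp add: overlap_def eig_coef_def w_def)
  define S where "S = (\<Sum>l<d. overlap d U V k l / b l)"
  have S0: "0 \<le> S" unfolding S_def using b0 overlap_nonneg by (intro sum_nonneg) auto
  \<comment> \<open>\<open>y\<close> is the inverse of \<open>B\<close> on its support applied to
    the \<open>k\<close>-th eigenvector of \<open>A\<close>; division by zero being zero, the kernel
    of \<open>B\<close> drops out. The hypothesis is tested at \<open>y\<close>, and
    \<open>S\<close> is the inner product of \<open>y\<close> with that eigenvector.\<close>
  define z where "z l = w l / of_real (b l)" for l
  define y where "y i = (\<Sum>l<d. V $$ (i, l) * z l)" for i
  have yV: "eig_coef d V y l = w l / of_real (b l)" if l: "l < d" for l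
  proof -
    have "eig_coef d V y l = (\<Sum>i<d. \<Sum>m<d. z m * (cnj (V $$ (i, l)) * V $$ (i, m)))"
      by (simp add: eig_coef_def y_def sum_distrib_left mult_ac)
    also have "\<dots> = (\<Sum>m<d. \<Sum>i<d. z m * (cnj (V $$ (i, l)) * V $$ (i, m)))" by (rule sum.swap)
    also have "\<dots> = (\<Sum>m<d. if l = m then z m else 0)"
      by (intro sum.cong refl) (simp add: sum_distrib_left[symmetric] is_eig_decompD(2)[OF Bc B(2)] l)
    finally show ?thesis using l by (simp add: z_def)
  qed
  have yU: "eig_coef d U y k = of_real S"
  proof -
    have "eig_coef d U y k = (\<Sum>i<d. \<Sum>l<d. z l * (cnj (U $$ (i, k)) * V $$ (i, l)))"
      by (simp add: eig_coef_def y_def sum_distrib_left mult_ac)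
    also have "\<dots> = (\<Sum>l<d. \<Sum>i<d. z l * (cnj (U $$ (i, k)) * V $$ (i, l)))" by (rule sum.swap)
    also have "\<dots> = (\<Sum>l<d. z l * cnj (w l))"
      unfolding sum_distrib_left[symmetric] w_def eig_coef_def by (simp add: mult.commute)
    also have "\<dots> = (\<Sum>l<d. (w l / of_real (b l)) * cnj (w l))" by (simp add: z_def)
    also have "\<dots> = (\<Sum>l<d. of_real (overlap d U V k l / b l))"
      unfolding ov of_real_divide complex_norm_square by (simp add: mult.commute)
    finally show ?thesis by (simp add: S_def)
  qed
  have "q * (a k * S\<^sup>2) \<le> q * Re (qform d A y)"
  proof -
    have "a k * S\<^sup>2 = a k * (cmod (eig_coef d U y k))\<^sup>2" using S0 by (simp add: yU)
    also have "\<dots> \<le> (\<Sum>k<d. a k * (cmod (eig_coef d U y k))\<^sup>2)"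
      using k psd_eig_nonneg[OF A] by (intro member_le_sum) auto
    finally show ?thesis unfolding qform_eig[OF Ac A(2)] using q by simp
  qed
  also have "\<dots> \<le> Re (qform d B y)" by (rule le)
  also have "\<dots> = (\<Sum>l<d. b l * (cmod (w l / of_real (b l)))\<^sup>2)"
    unfolding qform_eig[OF Bc B(2)] by (simp add: yV)
  also have "\<dots> = S"
    unfolding S_def ov using b0
    by (intro sum.cong refl) (auto simp: norm_divide power_divide power2_eq_square)
  finally have "S * (q * a k * S) \<le> S * 1" by (simp add: power2_eq_square mult_ac)
  hence "q * a k * S \<le> 1 \<or> S = 0" using S0 by (cases "S = 0") auto
  thus ?thesis unfolding S_def[symmetric] using q k by (auto simp: field_simps)
qed

text \<open>Comparing eigenvalues through \<open>ln y \<le> y - 1\<close> leaves the sum treated in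
  \<open>sum_overlap_inverse_le\<close>. Domination also gives inclusion of the kernels, so the
  relative entropy is finite.\<close>

lemma rel_entropy_le:
  assumes A: "psd d A" and tr: "mat_trace A = 1" and B: "psd d B"
    and q: "0 < q" and le: "\<And>v. q * Re (qform d A v) \<le> Re (qform d B v)"
  shows "rel_entropy A B \<le> ereal (- log 2 q)"
proof -
  obtain U a where Ad: "A \<in> carrier_mat d d" "is_eig_decomp A U a" and a0: "\<And>k. k < d \<Longrightarrow> 0 \<le> a k"
    using psd_obtain_eig[OF A] by metis
  obtain V b where Bd: "B \<in> carrier_mat d d" "is_eig_decomp B V b" and b0: "\<And>k. k < d \<Longrightarrow> 0 \<le> b k"
    using psd_obtain_eig[OF B] by metis
  define w where "w k l = overlap d U V k l" for k l
  have w0: "0 \<le> w k l" for k l by (simp add: w_def overlap_nonneg)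
  have w1: "(\<Sum>l<d. w k l) = 1" if "k < d" for k unfolding w_def by (rule overlap_sum[OF Ad Bd that])
  have a1: "(\<Sum>k<d. a k) = 1"
    using trace_mat_fun[OF Ad, of "\<lambda>t. t"] unfolding mat_fun_ident[OF Ad] tr by (metis of_real_eq_1_iff)
  have ker: "mat_kernel B \<subseteq> mat_kernel A"
  proof
    fix v assume "v \<in> mat_kernel B"
    hence v: "v \<in> carrier_vec d" "B *\<^sub>v v = 0\<^sub>v d" using Bd(1) by (auto simp: mat_kernel_def)
    have vi: "(C *\<^sub>v v) $ i = (\<Sum>j<d. C $$ (i, j) * v $ j)" if "C \<in> carrier_mat d d" "i < d" for C i
      using that v(1) by (simp add: scalar_prod_def lessThan_atLeast0)
    have "qform d B (vec_index v) = (\<Sum>i<d. cnj (v $ i) * (B *\<^sub>v v) $ i)"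
      using Bd(1) by (simp add: qform_def vi sum_distrib_left mult.assoc del: index_mult_mat_vec)
    also have "\<dots> = 0" by (simp add: v(2))
    finally have "q * Re (qform d A (vec_index v)) \<le> 0" using le[of "vec_index v"] by simp
    hence "(\<Sum>k<d. a k * (cmod (eig_coef d U (vec_index v) k))\<^sup>2) \<le> 0"
      unfolding qform_eig[OF Ad] using q by (simp add: mult_le_0_iff)
    moreover have "0 \<le> (\<Sum>k<d. a k * (cmod (eig_coef d U (vec_index v) k))\<^sup>2)"
      using a0 by (intro sum_nonneg) auto
    ultimately have "(\<Sum>k<d. a k * (cmod (eig_coef d U (vec_index v) k))\<^sup>2) = 0" by linarith
    hence z: "\<forall>k\<in>{..<d}. a k * (cmod (eig_coef d U (vec_index v) k))\<^sup>2 = 0"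
      using a0 by (subst (asm) sum_nonneg_eq_0_iff) auto
    have "(cmod (eig_coef d U (\<lambda>i. \<Sum>j<d. A $$ (i, j) * v $ j) k))\<^sup>2 = 0" if "k \<in> {..<d}" for k
      using z[rule_format, OF that] that by (simp add: eig_coef_mult_vec[OF Ad])
    hence "(\<Sum>i<d. (cmod (\<Sum>j<d. A $$ (i, j) * v $ j))\<^sup>2) = 0"
      unfolding sum_eig_coef[OF Ad, symmetric, of "\<lambda>i. \<Sum>j<d. A $$ (i, j) * v $ j"]
      by (intro sum.neutral ballI)
    hence "\<forall>i\<in>{..<d}. (cmod (\<Sum>j<d. A $$ (i, j) * v $ j))\<^sup>2 = 0"
      by (subst (asm) sum_nonneg_eq_0_iff) auto
    hence "A *\<^sub>v v = 0\<^sub>v d" using Ad(1)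
      by (intro eq_vecI) (auto simp: vi simp del: index_mult_mat_vec)
    thus "v \<in> mat_kernel A" using v(1) Ad(1) by (auto simp: mat_kernel_def)
  qed
  have "mat_trace (A * (mat_log2 A - mat_log2 B)) =
      mat_trace (mat_fun (\<lambda>t. t) A * mat_fun (log 2) A) - mat_trace (mat_fun (\<lambda>t. t) A * mat_fun (log 2) B)"
    unfolding mat_fun_ident[OF Ad] mat_log2_def
    by (rule trace_mult_minus_right[OF Ad(1) mat_fun_carrier_decomp(1)[OF Ad] mat_fun_carrier_decomp(1)[OF Bd]])
  hence "Re (mat_trace (A * (mat_log2 A - mat_log2 B))) =
      (\<Sum>k<d. a k * log 2 (a k)) - (\<Sum>k<d. \<Sum>l<d. a k * log 2 (b l) * w k l)"
    unfolding trace_mat_fun_mult_same[OF psdD(2)[OF A]] trace_mat_fun[OF Ad]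
      trace_mat_fun_mult_mat_fun[OF Ad Bd] w_def by simp
  also have "(\<Sum>k<d. a k * log 2 (a k)) = (\<Sum>k<d. \<Sum>l<d. a k * log 2 (a k) * w k l)"
    by (simp add: sum_distrib_left[symmetric] w1)
  also have "\<dots> - (\<Sum>k<d. \<Sum>l<d. a k * log 2 (b l) * w k l) =
      (\<Sum>k<d. \<Sum>l<d. a k * w k l * (log 2 (a k) - log 2 (b l)))"
    by (simp add: sum_subtractf[symmetric] algebra_simps)
  \<comment> \<open>Here y = q a_k / b_l. Wherever the weight \<open>a k * w k l\<close> is
    positive, domination at the \<open>l\<close>-th eigenvector of \<open>B\<close> makes
    \<open>b l\<close> positive.\<close>
  also have "\<dots> \<le> (\<Sum>k<d. \<Sum>l<d. a k * w k l * ((q * a k / b l - 1) / ln 2 - log 2 q))"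
  proof (intro sum_mono)
    fix k l assume "k \<in> {..<d}" "l \<in> {..<d}"
    hence kl: "k < d" "l < d" by auto
    show "a k * w k l * (log 2 (a k) - log 2 (b l)) \<le> a k * w k l * ((q * a k / b l - 1) / ln 2 - log 2 q)"
    proof (cases "0 < a k \<and> 0 < w k l")
      case True
      have "0 < q * (a k * w k l)" using True q by simp
      also have "\<dots> \<le> q * (\<Sum>k<d. a k * overlap d V U l k)"
        unfolding w_def overlap_commute[of d U V] using kl a0 q
        by (intro mult_left_mono member_le_sum) (auto simp: overlap_nonneg)
      also have "\<dots> \<le> b l"
        using le[of "\<lambda>m. V $$ (m, l)"] unfolding qform_eig_col[OF Ad] qform_col[OF Bd kl(2)] by simp
      finally have bl: "0 < b l" .
      have "log 2 (a k) - log 2 (b l) = ln (q * a k / b l) / ln 2 - log 2 q"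
        using True bl q by (simp add: log_def ln_mult ln_div field_simps)
      also have "\<dots> \<le> (q * a k / b l - 1) / ln 2 - log 2 q"
        using True bl q by (intro diff_right_mono divide_right_mono ln_le_minus_one) auto
      finally show ?thesis using True by (intro mult_left_mono) auto
    next
      case False
      hence eq: "a k * w k l = 0" using a0[OF kl(1)] w0[of k l] by auto
      show ?thesis unfolding eq by simp
    qed
  qed
  also have "\<dots> = (q * (\<Sum>k<d. \<Sum>l<d. a k * (a k * (w k l / b l))) - (\<Sum>k<d. \<Sum>l<d. a k * w k l)) / ln 2
      - (\<Sum>k<d. \<Sum>l<d. a k * w k l) * log 2 q"
    by (simp add: sum_distrib_left sum_distrib_right sum_subtractf[symmetric] sum_divide_distrib
        diff_divide_distrib algebra_simps)
  also have "(\<Sum>k<d. \<Sum>l<d. a k * w k l) = 1" by (simp add: sum_distrib_left[symmetric] w1 a1)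
  also have "(q * (\<Sum>k<d. \<Sum>l<d. a k * (a k * (w k l / b l))) - 1) / ln 2 - 1 * log 2 q \<le> - log 2 q"
  proof -
    have "a k * (a k * (\<Sum>l<d. w k l / b l)) \<le> a k * (1 / q)" if k: "k < d" for k
    proof (cases "a k = 0")
      case False
      hence pos: "0 < a k" using a0[OF k] by simp
      have "a k * (\<Sum>l<d. w k l / b l) \<le> a k * (1 / (q * a k))"
        unfolding w_def using pos sum_overlap_inverse_le[OF A Ad(2) B Bd(2) q le k pos]
        by (intro mult_left_mono) auto
      thus ?thesis using pos by (intro mult_left_mono) auto
    qed simp
    hence "(\<Sum>k<d. \<Sum>l<d. a k * (a k * (w k l / b l))) \<le> (\<Sum>k<d. a k * (1 / q))"
      unfolding sum_distrib_left[symmetric] by (intro sum_mono) auto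
    also have "\<dots> = 1 / q" by (simp only: sum_distrib_right[symmetric] a1)
    finally have "q * (\<Sum>k<d. \<Sum>l<d. a k * (a k * (w k l / b l))) \<le> 1" using q by (simp add: field_simps)
    hence "(q * (\<Sum>k<d. \<Sum>l<d. a k * (a k * (w k l / b l))) - 1) / ln 2 \<le> 0"
      by (intro divide_nonpos_pos) auto
    thus ?thesis by simp
  qed
  finally show ?thesis unfolding rel_entropy_def using ker by simp
qed

context state_family
begin

text \<open>The average state dominates \<open>Q x\<close> times \<open>\<rho> x\<close>, so each
  relative entropy is at most - log Q(x), and these average to H(Q). It serves to make rates above
  H(Q|B) nonnegative, so that rounding up the number of messages costs at most a factor 2.\<close>

lemma cond_entropy_nonneg:
  assumes Q: "Q \<in> types n"
  shows "0 \<le> cond_entropy d \<rho> Q"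
proof -
  note Q0 = types_nonneg[OF Q]
  have le: "Q x * Re (qform d (\<rho> x) v) \<le> Re (qform d (avg_state d \<rho> Q) v)" for x v
  proof -
    have eq: "Re (qform d (avg_state d \<rho> Q) v) = (\<Sum>y\<in>UNIV. Q y * Re (qform d (\<rho> y) v))"
      unfolding avg_state_def qform_msum by (simp add: qform_smult[OF psdD(1)[OF psd_rho]])
    show ?thesis unfolding eq
      using member_le_sum[of x UNIV "\<lambda>y. Q y * Re (qform d (\<rho> y) v)"] Q0 psd_rho
      by (simp add: psd_iff_qform)
  qed
  have "ereal (Q x) * rel_entropy (\<rho> x) (avg_state d \<rho> Q) \<le> ereal (- (Q x * log 2 (Q x)))" for x
  proof (cases "Q x = 0")
    case False
    hence pos: "0 < Q x" using Q0[of x] by simp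
    have "rel_entropy (\<rho> x) (avg_state d \<rho> Q) \<le> ereal (- log 2 (Q x))"
      by (rule rel_entropy_le[OF psd_rho trace_rho psd_avg_state[OF Q0] pos le])
    from ereal_mult_left_mono[OF this, of "ereal (Q x)"] Q0 show ?thesis by simp
  qed (simp add: zero_ereal_def[symmetric])
  hence "(\<Sum>x\<in>UNIV. ereal (Q x) * rel_entropy (\<rho> x) (avg_state d \<rho> Q)) \<le> (\<Sum>x\<in>UNIV. ereal (- (Q x * log 2 (Q x))))"
    by (intro sum_mono)
  also have "\<dots> = ereal (shannon_entropy Q)" by (simp add: shannon_entropy_def sum_negf)
  finally show ?thesis unfolding cond_entropy_def by (simp add: ereal_diff_positive)
qed

end

section \<open>A saddle state for the sphere-packing exponent\<close>

text \<open>Index pairs with positive eigenvalue of the first state. On them the log-likelihood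
  ratio is a true logarithm and is bounded, provided the second state is invertible.\<close>

definition ns_support :: "nat \<Rightarrow> (nat \<Rightarrow> real) \<Rightarrow> (nat \<times> nat) set" where
  "ns_support d a = {p \<in> {..<d} \<times> {..<d}. 0 < a (fst p)}"

lemma finite_ns_support [simp]: "finite (ns_support d a)"
  unfolding ns_support_def by (rule finite_subset[of _ "{..<d} \<times> {..<d}"]) auto

lemma sum_ns_support:
  assumes "\<And>k l. k < d \<Longrightarrow> l < d \<Longrightarrow> \<not> 0 < a k \<Longrightarrow> f k l = (0 :: real)"
  shows "(\<Sum>p\<in>ns_support d a. f (fst p) (snd p)) = (\<Sum>k<d. \<Sum>l<d. f k l)"
proof -
  have "(\<Sum>p\<in>ns_support d a. f (fst p) (snd p)) = (\<Sum>p\<in>{..<d} \<times> {..<d}. f (fst p) (snd p))"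
    by (rule sum.mono_neutral_left) (use assms in \<open>force simp: ns_support_def\<close>)+
  also have "\<dots> = (\<Sum>k<d. \<Sum>l<d. f k l)"
    unfolding sum.cartesian_product by (intro sum.cong) auto
  finally show ?thesis .
qed

text \<open>The trace in the Petz divergence of order 1/(1+s) is the moment generating function at
  1/(1+s) of the log-likelihood ratio of the Nussbaum-Szkola distributions, taken under the second
  of them.\<close>

lemma trace_powr_as_tilt:
  assumes A: "A \<in> carrier_mat d d" "is_eig_decomp A U a" and B: "B \<in> carrier_mat d d" "is_eig_decomp B V b"
    and a: "\<And>k. k < d \<Longrightarrow> 0 \<le> a k" and b: "\<And>l. l < d \<Longrightarrow> 0 < b l" and s: "0 \<le> s"
  shows "Re (mat_trace (mat_powr A (1 / (1 + s)) * mat_powr B (s / (1 + s)))) =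
    (\<Sum>p\<in>ns_support d a. b (snd p) * overlap d U V (fst p) (snd p) *
      2 powr ((log 2 (a (fst p)) - log 2 (b (snd p))) / (1 + s)))"
proof -
  have "(\<Sum>p\<in>ns_support d a. b (snd p) * overlap d U V (fst p) (snd p) *
      2 powr ((log 2 (a (fst p)) - log 2 (b (snd p))) / (1 + s))) =
    (\<Sum>p\<in>ns_support d a. a (fst p) powr (1 / (1 + s)) * b (snd p) powr (s / (1 + s)) * overlap d U V (fst p) (snd p))"
  proof (intro sum.cong refl)
    fix p assume "p \<in> ns_support d a"
    hence pos: "0 < a (fst p)" "0 < b (snd p)" using b by (auto simp: ns_support_def)
    have e: "s / (1 + s) = 1 - 1 / (1 + s)" using s by (simp add: field_simps)
    have "2 powr ((log 2 (a (fst p)) - log 2 (b (snd p))) / (1 + s)) =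
        (2 powr log 2 (a (fst p))) powr (1 / (1 + s)) / (2 powr log 2 (b (snd p))) powr (1 / (1 + s))"
      unfolding powr_powr powr_diff[symmetric] by (simp add: diff_divide_distrib)
    also have "\<dots> = a (fst p) powr (1 / (1 + s)) / b (snd p) powr (1 / (1 + s))" using pos by simp
    finally show "b (snd p) * overlap d U V (fst p) (snd p) * 2 powr ((log 2 (a (fst p)) - log 2 (b (snd p))) / (1 + s)) =
        a (fst p) powr (1 / (1 + s)) * b (snd p) powr (s / (1 + s)) * overlap d U V (fst p) (snd p)"
      unfolding e powr_diff using pos by simp
  qed
  also have "\<dots> = (\<Sum>k<d. \<Sum>l<d. a k powr (1 / (1 + s)) * b l powr (s / (1 + s)) * overlap d U V k l)"
  proof (rule sum_ns_support)
    show "a k powr (1 / (1 + s)) * b l powr (s / (1 + s)) * overlap d U V k l = 0" if "k < d" "\<not> 0 < a k" for k l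
      using a[OF that(1)] that(2) by simp
  qed
  finally show ?thesis unfolding trace_mult_eig[OF A B] ..
qed

lemma sum_eig_density:
  assumes "A \<in> density_ops d" "is_eig_decomp A U a"
  shows "(\<Sum>k<d. a k) = 1" "k < d \<Longrightarrow> 0 \<le> a k" "k < d \<Longrightarrow> a k \<le> 1"
proof -
  have A: "psd d A" "mat_trace A = 1" using assms(1) by (auto simp: density_ops_def)
  note Ac = psdD(1)[OF A(1)]
  show 1: "(\<Sum>k<d. a k) = 1"
    using trace_mat_fun[OF Ac assms(2), of "\<lambda>t. t"] unfolding mat_fun_ident[OF Ac assms(2)] A(2)
    by (metis of_real_eq_1_iff)
  show 2: "0 \<le> a k" if "k < d" for k using psd_eig_nonneg[OF A(1) assms(2) that] .
  show "a k \<le> 1" if "k < d" for k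
    using 1 2 that member_le_sum[of k "{..<d}" a] by simp
qed

section \<open>Mixtures of states and the maximally mixed state\<close>

definition depolarize :: "nat \<Rightarrow> real \<Rightarrow> complex mat \<Rightarrow> complex mat" where
  "depolarize d \<epsilon> \<tau> = complex_of_real (1 - \<epsilon>) \<cdot>\<^sub>m \<tau> + complex_of_real (\<epsilon> / real d) \<cdot>\<^sub>m 1\<^sub>m d"

definition mat_mix :: "real \<Rightarrow> complex mat \<Rightarrow> complex mat \<Rightarrow> complex mat" where
  "mat_mix w A B = complex_of_real w \<cdot>\<^sub>m A + complex_of_real (1 - w) \<cdot>\<^sub>m B"

lemma density_opsD: "A \<in> density_ops d \<Longrightarrow> psd d A" "A \<in> density_ops d \<Longrightarrow> mat_trace A = 1"
  "A \<in> density_ops d \<Longrightarrow> A \<in> carrier_mat d d"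
  by (auto simp: density_ops_def psdD(1))

lemma density_ops_dim_pos: "A \<in> density_ops d \<Longrightarrow> 0 < d"
  by (cases "d = 0") (auto simp: density_ops_def psd_def mat_trace_def)

lemma mat_trace_add: "A \<in> carrier_mat d d \<Longrightarrow> B \<in> carrier_mat d d \<Longrightarrow> mat_trace (A + B) = mat_trace A + mat_trace B"
  by (simp add: mat_trace_def sum.distrib)

lemma mat_trace_one: "mat_trace (1\<^sub>m d) = of_nat d"
  by (simp add: mat_trace_def)

lemma mat_mix_density:
  assumes "0 \<le> w" "w \<le> 1" "A \<in> density_ops d" "B \<in> density_ops d"
  shows "mat_mix w A B \<in> density_ops d"
proof -
  have "psd d (mat_mix w A B)"
    unfolding mat_mix_def using assms by (intro psd_add psd_smult density_opsD) auto
  moreover have "mat_trace (mat_mix w A B) = 1"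
    using density_opsD[OF assms(3)] density_opsD[OF assms(4)]
    by (simp add: mat_mix_def mat_trace_add[of _ d] mat_trace_smult)
  ultimately show ?thesis by (simp add: density_ops_def)
qed

lemma depolarize_density:
  assumes "0 \<le> \<epsilon>" "\<epsilon> \<le> 1" "\<tau> \<in> density_ops d"
  shows "depolarize d \<epsilon> \<tau> \<in> density_ops d"
proof -
  have d: "0 < d" by (rule density_ops_dim_pos[OF assms(3)])
  have "psd d (depolarize d \<epsilon> \<tau>)"
    unfolding depolarize_def using assms by (intro psd_add psd_smult psd_one density_opsD) auto
  moreover have "mat_trace (depolarize d \<epsilon> \<tau>) = 1"
    using density_opsD[OF assms(3)] d
    by (simp add: depolarize_def mat_trace_add[of _ d] mat_trace_smult[of _ d] mat_trace_one)
  ultimately show ?thesis by (simp add: density_ops_def)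
qed

lemma qform_depolarize:
  assumes "\<tau> \<in> carrier_mat d d"
  shows "Re (qform d (depolarize d \<epsilon> \<tau>) v) = (1 - \<epsilon>) * Re (qform d \<tau> v) + \<epsilon> / real d * (\<Sum>i<d. (cmod (v i))\<^sup>2)"
  using assms unfolding depolarize_def by (simp add: qform_add qform_smult qform_one del: of_real_divide)

lemma qform_mat_mix:
  assumes "A \<in> carrier_mat d d" "B \<in> carrier_mat d d"
  shows "Re (qform d (mat_mix w A B) v) = w * Re (qform d A v) + (1 - w) * Re (qform d B v)"
  using assms unfolding mat_mix_def by (simp add: qform_add qform_smult)

lemma depolarize_eig_ge:
  assumes \<epsilon>: "0 \<le> \<epsilon>" "\<epsilon> \<le> 1" and \<tau>: "\<tau> \<in> density_ops d" and dec: "is_eig_decomp (depolarize d \<epsilon> \<tau>) V b" and l: "l < d"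
  shows "\<epsilon> / real d \<le> b l"
proof -
  note D = density_opsD(3)[OF depolarize_density[OF \<epsilon> \<tau>]]
  have "of_real (\<Sum>i<d. (cmod (V $$ (i, l)))\<^sup>2) = (1 :: complex)"
    unfolding of_real_sum complex_norm_square
    using is_eig_decompD(2)[OF D dec l l] by (simp add: mult.commute)
  hence one: "(\<Sum>i<d. (cmod (V $$ (i, l)))\<^sup>2) = 1" by (simp only: of_real_eq_1_iff)
  have "b l = Re (qform d (depolarize d \<epsilon> \<tau>) (\<lambda>i. V $$ (i, l)))" using qform_col[OF D dec l] by simp
  also have "\<dots> = (1 - \<epsilon>) * Re (qform d \<tau> (\<lambda>i. V $$ (i, l))) + \<epsilon> / real d"
    unfolding qform_depolarize[OF density_opsD(3)[OF \<tau>]] one by simp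
  finally show ?thesis using density_opsD(1)[OF \<tau>] \<epsilon> by (simp add: psd_iff_qform)
qed

text \<open>The constant is 2 from \<open>n \<le> 2 * (n - 1)\<close> times 2 from
  \<open>1 / 2 \<le> ln 2\<close>.\<close>

lemma log_one_minus_inverse:
  assumes "2 \<le> n"
  shows "- log 2 (1 - 1 / real n) \<le> 4 / real n"
proof -
  have n: "2 \<le> real n" using assms by simp
  have eq: "1 - 1 / real n = inverse (1 + 1 / (real n - 1))" using n by (simp add: field_simps)
  have "ln (1 + 1 / (real n - 1)) \<le> 1 / (real n - 1)" using n by (intro ln_add_one_self_le_self) auto
  also have "\<dots> \<le> 2 / real n" using n by (simp add: field_simps)
  finally have "ln (1 + 1 / (real n - 1)) / ln 2 \<le> (2 / real n) / (1 / 2)"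
    using ln2_ge_two_thirds n by (intro frac_le) auto
  thus ?thesis unfolding eq using n by (simp add: log_def ln_inverse add_pos_pos)
qed

section \<open>Tilted traces as functions of the state\<close>

context state_family
begin

definition tilt_trace :: "real \<Rightarrow> 'x \<Rightarrow> complex mat \<Rightarrow> real" where
  "tilt_trace s x \<tau> = Re (mat_trace (mat_powr (\<rho> x) (1 / (1 + s)) * mat_powr \<tau> (s / (1 + s))))"

text \<open>For \<open>0 < s\<close> and positive traces on the support of \<open>Q\<close> this is
  s times the averaged Petz divergence of order 1/(1+s), see \<open>petz_sum_finite\<close>. It is
  real-valued, and on depolarized states it extends to \<open>s = 0\<close> with value 0.\<close>

definition tilt_exp :: "('x \<Rightarrow> real) \<Rightarrow> real \<Rightarrow> complex mat \<Rightarrow> real" where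
  "tilt_exp Q s \<tau> = - (1 + s) * (\<Sum>x\<in>UNIV. Q x * log 2 (tilt_trace s x \<tau>))"

lemma rho_eig:
  obtains U a where "is_eig_decomp (\<rho> x) U a" "(\<Sum>k<d. a k) = 1"
    "\<And>k. k < d \<Longrightarrow> 0 \<le> a k" "\<And>k. k < d \<Longrightarrow> a k \<le> 1"
proof -
  obtain U a where "is_eig_decomp (\<rho> x) U a" using hermitian_is_eig_decomp[OF psdD(2)[OF psd_rho]] by blast
  thus thesis using that sum_eig_density[OF density] by blast
qed

lemma dim_pos: "0 < d"
  using density_ops_dim_pos[OF density] .

text \<open>Eigenvalues of a density matrix are at most one and do not decrease under the power
  1/(1+s), while those of the depolarized state are at least \<epsilon>/d. The overlaps and the
  eigenvalues of \<open>\<rho> x\<close> then sum to one.\<close>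

lemma tilt_trace_ge:
  assumes \<epsilon>: "0 < \<epsilon>" "\<epsilon> \<le> 1" and \<tau>: "\<tau> \<in> density_ops d" and s: "0 \<le> s"
  shows "(\<epsilon> / real d) powr (s / (1 + s)) \<le> tilt_trace s x (depolarize d \<epsilon> \<tau>)"
proof -
  let ?\<tau> = "depolarize d \<epsilon> \<tau>"
  have D: "?\<tau> \<in> density_ops d" using depolarize_density \<epsilon> \<tau> by simp
  obtain V b where dec: "is_eig_decomp ?\<tau> V b" using hermitian_is_eig_decomp[OF psdD(2)[OF density_opsD(1)[OF D]]] by blast
  have b: "\<epsilon> / real d \<le> b l" if "l < d" for l using depolarize_eig_ge[OF _ \<epsilon>(2) \<tau> dec that] \<epsilon> by simp
  obtain U a where A: "is_eig_decomp (\<rho> x) U a" "(\<Sum>k<d. a k) = 1"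
    and a: "\<And>k. k < d \<Longrightarrow> 0 \<le> a k" "\<And>k. k < d \<Longrightarrow> a k \<le> 1" using rho_eig by metis
  note Ac = psdD(1)[OF psd_rho[of x]] and Bc = density_opsD(3)[OF D]
  have "(\<epsilon> / real d) powr (s / (1 + s)) = (\<Sum>k<d. \<Sum>l<d. a k * (\<epsilon> / real d) powr (s / (1 + s)) * overlap d U V k l)"
  proof -
    have "(\<Sum>l<d. a k * (\<epsilon> / real d) powr (s / (1 + s)) * overlap d U V k l) = a k * (\<epsilon> / real d) powr (s / (1 + s))"
      if "k < d" for k
      unfolding sum_distrib_left[symmetric] overlap_sum[OF Ac A(1) Bc dec that] by simp
    thus ?thesis by (simp add: sum_distrib_right[symmetric] A(2))
  qed
  also have "\<dots> \<le> (\<Sum>k<d. \<Sum>l<d. a k powr (1 / (1 + s)) * b l powr (s / (1 + s)) * overlap d U V k l)"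
  proof (intro sum_mono mult_right_mono mult_mono overlap_nonneg)
    fix k l assume kl: "k \<in> {..<d}" "l \<in> {..<d}"
    show "a k \<le> a k powr (1 / (1 + s))"
    proof (cases "a k = 0")
      case False
      hence "0 < a k" using a(1)[of k] kl by simp
      hence "a k powr 1 \<le> a k powr (1 / (1 + s))" using a(2)[of k] kl s by (intro powr_mono') auto
      thus ?thesis using \<open>0 < a k\<close> by simp
    qed simp
    show "(\<epsilon> / real d) powr (s / (1 + s)) \<le> b l powr (s / (1 + s))"
      using b kl \<epsilon> s by (intro powr_mono2) auto
  qed (use a in auto)
  finally show ?thesis unfolding tilt_trace_def trace_mult_eig[OF Ac A(1) Bc dec] .
qed

lemma tilt_trace_pos:
  assumes "0 < \<epsilon>" "\<epsilon> \<le> 1" "\<tau> \<in> density_ops d" "0 \<le> s"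
  shows "0 < tilt_trace s x (depolarize d \<epsilon> \<tau>)"
proof -
  have "0 < (\<epsilon> / real d) powr (s / (1 + s))" using assms dim_pos by simp
  thus ?thesis using tilt_trace_ge[OF assms, of x] by linarith
qed

lemma tilt_trace_zero:
  assumes \<epsilon>: "0 < \<epsilon>" "\<epsilon> \<le> 1" and \<tau>: "\<tau> \<in> density_ops d"
  shows "tilt_trace 0 x (depolarize d \<epsilon> \<tau>) = 1"
proof -
  let ?\<tau> = "depolarize d \<epsilon> \<tau>"
  have D: "?\<tau> \<in> density_ops d" using depolarize_density \<epsilon> \<tau> by simp
  obtain V b where dec: "is_eig_decomp ?\<tau> V b" using hermitian_is_eig_decomp[OF psdD(2)[OF density_opsD(1)[OF D]]] by blast
  have b: "b l \<noteq> 0" if "l < d" for l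
    using depolarize_eig_ge[OF _ \<epsilon>(2) \<tau> dec that] \<epsilon> dim_pos by (smt (verit) divide_pos_pos of_nat_0_less_iff)
  have "mat_powr ?\<tau> 0 = mat_fun (\<lambda>_. 1) ?\<tau>"
    unfolding mat_powr_def by (rule mat_fun_cong[OF density_opsD(3)[OF D] dec]) (use b in simp)
  also have "\<dots> = 1\<^sub>m d" by (rule mat_fun_one[OF psdD(2)[OF density_opsD(1)[OF D]]])
  finally show ?thesis
    using psdD(1)[OF psd_rho[of x]] by (simp add: tilt_trace_def mat_powr_one[OF psd_rho] trace_rho)
qed

text \<open>The depolarized state dominates \<open>1 - \<epsilon>\<close> times the original one,
  and powers with exponent s/(1+s) are operator monotone.\<close>

lemma tilt_trace_mono:
  assumes \<epsilon>: "0 \<le> \<epsilon>" "\<epsilon> \<le> 1" and \<tau>: "\<tau> \<in> density_ops d" and s: "0 < s"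
  shows "(1 - \<epsilon>) powr (s / (1 + s)) * tilt_trace s x \<tau> \<le> tilt_trace s x (depolarize d \<epsilon> \<tau>)"
proof -
  note T = density_opsD[OF \<tau>] and D = density_opsD[OF depolarize_density[OF \<epsilon> \<tau>]]
  have p: "0 < s / (1 + s)" "s / (1 + s) < 1" using s by auto
  have scaled: "psd d (complex_of_real (1 - \<epsilon>) \<cdot>\<^sub>m \<tau>)" using \<epsilon> by (intro psd_smult T) auto
  have "(1 - \<epsilon>) powr (s / (1 + s)) * tilt_trace s x \<tau> =
      Re (mat_trace (mat_powr (\<rho> x) (1 / (1 + s)) * mat_powr (complex_of_real (1 - \<epsilon>) \<cdot>\<^sub>m \<tau>) (s / (1 + s))))"
    using \<epsilon> mat_powr_smult[OF T(1), of "1 - \<epsilon>" "s / (1 + s)"]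
      trace_mult_smult_right[OF psdD(1)[OF psd_mat_powr[OF psd_rho]] psdD(1)[OF psd_mat_powr[OF T(1)]]]
    by (simp add: tilt_trace_def)
  also have "\<dots> \<le> tilt_trace s x (depolarize d \<epsilon> \<tau>)"
    unfolding tilt_trace_def
  proof (rule trace_mult_mono_qform)
    show "Re (qform d (mat_powr (complex_of_real (1 - \<epsilon>) \<cdot>\<^sub>m \<tau>) (s / (1 + s))) v) \<le>
        Re (qform d (mat_powr (depolarize d \<epsilon> \<tau>) (s / (1 + s))) v)" for v
    proof (rule qform_mat_powr_mono[OF scaled D(1) _ p])
      show "Re (qform d (complex_of_real (1 - \<epsilon>) \<cdot>\<^sub>m \<tau>) v) \<le> Re (qform d (depolarize d \<epsilon> \<tau>) v)" for v
        using \<epsilon> by (simp add: qform_depolarize[OF T(3)] qform_smult[OF T(3)] sum_nonneg)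
    qed
  qed (use psd_mat_powr psdD(1) psd_rho scaled D in blast)+
  finally show ?thesis .
qed

text \<open>Depolarizing is affine and the power with exponent s/(1+s) is operator concave.\<close>

lemma tilt_trace_concave:
  assumes \<epsilon>: "0 \<le> \<epsilon>" "\<epsilon> \<le> 1" and \<tau>: "\<tau> \<in> density_ops d" "\<tau>' \<in> density_ops d" and s: "0 < s"
    and w: "0 \<le> w" "w \<le> 1"
  shows "w * tilt_trace s x (depolarize d \<epsilon> \<tau>) + (1 - w) * tilt_trace s x (depolarize d \<epsilon> \<tau>') \<le>
    tilt_trace s x (depolarize d \<epsilon> (mat_mix w \<tau> \<tau>'))"
proof -
  let ?p = "s / (1 + s)"
  have p: "0 < ?p" "?p < 1" using s by auto
  note T = density_opsD[OF \<tau>(1)] and T' = density_opsD[OF \<tau>(2)]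
  note M = mat_mix_density[OF w \<tau>]
  note D = density_opsD[OF depolarize_density[OF \<epsilon> \<tau>(1)]] and D' = density_opsD[OF depolarize_density[OF \<epsilon> \<tau>(2)]]
    and DM = density_opsD[OF depolarize_density[OF \<epsilon> M]]
  obtain U a where A: "is_eig_decomp (\<rho> x) U a" and a: "\<And>k. k < d \<Longrightarrow> 0 \<le> a k" using rho_eig by metis
  note Ac = psdD(1)[OF psd_rho[of x]]
  have tr: "tilt_trace s x Y = (\<Sum>k<d. a k powr (1 / (1 + s)) * Re (qform d (mat_powr Y ?p) (\<lambda>i. U $$ (i, k))))"
    if "psd d Y" for Y
    using trace_mat_fun_mult[OF Ac A psdD(1)[OF psd_mat_powr[OF that]], of "\<lambda>t. t powr (1 / (1 + s))" ?p]
    by (simp add: tilt_trace_def mat_powr_def[of "\<rho> x"])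
  have "w * tilt_trace s x (depolarize d \<epsilon> \<tau>) + (1 - w) * tilt_trace s x (depolarize d \<epsilon> \<tau>') =
    (\<Sum>k<d. a k powr (1 / (1 + s)) * (w * Re (qform d (mat_powr (depolarize d \<epsilon> \<tau>) ?p) (\<lambda>i. U $$ (i, k))) +
      (1 - w) * Re (qform d (mat_powr (depolarize d \<epsilon> \<tau>') ?p) (\<lambda>i. U $$ (i, k)))))"
    unfolding tr[OF D(1)] tr[OF D'(1)] sum_distrib_left sum.distrib[symmetric]
    by (intro sum.cong refl) (simp add: algebra_simps)
  also have "\<dots> \<le> tilt_trace s x (depolarize d \<epsilon> (mat_mix w \<tau> \<tau>'))"
    unfolding tr[OF DM(1)]
  proof (intro sum_mono mult_left_mono qform_mat_powr_concave[OF D(1) D'(1) DM(1) w _ p])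
    fix v
    show "Re (qform d (depolarize d \<epsilon> (mat_mix w \<tau> \<tau>')) v) =
        w * Re (qform d (depolarize d \<epsilon> \<tau>) v) + (1 - w) * Re (qform d (depolarize d \<epsilon> \<tau>') v)"
      unfolding qform_depolarize[OF T(3)] qform_depolarize[OF T'(3)] qform_depolarize[OF density_opsD(3)[OF M]]
        qform_mat_mix[OF T(3) T'(3)] by (simp add: algebra_simps diff_divide_distrib)
  qed simp
  finally show ?thesis .
qed

end

lemma sum_types: "Q \<in> types n \<Longrightarrow> (\<Sum>x\<in>UNIV. Q x) = 1"
  by (simp add: types_def)

section \<open>The averaged exponent: concave in s, convex in the state\<close>

context state_family
begin

definition avg_log_tilt :: "('x \<Rightarrow> real) \<Rightarrow> real \<Rightarrow> complex mat \<Rightarrow> real" where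
  "avg_log_tilt Q s \<tau> = (\<Sum>x\<in>UNIV. Q x * log 2 (tilt_trace s x \<tau>))"

lemma tilt_exp_eq: "tilt_exp Q s \<tau> = - (1 + s) * avg_log_tilt Q s \<tau>"
  by (simp add: tilt_exp_def avg_log_tilt_def)

lemma tilt_exp_zero:
  assumes "0 < \<epsilon>" "\<epsilon> \<le> 1" "\<tau> \<in> density_ops d"
  shows "tilt_exp Q 0 (depolarize d \<epsilon> \<tau>) = 0"
  by (simp add: tilt_exp_def tilt_trace_zero[OF assms])

text \<open>Provides the linear growth bound that the minimax theorem requires. The slope depends on
  \<open>n\<close> through \<epsilon>, but it affects only the size of the grid and not the
  resulting estimate.\<close>

lemma tilt_exp_le:
  assumes Q: "Q \<in> types n" and \<epsilon>: "0 < \<epsilon>" "\<epsilon> \<le> 1" and \<tau>: "\<tau> \<in> density_ops d" and s: "0 \<le> s"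
  shows "tilt_exp Q s (depolarize d \<epsilon> \<tau>) \<le> s * (- log 2 (\<epsilon> / real d))"
proof -
  have \<mu>: "0 < \<epsilon> / real d" using \<epsilon> dim_pos by simp
  have "s / (1 + s) * log 2 (\<epsilon> / real d) \<le> log 2 (tilt_trace s x (depolarize d \<epsilon> \<tau>))" for x
  proof -
    have "s / (1 + s) * log 2 (\<epsilon> / real d) = log 2 ((\<epsilon> / real d) powr (s / (1 + s)))"
      using \<mu> by (simp add: log_powr)
    also have "\<dots> \<le> log 2 (tilt_trace s x (depolarize d \<epsilon> \<tau>))"
      using tilt_trace_ge[OF \<epsilon> \<tau> s, of x] tilt_trace_pos[OF \<epsilon> \<tau> s, of x] \<mu> dim_pos \<epsilon>
      by (subst log_le_cancel_iff) auto
    finally show ?thesis .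
  qed
  hence "(\<Sum>x\<in>UNIV. Q x * (s / (1 + s) * log 2 (\<epsilon> / real d))) \<le>
      (\<Sum>x\<in>UNIV. Q x * log 2 (tilt_trace s x (depolarize d \<epsilon> \<tau>)))"
    using types_nonneg[OF Q] by (intro sum_mono mult_left_mono)
  hence "s / (1 + s) * log 2 (\<epsilon> / real d) \<le> (\<Sum>x\<in>UNIV. Q x * log 2 (tilt_trace s x (depolarize d \<epsilon> \<tau>)))"
    by (simp only: sum_distrib_right[symmetric] sum_types[OF Q] mult_1)
  hence "(1 + s) * (s / (1 + s) * log 2 (\<epsilon> / real d)) \<le> (1 + s) * (\<Sum>x\<in>UNIV. Q x * log 2 (tilt_trace s x (depolarize d \<epsilon> \<tau>)))"
    using s by (intro mult_left_mono) auto
  moreover have "(1 + s) * (s / (1 + s) * log 2 (\<epsilon> / real d)) = s * log 2 (\<epsilon> / real d)" using s by simp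
  ultimately show ?thesis unfolding tilt_exp_def by (simp add: algebra_simps)
qed

text \<open>The loss is proportional to \<open>s\<close> and thus acts as a shift of the rate by
  4/n; a loss not proportional to \<open>s\<close> could not be hidden in the rate.\<close>

lemma tilt_exp_depolarize_le:
  assumes Q: "Q \<in> types m" and n: "2 \<le> n" and \<tau>: "\<tau> \<in> density_ops d" and s: "0 < s"
    and pos: "\<And>x. 0 < Q x \<Longrightarrow> 0 < tilt_trace s x \<tau>"
  shows "tilt_exp Q s (depolarize d (1 / real n) \<tau>) \<le> tilt_exp Q s \<tau> + s * (4 / real n)"
proof -
  define \<epsilon> where "\<epsilon> = 1 / real n"
  have \<epsilon>: "0 < \<epsilon>" "\<epsilon> < 1" using n by (auto simp: \<epsilon>_def)
  have "Q x * (s / (1 + s) * log 2 (1 - \<epsilon>) + log 2 (tilt_trace s x \<tau>)) \<le> Q x * log 2 (tilt_trace s x (depolarize d \<epsilon> \<tau>))" for x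
  proof (cases "Q x = 0")
    case False
    hence Qx: "0 < Q x" using types_nonneg[OF Q, of x] by simp
    note p = pos[OF Qx]
    have p1: "0 < (1 - \<epsilon>) powr (s / (1 + s))" using \<epsilon> by simp
    have "s / (1 + s) * log 2 (1 - \<epsilon>) + log 2 (tilt_trace s x \<tau>) = log 2 ((1 - \<epsilon>) powr (s / (1 + s)) * tilt_trace s x \<tau>)"
      using \<epsilon> p p1 by (simp add: log_mult log_powr)
    also have "\<dots> \<le> log 2 (tilt_trace s x (depolarize d \<epsilon> \<tau>))"
      using tilt_trace_mono[of \<epsilon> \<tau> s x] tilt_trace_pos[of \<epsilon> \<tau> s x] \<epsilon> \<tau> s mult_pos_pos[OF p1 p]
      by (subst log_le_cancel_iff) auto
    finally show ?thesis using Qx by (intro mult_left_mono) auto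
  qed simp
  hence "(\<Sum>x\<in>UNIV. Q x * (s / (1 + s) * log 2 (1 - \<epsilon>) + log 2 (tilt_trace s x \<tau>))) \<le>
      (\<Sum>x\<in>UNIV. Q x * log 2 (tilt_trace s x (depolarize d \<epsilon> \<tau>)))" by (intro sum_mono)
  moreover have "(\<Sum>x\<in>UNIV. Q x * (s / (1 + s) * log 2 (1 - \<epsilon>) + log 2 (tilt_trace s x \<tau>))) =
      s / (1 + s) * log 2 (1 - \<epsilon>) + (\<Sum>x\<in>UNIV. Q x * log 2 (tilt_trace s x \<tau>))"
    unfolding distrib_left sum.distrib by (simp only: sum_distrib_right[symmetric] sum_types[OF Q] mult_1)
  ultimately have "(1 + s) * (s / (1 + s) * log 2 (1 - \<epsilon>) + (\<Sum>x\<in>UNIV. Q x * log 2 (tilt_trace s x \<tau>))) \<le>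
      (1 + s) * (\<Sum>x\<in>UNIV. Q x * log 2 (tilt_trace s x (depolarize d \<epsilon> \<tau>)))"
    using s by (intro mult_left_mono) auto
  moreover have "(1 + s) * (s / (1 + s) * log 2 (1 - \<epsilon>)) = s * log 2 (1 - \<epsilon>)" using s by simp
  ultimately have "tilt_exp Q s (depolarize d \<epsilon> \<tau>) \<le> tilt_exp Q s \<tau> + s * (- log 2 (1 - \<epsilon>))"
    unfolding tilt_exp_eq avg_log_tilt_def[symmetric] by (simp add: algebra_simps)
  also have "s * (- log 2 (1 - \<epsilon>)) \<le> s * (4 / real n)"
    unfolding \<epsilon>_def using log_one_minus_inverse[OF n] s by (intro mult_left_mono) auto
  finally show ?thesis unfolding \<epsilon>_def by simp
qed

text \<open>For each letter (1 + s) times the logarithm of the tilted trace is a perspective in u =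
  1 + s, hence convex. The invertible second state supplies the required positive weights.\<close>

lemma tilt_exp_concave:
  assumes Q: "Q \<in> types n" and \<epsilon>: "0 < \<epsilon>" "\<epsilon> \<le> 1" and \<tau>: "\<tau> \<in> density_ops d"
    and s: "0 \<le> s" "0 \<le> t" and w: "0 \<le> w" "w \<le> 1"
  shows "w * tilt_exp Q s (depolarize d \<epsilon> \<tau>) + (1 - w) * tilt_exp Q t (depolarize d \<epsilon> \<tau>) \<le>
    tilt_exp Q (w * s + (1 - w) * t) (depolarize d \<epsilon> \<tau>)"
proof -
  let ?\<tau> = "depolarize d \<epsilon> \<tau>"
  have D: "?\<tau> \<in> density_ops d" using depolarize_density \<epsilon> \<tau> by simp
  obtain V b where dec: "is_eig_decomp ?\<tau> V b" using hermitian_is_eig_decomp[OF psdD(2)[OF density_opsD(1)[OF D]]] by blast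
  have b: "0 < b l" if "l < d" for l
    using depolarize_eig_ge[OF _ \<epsilon>(2) \<tau> dec that] \<epsilon> dim_pos by (smt (verit) divide_pos_pos of_nat_0_less_iff)
  have r0: "0 \<le> w * s + (1 - w) * t" using s w by simp
  have "(1 + (w * s + (1 - w) * t)) * log 2 (tilt_trace (w * s + (1 - w) * t) x ?\<tau>) \<le>
      w * ((1 + s) * log 2 (tilt_trace s x ?\<tau>)) + (1 - w) * ((1 + t) * log 2 (tilt_trace t x ?\<tau>))" for x
  proof -
    obtain U a where A: "is_eig_decomp (\<rho> x) U a" "(\<Sum>k<d. a k) = 1"
      and a: "\<And>k. k < d \<Longrightarrow> 0 \<le> a k" using rho_eig by metis
    define q where "q p = b (snd p) * overlap d U V (fst p) (snd p)" for p
    define X where "X p = log 2 (a (fst p)) - log 2 (b (snd p))" for p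
    have Z: "tilt_trace r x ?\<tau> = (\<Sum>p\<in>ns_support d a. q p * 2 powr (X p / (1 + r)))" if "0 \<le> r" for r
      unfolding tilt_trace_def q_def X_def
      by (rule trace_powr_as_tilt[OF psdD(1)[OF psd_rho] A(1) density_opsD(3)[OF D] dec a b that])
    have q0: "0 \<le> q p" if "p \<in> ns_support d a" for p
      using that b[of "snd p"] overlap_nonneg[of d U V] by (auto simp: q_def ns_support_def)
    have "\<exists>p\<in>ns_support d a. 0 < q p"
    proof (rule ccontr)
      assume "\<not> ?thesis"
      hence "q p = 0" if "p \<in> ns_support d a" for p using q0[OF that] that by force
      hence "tilt_trace 0 x ?\<tau> = 0" unfolding Z[OF order_refl] by (intro sum.neutral) auto
      thus False using tilt_trace_zero[OF \<epsilon> \<tau>, of x] by simp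
    qed
    then obtain p where p: "p \<in> ns_support d a" "0 < q p" by blast
    have e: "1 + (w * s + (1 - w) * t) = w * (1 + s) + (1 - w) * (1 + t)" by (simp add: algebra_simps)
    show ?thesis
      unfolding Z[OF s(1)] Z[OF s(2)] Z[OF r0] unfolding e
      by (rule perspective_log_sum_convex[where q = q and X = X and I = "ns_support d a", OF finite_ns_support q0 p _ _ w])
        (use s in auto)
  qed
  hence "(\<Sum>x\<in>UNIV. Q x * ((1 + (w * s + (1 - w) * t)) * log 2 (tilt_trace (w * s + (1 - w) * t) x ?\<tau>))) \<le>
      (\<Sum>x\<in>UNIV. Q x * (w * ((1 + s) * log 2 (tilt_trace s x ?\<tau>)) + (1 - w) * ((1 + t) * log 2 (tilt_trace t x ?\<tau>))))"
    using types_nonneg[OF Q] by (intro sum_mono mult_left_mono)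
  also have "\<dots> = w * (1 + s) * avg_log_tilt Q s ?\<tau> + (1 - w) * (1 + t) * avg_log_tilt Q t ?\<tau>"
    unfolding avg_log_tilt_def sum_distrib_left sum.distrib[symmetric]
    by (intro sum.cong refl) (simp add: algebra_simps)
  also have "\<dots> = - (w * tilt_exp Q s ?\<tau> + (1 - w) * tilt_exp Q t ?\<tau>)"
    by (simp add: tilt_exp_eq algebra_simps)
  also have "(\<Sum>x\<in>UNIV. Q x * ((1 + (w * s + (1 - w) * t)) * log 2 (tilt_trace (w * s + (1 - w) * t) x ?\<tau>))) =
      - tilt_exp Q (w * s + (1 - w) * t) ?\<tau>"
  proof -
    have "q * ((1 + u) * l) = - (- (1 + u) * (q * l))" for q u l :: real by (simp add: algebra_simps)
    thus ?thesis unfolding tilt_exp_def sum_distrib_left sum_negf[symmetric] by (intro sum.cong refl)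
  qed
  finally show ?thesis by simp
qed

text \<open>The tilted trace is concave in the state and the logarithm is increasing and concave;
  concavity of the logarithm is used in the form of \<open>young_powr\<close>.\<close>

lemma tilt_exp_convex:
  assumes Q: "Q \<in> types n" and \<epsilon>: "0 < \<epsilon>" "\<epsilon> \<le> 1" and \<tau>: "\<tau> \<in> density_ops d" "\<tau>' \<in> density_ops d"
    and s: "0 \<le> s" and w: "0 \<le> w" "w \<le> 1"
  shows "tilt_exp Q s (depolarize d \<epsilon> (mat_mix w \<tau> \<tau>')) \<le>
    w * tilt_exp Q s (depolarize d \<epsilon> \<tau>) + (1 - w) * tilt_exp Q s (depolarize d \<epsilon> \<tau>')"
proof (cases "s = 0")
  case True
  thus ?thesis using tilt_exp_zero[OF \<epsilon>] \<tau> mat_mix_density[OF w \<tau>] by simp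
next
  case False
  hence s: "0 < s" using s by simp
  note M = mat_mix_density[OF w \<tau>]
  have "w * log 2 (tilt_trace s x (depolarize d \<epsilon> \<tau>)) + (1 - w) * log 2 (tilt_trace s x (depolarize d \<epsilon> \<tau>')) \<le>
      log 2 (tilt_trace s x (depolarize d \<epsilon> (mat_mix w \<tau> \<tau>')))" for x
  proof -
    define y z where "y = tilt_trace s x (depolarize d \<epsilon> \<tau>)" and "z = tilt_trace s x (depolarize d \<epsilon> \<tau>')"
    have yz: "0 < y" "0 < z" unfolding y_def z_def using tilt_trace_pos[OF \<epsilon>] \<tau> s by auto
    have "w * log 2 y + (1 - w) * log 2 z = log 2 (y powr w * z powr (1 - w))"
      using yz by (simp add: log_mult log_powr)
    also have "\<dots> \<le> log 2 (w * y + (1 - w) * z)"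
      using young_powr[OF yz w] yz by (subst log_le_cancel_iff) (auto intro: less_le_trans[OF _ young_powr[OF yz w]])
    also have "\<dots> \<le> log 2 (tilt_trace s x (depolarize d \<epsilon> (mat_mix w \<tau> \<tau>')))"
    proof -
      have "0 < w * y + (1 - w) * z" using young_powr[OF yz w] yz by (auto intro: less_le_trans[OF _ young_powr[OF yz w]])
      moreover have "w * y + (1 - w) * z \<le> tilt_trace s x (depolarize d \<epsilon> (mat_mix w \<tau> \<tau>'))"
        unfolding y_def z_def using tilt_trace_concave[OF _ \<epsilon>(2) \<tau> s w] \<epsilon> by simp
      ultimately show ?thesis by (subst log_le_cancel_iff) auto
    qed
    finally show ?thesis unfolding y_def z_def .
  qed
  hence "(\<Sum>x\<in>UNIV. Q x * (w * log 2 (tilt_trace s x (depolarize d \<epsilon> \<tau>)) + (1 - w) * log 2 (tilt_trace s x (depolarize d \<epsilon> \<tau>')))) \<le>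
      (\<Sum>x\<in>UNIV. Q x * log 2 (tilt_trace s x (depolarize d \<epsilon> (mat_mix w \<tau> \<tau>'))))" (is "?l \<le> ?r")
    using types_nonneg[OF Q] by (intro sum_mono mult_left_mono)
  moreover have "?l = w * avg_log_tilt Q s (depolarize d \<epsilon> \<tau>) + (1 - w) * avg_log_tilt Q s (depolarize d \<epsilon> \<tau>')"
    unfolding avg_log_tilt_def sum_distrib_left sum.distrib[symmetric]
    by (intro sum.cong refl) (simp add: algebra_simps)
  ultimately have "(1 + s) * (w * avg_log_tilt Q s (depolarize d \<epsilon> \<tau>) + (1 - w) * avg_log_tilt Q s (depolarize d \<epsilon> \<tau>')) \<le>
      (1 + s) * avg_log_tilt Q s (depolarize d \<epsilon> (mat_mix w \<tau> \<tau>'))"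
    unfolding avg_log_tilt_def[symmetric] using s by (intro mult_left_mono) auto
  thus ?thesis unfolding tilt_exp_eq by (simp add: algebra_simps)
qed

section \<open>One state for all values of s\<close>

lemma petz_sum_finite:
  assumes Q: "Q \<in> types n" and \<tau>: "\<tau> \<in> density_ops d" and s: "0 < s"
    and fin: "(\<Sum>x\<in>UNIV. ereal (Q x) * petz_div (1 / (1 + s)) (\<rho> x) \<tau>) < \<infinity>"
  shows "\<And>x. 0 < Q x \<Longrightarrow> 0 < tilt_trace s x \<tau>"
    "(\<Sum>x\<in>UNIV. ereal (Q x) * petz_div (1 / (1 + s)) (\<rho> x) \<tau>) = ereal (tilt_exp Q s \<tau> / s)"
proof -
  have \<alpha>: "1 / (1 + s) \<noteq> 1" "1 - 1 / (1 + s) = s / (1 + s)" "1 / (1 / (1 + s) - 1) = - (1 + s) / s"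
    using s by (auto simp: field_simps)
  have petz: "petz_div (1 / (1 + s)) (\<rho> x) \<tau> =
      (if tilt_trace s x \<tau> = 0 then \<infinity> else ereal (- (1 + s) / s * log 2 (tilt_trace s x \<tau>)))" for x
    unfolding petz_div_def if_not_P[OF \<alpha>(1)] unfolding \<alpha>(2,3) tilt_trace_def[symmetric] Let_def ..
  have nn: "0 \<le> tilt_trace s x \<tau>" for x
    unfolding tilt_trace_def by (intro trace_psd_mult_nonneg[of d] psd_mat_powr psd_rho density_opsD(1)[OF \<tau>])
  show pos: "0 < tilt_trace s x \<tau>" if Qx: "0 < Q x" for x
  proof (rule ccontr)
    assume "\<not> 0 < tilt_trace s x \<tau>"
    hence "ereal (Q x) * petz_div (1 / (1 + s)) (\<rho> x) \<tau> = \<infinity>"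
      using nn[of x] Qx by (simp add: petz)
    hence "(\<Sum>x\<in>UNIV. ereal (Q x) * petz_div (1 / (1 + s)) (\<rho> x) \<tau>) = \<infinity>"
      unfolding sum_Pinfty by (intro conjI finite bexI[of _ x]) auto
    thus False using fin by simp
  qed
  have "ereal (Q x) * petz_div (1 / (1 + s)) (\<rho> x) \<tau> = ereal (Q x * (- (1 + s) / s * log 2 (tilt_trace s x \<tau>)))" for x
  proof (cases "Q x = 0")
    case False
    hence "0 < Q x" using types_nonneg[OF Q, of x] by simp
    thus ?thesis using pos[of x] by (simp add: petz)
  qed (simp add: zero_ereal_def[symmetric])
  hence "(\<Sum>x\<in>UNIV. ereal (Q x) * petz_div (1 / (1 + s)) (\<rho> x) \<tau>) =
      ereal (\<Sum>x\<in>UNIV. Q x * (- (1 + s) / s * log 2 (tilt_trace s x \<tau>)))" by simp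
  also have "(\<Sum>x\<in>UNIV. Q x * (- (1 + s) / s * log 2 (tilt_trace s x \<tau>))) = tilt_exp Q s \<tau> / s"
    unfolding tilt_exp_def by (simp add: sum_distrib_left sum_divide_distrib mult_ac)
  finally show "(\<Sum>x\<in>UNIV. ereal (Q x) * petz_div (1 / (1 + s)) (\<rho> x) \<tau>) = ereal (tilt_exp Q s \<tau> / s)" .
qed

lemma E_sps_nonneg: "0 \<le> E_sps d \<rho> R Q"
proof -
  have "ereal 0 * ((INF \<tau>\<in>density_ops d. \<Sum>x\<in>UNIV. ereal (Q x) * petz_div (1 / (1 + 0)) (\<rho> x) \<tau>)
                - ereal (shannon_entropy Q)) + ereal (0 * R) \<le> E_sps d \<rho> R Q"
    unfolding E_sps_def by (rule SUP_upper) simp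
  thus ?thesis by (simp add: zero_ereal_def[symmetric])
qed

lemma exists_near_optimal_state:
  assumes Q: "Q \<in> types n" and E: "E_sps d \<rho> R Q \<le> ereal e" and s: "0 < s" and \<eta>: "0 < \<eta>"
  shows "\<exists>\<tau>\<in>density_ops d. (\<forall>x. 0 < Q x \<longrightarrow> 0 < tilt_trace s x \<tau>) \<and>
    tilt_exp Q s \<tau> - s * (shannon_entropy Q - R) < e + \<eta>"
proof -
  let ?S = "\<lambda>\<tau>. \<Sum>x\<in>UNIV. ereal (Q x) * petz_div (1 / (1 + s)) (\<rho> x) \<tau>"
  define H where "H = shannon_entropy Q"
  define I where "I = (INF \<tau>\<in>density_ops d. ?S \<tau>)"
  have le: "ereal s * (I - ereal H) + ereal (s * R) \<le> ereal e"
    using E s unfolding E_sps_def I_def H_def by (auto simp: SUP_le_iff)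
  have "I < ereal ((e + \<eta> - s * R) / s + H)"
  proof (cases I)
    case (real i)
    have "s * (i - H) + s * R \<le> e" using le by (simp add: real)
    hence "s * i < e + \<eta> - s * R + s * H" using \<eta> by (simp add: algebra_simps)
    hence "i < (e + \<eta> - s * R + s * H) / s" using s by (simp add: pos_less_divide_eq mult.commute)
    thus ?thesis using s by (simp add: real add_divide_distrib)
  next
    case PInf
    thus ?thesis using le s by simp
  next
    case MInf
    thus ?thesis by simp
  qed
  then obtain \<tau> where \<tau>: "\<tau> \<in> density_ops d" and lt: "?S \<tau> < ereal ((e + \<eta> - s * R) / s + H)"
    unfolding I_def INF_less_iff by blast
  have fin: "?S \<tau> < \<infinity>" using lt by (rule less_trans) simp
  note petz = petz_sum_finite[OF Q \<tau> s fin]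
  have "tilt_exp Q s \<tau> / s < (e + \<eta> - s * R) / s + H" using lt unfolding petz(2) by simp
  hence "tilt_exp Q s \<tau> - s * (H - R) < e + \<eta>" using s by (simp add: field_simps)
  thus ?thesis using \<tau> petz(1) unfolding H_def by blast
qed

text \<open>\<open>E_sps\<close> provides a good state for each \<open>s\<close>; the minimax
  theorem exchanges the quantifiers. Depolarizing is built into the objective, so that it is
  real-valued and grows at most linearly. With \<epsilon> = 1/n, the term 2/n collects the
  approximation of the infimum and \<eta>, and 5/n collects the depolarizing loss 4/n and
  \<delta>.\<close>

lemma exists_saddle_state:
  assumes Q: "Q \<in> types m" and E: "E_sps d \<rho> R Q \<le> ereal e" and n: "2 \<le> n"
  shows "\<exists>\<tau>\<in>density_ops d. \<forall>s\<ge>0. tilt_exp Q s (depolarize d (1 / real n) \<tau>)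
    \<le> e + 2 / real n + s * (shannon_entropy Q - R + 5 / real n)"
proof -
  define \<epsilon> where "\<epsilon> = 1 / real n"
  have \<epsilon>: "0 < \<epsilon>" "\<epsilon> \<le> 1" using n by (auto simp: \<epsilon>_def)
  define r where "r = shannon_entropy Q - R + 4 * \<epsilon>"
  define F where "F s \<tau> = tilt_exp Q s (depolarize d \<epsilon> \<tau>) - s * r" for s \<tau>
  define C where "C = \<bar>- log 2 (\<epsilon> / real d) - r\<bar>"
  have e0: "0 \<le> e" using order_trans[OF E_sps_nonneg E] by simp
  have "\<exists>\<tau>\<in>density_ops d. \<forall>s\<ge>0. F s \<tau> \<le> (e + \<epsilon>) + \<epsilon> + s * \<epsilon>"
  proof (rule concave_convex_minimax[where m = mat_mix and C = C])
    fix s assume s: "0 \<le> (s :: real)"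
    show "\<exists>\<tau>\<in>density_ops d. F s \<tau> < e + \<epsilon>"
    proof (cases "s = 0")
      case True
      thus ?thesis using density tilt_exp_zero[OF \<epsilon> density] e0 \<epsilon>
        by (intro bexI[of _ "\<rho> undefined"]) (auto simp: F_def)
    next
      case False
      hence s: "0 < s" using s by simp
      obtain \<tau> where \<tau>: "\<tau> \<in> density_ops d" "\<And>x. 0 < Q x \<Longrightarrow> 0 < tilt_trace s x \<tau>"
        and lt: "tilt_exp Q s \<tau> - s * (shannon_entropy Q - R) < e + \<epsilon>"
        using exists_near_optimal_state[OF Q E s \<epsilon>(1)] by blast
      have "F s \<tau> \<le> tilt_exp Q s \<tau> + s * (4 * \<epsilon>) - s * r"
        using tilt_exp_depolarize_le[OF Q n \<tau>(1) s \<tau>(2)] by (simp add: F_def \<epsilon>_def)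
      also have "\<dots> = tilt_exp Q s \<tau> - s * (shannon_entropy Q - R)" by (simp add: r_def algebra_simps)
      finally show ?thesis using lt \<tau>(1) by (intro bexI[of _ \<tau>]) auto
    qed
  next
    fix s \<tau> assume s: "0 \<le> (s :: real)" and \<tau>: "\<tau> \<in> density_ops d"
    have "F s \<tau> \<le> s * (- log 2 (\<epsilon> / real d) - r)"
      using tilt_exp_le[OF Q \<epsilon> \<tau> s] by (simp add: F_def right_diff_distrib)
    also have "\<dots> \<le> s * C" unfolding C_def using s by (intro mult_left_mono) auto
    finally show "F s \<tau> \<le> C * s" by (simp add: mult.commute)
  next
    fix s w :: real and \<tau> \<tau>' assume *: "0 \<le> s" "0 \<le> w" "w \<le> 1" "\<tau> \<in> density_ops d" "\<tau>' \<in> density_ops d"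
    show "F s (mat_mix w \<tau> \<tau>') \<le> w * F s \<tau> + (1 - w) * F s \<tau>'"
      using tilt_exp_convex[OF Q \<epsilon> *(4,5,1,2,3)] by (simp add: F_def algebra_simps)
  next
    fix s t w :: real and \<tau> assume *: "0 \<le> s" "0 \<le> t" "0 \<le> w" "w \<le> 1" "\<tau> \<in> density_ops d"
    show "w * F s \<tau> + (1 - w) * F t \<tau> \<le> F (w * s + (1 - w) * t) \<tau>"
      using tilt_exp_concave[OF Q \<epsilon> *(5,1,2,3,4)] by (simp add: F_def algebra_simps)
  qed (use mat_mix_density tilt_exp_zero[OF \<epsilon>] e0 \<epsilon> in \<open>auto simp: F_def C_def\<close>)
  then obtain \<tau> where \<tau>: "\<tau> \<in> density_ops d" "\<And>s. 0 \<le> s \<Longrightarrow> F s \<tau> \<le> (e + \<epsilon>) + \<epsilon> + s * \<epsilon>" by blast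
  have "tilt_exp Q s (depolarize d (1 / real n) \<tau>) \<le> e + 2 / real n + s * (shannon_entropy Q - R + 5 / real n)"
    if "0 \<le> s" for s
    using \<tau>(2)[OF that] by (simp add: F_def r_def \<epsilon>_def algebra_simps)
  thus ?thesis using \<tau>(1) by blast
qed

end

section \<open>The sphere-packing bound\<close>

text \<open>Carries bounds for independent letters, stated over dependent products, to pairs of
  tensor indices. Surjectivity of the digit map follows from counting.\<close>

lemma sum_dig_pairs:
  fixes h :: "(nat \<Rightarrow> nat \<times> nat) \<Rightarrow> real"
  shows "(\<Sum>i<d ^ n. \<Sum>j<d ^ n. h (\<lambda>k\<in>{..<n}. (dig d n i k, dig d n j k))) =
    (\<Sum>\<omega>\<in>PiE {..<n} (\<lambda>_. {..<d} \<times> {..<d}). h \<omega>)"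
proof -
  define \<phi> where "\<phi> p = (\<lambda>k\<in>{..<n}. (dig d n (fst p) k, dig d n (snd p) k))" for p :: "nat \<times> nat"
  let ?D = "{..<d ^ n} \<times> {..<d ^ n}" and ?E = "PiE {..<n} (\<lambda>_. {..<d} \<times> {..<d})"
  have inj: "inj_on \<phi> ?D"
  proof (rule inj_onI)
    fix p p' assume p: "p \<in> ?D" "p' \<in> ?D" and eq: "\<phi> p = \<phi> p'"
    have "dig d n (fst p) k = dig d n (fst p') k" "dig d n (snd p) k = dig d n (snd p') k" if "k < n" for k
      using fun_cong[OF eq, of k] that by (auto simp: \<phi>_def)
    hence "fst p = fst p'" "snd p = snd p'" using p by (auto intro: dig_inject)
    thus "p = p'" by (rule prod_eqI)
  qed
  have sub: "\<phi> ` ?D \<subseteq> ?E"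
  proof (rule image_subsetI)
    fix p assume "p \<in> ?D"
    hence "fst p < d ^ n" "snd p < d ^ n" by auto
    thus "\<phi> p \<in> ?E" unfolding \<phi>_def by (intro restrict_PiE_iff[THEN iffD2] ballI) (simp add: dig_less)
  qed
  have "card (\<phi> ` ?D) = card ?E"
    unfolding card_image[OF inj] by (simp add: card_PiE card_cartesian_product power_mult_distrib)
  hence "\<phi> ` ?D = ?E" using sub by (intro card_subset_eq) (auto intro: finite_PiE)
  hence "(\<Sum>\<omega>\<in>?E. h \<omega>) = (\<Sum>p\<in>?D. h (\<phi> p))" using sum.reindex[OF inj, of h] by simp
  also have "\<dots> = (\<Sum>i<d ^ n. \<Sum>j<d ^ n. h (\<phi> (i, j)))"
    unfolding sum.cartesian_product by (intro sum.cong) auto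
  finally show ?thesis by (simp add: \<phi>_def)
qed

lemma eig_decomp_spec:
  assumes "hermitian d A"
  shows "is_eig_decomp A (fst (eig_decomp A)) (snd (eig_decomp A))"
proof -
  obtain V g where "is_eig_decomp A V g" using hermitian_is_eig_decomp[OF assms] by blast
  hence "case (V, g) of (U, e) \<Rightarrow> is_eig_decomp A U e" by simp
  hence "case eig_decomp A of (U, e) \<Rightarrow> is_eig_decomp A U e"
    unfolding eig_decomp_def by (rule someI[where P = "\<lambda>(U, e). is_eig_decomp A U e"])
  thus ?thesis by (simp add: case_prod_beta)
qed

section \<open>Testing a sequence against the power of the saddle state\<close>

context state_family
begin

text \<open>The inserted 1 makes \<open>Min\<close> meaningful and bounds the value by one. The
  chosen \<open>eig_decomp\<close> makes it a single constant of the family, independent of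
  \<open>n\<close> and \<open>Q\<close>.\<close>

definition min_eig :: real where
  "min_eig = Min (insert 1 {snd (eig_decomp (\<rho> x)) k |x k. k < d \<and> 0 < snd (eig_decomp (\<rho> x)) k})"

lemma min_eig:
  shows "0 < min_eig" "min_eig \<le> 1" "k < d \<Longrightarrow> 0 < snd (eig_decomp (\<rho> x)) k \<Longrightarrow> min_eig \<le> snd (eig_decomp (\<rho> x)) k"
proof -
  let ?S = "{snd (eig_decomp (\<rho> x)) k |x k. k < d \<and> 0 < snd (eig_decomp (\<rho> x)) k}"
  have "?S \<subseteq> (\<lambda>(x, k). snd (eig_decomp (\<rho> x)) k) ` (UNIV \<times> {..<d})" by auto
  hence fin: "finite (insert 1 ?S)" by (meson finite_SigmaI finite finite_imageI finite_insert finite_lessThan finite_subset)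
  show "0 < min_eig" unfolding min_eig_def using fin by (subst Min_gr_iff) auto
  show "min_eig \<le> 1" unfolding min_eig_def using fin by (intro Min_le) auto
  show "min_eig \<le> snd (eig_decomp (\<rho> x)) k" if "k < d" "0 < snd (eig_decomp (\<rho> x)) k"
    unfolding min_eig_def using fin that by (intro Min_le) auto
qed

text \<open>The logarithm subtracted in the exponent bounds the oscillation of one letter's
  log-likelihood ratio: eigenvalues on the support lie between \<open>min_eig\<close> and 1 for the
  given state and between 1/(dn) and 1 for the depolarized one. The factor 2 of
  \<open>nussbaum_szkola_bound\<close> turns 8 into 16.\<close>

lemma test_error_lower_bound:
  assumes Q: "Q \<in> types n" and n: "0 < n" and xs: "xs \<in> type_seqs n Q" and \<tau>: "\<tau> \<in> density_ops d"
    and hyp: "\<And>s. 0 \<le> s \<Longrightarrow> real n * tilt_exp Q s (depolarize d (1 / real n) \<tau>) - s * r \<le> E - s"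
    and T: "psd (d ^ n) T" "psd (d ^ n) (1\<^sub>m (d ^ n) - T)"
  shows "\<exists>\<gamma>\<ge>2 powr (r - E - log 2 (real d * real n / min_eig) - 1). \<gamma> * 2 powr (- r) / (16 * (real n + 1)) \<le>
    Re (mat_trace ((1\<^sub>m (d ^ n) - T) * seq_state \<rho> xs)) +
    \<gamma> * Re (mat_trace (T * tensor_list (replicate n (depolarize d (1 / real n) \<tau>))))"
proof -
  define \<sigma> where "\<sigma> = depolarize d (1 / real n) \<tau>"
  define B where "B = log 2 (real d * real n / min_eig)"
  have \<epsilon>: "0 < 1 / real n" "1 / real n \<le> 1" using n by auto
  have len: "length xs = n" "xs \<in> seqs n" using type_seqsD[OF xs] by auto
  have \<sigma>D: "\<sigma> \<in> density_ops d" unfolding \<sigma>_def using depolarize_density[OF _ \<epsilon>(2) \<tau>] by simp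
  note \<sigma> = density_opsD[OF \<sigma>D]
  obtain V b where V: "is_eig_decomp \<sigma> V b" using hermitian_is_eig_decomp[OF psdD(2)[OF \<sigma>(1)]] by blast
  have b: "1 / (real n * real d) \<le> b l" "b l \<le> 1" if "l < d" for l
    using depolarize_eig_ge[OF _ \<epsilon>(2) \<tau> V[unfolded \<sigma>_def] that] sum_eig_density(3)[OF \<sigma>D V that] by auto
  have b0: "0 < b l" if "l < d" for l
    using b(1)[OF that] n dim_pos by (smt (verit) divide_pos_pos mult_pos_pos of_nat_0_less_iff)
  define U where "U x = fst (eig_decomp (\<rho> x))" for x
  define a where "a x = snd (eig_decomp (\<rho> x))" for x
  have U: "is_eig_decomp (\<rho> x) (U x) (a x)" for x
    unfolding U_def a_def by (rule eig_decomp_spec[OF psdD(2)[OF psd_rho]])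
  have a: "0 \<le> a x k" "a x k \<le> 1" if "k < d" for x k
    using sum_eig_density(2,3)[OF density U that] by auto
  have a_min: "min_eig \<le> a x k" if "k < d" "0 < a x k" for x k using min_eig(3) that by (simp add: a_def)
  define w where "w k i j = overlap d (U (xs ! k)) V i j" for k i j
  define q where "q k p = b (snd p) * w k (fst p) (snd p)" for k and p :: "nat \<times> nat"
  define X where "X k p = log 2 (a (xs ! k) (fst p)) - log 2 (b (snd p))" for k and p :: "nat \<times> nat"
  define I where "I k = ns_support d (a (xs ! k))" for k
  have I: "fst p < d" "snd p < d" "0 < a (xs ! k) (fst p)" if "p \<in> I k" for p k
    using that by (auto simp: I_def ns_support_def)
  have tilt: "tilt_trace s (xs ! k) \<sigma> = (\<Sum>p\<in>I k. q k p * 2 powr (X k p / (1 + s)))" if "0 \<le> s" for s k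
    unfolding tilt_trace_def q_def X_def I_def w_def
    by (rule trace_powr_as_tilt[OF psdD(1)[OF psd_rho] U \<sigma>(3) V a(1) b0 that])
  have "\<exists>\<gamma>\<ge>2 powr (r - E - B - 1). \<gamma> * 2 powr (- r) / (8 * (real n + 1)) \<le>
    (\<Sum>\<omega>\<in>PiE {..<n} I. min ((\<Prod>j<n. q j (\<omega> j)) * 2 powr (\<Sum>j<n. X j (\<omega> j))) (\<gamma> * (\<Prod>j<n. q j (\<omega> j))))"
  proof (rule tilted_window)
    show "finite (I j)" for j by (simp add: I_def)
    show "0 \<le> q j p" if "p \<in> I j" for j p
      using b0[OF I(2)[OF that]] overlap_nonneg by (simp add: q_def w_def)
    show "(\<Sum>p\<in>I j. q j p * 2 powr X j p) = 1" for j
      using tilt[of 0 j] tilt_trace_zero[OF \<epsilon> \<tau>, of "xs ! j"] by (simp add: \<sigma>_def)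
    show "X j p - X j p' \<le> B" if p: "p' \<in> I j" "p \<in> I j" for j p p'
    proof -
      have "log 2 (a (xs ! j) (fst p)) \<le> log 2 1" using I[OF p(2)] a by (subst log_le_cancel_iff) auto
      moreover have "log 2 min_eig \<le> log 2 (a (xs ! j) (fst p'))"
        using I[OF p(1)] a_min min_eig by (subst log_le_cancel_iff) auto
      moreover have "log 2 (b (snd p')) \<le> log 2 1" using I[OF p(1)] b b0 by (subst log_le_cancel_iff) auto
      moreover have "log 2 (1 / (real n * real d)) \<le> log 2 (b (snd p))"
        using I[OF p(2)] b b0 n dim_pos by (subst log_le_cancel_iff) auto
      moreover have "B = - log 2 min_eig - log 2 (1 / (real n * real d))"
        using n dim_pos min_eig by (simp add: B_def log_divide log_mult)
      ultimately show ?thesis unfolding X_def by simp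
    qed
    show "0 \<le> B"
    proof -
      have "min_eig \<le> 1" "1 \<le> real d * real n"
        using min_eig n dim_pos mult_mono[of 1 "real d" 1 "real n"] by auto
      hence "1 \<le> real d * real n / min_eig" using min_eig(1) by (simp add: le_divide_eq)
      thus ?thesis unfolding B_def by simp
    qed
    fix s :: real assume s: "0 \<le> s"
    have "(\<Sum>j<n. log 2 (\<Sum>p\<in>I j. q j p * 2 powr (X j p / (1 + s)))) = (\<Sum>j<n. log 2 (tilt_trace s (xs ! j) \<sigma>))"
      using tilt[OF s] by simp
    also have "\<dots> = real n * avg_log_tilt Q s \<sigma>"
      unfolding avg_log_tilt_def by (rule sum_type_seqs[OF xs])
    finally show "- (1 + s) * (\<Sum>j<n. log 2 (\<Sum>p\<in>I j. q j p * 2 powr (X j p / (1 + s)))) - s * r \<le> E - s"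
      using hyp[OF s] by (simp add: tilt_exp_eq \<sigma>_def mult.left_commute)
  qed
  then obtain \<gamma> where \<gamma>: "2 powr (r - E - B - 1) \<le> \<gamma>" and window: "\<gamma> * 2 powr (- r) / (8 * (real n + 1)) \<le>
    (\<Sum>\<omega>\<in>PiE {..<n} I. min ((\<Prod>j<n. q j (\<omega> j)) * 2 powr (\<Sum>j<n. X j (\<omega> j))) (\<gamma> * (\<Prod>j<n. q j (\<omega> j))))" by blast
  have \<gamma>0: "0 \<le> \<gamma>" using \<gamma> by (smt (verit) powr_ge_zero)
  define p where "p k z = a (xs ! k) (fst z) * w k (fst z) (snd z)" for k z
  define h where "h \<omega> = min (\<Prod>k<n. p k (\<omega> k)) (\<gamma> * (\<Prod>k<n. q k (\<omega> k)))" for \<omega>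
  have h0: "0 \<le> h \<omega>" if "\<omega> \<in> PiE {..<n} (\<lambda>_. {..<d} \<times> {..<d})" for \<omega>
  proof -
    have "0 \<le> p k (\<omega> k)" "0 \<le> q k (\<omega> k)" if k: "k < n" for k
    proof -
      have "\<omega> k \<in> {..<d} \<times> {..<d}" using \<open>\<omega> \<in> _\<close> k by (auto simp: PiE_iff)
      hence "fst (\<omega> k) < d" "snd (\<omega> k) < d" by auto
      thus "0 \<le> p k (\<omega> k)" "0 \<le> q k (\<omega> k)"
        using a(1) b0[of "snd (\<omega> k)"] overlap_nonneg by (auto simp: p_def q_def w_def)
    qed
    thus ?thesis unfolding h_def using \<gamma>0 by (auto intro!: prod_nonneg mult_nonneg_nonneg)
  qed
  have "(\<Sum>\<omega>\<in>PiE {..<n} I. min ((\<Prod>j<n. q j (\<omega> j)) * 2 powr (\<Sum>j<n. X j (\<omega> j))) (\<gamma> * (\<Prod>j<n. q j (\<omega> j)))) =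
      (\<Sum>\<omega>\<in>PiE {..<n} I. h \<omega>)"
  proof (intro sum.cong refl)
    fix \<omega> assume \<omega>: "\<omega> \<in> PiE {..<n} I"
    have "q k (\<omega> k) * 2 powr X k (\<omega> k) = p k (\<omega> k)" if "k < n" for k
    proof -
      have "\<omega> k \<in> I k" using \<omega> that by (auto simp: PiE_iff)
      note i = I[OF this]
      have "2 powr X k (\<omega> k) = a (xs ! k) (fst (\<omega> k)) / b (snd (\<omega> k))"
        unfolding X_def powr_diff using i b0 by simp
      thus ?thesis using b0[OF i(2)] by (simp add: p_def q_def)
    qed
    hence "(\<Prod>j<n. q j (\<omega> j)) * 2 powr (\<Sum>j<n. X j (\<omega> j)) = (\<Prod>k<n. p k (\<omega> k))"
      by (simp add: powr_sum prod.distrib[symmetric])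
    thus "min ((\<Prod>j<n. q j (\<omega> j)) * 2 powr (\<Sum>j<n. X j (\<omega> j))) (\<gamma> * (\<Prod>j<n. q j (\<omega> j))) = h \<omega>"
      by (simp add: h_def)
  qed
  \<comment> \<open>Index pairs outside the supports contribute nonnegative terms, so the sum may be
    enlarged to all of them.\<close>
  also have "\<dots> \<le> (\<Sum>\<omega>\<in>PiE {..<n} (\<lambda>_. {..<d} \<times> {..<d}). h \<omega>)"
  proof (rule sum_mono2)
    show "PiE {..<n} I \<subseteq> PiE {..<n} (\<lambda>_. {..<d} \<times> {..<d})"
      using I by (intro PiE_mono) (auto simp: mem_Times_iff)
  qed (auto intro: finite_PiE h0)
  also have "\<dots> = (\<Sum>i<d ^ n. \<Sum>j<d ^ n. h (\<lambda>k\<in>{..<n}. (dig d n i k, dig d n j k)))"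
    by (rule sum_dig_pairs[symmetric])
  finally have le: "\<gamma> * 2 powr (- r) / (8 * (real n + 1)) \<le>
      (\<Sum>i<d ^ n. \<Sum>j<d ^ n. h (\<lambda>k\<in>{..<n}. (dig d n i k, dig d n j k)))" using window by linarith
  define Us where "Us = map U xs"
  define Vs where "Vs = replicate n V"
  have lenU: "length Us = n" "length Vs = n" using len by (auto simp: Us_def Vs_def)
  have Uc: "Us ! k \<in> carrier_mat d d" "Vs ! k \<in> carrier_mat d d" if "k < n" for k
    using that len is_eig_decompD(1)[OF psdD(1)[OF psd_rho] U] is_eig_decompD(1)[OF \<sigma>(3) V]
    by (auto simp: Us_def Vs_def)
  have decA: "is_eig_decomp (seq_state \<rho> xs) (tensor_list Us) (\<lambda>i. \<Prod>k<n. a (xs ! k) (dig d n i k))"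
    unfolding seq_state_def
    by (rule is_eig_decomp_tensor_list[OF _ lenU(1)]) (use len psdD(1)[OF psd_rho] U in \<open>auto simp: Us_def\<close>)
  have decB: "is_eig_decomp (tensor_list (replicate n \<sigma>)) (tensor_list Vs) (\<lambda>j. \<Prod>k<n. b (dig d n j k))"
    by (rule is_eig_decomp_tensor_list[OF _ lenU(2)]) (use \<sigma>(3) V in \<open>auto simp: Vs_def\<close>)
  have psdB: "psd (d ^ n) (tensor_list (replicate n \<sigma>))"
    using psd_tensor_list[of "replicate n \<sigma>" d] \<sigma>(1) by simp
  have "h (\<lambda>k\<in>{..<n}. (dig d n i k, dig d n j k)) =
      min ((\<Prod>k<n. a (xs ! k) (dig d n i k)) * overlap (d ^ n) (tensor_list Us) (tensor_list Vs) i j)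
        (\<gamma> * ((\<Prod>k<n. b (dig d n j k)) * overlap (d ^ n) (tensor_list Us) (tensor_list Vs) i j))"
    if ij: "i < d ^ n" "j < d ^ n" for i j
  proof -
    have "overlap (d ^ n) (tensor_list Us) (tensor_list Vs) i j = (\<Prod>k<n. w k (dig d n i k) (dig d n j k))"
    proof -
      have "overlap (d ^ n) (tensor_list Us) (tensor_list Vs) i j =
          (\<Prod>k<n. overlap d (Us ! k) (Vs ! k) (dig d n i k) (dig d n j k))"
        by (rule overlap_tensor_list) (use lenU Uc ij in auto)
      also have "\<dots> = (\<Prod>k<n. w k (dig d n i k) (dig d n j k))"
        using len by (intro prod.cong refl) (auto simp: Us_def Vs_def w_def)
      finally show ?thesis .
    qed
    thus ?thesis by (simp add: h_def p_def q_def prod.distrib)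
  qed
  hence "(\<Sum>i<d ^ n. \<Sum>j<d ^ n. h (\<lambda>k\<in>{..<n}. (dig d n i k, dig d n j k))) / 2 =
      (\<Sum>i<d ^ n. \<Sum>j<d ^ n.
        min ((\<Prod>k<n. a (xs ! k) (dig d n i k)) * overlap (d ^ n) (tensor_list Us) (tensor_list Vs) i j)
        (\<gamma> * ((\<Prod>k<n. b (dig d n j k)) * overlap (d ^ n) (tensor_list Us) (tensor_list Vs) i j))) / 2" by simp
  also have "\<dots> \<le> Re (mat_trace ((1\<^sub>m (d ^ n) - T) * seq_state \<rho> xs)) + \<gamma> * Re (mat_trace (T * tensor_list (replicate n \<sigma>)))"
    by (rule nussbaum_szkola_bound[OF psd_seq_state[OF len(2)] decA psdB decB T \<gamma>0])
  finally have half: "(\<Sum>i<d ^ n. \<Sum>j<d ^ n. h (\<lambda>k\<in>{..<n}. (dig d n i k, dig d n j k))) / 2 \<le>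
      Re (mat_trace ((1\<^sub>m (d ^ n) - T) * seq_state \<rho> xs)) + \<gamma> * Re (mat_trace (T * tensor_list (replicate n \<sigma>)))"
 .
  have "\<gamma> * 2 powr (- r) / (16 * (real n + 1)) \<le>
      Re (mat_trace ((1\<^sub>m (d ^ n) - T) * seq_state \<rho> xs)) + \<gamma> * Re (mat_trace (T * tensor_list (replicate n \<sigma>)))"
  proof -
    have "\<gamma> * 2 powr (- r) / (16 * (real n + 1)) = \<gamma> * 2 powr (- r) / (8 * (real n + 1)) / 2" by simp
    also have "\<dots> \<le> (\<Sum>i<d ^ n. \<Sum>j<d ^ n. h (\<lambda>k\<in>{..<n}. (dig d n i k, dig d n j k))) / 2"
      by (rule divide_right_mono[OF le]) simp
    also note half
    finally show ?thesis .
  qed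
  thus ?thesis using \<gamma> unfolding \<sigma>_def[symmetric] B_def[symmetric] by (intro exI[of _ \<gamma>] conjI)
qed

end

lemma frac_le_frac:
  fixes a b c e :: real
  assumes "0 < b" "0 < e" "a * e \<le> c * b"
  shows "a / b \<le> c / e"
  using assms by (simp add: field_simps)

section \<open>The converse for codes\<close>

context state_family
begin

text \<open>For a fixed message the measurement distributes total weight one over all sequences;
  counting every sequence under every message gives the number of messages.\<close>

lemma sum_povm_fixed_state_le:
  assumes c: "(enc, P) \<in> source_codes d n R" and T: "T \<subseteq> seqs n"
    and \<tau>: "psd (d ^ n) \<tau>" "mat_trace \<tau> = 1"
  shows "(\<Sum>xs\<in>T. Re (mat_trace (P (enc xs) xs * \<tau>))) \<le> real (card (messages n R))"
proof -
  have povm: "is_povm (d ^ n) (seqs n) (P z)" if "z \<in> messages n R" for z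
    using c that by (auto simp: source_codes_def)
  have enc: "enc xs \<in> messages n R" if "xs \<in> seqs n" for xs using c that by (auto simp: source_codes_def)
  have fin: "finite (messages n R)" by (simp add: messages_def)
  have nonneg: "0 \<le> Re (mat_trace (P z xs * \<tau>))" if "z \<in> messages n R" "xs \<in> seqs n" for z xs
    by (rule trace_psd_mult_nonneg[OF is_povm_le_one(1)[OF povm[OF that(1)] finite_seqs that(2)] \<tau>(1)])
  have "(\<Sum>xs\<in>T. Re (mat_trace (P (enc xs) xs * \<tau>))) \<le> (\<Sum>xs\<in>T. \<Sum>z\<in>messages n R. Re (mat_trace (P z xs * \<tau>)))"
    using T enc nonneg by (intro sum_mono member_le_sum fin) auto
  also have "\<dots> \<le> (\<Sum>xs\<in>seqs n. \<Sum>z\<in>messages n R. Re (mat_trace (P z xs * \<tau>)))"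
    using T nonneg by (intro sum_mono2 finite_seqs sum_nonneg) auto
  also have "\<dots> = (\<Sum>z\<in>messages n R. \<Sum>xs\<in>seqs n. Re (mat_trace (P z xs * \<tau>)))" by (rule sum.swap)
  also have "\<dots> = (\<Sum>z\<in>messages n R. 1)"
  proof (rule sum.cong[OF refl])
    fix z assume z: "z \<in> messages n R"
    have carr: "P z xs \<in> carrier_mat (d ^ n) (d ^ n)" if "xs \<in> seqs n" for xs
      using is_povm_le_one(1)[OF povm[OF z] finite_seqs that] by (rule psdD(1))
    have "(\<Sum>xs\<in>seqs n. mat_trace (P z xs * \<tau>)) = (\<Sum>xs\<in>seqs n. mat_trace (\<tau> * P z xs))"
      by (intro sum.cong refl mat_trace_mult_comm[OF carr psdD(1)[OF \<tau>(1)]])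
    also have "\<dots> = mat_trace (\<tau> * msum (d ^ n) (P z) (seqs n))"
      by (rule trace_mult_msum_right[OF psdD(1)[OF \<tau>(1)] carr, symmetric])
    also have "\<dots> = 1" using povm[OF z] \<tau> psdD(1)[OF \<tau>(1)] by (simp add: is_povm_def right_mult_one_mat)
    finally show "(\<Sum>xs\<in>seqs n. Re (mat_trace (P z xs * \<tau>))) = 1"
      by (metis Re_sum one_complex.sel(1))
  qed
  also have "\<dots> = real (card (messages n R))" by simp
  finally show ?thesis .
qed

lemma opt_err_prob_ge:
  assumes Q: "Q \<in> types n" and n: "4096 \<le> n" and R: "0 \<le> R"
    and E: "E_sps d \<rho> (R + rate_slack TYPE('x) n) Q \<le> ereal e"
  shows "2 powr (- (real n * e + 8 + log 2 (real d * real n / min_eig))) / (real n + 1) \<le> opt_err_prob d \<rho> n R Q"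
proof -
  have n0: "0 < n" using n by simp
  define H where "H = shannon_entropy Q"
  define \<delta> where "\<delta> = rate_slack TYPE('x) n"
  define B where "B = log 2 (real d * real n / min_eig)"
  \<comment> \<open>Of the 6, the saddle estimate multiplied by \<open>n\<close> uses 5; the last
    unit provides the term \<open>- s\<close> demanded by the tilting argument.\<close>
  define r where "r = real n * (H - (R + \<delta>)) + 6"
  define E' where "E' = real n * e + 2"
  define \<gamma>\<^sub>0 where "\<gamma>\<^sub>0 = 2 powr (r - E' - B - 1)"
  define \<beta> where "\<beta> = 2 powr (- r) / (16 * (real n + 1))"
  let ?T = "type_seqs n Q"
  have T: "?T \<noteq> {}" by (rule type_seqs_nonempty[OF Q n0])
  have sub: "?T \<subseteq> seqs n" using type_seqsD(2) by blast
  hence finT: "finite ?T" using finite_subset finite_seqs by blast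
  hence cardT: "0 < real (card ?T)" using T by (simp add: card_gt_0_iff)
  have "E_sps d \<rho> (R + \<delta>) Q \<le> ereal e" "2 \<le> n" using E n by (auto simp: \<delta>_def)
  from exists_saddle_state[OF Q this] obtain \<tau> where \<tau>: "\<tau> \<in> density_ops d" and saddle: "\<And>s. 0 \<le> s \<Longrightarrow>
      tilt_exp Q s (depolarize d (1 / real n) \<tau>) \<le> e + 2 / real n + s * (H - (R + \<delta>) + 5 / real n)"
    unfolding H_def by blast
  have hyp: "real n * tilt_exp Q s (depolarize d (1 / real n) \<tau>) - s * r \<le> E' - s" if "0 \<le> s" for s
  proof -
    have "real n * tilt_exp Q s (depolarize d (1 / real n) \<tau>)
        \<le> real n * (e + 2 / real n + s * (H - (R + \<delta>) + 5 / real n))"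
      using saddle[OF that] by (intro mult_left_mono) auto
    also have "\<dots> = E' + s * (r - 1)" using n0 by (simp add: E'_def r_def field_simps)
    finally show ?thesis by (simp add: algebra_simps)
  qed
  define \<sigma> where "\<sigma> = depolarize d (1 / real n) \<tau>"
  define \<sigma>n where "\<sigma>n = tensor_list (replicate n \<sigma>)"
  have "\<sigma> \<in> density_ops d" unfolding \<sigma>_def using n0 by (intro depolarize_density[OF _ _ \<tau>]) auto
  note \<sigma> = density_opsD[OF this]
  have \<sigma>n: "psd (d ^ n) \<sigma>n" "mat_trace \<sigma>n = 1"
    using psd_tensor_list[of "replicate n \<sigma>" d] trace_tensor_list[of "replicate n \<sigma>" d] \<sigma> by (auto simp: \<sigma>n_def)
  have \<beta>0: "0 < \<beta>" by (simp add: \<beta>_def)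
  \<comment> \<open>With k letters, the slack contributes (n + 1)^(k + 1): k - 1 factors undo the
    estimate of the type class, one cancels the denominator of \<beta>, and one absorbs the
    numerical constants.\<close>
  have "real (card (messages n R)) / real (card ?T) \<le> \<beta> / 2"
  proof -
    define k where "k = CARD('x)"
    have k: "1 \<le> k" unfolding k_def by (simp add: Suc_leI)
    have slack: "real n * \<delta> = (real k + 1) * log 2 (real n + 1)"
      using n0 by (simp add: \<delta>_def rate_slack_def k_def add.commute)
    have pow: "2 powr (real n * \<delta>) = (real n + 1) ^ (k - 1) * (real n + 1) * (real n + 1)"
    proof -
      have "2 powr (real n * \<delta>) = (2 powr log 2 (real n + 1)) powr (real (k + 1))"
        unfolding slack powr_powr by (simp add: mult.commute add.commute)
      also have "\<dots> = (real n + 1) ^ (k + 1)" by (subst powr_log_cancel) (use powr_realpow[of "real n + 1" "k + 1"] in auto)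
      also have "k + 1 = Suc (Suc (k - 1))" using k by simp
      finally show ?thesis by simp
    qed
    have H: "2 powr (real n * H) \<le> real (card ?T) * (real n + 1) ^ (k - 1)"
      using card_type_seqs_ge[OF Q n0] by (simp add: H_def k_def add.commute)
    have "real (card (messages n R)) \<le> 2 powr (real n * R) + 1"
      by (simp add: messages_def)
    also have "\<dots> \<le> 2 * 2 powr (real n * R)" using R by (simp add: ge_one_powr_ge_zero)
    finally have "real (card (messages n R)) * 2048 * 2 powr (real n * H)
        \<le> (2 * 2 powr (real n * R)) * 2048 * (real (card ?T) * (real n + 1) ^ (k - 1))"
      using H by (intro mult_mono) auto
    also have "\<dots> = 4096 * (2 powr (real n * R) * (real (card ?T) * (real n + 1) ^ (k - 1)))" by simp
    \<comment> \<open>Origin of the bound on \<open>n\<close>: 4096 = 2 * 64 * 16 * 2, from the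
      rounded number of messages, the 6 in \<open>r\<close>, the 16 in \<beta>, and the halving of
      \<beta>.\<close>
    also have "\<dots> \<le> (real n + 1) * (2 powr (real n * R) * (real (card ?T) * (real n + 1) ^ (k - 1)))"
      using n by (intro mult_right_mono) auto
    finally have *: "real (card (messages n R)) * 2048 * 2 powr (real n * H) \<le>
      (real n + 1) * (2 powr (real n * R) * (real (card ?T) * (real n + 1) ^ (k - 1)))" .
    have "2 powr (- r) = 2 powr (real n * R + real n * \<delta> - real n * H - 6)" by (simp add: r_def algebra_simps)
    also have "\<dots> = 2 powr (real n * R) * 2 powr (real n * \<delta>) / (2 powr (real n * H) * 64)"
      by (simp add: powr_diff powr_add)
    finally have "\<beta> / 2 = 2 powr (real n * R) * ((real n + 1) ^ (k - 1) * (real n + 1) * (real n + 1)) /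
        (2 powr (real n * H) * 64) / (16 * (real n + 1)) / 2"
      unfolding \<beta>_def pow by simp
    also have "\<dots> = (real n + 1) * (2 powr (real n * R) * (real n + 1) ^ (k - 1)) / (2048 * 2 powr (real n * H))"
    proof -
      have "x * (y * N * N) / (h * 64) / (16 * N) / 2 = N * (x * y) / (2048 * h)" if "N \<noteq> 0" for x y h N :: real
        using that by simp
      thus ?thesis by (metis of_nat_Suc of_nat_eq_0_iff add.commute nat.distinct(1))
    qed
    finally have "\<beta> / 2 = (real n + 1) * (2 powr (real n * R) * (real n + 1) ^ (k - 1)) / (2048 * 2 powr (real n * H))" .
    moreover have "real (card (messages n R)) / real (card ?T) \<le>
        (real n + 1) * (2 powr (real n * R) * (real n + 1) ^ (k - 1)) / (2048 * 2 powr (real n * H))"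
    proof (rule frac_le_frac)
      show "0 < real (card ?T)" by (rule cardT)
      show "0 < 2048 * 2 powr (real n * H)" by simp
      show "real (card (messages n R)) * (2048 * 2 powr (real n * H)) \<le>
          (real n + 1) * (2 powr (real n * R) * (real n + 1) ^ (k - 1)) * real (card ?T)"
        using * by (simp only: mult_ac)
    qed
    ultimately show ?thesis by simp
  qed
  hence M: "real (card (messages n R)) \<le> \<beta> / 2 * real (card ?T)" using cardT by (simp add: divide_le_eq)
  have err: "\<gamma>\<^sub>0 * \<beta> / 2 \<le> err_prob \<rho> n Q c" if "c \<in> source_codes d n R" for c
  proof -
    obtain enc P where c: "c = (enc, P)" by force
    have code: "(enc, P) \<in> source_codes d n R" using that c by simp
    define err where "err xs = Re (mat_trace ((1\<^sub>m (d ^ n) - P (enc xs) xs) * seq_state \<rho> xs))" for xs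
    define b where "b xs = Re (mat_trace (P (enc xs) xs * \<sigma>n))" for xs
    \<comment> \<open>The threshold \<gamma> depends on the sequence. It is replaced by its common
      lower bound, which is legitimate when \<open>b xs < \<beta>\<close>; otherwise the left side
      is not positive.\<close>
    have "\<gamma>\<^sub>0 * (\<beta> - b xs) \<le> err xs" if xs: "xs \<in> ?T" for xs
    proof -
      have povm: "is_povm (d ^ n) (seqs n) (P (enc xs))" and sq: "xs \<in> seqs n"
        using code xs sub by (auto simp: source_codes_def)
      note p = is_povm_le_one[OF povm finite_seqs sq]
      have err0: "0 \<le> err xs" unfolding err_def by (rule trace_psd_mult_nonneg[OF p(2) psd_seq_state[OF sq]])
      from test_error_lower_bound[OF Q n0 xs \<tau> hyp p]
      obtain \<gamma> where \<gamma>: "\<gamma>\<^sub>0 \<le> \<gamma>" "\<gamma> * \<beta> \<le> err xs + \<gamma> * b xs"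
        unfolding \<gamma>\<^sub>0_def B_def \<beta>_def err_def b_def \<sigma>n_def \<sigma>_def by auto
      show ?thesis
      proof (cases "\<beta> \<le> b xs")
        case True
        hence "\<gamma>\<^sub>0 * (\<beta> - b xs) \<le> 0" by (simp add: \<gamma>\<^sub>0_def mult_nonneg_nonpos)
        thus ?thesis using err0 by linarith
      next
        case False
        hence "\<gamma>\<^sub>0 * (\<beta> - b xs) \<le> \<gamma> * (\<beta> - b xs)" using \<gamma>(1) by (intro mult_right_mono) auto
        thus ?thesis using \<gamma>(2) by (simp add: right_diff_distrib)
      qed
    qed
    hence "(\<Sum>xs\<in>?T. \<gamma>\<^sub>0 * (\<beta> - b xs)) \<le> (\<Sum>xs\<in>?T. err xs)" by (rule sum_mono)
    moreover have "(\<Sum>xs\<in>?T. \<gamma>\<^sub>0 * (\<beta> - b xs)) = \<gamma>\<^sub>0 * (\<beta> * real (card ?T) - (\<Sum>xs\<in>?T. b xs))"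
      by (simp add: sum_distrib_left[symmetric] sum_subtractf mult.commute)
    moreover have "(\<Sum>xs\<in>?T. b xs) \<le> \<beta> / 2 * real (card ?T)"
      unfolding b_def using sum_povm_fixed_state_le[OF code sub \<sigma>n] M by linarith
    hence "\<gamma>\<^sub>0 * (\<beta> / 2 * real (card ?T)) \<le> \<gamma>\<^sub>0 * (\<beta> * real (card ?T) - (\<Sum>xs\<in>?T. b xs))"
      by (intro mult_left_mono) (auto simp: \<gamma>\<^sub>0_def)
    ultimately have "\<gamma>\<^sub>0 * \<beta> / 2 * real (card ?T) \<le> (\<Sum>xs\<in>?T. err xs)" by simp
    thus ?thesis unfolding c err_prob_eq[OF code T] err_def[symmetric] using cardT by (simp add: le_divide_eq)
  qed
  \<comment> \<open>The 8 is 2 from \<open>E'\<close>, 1 from the threshold, and 5 from 16 * 2 =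
    2^5.\<close>
  have "- (real n * e + 8 + B) = (r - E' - B - 1) + - r + - 5" by (simp add: E'_def)
  hence "2 powr (- (real n * e + 8 + B)) = \<gamma>\<^sub>0 * 2 powr (- r) * 2 powr (- 5)"
    by (simp only: powr_add \<gamma>\<^sub>0_def)
  also have "(2 :: real) powr (- 5) = 1 / 32" by (simp add: powr_minus powr_numeral)
  finally have "2 powr (- (real n * e + 8 + B)) / (real n + 1) = \<gamma>\<^sub>0 * 2 powr (- r) * (1 / 32) / (real n + 1)" by metis
  also have "\<dots> = \<gamma>\<^sub>0 * \<beta> / 2" by (simp add: \<beta>_def)
  finally have "2 powr (- (real n * e + 8 + B)) / (real n + 1) = \<gamma>\<^sub>0 * \<beta> / 2" .
  thus ?thesis unfolding opt_err_prob_def B_def[symmetric]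
    by (metis cINF_greatest opt_err_prob_bounds(1)[OF Q n0] err)
qed

text \<open>An infinite right side is trivial. Otherwise \<open>1 \<le> log 2 n\<close> turns
  additive constants into multiples of the logarithm: 8 from \<open>opt_err_prob_ge\<close>, 1 from
  log (n + 1) \<le> 1 + log n, and one logarithm each from the factor n + 1 and from the oscillation
  bound make 11.\<close>

theorem err_exponent_le_sphere_packing:
  assumes Q: "Q \<in> types n" and n: "4096 \<le> n" and R: "0 \<le> R"
  shows "err_exponent d \<rho> n R Q \<le> E_sps d \<rho> (R + rate_slack TYPE('x) n) Q
    + ereal ((11 + log 2 (real d / min_eig)) * log 2 (real n) / real n)"
proof (cases "E_sps d \<rho> (R + rate_slack TYPE('x) n) Q")
  case PInf
  thus ?thesis by simp
next
  case MInf
  thus ?thesis using E_sps_nonneg[of "R + rate_slack TYPE('x) n" Q] by simp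
next
  case (real e)
  define C where "C = log 2 (real d / min_eig)"
  define p where "p = opt_err_prob d \<rho> n R Q"
  define l where "l = log 2 (real n)"
  have n0: "0 < real n" using n by simp
  have d: "1 \<le> real d" using dim_pos by simp
  have C: "0 \<le> C" unfolding C_def using d min_eig(1,2) by (simp add: le_divide_eq)
  have "log 2 2 \<le> l" unfolding l_def using n by (subst log_le_cancel_iff) auto
  hence l: "1 \<le> l" by simp
  have "log 2 (real n + 1) \<le> log 2 (2 * real n)" using n by (subst log_le_cancel_iff) auto
  also have "\<dots> = 1 + l" using n0 by (simp add: log_mult l_def)
  finally have l1: "log 2 (real n + 1) \<le> 1 + l" .
  have B: "log 2 (real d * real n / min_eig) = C + l"
    using d n0 min_eig(1) by (simp add: C_def l_def log_mult log_divide)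
  have lower: "2 powr (- (real n * e + 8 + (C + l))) / (real n + 1) \<le> p"
    using opt_err_prob_ge[OF Q n R, of e] real unfolding B p_def by simp
  moreover have pos: "0 < 2 powr (- (real n * e + 8 + (C + l))) / (real n + 1)" by simp
  ultimately have p: "0 < p" by linarith
  have "log 2 (2 powr (- (real n * e + 8 + (C + l))) / (real n + 1)) \<le> log 2 p"
    using lower pos p by (subst log_le_cancel_iff) auto
  moreover have "log 2 (2 powr (- (real n * e + 8 + (C + l))) / (real n + 1)) =
      - (real n * e + 8 + (C + l)) - log 2 (real n + 1)"
    by (subst log_divide) auto
  ultimately have "- log 2 p \<le> real n * e + (9 + C + 2 * l)" using l1 by linarith
  also have "\<dots> \<le> real n * e + (11 + C) * l"
  proof -
    have "9 * 1 \<le> 9 * l" "C * 1 \<le> C * l" using l C by (intro mult_left_mono; simp)+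
    thus ?thesis by (simp add: distrib_right)
  qed
  finally have "- log 2 p / real n \<le> (real n * e + (11 + C) * l) / real n" by (rule divide_right_mono) simp
  also have "\<dots> = e + (11 + C) * l / real n" using n0 by (simp add: add_divide_distrib)
  finally show ?thesis using p unfolding err_exponent_def p_def[symmetric] real C_def[symmetric] l_def[symmetric]
    by (simp add: log2_ereal_def)
qed

end

lemma rate_slack_nonneg: "0 \<le> rate_slack TYPE('x::finite) n"
  by (simp add: rate_slack_def)

theorem theorem4p4:
  fixes d :: nat and \<rho> :: "'x::finite \<Rightarrow> complex mat" and R :: real
  assumes "\<And>x. \<rho> x \<in> density_ops d"
  shows "\<exists>(K\<^sub>1::real) (K\<^sub>2::real) (N\<^sub>0::nat). K\<^sub>1 > 0 \<and> K\<^sub>2 > 0 \<and> N\<^sub>0 > 0 \<and>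
    (\<forall>(n::nat) (Q :: 'x \<Rightarrow> real). n \<ge> 1 \<longrightarrow> Q \<in> types n \<longrightarrow> 0 < R \<longrightarrow> R < shannon_entropy Q \<longrightarrow>
       err_exponent d \<rho> n (R + rate_slack TYPE('x) n) Q
         \<ge> E_rs_down d \<rho> R Q - ereal (K\<^sub>1 * log 2 (real n) / real n) - ereal (1 / real n)) \<and>
    (\<forall>(n::nat) (Q :: 'x \<Rightarrow> real). n \<ge> N\<^sub>0 \<longrightarrow> Q \<in> types n \<longrightarrow>
       cond_entropy d \<rho> Q < ereal R \<longrightarrow> ereal R < cond_entropy_hat0 d \<rho> Q \<longrightarrow>
       err_exponent d \<rho> n R Q
         \<le> E_sps d \<rho> (R + rate_slack TYPE('x) n) Q + ereal (K\<^sub>2 * log 2 (real n) / real n)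
            + ereal (1 / real n * log 2 (1 + 1 / real n)))"
proof -
  interpret state_family d \<rho> by unfold_locales (rule assms)
  define K where "K = 11 + log 2 (real d / min_eig)"
  have "1 \<le> real d / min_eig" using dim_pos min_eig(1,2) by (simp add: le_divide_eq)
  hence K: "0 < K" unfolding K_def by (smt (verit) zero_le_log_cancel_iff)
  \<comment> \<open>The achievability bound has no remainder, so any positive number serves as the
    first witness; the other two are the constant and the threshold of the sphere-packing
    estimate.\<close>
  show ?thesis
  proof (rule exI[of _ "1 :: real"], rule exI[of _ K], rule exI[of _ "4096 :: nat"], intro conjI allI impI)
    show "0 < (1 :: real)" "0 < (4096 :: nat)" by simp_all
    show "0 < K" by (rule K)
  next
    fix n :: nat and Q :: "'x \<Rightarrow> real"
    assume n: "1 \<le> n" and Q: "Q \<in> types n"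
    have sub: "a - ereal b \<le> a" if "0 \<le> b" for a :: ereal and b
      using ereal_minus_mono[of a a 0 "ereal b"] that by simp
    have "E_rs_down d \<rho> R Q - ereal (1 * log 2 (real n) / real n) - ereal (1 / real n) \<le> E_rs_down d \<rho> R Q"
      using n by (intro order_trans[OF sub] sub) (auto intro!: divide_nonneg_nonneg)
    also have "\<dots> \<le> E_rs_down d \<rho> (R + rate_slack TYPE('x) n) Q"
      by (rule E_rs_down_mono) (simp add: rate_slack_nonneg)
    also have "\<dots> \<le> err_exponent d \<rho> n (R + rate_slack TYPE('x) n) Q"
      using n by (intro random_coding_exponent_le[OF Q]) auto
    finally show "E_rs_down d \<rho> R Q - ereal (1 * log 2 (real n) / real n) - ereal (1 / real n)
      \<le> err_exponent d \<rho> n (R + rate_slack TYPE('x) n) Q" .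
  next
    fix n :: nat and Q :: "'x \<Rightarrow> real"
    assume n: "4096 \<le> n" and Q: "Q \<in> types n" and R: "cond_entropy d \<rho> Q < ereal R"
    \<comment> \<open>Nonnegativity of H(Q|B) turns the lower limit of the rate interval into the
      condition \<open>0 \<le> R\<close>.\<close>
    have "ereal 0 \<le> ereal R" using cond_entropy_nonneg[OF Q] R unfolding zero_ereal_def by (rule order_trans[OF _ less_imp_le])
    hence "0 \<le> R" by simp
    hence "err_exponent d \<rho> n R Q \<le> E_sps d \<rho> (R + rate_slack TYPE('x) n) Q + ereal (K * log 2 (real n) / real n)"
      unfolding K_def by (rule err_exponent_le_sphere_packing[OF Q n])
    also have "\<dots> = \<dots> + ereal 0" by (simp add: zero_ereal_def[symmetric])
    also have "\<dots> \<le> E_sps d \<rho> (R + rate_slack TYPE('x) n) Q + ereal (K * log 2 (real n) / real n)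
        + ereal (1 / real n * log 2 (1 + 1 / real n))"
    proof (rule add_left_mono)
      have "log 2 1 \<le> log 2 (1 + 1 / real n)" using n by (subst log_le_cancel_iff) (auto intro: add_pos_nonneg)
      thus "ereal 0 \<le> ereal (1 / real n * log 2 (1 + 1 / real n))" by simp
    qed
    finally show "err_exponent d \<rho> n R Q \<le> E_sps d \<rho> (R + rate_slack TYPE('x) n) Q + ereal (K * log 2 (real n) / real n)
        + ereal (1 / real n * log 2 (1 + 1 / real n))" .
  qed
qed

end
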